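(* Let $\Lambda$ be a finite, locally convex $k$-graph that has no cycle with an entrance. For $N := (|\Lambda^0|,\dots,|\Lambda^0|)\in\mathbb{N}^k$, $$C^*(\Lambda)\cong \bigoplus_{[\mu]\in \mathrm{IC}(\Lambda)/\sim} M_{\Lambda^{\le N}(\mu^\infty)^0}\big(s_{r(\mu)}C^*(\Lambda)s_{r(\mu)}\big),$$ and each $s_{r(\mu)}C^*(\Lambda)s_{r(\mu)}\cong C(\mathbb{T}^{\ell_\mu})$.
   Context: A $k$-graph ($k\ge1$) is a nonempty countable small category $\Lambda$ with a functor $d:\Lambda\to\mathbb{N}^k$ such that whenever $d(\lambda)=m+n$ there are unique $\mu,\nu\in\Lambda$ with $d(\mu)=m$, $d(\nu)=n$, $\lambda=\mu\nu$. $\Lambda^n:=d^{-1}(n)$; $\Lambda^0$ (the vertices) is identified with the objects; $r(\lambda),s(\lambda)$ are the codomain and domain of $\lambda$; $e_1,\dots,e_k$ are the generators of $\mathbb{N}^k$. For $E\subseteq\Lambda$, $v\in\Lambda^0$: $vE=\{\nu\in E: r(\nu)=v\}$, $Ev=\{\nu\in E:s(\nu)=v\}$, and for $V\subseteq \Lambda^0$, $EV=\bigcup_{v\in V}Ev$. For $n\in\mathbb{N}^k$, $\Lambda^{\le n}:=\{\lambda: d(\lambda)\le n,\ s(\lambda)\Lambda^{e_i}=\emptyset \text{ whenever } d(\lambda)+e_i\le n\}$. $\Lambda$ is finite if $|\Lambda^n|<\infty$ for all $n$; locally convex if for all $i\ne j$, $\lambda\in\Lambda^{e_i}$, $\mu\in\Lambda^{e_j}$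 with $r(\lambda)=r(\mu)$, the sets $s(\lambda)\Lambda^{e_j}$ and $s(\mu)\Lambda^{e_i}$ are nonempty. For $m\le n\le d(\lambda)$, $\lambda(m,n)$ is the unique element of $\Lambda^{n-m}$ with $\lambda=\lambda'\lambda(m,n)\lambda''$ where $d(\lambda')=m$, $d(\lambda'')=d(\lambda)-n$; $\lambda(m):=\lambda(m,m)$. The same notation is used for (possibly infinite) paths of degree $m\in(\mathbb{N}\cup\{\infty\})^k$, i.e. degree-preserving functors $x:\{(p,q)\in\mathbb{N}^k\times\mathbb{N}^k:p\le q\le m\}\to\Lambda$ (where $(p,q)$ has range $p$, source $q$, degree $q-p$). $C^*(\Lambda)$ is the universal $C^*$-algebra generated by $\{s_\lambda:\lambda\in\Lambda\}$ subject to: the $s_v$, $v\in\Lambda^0$, are mutually orthogonal projections; $s_\mu s_\nu=s_{\mu\nu}$ if $s(\mu)=r(\nu)$; $s_\lambda^*s_\lambda=s_{s(\lambda)}$; $s_v=\sum_{\lambda\in v\Lambda^{\le n}}s_\lambda s_\lambda^*$ for all $v\in\Lambda^0$, $n\in\mathbb{N}^k$. A cycle is $\lambda\in\Lambda\setminus\Lambda^0$ with $r(\lambda)=s(\lambda)$. For a cycle $\tau$, $\tau^\infty=\tau\tau\tau\cdots$ is the path with $d(\tau^\infty)_i=\infty$ if $d(\tau)_i>0$, $d(\tau^\infty)_i=0$ if $d(\tau)_i=0$, and $\tau^\infty(n\,d(\tau),(n+1)d(\tau))=\tau$ for all $n\in\mathbb{N}$. A cycle $\lambda$ has an entrance if there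 is $\tau\in r(\lambda)\Lambda$ with $d(\tau)\le d(\lambda^\infty)$ and $\tau\ne\lambda^\infty(0,d(\tau))$. For $\Lambda$ with no cycle with an entrance, an initial cycle is $\mu\in\Lambda$ (possibly a vertex) with $r(\mu)=s(\mu)$ and $r(\mu)\Lambda^{e_i}=\emptyset$ whenever $d(\mu)_i=0$; $\mathrm{IC}(\Lambda)$ is the set of initial cycles. A vertex $v$ is said to be on the initial cycle $\mu$ if $v=\mu(p)$ for some $p\le d(\mu)$; $(\mu^\infty)^0$ denotes the set of all vertices on $\mu$, and $\mu\sim\nu$ iff $(\mu^\infty)^0=(\nu^\infty)^0$. $G_\mu:=\{m-n: m,n\in\mathbb{N}^k,\ m,n\le d(\mu^\infty),\ \mu^\infty(m)=\mu^\infty(n)\}$ if $\mu$ is not a vertex, and $G_\mu:=\{0\}$ otherwise; this is a subgroup of $\mathbb{Z}^k$ and $\ell_\mu$ denotes its rank, so $G_\mu\cong\mathbb{Z}^{\ell_\mu}$. For a finite set $X$, $M_X(A)$ denotes the matrices over $A$ indexed by $X$, i.e. $M_{|X|}(A)$.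
   Formalization: The set (μ^∞)^0 of vertices on an initial cycle μ is taken to be all μ^∞(p) with p ≤ d(μ^∞), not only μ(p) with p ≤ d(μ); with the smaller sets the claim fails for some 2-graphs (e.g. on ℤ/5 with s(v,n)=v+n₁−n₂). *)

theory Defs
  imports "HOL-Analysis.Analysis" "HOL-Algebra.FiniteProduct"
begin

section \<open>Higher-rank graphs\<close>

text \<open>A small category is given by its set of morphisms, each object being identified with its
  identity morphism; hence range (codomain) and source (domain) are again morphisms.
  The composite \<open>cmp \<Lambda> \<mu> \<nu>\<close>, written \<open>\<mu>\<nu>\<close> in the text, is meaningful only if
  \<open>src \<Lambda> \<mu> = rng \<Lambda> \<nu>\<close>. The rank \<open>k \<ge> 1\<close> is \<open>CARD('k)\<close>, and the order and the arithmetic of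
  \<open>\<nat>\<^sup>k\<close> are the componentwise ones of \<open>nat ^ 'k\<close>.\<close>

record ('a, 'k) kgraph =
  paths :: "'a set"
  deg :: "'a \<Rightarrow> nat ^ 'k"
  rng :: "'a \<Rightarrow> 'a"
  src :: "'a \<Rightarrow> 'a"
  cmp :: "'a \<Rightarrow> 'a \<Rightarrow> 'a"

locale k_graph =
  fixes \<Lambda> :: "('a, 'k::finite) kgraph"
  assumes nonempty: "paths \<Lambda> \<noteq> {}"
    and countable: "countable (paths \<Lambda>)"
    and rng_closed: "x \<in> paths \<Lambda> \<Longrightarrow> rng \<Lambda> x \<in> paths \<Lambda>"
    and src_closed: "x \<in> paths \<Lambda> \<Longrightarrow> src \<Lambda> x \<in> paths \<Lambda>"
    and rng_rng: "x \<in> paths \<Lambda> \<Longrightarrow> rng \<Lambda> (rng \<Lambda> x) = rng \<Lambda> x"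
    and src_rng: "x \<in> paths \<Lambda> \<Longrightarrow> src \<Lambda> (rng \<Lambda> x) = rng \<Lambda> x"
    and rng_src: "x \<in> paths \<Lambda> \<Longrightarrow> rng \<Lambda> (src \<Lambda> x) = src \<Lambda> x"
    and src_src: "x \<in> paths \<Lambda> \<Longrightarrow> src \<Lambda> (src \<Lambda> x) = src \<Lambda> x"
    and cmp_closed: "\<lbrakk>x \<in> paths \<Lambda>; y \<in> paths \<Lambda>; src \<Lambda> x = rng \<Lambda> y\<rbrakk> \<Longrightarrow> cmp \<Lambda> x y \<in> paths \<Lambda>"
    and rng_cmp: "\<lbrakk>x \<in> paths \<Lambda>; y \<in> paths \<Lambda>; src \<Lambda> x = rng \<Lambda> y\<rbrakk> \<Longrightarrow> rng \<Lambda> (cmp \<Lambda> x y) = rng \<Lambda> x"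
    and src_cmp: "\<lbrakk>x \<in> paths \<Lambda>; y \<in> paths \<Lambda>; src \<Lambda> x = rng \<Lambda> y\<rbrakk> \<Longrightarrow> src \<Lambda> (cmp \<Lambda> x y) = src \<Lambda> y"
    and cmp_assoc: "\<lbrakk>x \<in> paths \<Lambda>; y \<in> paths \<Lambda>; z \<in> paths \<Lambda>; src \<Lambda> x = rng \<Lambda> y; src \<Lambda> y = rng \<Lambda> z\<rbrakk>
      \<Longrightarrow> cmp \<Lambda> (cmp \<Lambda> x y) z = cmp \<Lambda> x (cmp \<Lambda> y z)"
    and cmp_rng: "x \<in> paths \<Lambda> \<Longrightarrow> cmp \<Lambda> (rng \<Lambda> x) x = x"
    and cmp_src: "x \<in> paths \<Lambda> \<Longrightarrow> cmp \<Lambda> x (src \<Lambda> x) = x"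
    and deg_rng: "x \<in> paths \<Lambda> \<Longrightarrow> deg \<Lambda> (rng \<Lambda> x) = 0"
    and deg_src: "x \<in> paths \<Lambda> \<Longrightarrow> deg \<Lambda> (src \<Lambda> x) = 0"
    and deg_cmp: "\<lbrakk>x \<in> paths \<Lambda>; y \<in> paths \<Lambda>; src \<Lambda> x = rng \<Lambda> y\<rbrakk>
      \<Longrightarrow> deg \<Lambda> (cmp \<Lambda> x y) = deg \<Lambda> x + deg \<Lambda> y"
    and factorization: "\<lbrakk>x \<in> paths \<Lambda>; deg \<Lambda> x = m + n\<rbrakk>
      \<Longrightarrow> \<exists>!(y, z). y \<in> paths \<Lambda> \<and> z \<in> paths \<Lambda> \<and> deg \<Lambda> y = m \<and> deg \<Lambda> z = n \<and>
            src \<Lambda> y = rng \<Lambda> z \<and> x = cmp \<Lambda> y z"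

definition paths_of_deg :: "('a, 'k::finite) kgraph \<Rightarrow> nat ^ 'k \<Rightarrow> 'a set" where
  "paths_of_deg \<Lambda> n = {x \<in> paths \<Lambda>. deg \<Lambda> x = n}"

definition vertices :: "('a, 'k::finite) kgraph \<Rightarrow> 'a set" where
  "vertices \<Lambda> = paths_of_deg \<Lambda> 0"

definition with_range :: "('a, 'k::finite) kgraph \<Rightarrow> 'a \<Rightarrow> 'a set \<Rightarrow> 'a set" where
  "with_range \<Lambda> v E = {x \<in> E. rng \<Lambda> x = v}"

definition with_source_in :: "('a, 'k::finite) kgraph \<Rightarrow> 'a set \<Rightarrow> 'a set \<Rightarrow> 'a set" where
  "with_source_in \<Lambda> E V = {x \<in> E. src \<Lambda> x \<in> V}"

text \<open>\<open>\<Lambda>\<^sup>e\<close> for the generator \<open>e = e\<^sub>i\<close>.\<close>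

definition edges :: "('a, 'k::finite) kgraph \<Rightarrow> 'k \<Rightarrow> 'a set" where
  "edges \<Lambda> i = paths_of_deg \<Lambda> (axis i 1)"

text \<open>The set \<open>\<Lambda>\<^sup>\<le>\<^sup>n\<close>.\<close>

definition paths_le :: "('a, 'k::finite) kgraph \<Rightarrow> nat ^ 'k \<Rightarrow> 'a set" where
  "paths_le \<Lambda> n = {x \<in> paths \<Lambda>. deg \<Lambda> x \<le> n \<and>
     (\<forall>i. deg \<Lambda> x + axis i 1 \<le> n \<longrightarrow> with_range \<Lambda> (src \<Lambda> x) (edges \<Lambda> i) = {})}"

definition finite_kgraph :: "('a, 'k::finite) kgraph \<Rightarrow> bool" where
  "finite_kgraph \<Lambda> \<longleftrightarrow> (\<forall>n. finite (paths_of_deg \<Lambda> n))"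

definition locally_convex :: "('a, 'k::finite) kgraph \<Rightarrow> bool" where
  "locally_convex \<Lambda> \<longleftrightarrow>
     (\<forall>i j. \<forall>x \<in> edges \<Lambda> i. \<forall>y \<in> edges \<Lambda> j. i \<noteq> j \<and> rng \<Lambda> x = rng \<Lambda> y \<longrightarrow>
        with_range \<Lambda> (src \<Lambda> x) (edges \<Lambda> j) \<noteq> {} \<and> with_range \<Lambda> (src \<Lambda> y) (edges \<Lambda> i) \<noteq> {})"

definition le_deg :: "nat ^ 'k \<Rightarrow> enat ^ 'k::finite \<Rightarrow> bool" where
  "le_deg p m \<longleftrightarrow> (\<forall>i. enat (p $ i) \<le> m $ i)"

text \<open>Paths of degree \<open>m \<in> (\<nat> \<union> {\<infinity>})\<^sup>k\<close>: degree-preserving functors from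
  \<open>{(p, q). p \<le> q \<le> m}\<close> to \<open>\<Lambda>\<close>. The last clause normalizes the values of the HOL function
  outside this domain, so that a path is determined by its values on the domain.\<close>

definition is_path :: "('a, 'k::finite) kgraph \<Rightarrow> enat ^ 'k \<Rightarrow> (nat ^ 'k \<Rightarrow> nat ^ 'k \<Rightarrow> 'a) \<Rightarrow> bool" where
  "is_path \<Lambda> m x \<longleftrightarrow>
     (\<forall>p q. p \<le> q \<and> le_deg q m \<longrightarrow>
        x p q \<in> paths \<Lambda> \<and> deg \<Lambda> (x p q) = q - p \<and>
        rng \<Lambda> (x p q) = x p p \<and> src \<Lambda> (x p q) = x q q) \<and>
     (\<forall>p q t. p \<le> q \<and> q \<le> t \<and> le_deg t m \<longrightarrow> x p t = cmp \<Lambda> (x p q) (x q t)) \<and>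
     (\<forall>p q. \<not> (p \<le> q \<and> le_deg q m) \<longrightarrow> x p q = undefined)"

definition cycle :: "('a, 'k::finite) kgraph \<Rightarrow> 'a \<Rightarrow> bool" where
  "cycle \<Lambda> x \<longleftrightarrow> x \<in> paths \<Lambda> - vertices \<Lambda> \<and> rng \<Lambda> x = src \<Lambda> x"

definition inf_deg :: "('a, 'k::finite) kgraph \<Rightarrow> 'a \<Rightarrow> enat ^ 'k" where
  "inf_deg \<Lambda> x = (\<chi> i. if deg \<Lambda> x $ i > 0 then \<infinity> else 0)"

text \<open>The path \<open>\<tau>\<^sup>\<infinity>\<close> of a cycle \<open>\<tau>\<close>; its degree is \<open>inf_deg \<Lambda> \<tau>\<close>.\<close>

definition inf_path :: "('a, 'k::finite) kgraph \<Rightarrow> 'a \<Rightarrow> nat ^ 'k \<Rightarrow> nat ^ 'k \<Rightarrow> 'a" where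
  "inf_path \<Lambda> t = (THE x. is_path \<Lambda> (inf_deg \<Lambda> t) x \<and>
     (\<forall>n. x (n *s deg \<Lambda> t) (Suc n *s deg \<Lambda> t) = t))"

definition has_entrance :: "('a, 'k::finite) kgraph \<Rightarrow> 'a \<Rightarrow> bool" where
  "has_entrance \<Lambda> x \<longleftrightarrow>
     (\<exists>t \<in> with_range \<Lambda> (rng \<Lambda> x) (paths \<Lambda>).
        le_deg (deg \<Lambda> t) (inf_deg \<Lambda> x) \<and> t \<noteq> inf_path \<Lambda> x 0 (deg \<Lambda> t))"

definition initial_cycles :: "('a, 'k::finite) kgraph \<Rightarrow> 'a set" where
  "initial_cycles \<Lambda> = {x \<in> paths \<Lambda>. rng \<Lambda> x = src \<Lambda> x \<and>
     (\<forall>i. deg \<Lambda> x $ i = 0 \<longrightarrow> with_range \<Lambda> (rng \<Lambda> x) (edges \<Lambda> i) = {})}"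

text \<open>The set \<open>(\<mu>\<^sup>\<infinity>)\<^sup>0\<close> of the vertices on an initial cycle \<open>\<mu>\<close>, i.e. of the vertices \<open>\<mu>\<^sup>\<infinity>(p)\<close> for
  \<open>p \<le> d(\<mu>\<^sup>\<infinity>)\<close> (if \<open>\<mu>\<close> is a vertex, \<open>\<mu>\<^sup>\<infinity>\<close> is the path \<open>\<mu>\<close> of degree 0). The vertices \<open>\<mu>(p)\<close> with
  \<open>p \<le> d(\<mu>)\<close> do not suffice if \<open>k \<ge> 2\<close>. Consider the 2-graph with \<open>\<Lambda>\<^sup>0 = \<int>/5\<close> and exactly one path
  of each degree \<open>n \<in> \<nat>\<^sup>2\<close> with range \<open>v\<close>, its source being \<open>v + n\<^sub>1 - n\<^sub>2\<close>. The cycle \<open>\<mu>\<close> of degree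
  \<open>(1, 1)\<close> at \<open>0\<close> only has \<open>\<mu>(p) \<in> {0, 1, 4}\<close>, while \<open>\<mu>\<^sup>\<infinity>\<close> visits all vertices. With the smaller
  sets, this graph would have several classes of initial cycles although its algebra
  \<open>M\<^sub>5(C(T\<^sup>2))\<close> is indecomposable.\<close>

definition vertices_on :: "('a, 'k::finite) kgraph \<Rightarrow> 'a \<Rightarrow> 'a set" where
  "vertices_on \<Lambda> x = {inf_path \<Lambda> x p p | p. le_deg p (inf_deg \<Lambda> x)}"

definition ic_equiv :: "('a, 'k::finite) kgraph \<Rightarrow> ('a \<times> 'a) set" where
  "ic_equiv \<Lambda> = {(x, y). x \<in> initial_cycles \<Lambda> \<and> y \<in> initial_cycles \<Lambda> \<and>
     vertices_on \<Lambda> x = vertices_on \<Lambda> y}"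

definition period_group :: "('a, 'k::finite) kgraph \<Rightarrow> 'a \<Rightarrow> (int ^ 'k) set" where
  "period_group \<Lambda> x = (if x \<in> vertices \<Lambda> then {0} else
     {(\<chi> i. int (m $ i) - int (n $ i)) | m n.
        le_deg m (inf_deg \<Lambda> x) \<and> le_deg n (inf_deg \<Lambda> x) \<and> inf_path \<Lambda> x m m = inf_path \<Lambda> x n n})"

text \<open>Rank of a subgroup of \<open>\<int>\<^sup>k\<close>: the maximal cardinality of a subset that is linearly
  independent over \<open>\<int>\<close> (such sets have at most \<open>k\<close> elements).\<close>

definition int_rank :: "(int ^ 'k::finite) set \<Rightarrow> nat" where
  "int_rank G = Max {card S | S. S \<subseteq> G \<and> finite S \<and>
     \<not> module.dependent ((*s) :: int \<Rightarrow> int ^ 'k \<Rightarrow> int ^ 'k) S}"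


section \<open>Complex *-algebras\<close>

text \<open>Not necessarily unital. C*-algebras are represented by their underlying *-algebras: an
  isomorphism of C*-algebras is a bijective *-homomorphism (it is then automatically isometric),
  and a *-algebra carries at most one complete C*-norm.\<close>

record 'b star_algebra = "'b partial_object" +
  sa_zero :: 'b
  sa_add :: "'b \<Rightarrow> 'b \<Rightarrow> 'b"
  sa_scale :: "complex \<Rightarrow> 'b \<Rightarrow> 'b"
  sa_mult :: "'b \<Rightarrow> 'b \<Rightarrow> 'b"
  sa_star :: "'b \<Rightarrow> 'b"

definition sa_diff :: "'b star_algebra \<Rightarrow> 'b \<Rightarrow> 'b \<Rightarrow> 'b" where
  "sa_diff A x y = sa_add A x (sa_scale A (-1) y)"

text \<open>Finite sums in \<open>A\<close>, as iterated products in the additive monoid of \<open>A\<close>.\<close>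

definition sa_sum :: "'b star_algebra \<Rightarrow> ('i \<Rightarrow> 'b) \<Rightarrow> 'i set \<Rightarrow> 'b" where
  "sa_sum A f I = finprod \<lparr>carrier = carrier A, mult = sa_add A, one = sa_zero A\<rparr> f I"

definition star_iso :: "'b star_algebra \<Rightarrow> 'c star_algebra \<Rightarrow> ('b \<Rightarrow> 'c) \<Rightarrow> bool" where
  "star_iso A B h \<longleftrightarrow> bij_betw h (carrier A) (carrier B) \<and>
     (\<forall>x \<in> carrier A. \<forall>y \<in> carrier A. h (sa_add A x y) = sa_add B (h x) (h y)) \<and>
     (\<forall>x \<in> carrier A. \<forall>c. h (sa_scale A c x) = sa_scale B c (h x)) \<and>
     (\<forall>x \<in> carrier A. \<forall>y \<in> carrier A. h (sa_mult A x y) = sa_mult B (h x) (h y)) \<and>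
     (\<forall>x \<in> carrier A. h (sa_star A x) = sa_star B (h x))"

definition star_isomorphic :: "'b star_algebra \<Rightarrow> 'c star_algebra \<Rightarrow> bool" where
  "star_isomorphic A B \<longleftrightarrow> (\<exists>h. star_iso A B h)"

text \<open>The corner \<open>pAp\<close> of a projection \<open>p\<close>.\<close>

definition corner :: "'b star_algebra \<Rightarrow> 'b \<Rightarrow> 'b star_algebra" where
  "corner A p = A\<lparr>carrier := {sa_mult A (sa_mult A p x) p | x. x \<in> carrier A}\<rparr>"

text \<open>\<open>M\<^sub>X(A)\<close>, for a finite set \<open>X\<close>.\<close>

definition matrix_algebra :: "'i set \<Rightarrow> 'b star_algebra \<Rightarrow> ('i \<times> 'i \<Rightarrow> 'b) star_algebra" where
  "matrix_algebra X A = \<lparr>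
     carrier = X \<times> X \<rightarrow>\<^sub>E carrier A,
     sa_zero = (\<lambda>ij \<in> X \<times> X. sa_zero A),
     sa_add = (\<lambda>F G. \<lambda>ij \<in> X \<times> X. sa_add A (F ij) (G ij)),
     sa_scale = (\<lambda>c F. \<lambda>ij \<in> X \<times> X. sa_scale A c (F ij)),
     sa_mult = (\<lambda>F G. \<lambda>(i, j) \<in> X \<times> X. sa_sum A (\<lambda>l. sa_mult A (F (i, l)) (G (l, j))) X),
     sa_star = (\<lambda>F. \<lambda>(i, j) \<in> X \<times> X. sa_star A (F (j, i)))\<rparr>"

text \<open>Direct sum of a family indexed by a finite set \<open>I\<close>.\<close>

definition direct_sum :: "'i set \<Rightarrow> ('i \<Rightarrow> 'b star_algebra) \<Rightarrow> ('i \<Rightarrow> 'b) star_algebra" where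
  "direct_sum I A = \<lparr>
     carrier = (\<Pi>\<^sub>E i \<in> I. carrier (A i)),
     sa_zero = (\<lambda>i \<in> I. sa_zero (A i)),
     sa_add = (\<lambda>f g. \<lambda>i \<in> I. sa_add (A i) (f i) (g i)),
     sa_scale = (\<lambda>c f. \<lambda>i \<in> I. sa_scale (A i) c (f i)),
     sa_mult = (\<lambda>f g. \<lambda>i \<in> I. sa_mult (A i) (f i) (g i)),
     sa_star = (\<lambda>f. \<lambda>i \<in> I. sa_star (A i) (f i))\<rparr>"

text \<open>\<open>C(X)\<close>, for a compact Hausdorff space \<open>X\<close>.\<close>

definition continuous_functions :: "'x topology \<Rightarrow> ('x \<Rightarrow> complex) star_algebra" where
  "continuous_functions X = \<lparr>
     carrier = {f \<in> extensional (topspace X). continuous_map X euclidean f},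
     sa_zero = (\<lambda>x \<in> topspace X. 0),
     sa_add = (\<lambda>f g. \<lambda>x \<in> topspace X. f x + g x),
     sa_scale = (\<lambda>c f. \<lambda>x \<in> topspace X. c * f x),
     sa_mult = (\<lambda>f g. \<lambda>x \<in> topspace X. f x * g x),
     sa_star = (\<lambda>f. \<lambda>x \<in> topspace X. cnj (f x))\<rparr>"

definition torus :: "nat \<Rightarrow> (nat \<Rightarrow> complex) topology" where
  "torus l = product_topology (\<lambda>_. top_of_set (sphere 0 1)) {..<l}"


section \<open>Universal C*-algebras\<close>

text \<open>The free (non-unital) *-algebra on a set \<open>X\<close>: finite linear combinations of nonempty words
  in letters \<open>(x, False)\<close> and \<open>(x, True)\<close>, \<open>x \<in> X\<close>, the latter standing for \<open>x\<^sup>*\<close>. The product is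
  determined by concatenation of words, and \<open>(x\<^sub>1 \<dots> x\<^sub>n)\<^sup>* = x\<^sub>n\<^sup>* \<dots> x\<^sub>1\<^sup>*\<close>.\<close>

type_synonym 'a star_poly = "('a \<times> bool) list \<Rightarrow> complex"

definition free_star_algebra :: "'a set \<Rightarrow> 'a star_poly star_algebra" where
  "free_star_algebra X = \<lparr>
     carrier = {f. finite {w. f w \<noteq> 0} \<and> (\<forall>w. f w \<noteq> 0 \<longrightarrow> w \<noteq> [] \<and> fst ` set w \<subseteq> X)},
     sa_zero = (\<lambda>w. 0),
     sa_add = (\<lambda>f g w. f w + g w),
     sa_scale = (\<lambda>c f w. c * f w),
     sa_mult = (\<lambda>f g w. \<Sum>i\<le>length w. f (take i w) * g (drop i w)),
     sa_star = (\<lambda>f w. cnj (f (rev (map (\<lambda>(x, b). (x, \<not> b)) w))))\<rparr>"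

definition free_gen :: "'a \<Rightarrow> 'a star_poly" where
  "free_gen x = (\<lambda>w. if w = [(x, False)] then 1 else 0)"

definition cstar_seminorm :: "'b star_algebra \<Rightarrow> ('b \<Rightarrow> real) \<Rightarrow> bool" where
  "cstar_seminorm A p \<longleftrightarrow>
     (\<forall>x \<in> carrier A. 0 \<le> p x) \<and>
     (\<forall>x \<in> carrier A. \<forall>y \<in> carrier A. p (sa_add A x y) \<le> p x + p y) \<and>
     (\<forall>x \<in> carrier A. \<forall>c. p (sa_scale A c x) = cmod c * p x) \<and>
     (\<forall>x \<in> carrier A. \<forall>y \<in> carrier A. p (sa_mult A x y) \<le> p x * p y) \<and>
     (\<forall>x \<in> carrier A. p (sa_mult A (sa_star A x) x) = (p x)\<^sup>2)"

text \<open>The Hausdorff completion of a *-algebra \<open>A\<close> with respect to a C*-seminorm \<open>p\<close>. Its elements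
  are equivalence classes of Cauchy sequences; operations are applied to all representatives (the
  union is that of a single class).\<close>

definition cauchy_seq :: "'b star_algebra \<Rightarrow> ('b \<Rightarrow> real) \<Rightarrow> (nat \<Rightarrow> 'b) \<Rightarrow> bool" where
  "cauchy_seq A p X \<longleftrightarrow> (\<forall>n. X n \<in> carrier A) \<and>
     (\<forall>e > 0. \<exists>N. \<forall>m \<ge> N. \<forall>n \<ge> N. p (sa_diff A (X m) (X n)) < e)"

definition cauchy_class :: "'b star_algebra \<Rightarrow> ('b \<Rightarrow> real) \<Rightarrow> (nat \<Rightarrow> 'b) \<Rightarrow> (nat \<Rightarrow> 'b) set" where
  "cauchy_class A p X = {Y. cauchy_seq A p Y \<and> (\<lambda>n. p (sa_diff A (X n) (Y n))) \<longlonglongrightarrow> 0}"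

definition completion :: "'b star_algebra \<Rightarrow> ('b \<Rightarrow> real) \<Rightarrow> (nat \<Rightarrow> 'b) set star_algebra" where
  "completion A p = \<lparr>
     carrier = cauchy_class A p ` {X. cauchy_seq A p X},
     sa_zero = cauchy_class A p (\<lambda>n. sa_zero A),
     sa_add = (\<lambda>C D. \<Union>X \<in> C. \<Union>Y \<in> D. cauchy_class A p (\<lambda>n. sa_add A (X n) (Y n))),
     sa_scale = (\<lambda>c C. \<Union>X \<in> C. cauchy_class A p (\<lambda>n. sa_scale A c (X n))),
     sa_mult = (\<lambda>C D. \<Union>X \<in> C. \<Union>Y \<in> D. cauchy_class A p (\<lambda>n. sa_mult A (X n) (Y n))),
     sa_star = (\<lambda>C. \<Union>X \<in> C. cauchy_class A p (\<lambda>n. sa_star A (X n)))\<rparr>"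

text \<open>The universal C*-algebra on generators \<open>X\<close> subject to relations \<open>r = 0\<close>, \<open>r \<in> R\<close>: the completion
  of the free *-algebra in the largest C*-seminorm that vanishes on \<open>R\<close>. The C*-seminorms that
  vanish on \<open>R\<close> are exactly the functions \<open>x \<mapsto> \<parallel>\<pi>(x)\<parallel>\<close> for *-homomorphisms \<open>\<pi>\<close> into C*-algebras
  that satisfy the relations; the supremum is over all of them, without restriction on the size
  of the target. It has to be finite; this holds for the relations below since projections and
  partial isometries have norm at most 1.\<close>

definition universal_seminorm :: "'a set \<Rightarrow> 'a star_poly set \<Rightarrow> 'a star_poly \<Rightarrow> real" where
  "universal_seminorm X R f =
     (SUP p \<in> {p. cstar_seminorm (free_star_algebra X) p \<and> (\<forall>r \<in> R. p r = 0)}. p f)"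

definition universal_cstar :: "'a set \<Rightarrow> 'a star_poly set \<Rightarrow> (nat \<Rightarrow> 'a star_poly) set star_algebra" where
  "universal_cstar X R = completion (free_star_algebra X) (universal_seminorm X R)"

definition universal_gen :: "'a set \<Rightarrow> 'a star_poly set \<Rightarrow> 'a \<Rightarrow> (nat \<Rightarrow> 'a star_poly) set" where
  "universal_gen X R x = cauchy_class (free_star_algebra X) (universal_seminorm X R) (\<lambda>n. free_gen x)"


section \<open>The C*-algebra of a higher-rank graph\<close>

text \<open>The differences of the two sides of the defining relations, for a family \<open>t\<close> in a *-algebra
  \<open>A\<close>; the \<open>t v\<close>, \<open>v \<in> \<Lambda>\<^sup>0\<close>, are to be mutually orthogonal projections. The sums in the last
  relation are finite for a row-finite \<open>\<Lambda>\<close>, in particular for a finite one.\<close>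

definition ck_relators :: "('a, 'k::finite) kgraph \<Rightarrow> 'b star_algebra \<Rightarrow> ('a \<Rightarrow> 'b) \<Rightarrow> 'b set" where
  "ck_relators \<Lambda> A t =
     {sa_diff A (sa_mult A (t v) (t v)) (t v) | v. v \<in> vertices \<Lambda>} \<union>
     {sa_diff A (sa_star A (t v)) (t v) | v. v \<in> vertices \<Lambda>} \<union>
     {sa_mult A (t v) (t w) | v w. v \<in> vertices \<Lambda> \<and> w \<in> vertices \<Lambda> \<and> v \<noteq> w} \<union>
     {sa_diff A (sa_mult A (t x) (t y)) (t (cmp \<Lambda> x y)) | x y.
        x \<in> paths \<Lambda> \<and> y \<in> paths \<Lambda> \<and> src \<Lambda> x = rng \<Lambda> y} \<union>
     {sa_diff A (sa_mult A (sa_star A (t x)) (t x)) (t (src \<Lambda> x)) | x. x \<in> paths \<Lambda>} \<union>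
     {sa_diff A (t v) (sa_sum A (\<lambda>x. sa_mult A (t x) (sa_star A (t x)))
        (with_range \<Lambda> v (paths_le \<Lambda> n))) | v n. v \<in> vertices \<Lambda>}"

definition graph_relations :: "('a, 'k::finite) kgraph \<Rightarrow> 'a star_poly set" where
  "graph_relations \<Lambda> = ck_relators \<Lambda> (free_star_algebra (paths \<Lambda>)) free_gen"

definition graph_cstar :: "('a, 'k::finite) kgraph \<Rightarrow> (nat \<Rightarrow> 'a star_poly) set star_algebra" where
  "graph_cstar \<Lambda> = universal_cstar (paths \<Lambda>) (graph_relations \<Lambda>)"

text \<open>The canonical generator \<open>s\<^sub>\<lambda>\<close> of \<open>C\<^sup>*(\<Lambda>)\<close>.\<close>

definition graph_gen :: "('a, 'k::finite) kgraph \<Rightarrow> 'a \<Rightarrow> (nat \<Rightarrow> 'a star_poly) set" where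
  "graph_gen \<Lambda> = universal_gen (paths \<Lambda>) (graph_relations \<Lambda>)"

text \<open>\<open>s\<^sub>v C\<^sup>*(\<Lambda>) s\<^sub>v\<close>.\<close>

definition vertex_corner :: "('a, 'k::finite) kgraph \<Rightarrow> 'a \<Rightarrow> (nat \<Rightarrow> 'a star_poly) set star_algebra" where
  "vertex_corner \<Lambda> v = corner (graph_cstar \<Lambda>) (graph_gen \<Lambda> v)"

end

theory Submission
  imports Defs
begin

text \<open>Every \<open>\<alpha> \<in> \<Lambda>\<^sup>\<le>\<^sup>N\<close> ends on an initial cycle: the pigeonhole principle yields cycles in all directions
  in which \<open>s(\<alpha>)\<close> emits edges. From there on the path continues uniquely, because no cycle has an
  entrance, so \<open>\<Lambda>\<^sup>\<le>\<^sup>N\<close> labels the boundary paths, and words in the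
  generators and their adjoints act on \<open>\<Lambda>\<^sup>\<le>\<^sup>N\<close> by partial injections. Weighting this action by the
  characters of the period group of a class of initial cycles gives representations by
  matrices over \<open>C(T\<^sup>\<ell>)\<close>, which bound the universal seminorm from below.

  For the converse bound, let \<open>q\<close> be any C*-seminorm that kills the relations. Modulo \<open>q\<close>, a word is
  determined by the partial injection it induces and by its degree, since
  \<open>s\<^sub>\<xi>\<^sub>\<zeta>s\<^sub>\<eta>\<^sub>\<zeta>\<^sup>* = s\<^sub>\<xi>s\<^sub>\<eta>\<^sup>*\<close> whenever \<open>\<zeta>\<close> lies on an initial cycle. Hence \<open>q(f)\<close> is at most the sum
  of the absolute values of the Fourier coefficients of the matrix entries, that is, their supremum up
  to a factor polynomial in the degree of \<open>f\<close>. The identity \<open>q(f)\<^sup>2 = q(f\<^sup>*f)\<close>, iterated, removes this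
  factor. So the universal seminorm is equivalent to the supremum norm of the matrix entries, and the
  completion is the full direct sum of matrix algebras over \<open>C(T\<^sup>\<ell>)\<close> by the Stone--Weierstrass
  theorem. A vertex \<open>v\<close> on an initial cycle is a diagonal matrix unit there, and its corner is one copy
  of \<open>C(T\<^sup>\<ell>)\<close>.\<close>

section \<open>Paths in k-graphs\<close>

text \<open>The upper bound has to hold for an arbitrary C*-seminorm \<open>q\<close>, so neither a
  Hilbert space nor positivity nor spectral theory is at hand, and every identity is one up to
  \<open>q (x - y) = 0\<close>. The fact that suffers is orthogonality: the relations make the
  elements \<open>s_x s_x^*\<close> with \<open>x\<close> in
  \<open>v\<Lambda>\<^sup>\<le>\<^sup>n\<close> projections with sum \<open>s_v\<close>, but do not
  say that these are orthogonal. Usually this follows from positivity; here it is drawn from the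
  extremality of a projection in the unit ball of its corner, an argument that uses only the axioms
  of the seminorm.

  The universal seminorm and the supremum of the matrix entries are compared up to the factor
  \<open>card X + 1\<close>. This is enough, because a completion depends only on which sequences
  are Cauchy and which are null.

  The value of \<open>N\<close> is what the pigeonhole principle asks for: as many edges of one
  colour as there are vertices visit one vertex more than there are.\<close>

definition vec_min :: "nat ^ 'k \<Rightarrow> nat ^ 'k \<Rightarrow> nat ^ 'k" where
  "vec_min m n = (\<chi> i. min (m $ i) (n $ i))"

lemma vec_min_nth [simp]: "vec_min m n $ i = min (m $ i) (n $ i)"
  by (simp add: vec_min_def)

lemma vec_le_add_diff: "m \<le> n \<Longrightarrow> m + (n - m) = n" for m n :: "nat ^ 'k::finite"
  by (simp add: vec_eq_iff less_eq_vec_def)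

lemma axis_le_iff: "axis i 1 \<le> n \<longleftrightarrow> 0 < n $ i" for n :: "nat ^ 'k::finite"
  by (auto simp: less_eq_vec_def axis_def Suc_le_eq)

lemma add_axis_le_iff: "m \<le> n \<Longrightarrow> m + axis i 1 \<le> n \<longleftrightarrow> m $ i < n $ i" for n :: "nat ^ 'k::finite"
  by (auto simp: less_eq_vec_def axis_def Suc_le_eq)

context k_graph
begin

abbreviation comp (infixl "\<cdot>" 70) where "x \<cdot> y \<equiv> cmp \<Lambda> x y"
abbreviation "P \<equiv> paths \<Lambda>"
abbreviation "d \<equiv> deg \<Lambda>"
abbreviation "r \<equiv> rng \<Lambda>"
abbreviation "s \<equiv> src \<Lambda>"

definition live :: "'a \<Rightarrow> 'k \<Rightarrow> bool" where
  "live u i \<longleftrightarrow> with_range \<Lambda> u (edges \<Lambda> i) \<noteq> {}"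

lemma live_iff: "live u i \<longleftrightarrow> (\<exists>x\<in>P. r x = u \<and> d x = axis i 1)"
  by (auto simp: live_def with_range_def edges_def paths_of_deg_def)

lemmas path_simps = rng_closed src_closed rng_rng src_rng rng_src src_src cmp_closed rng_cmp src_cmp
  cmp_rng cmp_src deg_rng deg_src deg_cmp

lemma factor:
  assumes "x \<in> P" "d x = m + n"
  obtains y z where "y \<in> P" "z \<in> P" "d y = m" "d z = n" "s y = r z" "x = y \<cdot> z"
  using factorization[OF assms] by blast

lemma factor_unique:
  assumes "y \<in> P" "z \<in> P" "s y = r z" "y' \<in> P" "z' \<in> P" "s y' = r z'"
    and "y \<cdot> z = y' \<cdot> z'" "d y = d y'"
  shows "y = y'" "z = z'"
proof -
  have e: "d (y \<cdot> z) = d y + d z" "d (y \<cdot> z) = d y + d z'"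
    using deg_cmp[of y z] deg_cmp[of y' z'] assms by auto
  hence "d z = d z'" by simp
  moreover have "\<exists>!(a, b). a \<in> P \<and> b \<in> P \<and> d a = d y \<and> d b = d z \<and> s a = r b \<and> y \<cdot> z = a \<cdot> b"
    using factorization[OF cmp_closed e(1)] assms by auto
  ultimately have "(y, z) = (y', z')" using assms by (smt (verit, ccfv_threshold) case_prodI)
  thus "y = y'" "z = z'" by auto
qed

lemma prefix:
  assumes "x \<in> P" "n \<le> d x"
  obtains y z where "y \<in> P" "z \<in> P" "d y = n" "d z = d x - n" "s y = r z" "x = y \<cdot> z"
  using factor[OF assms(1), of n "d x - n"] vec_le_add_diff[OF assms(2)] by metis

lemma vertices_iff: "v \<in> vertices \<Lambda> \<longleftrightarrow> v \<in> P \<and> d v = 0"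
  by (auto simp: vertices_def paths_of_deg_def)

text \<open>The two sides of \<open>r v \<cdot> v = v \<cdot> s v\<close> split one path into two of
  degree 0, so unique factorization identifies first factors with each other and second factors with
  each other.\<close>

lemma vertex_rng_src:
  assumes "v \<in> P" "d v = 0"
  shows "r v = v" "s v = v"
proof -
  have "r v \<in> P" "s v \<in> P" "s (r v) = r v" "s v = r (s v)" "r v \<cdot> v = v \<cdot> s v" "d (r v) = d v"
    using assms by (auto simp: path_simps)
  from factor_unique[OF this(1) assms(1) this(3) assms(1) this(2,4,5,6)]
  show "r v = v" "s v = v" by auto
qed

lemma rng_vertex: "x \<in> P \<Longrightarrow> r x \<in> vertices \<Lambda>" and src_vertex: "x \<in> P \<Longrightarrow> s x \<in> vertices \<Lambda>"
  by (auto simp: vertices_iff path_simps)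

lemma live_rng_if_deg:
  assumes "x \<in> P" "0 < d x $ i"
  shows "live (r x) i"
  using prefix[OF assms(1), of "axis i 1"] assms(2) unfolding axis_le_iff live_iff
  by (metis rng_cmp)

lemma cycle_power:
  assumes "x \<in> P" "r x = s x"
  obtains y where "y \<in> P" "r y = r x" "s y = r x" "d y = m *s d x"
proof -
  have "\<exists>y\<in>P. r y = r x \<and> s y = r x \<and> d y = m *s d x"
  proof (induction m)
    case 0
    show ?case using assms by (intro bexI[of _ "r x"]) (auto simp: path_simps)
  next
    case (Suc m)
    then obtain y where "y \<in> P" "r y = r x" "s y = r x" "d y = m *s d x" by blast
    thus ?case using assms
      by (intro bexI[of _ "x \<cdot> y"]) (auto simp: path_simps vec_eq_iff)
  qed
  thus thesis using that by blast
qed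

text \<open>The vertices from which a path continues in only one way for each degree
  (\<open>terminal_unique\<close>). Ranges suffice to capture all vertices on initial cycles, since
  a cycle can be rotated (\<open>terminal_src\<close>).\<close>

definition terminal :: "'a set" where
  "terminal = r ` initial_cycles \<Lambda>"

lemma terminalE:
  assumes "v \<in> terminal"
  obtains \<mu> where "\<mu> \<in> initial_cycles \<Lambda>" "\<mu> \<in> P" "r \<mu> = v" "s \<mu> = v"
    "\<And>i. live v i \<longleftrightarrow> 0 < d \<mu> $ i"
proof -
  obtain \<mu> where m: "\<mu> \<in> initial_cycles \<Lambda>" "v = r \<mu>" using assms by (auto simp: terminal_def)
  hence p: "\<mu> \<in> P" "r \<mu> = s \<mu>" "\<And>i. d \<mu> $ i = 0 \<Longrightarrow> \<not> live v i"
    by (auto simp: initial_cycles_def live_def)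
  show thesis
    using that[OF m(1) p(1)] m p live_rng_if_deg[OF p(1)] by (metis neq0_conv)
qed

lemma terminal_paths: "v \<in> terminal \<Longrightarrow> v \<in> P"
  by (metis terminalE rng_closed)

end

section \<open>Unique continuation along cycles without entrance\<close>

locale no_entrance_graph = k_graph +
  assumes fin: "finite_kgraph \<Lambda>"
    and convex: "locally_convex \<Lambda>"
    and no_entrance: "\<not> (\<exists>x. cycle \<Lambda> x \<and> has_entrance \<Lambda> x)"
begin

lemma finite_vertices: "finite (vertices \<Lambda>)"
  using fin by (auto simp: finite_kgraph_def vertices_def)

text \<open>Since \<open>c\<close> has no entrance, \<open>x\<close> and \<open>y\<close> both equal
  the same term \<open>inf_path \<Lambda> c 0 (d x)\<close>; the definite description behind it is
  never unfolded. A vertex \<open>c\<close> is not a cycle and is treated separately.\<close>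

lemma cycle_unique:
  assumes c: "c \<in> P" "r c = s c" and x: "x \<in> P" "r x = r c" and y: "y \<in> P" "r y = r c"
    and "d x = d y" and le: "\<And>i. d c $ i = 0 \<Longrightarrow> d x $ i = 0"
  shows "x = y"
proof (cases "d c = 0")
  case True
  hence "d x = 0" using le by (auto simp: vec_eq_iff)
  thus ?thesis using vertex_rng_src[of x] vertex_rng_src[of y] assms by metis
next
  case False
  hence "cycle \<Lambda> c" using c by (auto simp: cycle_def vertices_iff)
  hence n: "\<not> has_entrance \<Lambda> c" using no_entrance by blast
  have le: "le_deg (d x) (inf_deg \<Lambda> c)" using le by (auto simp: le_deg_def inf_deg_def zero_enat_def)
  have "t = inf_path \<Lambda> c 0 (d t)" if "t \<in> P" "r t = r c" "le_deg (d t) (inf_deg \<Lambda> c)" for t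
    using n that unfolding has_entrance_def with_range_def by blast
  from this[OF x le] this[OF y le[unfolded \<open>d x = d y\<close>]] \<open>d x = d y\<close> show ?thesis by metis
qed

lemma terminal_unique:
  assumes "v \<in> terminal" "x \<in> P" "y \<in> P" "r x = v" "r y = v" "d x = d y"
  shows "x = y"
proof -
  obtain \<mu> where m: "\<mu> \<in> P" "r \<mu> = v" "s \<mu> = v" "\<And>i. live v i \<longleftrightarrow> 0 < d \<mu> $ i"
    using terminalE[OF assms(1)] by metis
  show ?thesis
    by (rule cycle_unique[of \<mu>]) (use assms m live_rng_if_deg in \<open>auto, fastforce\<close>)
qed

text \<open>By uniqueness, a high power of the initial cycle at \<open>v\<close> begins with
  \<open>x\<close>; what remains after \<open>x\<close> leads back to \<open>v\<close>.\<close>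

lemma terminal_return:
  assumes "v \<in> terminal" "x \<in> P" "r x = v"
  obtains y where "y \<in> P" "r y = s x" "s y = v" "\<And>i. live v i \<Longrightarrow> 0 < d y $ i"
proof -
  obtain \<mu> where m: "\<mu> \<in> P" "r \<mu> = v" "s \<mu> = v" "\<And>i. live v i \<longleftrightarrow> 0 < d \<mu> $ i"
    using terminalE[OF assms(1)] by metis
  \<comment> \<open>\<open>M\<close> exceeds every entry of \<open>d x\<close>, so the remainder has
    positive degree in each live direction; \<open>terminal_src\<close> needs this to close up an
    initial cycle at \<open>s x\<close>.\<close>
  define M where "M = Suc (\<Sum>i\<in>UNIV. d x $ i)"
  obtain z where z: "z \<in> P" "r z = v" "s z = v" "d z = M *s d \<mu>"
    using cycle_power[of \<mu> M] m by metis
  have lt: "d x $ i < M" for i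
    using member_le_sum[of i UNIV "\<lambda>i. d x $ i"] by (simp add: M_def)
  have pos: "d x $ i \<le> (M *s d \<mu>) $ i \<and> (0 < d \<mu> $ i \<longrightarrow> d x $ i < (M *s d \<mu>) $ i)" for i
  proof (cases "d \<mu> $ i = 0")
    case True
    hence "d x $ i = 0" using live_rng_if_deg[OF assms(2)] m(4) assms(3) by fastforce
    thus ?thesis using True by simp
  next
    case False
    hence "M * 1 \<le> M * d \<mu> $ i" by (intro mult_le_mono) auto
    hence "d x $ i < M * d \<mu> $ i" using lt[of i] by linarith
    thus ?thesis by simp
  qed
  hence "d x \<le> d z" using z by (simp add: less_eq_vec_def)
  then obtain x' y where y: "x' \<in> P" "y \<in> P" "d x' = d x" "d y = d z - d x" "s x' = r y" "z = x' \<cdot> y"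
    using prefix[OF z(1)] by blast
  have "x' = x" using terminal_unique[OF assms(1)] y assms z rng_cmp by metis
  moreover have "s y = v" using y z by (metis src_cmp)
  moreover have "0 < d y $ i" if "live v i" for i using that pos[of i] m(4) y(4) z(4) by simp
  ultimately show thesis using that[of y] y by metis
qed

text \<open>Rotate the cycle: with \<open>y\<close> leading back to \<open>v\<close>, the cycle
  \<open>y \<cdot> x\<close> at \<open>s x\<close> has positive degree in every live
  direction.\<close>

lemma terminal_src:
  assumes "v \<in> terminal" "x \<in> P" "r x = v"
  shows "s x \<in> terminal" "live (s x) i \<longleftrightarrow> live v i"
proof -
  obtain y where y: "y \<in> P" "r y = s x" "s y = v" "\<And>i. live v i \<Longrightarrow> 0 < d y $ i"
    using terminal_return[OF assms] by blast
  have 1: "live v i" if "live (s x) i" for i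
  proof -
    obtain e where "e \<in> P" "r e = s x" "d e = axis i 1" using \<open>live (s x) i\<close> by (auto simp: live_iff)
    thus ?thesis using live_rng_if_deg[of "x \<cdot> e" i] assms by (auto simp: path_simps axis_def)
  qed
  have yx: "y \<cdot> x \<in> P" "d (y \<cdot> x) = d y + d x" "r (y \<cdot> x) = s x" "s (y \<cdot> x) = s x"
    using y assms by (auto simp: path_simps)
  hence "y \<cdot> x \<in> initial_cycles \<Lambda>"
    using 1 y(4) unfolding initial_cycles_def live_def by fastforce
  thus "s x \<in> terminal" using yx by (force simp: terminal_def)
  show "live (s x) i \<longleftrightarrow> live v i"
    using 1 y(1,2) y(4) live_rng_if_deg[of y i] by metis
qed

text \<open>Take a prefix of a high power of the initial cycle at \<open>v\<close>.\<close>

lemma terminal_exists: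
  assumes "v \<in> terminal" "\<And>i. 0 < n $ i \<Longrightarrow> live v i"
  obtains x where "x \<in> P" "r x = v" "d x = n"
proof -
  obtain \<mu> where m: "\<mu> \<in> P" "r \<mu> = v" "s \<mu> = v" "\<And>i. live v i \<longleftrightarrow> 0 < d \<mu> $ i"
    using terminalE[OF assms(1)] by metis
  define M where "M = (\<Sum>i\<in>UNIV. n $ i)"
  obtain z where z: "z \<in> P" "r z = v" "s z = v" "d z = M *s d \<mu>"
    using cycle_power[of \<mu> M] m by metis
  have lt: "n $ i \<le> M" for i
    using member_le_sum[of i UNIV "\<lambda>i. n $ i"] by (simp add: M_def)
  have "n $ i \<le> M * d \<mu> $ i" for i
  proof (cases "n $ i = 0")
    case False
    hence "M * 1 \<le> M * d \<mu> $ i" using m(4) assms(2) by (intro mult_le_mono) (auto simp: Suc_le_eq)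
    thus ?thesis using lt[of i] by linarith
  qed simp
  hence "n \<le> d z" using z by (simp add: less_eq_vec_def)
  thus thesis using prefix[OF z(1)] that z rng_cmp by metis
qed

text \<open>The truncated differences \<open>d y - d x\<close> and \<open>d x - d y\<close> are what
  the two paths lack to the degree \<open>max (d x) (d y)\<close>, and paths of equal degree from
  \<open>v\<close> coincide.\<close>

lemma terminal_join:
  assumes "v \<in> terminal" "x \<in> P" "r x = v" "y \<in> P" "r y = v"
  obtains x' y' where "x' \<in> P" "y' \<in> P" "s x = r x'" "s y = r y'" "x \<cdot> x' = y \<cdot> y'"
proof -
  have l: "live v i" if "0 < (d y - d x) $ i \<or> 0 < (d x - d y) $ i" for i
    using that live_rng_if_deg[of x i] live_rng_if_deg[of y i] assms by auto
  obtain x' where x': "x' \<in> P" "r x' = s x" "d x' = d y - d x"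
    using terminal_exists[of "s x" "d y - d x"] l terminal_src assms by metis
  obtain y' where y': "y' \<in> P" "r y' = s y" "d y' = d x - d y"
    using terminal_exists[of "s y" "d x - d y"] l terminal_src assms by metis
  have "d (x \<cdot> x') = d (y \<cdot> y')" using x' y' assms
    by (auto simp: path_simps vec_eq_iff)
  hence "x \<cdot> x' = y \<cdot> y'"
    using terminal_unique[OF assms(1)] x' y' assms by (metis cmp_closed rng_cmp)
  thus thesis using that x' y' by metis
qed

text \<open>Here local convexity enters: passing an edge of another colour does not destroy
  direction \<open>i\<close>, and induction on the length of \<open>x\<close> carries the direction
  through a path that does not use it.\<close>

lemma live_along:
  assumes "x \<in> P" "live (r x) i" "d x $ i = 0"
  shows "live (s x) i"
  using assms
proof (induction "\<Sum>j\<in>UNIV. d x $ j" arbitrary: x rule: less_induct)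
  case less
  show ?case
  proof (cases "d x = 0")
    case True
    thus ?thesis using less vertex_rng_src[of x] by simp
  next
    case False
    then obtain j where j: "0 < d x $ j" by (auto simp: vec_eq_iff)
    then obtain e y where y: "e \<in> P" "y \<in> P" "d e = axis j 1" "d y = d x - axis j 1" "s e = r y" "x = e \<cdot> y"
      using prefix[OF less(2), of "axis j 1"] axis_le_iff by metis
    have ij: "i \<noteq> j" using j less by auto
    obtain f where "f \<in> P" "r f = r e" "d f = axis i 1"
      using less(3) y by (auto simp: live_iff path_simps)
    hence "live (s e) i"
      using convex y(1,3) ij unfolding locally_convex_def live_def edges_def paths_of_deg_def
      by (metis (mono_tags, lifting) mem_Collect_eq)
    moreover have "(\<Sum>j\<in>UNIV. d y $ j) < (\<Sum>j\<in>UNIV. d x $ j)"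
      by (rule sum_strict_mono_ex1) (use y j in \<open>auto simp: axis_def intro!: bexI[of _ j]\<close>)
    moreover have "d y $ i = 0" using y(4) less(4) by simp
    ultimately have "live (s y) i" using less(1)[of y] y by simp
    thus ?thesis using y by (simp add: path_simps)
  qed
qed

text \<open>The maximality condition of \<open>paths_le \<Lambda> n\<close> freed from the bound
  \<open>d x \<le> n\<close>, so that it also applies to long extensions, which are then cut back
  into \<open>paths_le \<Lambda> n\<close>.\<close>

definition full :: "nat ^ 'b \<Rightarrow> 'a \<Rightarrow> bool" where
  "full n x \<longleftrightarrow> (\<forall>i. n $ i \<le> d x $ i \<or> \<not> live (s x) i)"

lemma paths_le_iff: "x \<in> paths_le \<Lambda> n \<longleftrightarrow> x \<in> P \<and> d x \<le> n \<and> full n x"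
proof -
  have "(\<forall>i. d x + axis i 1 \<le> n \<longrightarrow> with_range \<Lambda> (s x) (edges \<Lambda> i) = {}) \<longleftrightarrow> full n x" if "d x \<le> n"
    unfolding add_axis_le_iff[OF that] full_def live_def by (metis not_less)
  thus ?thesis unfolding paths_le_def by auto
qed

text \<open>Cut at degree \<open>min (d x) n\<close>. In a direction where \<open>d x\<close> stays
  below \<open>n\<close>, the part cut off has degree 0; were the direction live at the cut, it
  would by \<open>live_along\<close> still be live at \<open>s x\<close>.\<close>

lemma full_truncate:
  assumes "x \<in> P" "full n x"
  obtains y z where "y \<in> paths_le \<Lambda> n" "z \<in> P" "d z = d x - vec_min (d x) n" "s y = r z" "x = y \<cdot> z"
proof -
  have "vec_min (d x) n \<le> d x" by (simp add: less_eq_vec_def)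
  then obtain y z where y: "y \<in> P" "z \<in> P" "d y = vec_min (d x) n" "d z = d x - vec_min (d x) n"
      "s y = r z" "x = y \<cdot> z"
    using prefix[OF assms(1)] by metis
  have "full n y" unfolding full_def
  proof
    fix i
    show "n $ i \<le> d y $ i \<or> \<not> live (s y) i"
    proof (cases "n $ i \<le> d x $ i")
      case False
      moreover have "s x = s z" using y by (metis src_cmp)
      ultimately have "\<not> live (s z) i" using assms(2) by (auto simp: full_def)
      moreover have "d z $ i = 0" using False y(4) by simp
      ultimately show ?thesis using live_along[of z i] y(2,5) by auto
    qed (use y(3) in simp)
  qed
  hence "y \<in> paths_le \<Lambda> n" using y(1,3) by (auto simp: paths_le_iff less_eq_vec_def)
  thus thesis using that y by blast
qed

text \<open>Where \<open>d y\<close> is below \<open>n\<close>, the direction is dead at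
  \<open>s y\<close>, so \<open>z\<close> does not move in it. The degree of a prefix in
  \<open>paths_le \<Lambda> n\<close>, and with it the prefix, is thus determined by the whole
  path.\<close>

lemma paths_le_prefix_deg:
  assumes "y \<in> paths_le \<Lambda> n" "z \<in> P" "s y = r z"
  shows "d y = vec_min (d (y \<cdot> z)) n"
proof -
  have y: "y \<in> P" "d y \<le> n" "full n y" using assms by (auto simp: paths_le_iff)
  have "d y $ i = min (d y $ i + d z $ i) (n $ i)" for i
  proof (cases "n $ i \<le> d y $ i")
    case False
    hence "d z $ i = 0" using y(3) live_rng_if_deg[of z i] assms by (auto simp: full_def)
    thus ?thesis using False by simp
  qed (use y in \<open>auto simp: less_eq_vec_def intro: antisym\<close>)
  thus ?thesis using y assms by (simp add: vec_eq_iff path_simps)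
qed

lemma paths_le_prefix_unique:
  assumes "y \<in> paths_le \<Lambda> n" "z \<in> P" "s y = r z" "y' \<in> paths_le \<Lambda> n" "z' \<in> P" "s y' = r z'"
    and "y \<cdot> z = y' \<cdot> z'"
  shows "y = y'"
  using factor_unique(1)[of y z y' z'] paths_le_prefix_deg[of y n z] paths_le_prefix_deg[of y' n z'] assms
  by (auto simp: paths_le_iff)

lemma full_extend:
  assumes "x \<in> P" "s x \<in> terminal"
  obtains z where "z \<in> P" "r z = s x" "full n (x \<cdot> z)"
proof -
  define n' where "n' = (\<chi> i. if live (s x) i then n $ i else 0)"
  have "live (s x) i" if "0 < n' $ i" for i using that by (auto simp: n'_def split: if_splits)
  then obtain z where z: "z \<in> P" "r z = s x" "d z = n'"
    using terminal_exists[OF assms(2)] by blast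
  have "full n (x \<cdot> z)"
    unfolding full_def using z assms terminal_src(2)[OF assms(2) z(1,2)]
    by (auto simp: path_simps n'_def)
  thus thesis using that z by blast
qed

text \<open>As direction \<open>i\<close> is live at its end, \<open>x\<close> contains
  \<open>card (vertices \<Lambda>)\<close> steps of colour \<open>i\<close>. A vertex repeats along
  them, which gives a cycle \<open>c\<close>. The rest of \<open>x\<close> runs along
  \<open>c\<close>, because \<open>c\<close> has no entrance, and following \<open>c\<close> further
  closes up a cycle at \<open>s x\<close>.\<close>

lemma return_at_live_source:
  assumes "x \<in> paths_le \<Lambda> (\<chi> i. card (vertices \<Lambda>))" "live (s x) i"
  obtains c q where "c \<in> P" "r c = s x" "s c = s x" "d c = axis i q" "0 < q"
proof -
  define n where "n = card (vertices \<Lambda>)"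
  have x: "x \<in> P" "d x $ i = n"
    using assms by (auto simp: paths_le_iff full_def n_def less_eq_vec_def intro: antisym)
  \<comment> \<open>Unique factorization allows all steps in direction \<open>i\<close> to be moved
    to the end of \<open>x\<close>.\<close>
  have "d x - axis i n \<le> d x" by (auto simp: less_eq_vec_def)
  then obtain x' y where y: "x' \<in> P" "y \<in> P" "d y = d x - (d x - axis i n)" "s x' = r y" "x = x' \<cdot> y"
    using prefix[OF x(1)] by metis
  have dy: "d y = axis i n" and sy: "s y = s x"
    using y x(2) by (auto simp: vec_eq_iff axis_def src_cmp)
  have "axis i a \<le> d y" if "a \<le> n" for a using that dy by (auto simp: less_eq_vec_def axis_def)
  hence "\<forall>a\<in>{..n}. \<exists>p. \<exists>z\<in>P. p \<in> P \<and> d p = axis i a \<and> d z = axis i (n - a) \<and> s p = r z \<and> y = p \<cdot> z"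
  proof (intro ballI)
    fix a assume "a \<in> {..n}"
    then obtain p z where "p \<in> P" "z \<in> P" "d p = axis i a" "d z = d y - axis i a" "s p = r z" "y = p \<cdot> z"
      using prefix[OF y(2)] \<open>\<And>a. a \<le> n \<Longrightarrow> axis i a \<le> d y\<close> by (metis atMost_iff)
    moreover have "d y - axis i a = axis i (n - a)" by (auto simp: dy vec_eq_iff axis_def)
    ultimately show "\<exists>p. \<exists>z\<in>P. p \<in> P \<and> d p = axis i a \<and> d z = axis i (n - a) \<and> s p = r z \<and> y = p \<cdot> z"
      by metis
  qed
  then obtain p where p: "\<And>a. a \<le> n \<Longrightarrow>
      \<exists>z\<in>P. p a \<in> P \<and> d (p a) = axis i a \<and> d z = axis i (n - a) \<and> s (p a) = r z \<and> y = p a \<cdot> z"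
    by (metis atMost_iff bchoice)
  \<comment> \<open>The prefixes \<open>p 0, ..., p n\<close> of \<open>y\<close> end at
    \<open>n + 1\<close> vertices, one more than there are.\<close>
  have "\<not> inj_on (\<lambda>a. s (p a)) {..n}"
  proof
    assume "inj_on (\<lambda>a. s (p a)) {..n}"
    moreover have "(\<lambda>a. s (p a)) ` {..n} \<subseteq> vertices \<Lambda>" using p src_vertex by force
    ultimately have "card {..n} \<le> n" unfolding n_def by (intro card_inj_on_le[OF _ _ finite_vertices])
    thus False by simp
  qed
  then obtain a b where "a \<le> n" "b \<le> n" "a \<noteq> b" "s (p a) = s (p b)" by (auto simp: inj_on_def)
  then obtain a b where ab: "a \<le> n" "b \<le> n" "a < b" "s (p a) = s (p b)" by (metis nat_neq_iff)
  obtain z where z: "z \<in> P" "p a \<in> P" "d (p a) = axis i a" "d z = axis i (n - a)" "s (p a) = r z" "y = p a \<cdot> z"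
    using p[OF ab(1)] by blast
  have "axis i (b - a) \<le> d z" using ab z(4) by (auto simp: less_eq_vec_def axis_def)
  then obtain c w where c: "c \<in> P" "w \<in> P" "d c = axis i (b - a)" "s c = r w" "z = c \<cdot> w"
    using prefix[OF z(1)] by metis
  have rc: "r c = s (p a)" using c z by (metis rng_cmp)
  have "y = (p a \<cdot> c) \<cdot> w" using z c rc by (metis cmp_assoc)
  moreover have "d (p a \<cdot> c) = axis i b"
    using deg_cmp[OF z(2) c(1)] rc z(3) c(3) ab by (auto simp: vec_eq_iff axis_def)
  moreover obtain w' where "w' \<in> P" "p b \<in> P" "d (p b) = axis i b" "s (p b) = r w'" "y = p b \<cdot> w'"
    using p[OF ab(2)] by blast
  ultimately have "p a \<cdot> c = p b"
    using factor_unique(1)[of "p a \<cdot> c" w "p b" w'] z c rc by (metis cmp_closed src_cmp)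
  hence sc: "s c = s (p a)" using ab(4) z c rc by (metis src_cmp)
  \<comment> \<open>The power \<open>n + 1\<close> of \<open>c\<close> is long enough to contain
    \<open>z\<close>, whose degree in direction \<open>i\<close> is \<open>n - a\<close>.\<close>
  obtain m where m: "m \<in> P" "r m = r c" "s m = r c" "d m = Suc n *s d c"
    using cycle_power[OF c(1), of "Suc n"] rc sc by metis
  have "Suc n * 1 \<le> Suc n * (b - a)" using ab by (intro mult_le_mono) auto
  hence "n < Suc n * (b - a)" unfolding mult_1_right by (rule Suc_le_lessD)
  hence "n - a < Suc n * (b - a)" by (rule le_less_trans[OF diff_le_self])
  hence le: "d z \<le> d m" "0 < Suc n * (b - a)" using z(4) m(4) c(3) by (auto simp: less_eq_vec_def axis_def)
  then obtain z' t where t: "z' \<in> P" "t \<in> P" "d z' = d z" "s z' = r t" "m = z' \<cdot> t"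
    using prefix[OF m(1)] by metis
  have rz': "r z' = r c" using t m by (metis rng_cmp)
  have rz: "r z = r c" using z rc by simp
  have "d z $ j = 0" if "d c $ j = 0" for j using that c(3) ab z(4) by (auto simp: axis_def split: if_splits)
  hence "z' = z" using cycle_unique[of c z' z] c(1) rc sc t rz' rz z(1) by metis
  have sz: "s z = s x" using z sy by (metis src_cmp)
  have t': "r t = s x" "s t = r z" using t \<open>z' = z\<close> sz m rz by (metis, metis src_cmp)
  have "d (t \<cdot> z) = d z + d t" using deg_cmp[OF t(2) z(1)] t' by (simp add: add.commute)
  also have "\<dots> = d m" using deg_cmp[OF t(1,2,4)] t(5) \<open>z' = z\<close> by simp
  also have "\<dots> = axis i (Suc n * (b - a))" using m(4) c(3) by (auto simp: vec_eq_iff axis_def)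
  finally have "d (t \<cdot> z) = axis i (Suc n * (b - a))" .
  with le(2) show thesis
    using that[of "t \<cdot> z"] cmp_closed[OF t(2) z(1)] rng_cmp[OF t(2) z(1)] src_cmp[OF t(2) z(1)] t' sz by metis
qed

text \<open>Compose one cycle at \<open>s x\<close> for each live direction. The result has positive
  degree exactly in the live directions, as an initial cycle requires.\<close>

lemma src_terminal:
  assumes x: "x \<in> paths_le \<Lambda> (\<chi> i. card (vertices \<Lambda>))"
  shows "s x \<in> terminal"
proof -
  have xP: "x \<in> P" using x by (simp add: paths_le_iff)
  have *: "\<exists>c\<in>P. r c = s x \<and> s c = s x \<and> (\<forall>i. 0 < d c $ i \<longleftrightarrow> i \<in> I)"
    if "I \<subseteq> {i. live (s x) i}" for I :: "'b set"
    using finite[of I] that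
  proof (induction I)
    case empty
    show ?case using xP by (intro bexI[of _ "s x"]) (auto simp: path_simps)
  next
    case (insert i I)
    then obtain c where c: "c \<in> P" "r c = s x" "s c = s x" "\<And>i. 0 < d c $ i \<longleftrightarrow> i \<in> I" by auto
    obtain e q where e: "e \<in> P" "r e = s x" "s e = s x" "d e = axis i q" "0 < q"
      using return_at_live_source[OF x, of i] insert.prems by auto
    have ce: "s c = r e" using c e by simp
    have "\<forall>j. 0 < d (c \<cdot> e) $ j \<longleftrightarrow> j \<in> insert i I"
      using c(4) e(4,5) by (auto simp: deg_cmp[OF c(1) e(1) ce] axis_def)
    moreover have "c \<cdot> e \<in> P" "r (c \<cdot> e) = s x" "s (c \<cdot> e) = s x"
      using cmp_closed[OF c(1) e(1) ce] rng_cmp[OF c(1) e(1) ce] src_cmp[OF c(1) e(1) ce] c(2) e(3) by auto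
    ultimately show ?case by blast
  qed
  obtain c where c: "c \<in> P" "r c = s x" "s c = s x" "\<And>i. 0 < d c $ i \<longleftrightarrow> live (s x) i"
    using *[OF subset_refl] by blast
  have "with_range \<Lambda> (r c) (edges \<Lambda> i) = {}" if "d c $ i = 0" for i
    using c(4)[of i] c(2) that by (simp add: live_def)
  hence "c \<in> initial_cycles \<Lambda>" using c(1-3) by (simp add: initial_cycles_def)
  thus ?thesis using c by (force simp: terminal_def)
qed

section \<open>Vertex sets and periods of initial cycles\<close>

definition reach :: "'a \<Rightarrow> 'a set" where
  "reach v = {s x | x. x \<in> P \<and> r x = v}"

lemma reachI: "x \<in> P \<Longrightarrow> r x = v \<Longrightarrow> s x \<in> reach v"
  by (auto simp: reach_def)

lemma terminal_in_reach: "v \<in> terminal \<Longrightarrow> v \<in> reach v"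
  using reachI[of v v] by (metis terminalE rng_closed rng_rng src_rng)

lemma reach_terminal: "v \<in> terminal \<Longrightarrow> u \<in> reach v \<Longrightarrow> u \<in> terminal"
  using terminal_src(1) by (auto simp: reach_def)

lemma reach_mono:
  assumes "u \<in> reach v"
  shows "reach u \<subseteq> reach v"
proof
  fix w assume "w \<in> reach u"
  then obtain x y where "x \<in> P" "r x = v" "s x = u" "y \<in> P" "r y = u" "s y = w"
    using assms by (auto simp: reach_def)
  thus "w \<in> reach v" using reachI[of "x \<cdot> y"] by (metis cmp_closed rng_cmp src_cmp)
qed

lemma reach_sym: "v \<in> terminal \<Longrightarrow> u \<in> reach v \<Longrightarrow> v \<in> reach u"
  using terminal_return reachI by (force simp: reach_def)

text \<open>On terminal vertices reachability is an equivalence relation, so the set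
  \<open>reach v\<close> can name a class of initial cycles; by \<open>vertices_on_eq\<close> it is
  the vertex set of each cycle in the class.\<close>

lemma reach_eq: "v \<in> terminal \<Longrightarrow> u \<in> reach v \<Longrightarrow> reach u = reach v"
  using reach_mono reach_sym by blast

definition deg_diff :: "'a \<Rightarrow> 'a \<Rightarrow> int ^ 'b" where
  "deg_diff x y = (\<chi> i. int (d x $ i) - int (d y $ i))"

text \<open>The group \<open>G_\<mu>\<close> for \<open>v = r \<mu>\<close>, phrased with finite
  paths instead of \<open>\<mu>\<^sup>\<infinity>\<close>; see
  \<open>period_group_eq\<close>.\<close>

definition periods :: "'a \<Rightarrow> (int ^ 'b) set" where
  "periods v = {deg_diff x y | x y. x \<in> P \<and> y \<in> P \<and> r x = v \<and> r y = v \<and> s x = s y}"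

lemma periodsI: "x \<in> P \<Longrightarrow> y \<in> P \<Longrightarrow> r x = v \<Longrightarrow> r y = v \<Longrightarrow> s x = s y \<Longrightarrow> deg_diff x y \<in> periods v"
  by (auto simp: periods_def)

lemma deg_diff_comp:
  assumes "x \<in> P" "x' \<in> P" "s x = r x'" "y \<in> P" "y' \<in> P" "s y = r y'"
  shows "deg_diff (x \<cdot> x') (y \<cdot> y') = deg_diff x y + deg_diff x' y'"
  using deg_cmp[OF assms(1-3)] deg_cmp[OF assms(4-6)] by (simp add: deg_diff_def vec_eq_iff)

lemma deg_diff_self [simp]: "deg_diff x x = 0"
  by (simp add: deg_diff_def vec_eq_iff)

text \<open>Prolonging both paths by one return path to \<open>v\<close> keeps their degree
  difference. With cycles as representatives, adding periods is composing paths.\<close>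

lemma periods_closed_cycles:
  assumes "v \<in> terminal" "g \<in> periods v"
  obtains x y where "x \<in> P" "y \<in> P" "r x = v" "r y = v" "s x = v" "s y = v" "g = deg_diff x y"
proof -
  obtain x y where x: "x \<in> P" "y \<in> P" "r x = v" "r y = v" "s x = s y" "g = deg_diff x y"
    using assms by (auto simp: periods_def)
  obtain z where z: "z \<in> P" "r z = s x" "s z = v" using terminal_return[OF assms(1) x(1,3)] by metis
  have "deg_diff (x \<cdot> z) (y \<cdot> z) = g" using x z by (subst deg_diff_comp) auto
  thus thesis using that[of "x \<cdot> z" "y \<cdot> z"] x z by (metis cmp_closed rng_cmp src_cmp)
qed

lemma zero_in_periods: "v \<in> terminal \<Longrightarrow> 0 \<in> periods v"
  using periodsI[of v v v] by (metis deg_diff_self terminalE rng_closed rng_rng)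

lemma periods_uminus: "g \<in> periods v \<Longrightarrow> - g \<in> periods v"
  unfolding periods_def by (force simp: deg_diff_def vec_eq_iff)

lemma periods_add:
  assumes "v \<in> terminal" "g \<in> periods v" "h \<in> periods v"
  shows "g + h \<in> periods v"
proof -
  obtain x y where x: "x \<in> P" "y \<in> P" "r x = v" "r y = v" "s x = v" "s y = v" "g = deg_diff x y"
    using periods_closed_cycles[OF assms(1,2)] .
  obtain x' y' where x': "x' \<in> P" "y' \<in> P" "r x' = v" "r y' = v" "s x' = v" "s y' = v" "h = deg_diff x' y'"
    using periods_closed_cycles[OF assms(1,3)] .
  have "g + h = deg_diff (x \<cdot> x') (y \<cdot> y')" using x x' by (subst deg_diff_comp) auto
  thus ?thesis using x x' by (auto intro!: periodsI simp: rng_cmp src_cmp cmp_closed)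
qed

text \<open>Prefixing both paths with one path between \<open>v\<close> and \<open>u\<close> leaves
  their degree difference unchanged, and reachability is symmetric here.\<close>

lemma periods_reach:
  assumes "v \<in> terminal" "u \<in> reach v"
  shows "periods u = periods v"
proof -
  have *: "periods u \<subseteq> periods v" if v: "v \<in> terminal" and u: "u \<in> reach v" for u v
  proof
    fix g assume "g \<in> periods u"
    then obtain x y where x: "x \<in> P" "y \<in> P" "r x = u" "r y = u" "s x = s y" "g = deg_diff x y"
      by (auto simp: periods_def)
    obtain z where z: "z \<in> P" "r z = v" "s z = u" using u by (auto simp: reach_def)
    have "deg_diff (z \<cdot> x) (z \<cdot> y) = g" using x z by (subst deg_diff_comp) auto
    thus "g \<in> periods v" using periodsI[of "z \<cdot> x" "z \<cdot> y" v] x z by (metis cmp_closed rng_cmp src_cmp)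
  qed
  show ?thesis using *[OF assms] *[OF reach_terminal[OF assms] reach_sym[OF assms]] by blast
qed

lemma initial_cycleD:
  assumes "\<mu> \<in> initial_cycles \<Lambda>"
  shows "\<mu> \<in> P" "s \<mu> = r \<mu>" "r \<mu> \<in> terminal" "live (r \<mu>) i \<longleftrightarrow> 0 < d \<mu> $ i"
proof -
  show 1: "\<mu> \<in> P" "s \<mu> = r \<mu>" "r \<mu> \<in> terminal" using assms by (auto simp: initial_cycles_def terminal_def)
  show "live (r \<mu>) i \<longleftrightarrow> 0 < d \<mu> $ i"
    using live_rng_if_deg[OF 1(1)] assms by (auto simp: initial_cycles_def live_def)
qed

lemma le_inf_deg_iff: "\<mu> \<in> initial_cycles \<Lambda> \<Longrightarrow> le_deg n (inf_deg \<Lambda> \<mu>) \<longleftrightarrow> (\<forall>i. 0 < n $ i \<longrightarrow> live (r \<mu>) i)"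
  by (auto simp: le_deg_def inf_deg_def initial_cycleD(4) zero_enat_def)

text \<open>This gives the definite description \<open>inf_path\<close> its value. There is just one
  path \<open>p n\<close> with range \<open>v\<close> for each admissible degree \<open>n\<close>,
  and the infinite path consists of the segments \<open>z a b\<close> that lead from
  \<open>p a\<close> to \<open>p b\<close>.\<close>

lemma inf_path_initial_cycle:
  assumes \<mu>: "\<mu> \<in> initial_cycles \<Lambda>" and x: "x \<in> P" "r x = r \<mu>"
  shows "inf_path \<Lambda> \<mu> (d x) (d x) = s x"
proof -
  define v where "v = r \<mu>"
  note m = initial_cycleD[OF \<mu>, folded v_def]
  define m' where "m' = inf_deg \<Lambda> \<mu>"
  define ok where "ok = (\<lambda>n. le_deg n m')"
  have ok_eq: "ok n = le_deg n m'" for n by (simp add: ok_def)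
  have ok_iff: "ok n \<longleftrightarrow> (\<forall>i. 0 < n $ i \<longrightarrow> live v i)" for n
    using le_inf_deg_iff[OF \<mu>] by (simp add: ok_def m'_def v_def)
  have ok_mono: "ok q \<Longrightarrow> p \<le> q \<Longrightarrow> ok p" for p q
    unfolding ok_iff less_eq_vec_def by (metis gr_zeroI le_zero_eq)
  have "\<forall>n. \<exists>x. ok n \<longrightarrow> x \<in> P \<and> r x = v \<and> d x = n"
    using terminal_exists[OF m(3)] unfolding ok_iff by metis
  then obtain p where p: "\<And>n. ok n \<Longrightarrow> p n \<in> P \<and> r (p n) = v \<and> d (p n) = n" by metis
  have p_eq: "x = p (d x)" if "x \<in> P" "r x = v" for x
  proof -
    have "ok (d x)" unfolding ok_iff using live_rng_if_deg that by metis
    thus ?thesis using terminal_unique[OF m(3), of x "p (d x)"] that p by metis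
  qed
  have "\<forall>a b. \<exists>z. a \<le> b \<and> ok b \<longrightarrow> z \<in> P \<and> d z = b - a \<and> s (p a) = r z \<and> p b = p a \<cdot> z"
  proof (intro allI)
    fix a b
    show "\<exists>z. a \<le> b \<and> ok b \<longrightarrow> z \<in> P \<and> d z = b - a \<and> s (p a) = r z \<and> p b = p a \<cdot> z"
    proof (cases "a \<le> b \<and> ok b")
      case True
      then obtain y z where "y \<in> P" "z \<in> P" "d y = a" "d z = d (p b) - a" "s y = r z" "p b = y \<cdot> z"
        using prefix[of "p b" a] p by metis
      thus ?thesis using p[of b] True p_eq[of y] by (metis rng_cmp)
    qed blast
  qed
  then obtain z where z: "\<And>a b. a \<le> b \<Longrightarrow> ok b \<Longrightarrow>
      z a b \<in> P \<and> d (z a b) = b - a \<and> s (p a) = r (z a b) \<and> p b = p a \<cdot> z a b" by metis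
  have z_eq: "w = z a b" if "a \<le> b" "ok b" "w \<in> P" "s (p a) = r w" "p b = p a \<cdot> w" for a b w
    using z[OF that(1,2)] that p[OF ok_mono[OF that(2,1)]]
      factor_unique(2)[of "p a" w "p a" "z a b"] by metis
  have sz: "s (z a b) = s (p b)" if "a \<le> b" "ok b" for a b
    using z[OF that] p[OF ok_mono[OF that(2,1)]] by (metis src_cmp)
  have zz: "z a a = s (p a)" if "ok a" for a
    using z_eq[of a a "s (p a)"] p[OF that] that by (simp add: path_simps)
  \<comment> \<open>\<open>is_path\<close> demands \<open>undefined\<close> off the domain, which is
    what makes the description unique as a function.\<close>
  define y where "y = (\<lambda>a b. if a \<le> b \<and> ok b then z a b else undefined)"
  let ?Q = "\<lambda>y. is_path \<Lambda> (inf_deg \<Lambda> \<mu>) y \<and> (\<forall>n. y (n *s d \<mu>) (Suc n *s d \<mu>) = \<mu>)"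
  have mult: "n *s d \<mu> \<le> Suc n *s d \<mu>" "ok (n *s d \<mu>)" for n
    by (auto simp: less_eq_vec_def ok_iff m(4))
  have Qy: "?Q y"
  proof
    show "is_path \<Lambda> (inf_deg \<Lambda> \<mu>) y"
      unfolding is_path_def m'_def[symmetric] ok_eq[symmetric]
    proof (intro conjI allI impI)
      fix a b assume "a \<le> b \<and> ok b"
      hence ab: "a \<le> b" "ok b" "ok a" using ok_mono by blast+
      show "y a b \<in> P" "d (y a b) = b - a" "r (y a b) = y a a" "s (y a b) = y b b"
        using z[OF ab(1,2)] zz[OF ab(3)] zz[OF ab(2)] sz[OF ab(1,2)] ab by (auto simp: y_def)
    next
      fix a b c assume "a \<le> b \<and> b \<le> c \<and> ok c"
      hence o: "a \<le> b" "b \<le> c" "ok c" "ok b" "a \<le> c" "ok a" by (auto intro: ok_mono)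
      have 1: "s (z a b) = r (z b c)" using sz[OF o(1,4)] z[OF o(2,3)] by simp
      have "p c = p a \<cdot> (z a b \<cdot> z b c)"
        using z[OF o(1,4)] z[OF o(2,3)] p[OF o(6)] 1 cmp_assoc by metis
      hence "z a b \<cdot> z b c = z a c"
        using z_eq[OF o(5,3), of "z a b \<cdot> z b c"] z[OF o(1,4)] z[OF o(2,3)] 1 by (metis cmp_closed rng_cmp)
      thus "y a c = y a b \<cdot> y b c" using o by (simp add: y_def)
    qed (auto simp: y_def)
    show "\<forall>n. y (n *s d \<mu>) (Suc n *s d \<mu>) = \<mu>"
    proof
      fix n
      \<comment> \<open>The power \<open>w\<close> of \<open>\<mu>\<close> is the unique path of its
        degree, so the next segment of degree \<open>d \<mu>\<close> is \<open>\<mu>\<close>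
        itself.\<close>
      obtain w where w: "w \<in> P" "r w = v" "s w = v" "d w = n *s d \<mu>"
        using cycle_power[OF m(1), of n] m(2) v_def by metis
      have sw: "s w = r \<mu>" using w v_def by simp
      have "d (w \<cdot> \<mu>) = Suc n *s d \<mu>" using deg_cmp[OF w(1) m(1) sw] w(4) by (simp add: vec_eq_iff)
      hence "w \<cdot> \<mu> = p (Suc n *s d \<mu>)" "w = p (n *s d \<mu>)"
        using p_eq[of w] p_eq[of "w \<cdot> \<mu>"] w m(1) sw by (metis cmp_closed rng_cmp, metis)
      hence "\<mu> = z (n *s d \<mu>) (Suc n *s d \<mu>)"
        using z_eq[OF mult(1) mult(2) m(1)] sw by metis
      thus "y (n *s d \<mu>) (Suc n *s d \<mu>) = \<mu>" using mult by (simp add: y_def del: vector_smult_component)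
    qed
  qed
  have "inf_path \<Lambda> \<mu> = y" unfolding inf_path_def
  proof (rule the_equality)
    fix x assume Q: "?Q x"
    note isp = Q[THEN conjunct1, unfolded is_path_def m'_def[symmetric] ok_eq[symmetric]]
    note x1 = isp[THEN conjunct1, rule_format]
      and x2 = isp[THEN conjunct2, THEN conjunct1, rule_format]
      and x3 = isp[THEN conjunct2, THEN conjunct2, rule_format]
    have nn: "0 \<le> b" for b :: "nat ^ 'b" by (simp add: less_eq_vec_def)
    \<comment> \<open>The clause for \<open>n = 0\<close> fixes the range of a competing path
      \<open>x\<close>; its values are then forced by the uniqueness of paths of given
      degree.\<close>
    have "x (0 *s d \<mu>) (Suc 0 *s d \<mu>) = \<mu>" using Q by blast
    moreover have "0 *s d \<mu> = 0" "Suc 0 *s d \<mu> = d \<mu>" by (simp_all add: vec_eq_iff)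
    ultimately have "x 0 (d \<mu>) = \<mu>" by metis
    hence x00: "x 0 0 = v" using x1[of 0 "d \<mu>"] nn by (simp add: v_def[symmetric] ok_iff m(4))
    have x0: "x 0 b = p b" if "ok b" for b
      using p_eq[of "x 0 b"] x1[of 0 b] that nn x00 by simp
    show "x = y"
    proof (intro ext)
      fix a b
      show "x a b = y a b"
      proof (cases "a \<le> b \<and> ok b")
        case True
        hence "ok a" using ok_mono by blast
        have "p b = p a \<cdot> x a b" using x2[of 0 a b] x0 True \<open>ok a\<close> nn by metis
        moreover have "s (p a) = r (x a b)" using x1[of 0 a] x1[of a b] x0[OF \<open>ok a\<close>] \<open>ok a\<close> True nn by metis
        ultimately show ?thesis using z_eq[of a b "x a b"] x1[OF True] True by (simp add: y_def)
      next
        case False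
        thus ?thesis using x3[OF False] by (auto simp: y_def)
      qed
    qed
  qed (rule Qy)
  moreover have "ok (d x)" unfolding ok_iff using live_rng_if_deg x v_def by metis
  moreover have "x = p (d x)" using p_eq x v_def by metis
  ultimately show ?thesis using zz[of "d x"] by (simp add: y_def)
qed

lemma le_inf_deg_path:
  assumes "\<mu> \<in> initial_cycles \<Lambda>"
  shows "le_deg n (inf_deg \<Lambda> \<mu>) \<longleftrightarrow> (\<exists>x\<in>P. r x = r \<mu> \<and> d x = n)"
  using terminal_exists[OF initial_cycleD(3)[OF assms]] live_rng_if_deg le_inf_deg_iff[OF assms] by metis

lemma vertices_on_eq:
  assumes "\<mu> \<in> initial_cycles \<Lambda>"
  shows "vertices_on \<Lambda> \<mu> = reach (r \<mu>)"
proof -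
  have "vertices_on \<Lambda> \<mu> = {inf_path \<Lambda> \<mu> (d x) (d x) | x. x \<in> P \<and> r x = r \<mu>}"
    unfolding vertices_on_def le_inf_deg_path[OF assms] by blast
  also have "\<dots> = reach (r \<mu>)"
    unfolding reach_def using inf_path_initial_cycle[OF assms] by (metis (mono_tags, lifting))
  finally show ?thesis .
qed

text \<open>At a vertex \<open>\<mu>\<close> no direction is live, so paths with range
  \<open>\<mu>\<close> have degree 0 and the special clause of \<open>period_group\<close> agrees
  with the general formula.\<close>

lemma period_group_eq:
  assumes \<mu>: "\<mu> \<in> initial_cycles \<Lambda>"
  shows "period_group \<Lambda> \<mu> = periods (r \<mu>)"
proof (cases "\<mu> \<in> vertices \<Lambda>")
  case True
  hence "d \<mu> = 0" by (simp add: vertices_iff)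
  hence "d x = 0" if "x \<in> P" "r x = r \<mu>" for x
    using live_rng_if_deg[OF that(1)] that(2) initial_cycleD(4)[OF \<mu>] by (fastforce simp: vec_eq_iff)
  hence "periods (r \<mu>) \<subseteq> {0}" by (auto simp: periods_def deg_diff_def vec_eq_iff)
  thus ?thesis using zero_in_periods[OF initial_cycleD(3)[OF \<mu>]] True by (auto simp: period_group_def)
next
  case False
  let ?D = "\<lambda>m n. (\<chi> i. int (m $ i) - int (n $ i)) :: int ^ 'b"
  have "period_group \<Lambda> \<mu> = {?D (d x) (d y) | x y. x \<in> P \<and> r x = r \<mu> \<and> y \<in> P \<and> r y = r \<mu> \<and>
      inf_path \<Lambda> \<mu> (d x) (d x) = inf_path \<Lambda> \<mu> (d y) (d y)}"
    using False unfolding period_group_def le_inf_deg_path[OF \<mu>] by auto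
  also have "\<dots> = periods (r \<mu>)"
    unfolding periods_def deg_diff_def using inf_path_initial_cycle[OF \<mu>] by (auto; metis)
  finally show ?thesis .
qed

end

section \<open>The action of words on boundary paths\<close>

definition word_star :: "('a \<times> bool) list \<Rightarrow> ('a \<times> bool) list" where
  "word_star w = rev (map (\<lambda>(x, b). (x, \<not> b)) w)"

lemma word_star_Nil [simp]: "word_star [] = []"
  by (simp add: word_star_def)

lemma word_star_Cons: "word_star (l # w) = word_star w @ [(fst l, \<not> snd l)]"
  by (simp add: word_star_def case_prod_unfold)

context no_entrance_graph
begin

definition NN :: "nat ^ 'b" where
  "NN = (\<chi> i. card (vertices \<Lambda>))"

definition X :: "'a set" where
  "X = paths_le \<Lambda> NN"

lemma finite_paths_le: "finite (paths_le \<Lambda> n)"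
proof -
  have "{m. m \<le> n} \<subseteq> (\<lambda>f. \<chi> i. f i) ` (\<Pi>\<^sub>E i\<in>UNIV. {..n $ i})"
  proof
    fix m assume "m \<in> {m. m \<le> n}"
    thus "m \<in> (\<lambda>f. \<chi> i. f i) ` (\<Pi>\<^sub>E i\<in>UNIV. {..n $ i})"
      by (intro image_eqI[of _ _ "vec_nth m"]) (auto simp: less_eq_vec_def)
  qed
  moreover have "finite ((\<lambda>f. \<chi> i. f i) ` (\<Pi>\<^sub>E i\<in>UNIV. {..n $ i}))"
    by (intro finite_imageI finite_PiE) auto
  ultimately have "finite {m. m \<le> n}" by (rule finite_subset)
  hence "finite (\<Union>m\<in>{m. m \<le> n}. paths_of_deg \<Lambda> m)" using fin by (auto simp: finite_kgraph_def)
  moreover have "paths_le \<Lambda> n \<subseteq> (\<Union>m\<in>{m. m \<le> n}. paths_of_deg \<Lambda> m)"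
    by (auto simp: paths_le_iff paths_of_deg_def)
  ultimately show ?thesis by (rule rev_finite_subset)
qed

lemma finite_X: "finite X"
  unfolding X_def by (rule finite_paths_le)

lemma X_paths: "a \<in> X \<Longrightarrow> a \<in> P" and X_full: "a \<in> X \<Longrightarrow> full NN a"
  by (auto simp: X_def paths_le_iff)

lemma X_terminal: "a \<in> X \<Longrightarrow> s a \<in> terminal"
  using src_terminal unfolding X_def NN_def by blast

text \<open>Every \<open>\<alpha> \<in> \<Lambda>\<^sup>\<le>\<^sup>N\<close> extends uniquely to a boundary path; \<open>fwd l a b\<close> says that
  prepending \<open>l\<close> to the boundary path of \<open>a\<close> yields that of \<open>b\<close>.\<close>

definition fwd :: "'a \<Rightarrow> 'a \<Rightarrow> 'a \<Rightarrow> bool" where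
  "fwd l a b \<longleftrightarrow> l \<in> P \<and> a \<in> X \<and> b \<in> X \<and> s l = r a \<and> (\<exists>g\<in>P. s b = r g \<and> b \<cdot> g = l \<cdot> a)"

lemma fwd_unique: "fwd l a b \<Longrightarrow> fwd l a b' \<Longrightarrow> b = b'"
  unfolding fwd_def X_def using paths_le_prefix_unique by metis

lemma fwd_exists:
  assumes "l \<in> P" "a \<in> X" "s l = r a"
  obtains b where "fwd l a b"
proof -
  note a = X_paths[OF assms(2)]
  have "full NN (l \<cdot> a)" using X_full[OF assms(2)]
    by (auto simp: full_def deg_cmp[OF assms(1) a assms(3)] src_cmp[OF assms(1) a assms(3)] intro: trans_le_add2)
  then obtain b g where "b \<in> X" "g \<in> P" "s b = r g" "l \<cdot> a = b \<cdot> g"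
    using full_truncate[OF cmp_closed[OF assms(1) a assms(3)]] unfolding X_def by metis
  thus thesis using that[of b] assms unfolding fwd_def by metis
qed

text \<open>Prolonging \<open>l \<cdot> a\<close> to the right does not change its prefix in
  \<open>X\<close>, so the relation may be tested after an extension \<open>w\<close>.\<close>

lemma fwdI:
  assumes "l \<in> P" "a \<in> X" "s l = r a" "b \<in> X" "w \<in> P" "s a = r w" "z \<in> P" "s b = r z"
    and "(l \<cdot> a) \<cdot> w = b \<cdot> z"
  shows "fwd l a b"
proof -
  obtain b' where b': "fwd l a b'" using fwd_exists assms by metis
  then obtain g where g: "g \<in> P" "s b' = r g" "b' \<cdot> g = l \<cdot> a" "b' \<in> X" by (auto simp: fwd_def)
  note a = X_paths[OF assms(2)]
  have "s g = r w" using g a assms X_paths by (metis src_cmp)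
  hence "b' \<cdot> (g \<cdot> w) = b \<cdot> z" "s b' = r (g \<cdot> w)" "g \<cdot> w \<in> P"
    using g assms cmp_assoc[of b' g w] X_paths by (auto simp: rng_cmp cmp_closed)
  hence "b' = b" using paths_le_prefix_unique[of b' NN "g \<cdot> w" b z] g assms unfolding X_def by metis
  thus ?thesis using b' by simp
qed

lemma fwd_rng: "fwd l a b \<Longrightarrow> r b = r l"
  unfolding fwd_def using rng_cmp X_paths by metis

lemma join_after:
  assumes "b \<in> X" "g \<in> P" "s b = r g" "g' \<in> P" "s b = r g'"
  obtains x y where "x \<in> P" "y \<in> P" "s g = r x" "s g' = r y" "g \<cdot> x = g' \<cdot> y"
  using terminal_join[OF X_terminal[OF assms(1)] assms(2) _ assms(4)] assms by metis

text \<open>The remainders of \<open>l \<cdot> a\<close> and \<open>l' \<cdot> a'\<close> beyond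
  \<open>b\<close> both start at the terminal vertex \<open>s b\<close> and hence have a common
  extension. Injectivity of \<open>fwd l\<close> and disjointness of ranges both follow from
  this.\<close>

lemma fwd_common:
  assumes "fwd l a b" "fwd l' a' b"
  obtains x y where "x \<in> P" "y \<in> P" "s a = r x" "s a' = r y" "l \<cdot> (a \<cdot> x) = l' \<cdot> (a' \<cdot> y)"
proof -
  obtain g where g: "g \<in> P" "s b = r g" "b \<cdot> g = l \<cdot> a" using assms(1) by (auto simp: fwd_def)
  obtain g' where g': "g' \<in> P" "s b = r g'" "b \<cdot> g' = l' \<cdot> a'" using assms(2) by (auto simp: fwd_def)
  have P: "l \<in> P" "a \<in> P" "b \<in> P" "l' \<in> P" "a' \<in> P" "b \<in> X" "s l = r a" "s l' = r a'"
    using assms X_paths by (auto simp: fwd_def)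
  obtain x y where xy: "x \<in> P" "y \<in> P" "s g = r x" "s g' = r y" "g \<cdot> x = g' \<cdot> y"
    using join_after[OF P(6) g(1,2) g'(1,2)] .
  have 1: "s a = r x" "s a' = r y" using g g' P xy by (metis src_cmp)+
  have "l \<cdot> (a \<cdot> x) = b \<cdot> (g \<cdot> x)" using cmp_assoc[of l a x] cmp_assoc[of b g x] P g xy 1 by metis
  moreover have "l' \<cdot> (a' \<cdot> y) = b \<cdot> (g' \<cdot> y)" using cmp_assoc[of l' a' y] cmp_assoc[of b g' y] P g' xy 1 by metis
  ultimately show thesis using that xy 1 by metis
qed

lemma fwd_inj:
  assumes "fwd l a b" "fwd l a' b"
  shows "a = a'"
proof -
  obtain x y where x: "x \<in> P" "y \<in> P" "s a = r x" "s a' = r y" "l \<cdot> (a \<cdot> x) = l \<cdot> (a' \<cdot> y)"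
    using fwd_common[OF assms] .
  have P: "l \<in> P" "a \<in> P" "a' \<in> P" "s l = r a" "s l = r a'" "a \<in> X" "a' \<in> X"
    using assms X_paths by (auto simp: fwd_def)
  have "a \<cdot> x = a' \<cdot> y"
    using factor_unique(2)[OF P(1) _ _ P(1) _ _ x(5)] P x by (metis cmp_closed rng_cmp)
  thus ?thesis using paths_le_prefix_unique P x unfolding X_def by metis
qed

text \<open>The combinatorial counterpart of the orthogonality of the ranges of \<open>s_l\<close>
  for \<open>l\<close> in \<open>\<Lambda>\<^sup>\<le>\<^sup>n\<close>.\<close>

lemma fwd_paths_le_unique:
  assumes "fwd l a b" "fwd l' a' b" "l \<in> paths_le \<Lambda> n" "l' \<in> paths_le \<Lambda> n"
  shows "l = l'"
proof -
  obtain x y where x: "x \<in> P" "y \<in> P" "s a = r x" "s a' = r y" "l \<cdot> (a \<cdot> x) = l' \<cdot> (a' \<cdot> y)"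
    using fwd_common[OF assms(1,2)] .
  have "a \<in> P" "a' \<in> P" "s l = r a" "s l' = r a'"
    using assms X_paths by (auto simp: fwd_def)
  thus ?thesis
    using paths_le_prefix_unique[OF assms(3) _ _ assms(4) _ _ x(5)] x by (metis cmp_closed rng_cmp)
qed

text \<open>The bound \<open>n + NN\<close> reserves enough length: behind a prefix of degree at
  most \<open>n\<close>, a full \<open>NN\<close> is left for an element of
  \<open>X\<close>.\<close>

lemma full_split:
  assumes x: "x \<in> P" "full (n + NN) x" and l: "l \<in> paths_le \<Lambda> n" "y \<in> P" "s l = r y" "x = l \<cdot> y"
  obtains a w where "a \<in> X" "w \<in> P" "s a = r w" "y = a \<cdot> w"
proof -
  have lP: "l \<in> P" using l by (simp add: paths_le_iff)
  have "full NN y" unfolding full_def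
  proof
    fix i
    have "d x $ i = d l $ i + d y $ i" "d l $ i \<le> n $ i" "s x = s y"
      using deg_cmp[OF lP l(2,3)] src_cmp[OF lP l(2,3)] l by (auto simp: paths_le_iff less_eq_vec_def)
    moreover have "(n + NN) $ i \<le> d x $ i \<or> \<not> live (s x) i" using x(2) unfolding full_def by (rule spec)
    ultimately show "NN $ i \<le> d y $ i \<or> \<not> live (s y) i" by auto
  qed
  thus thesis using full_truncate[OF l(2)] that unfolding X_def by metis
qed

text \<open>Together with \<open>fwd_paths_le_unique\<close>, every boundary path has exactly one
  initial segment in \<open>\<Lambda>\<^sup>\<le>\<^sup>n\<close>; this is what the last defining
  relation says about the action.\<close>

lemma fwd_cover:
  assumes b: "b \<in> X"
  obtains l a where "l \<in> paths_le \<Lambda> n" "r l = r b" "fwd l a b"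
proof -
  note bP = X_paths[OF b]
  obtain z where z: "z \<in> P" "r z = s b" "full (n + NN) (b \<cdot> z)"
    using full_extend[OF bP X_terminal[OF b]] .
  have sz: "s b = r z" using z by simp
  have bz: "b \<cdot> z \<in> P" using cmp_closed bP z by metis
  have "full n (b \<cdot> z)" unfolding full_def
  proof
    fix i
    have "(n + NN) $ i \<le> d (b \<cdot> z) $ i \<or> \<not> live (s (b \<cdot> z)) i" using z(3) unfolding full_def by (rule spec)
    thus "n $ i \<le> d (b \<cdot> z) $ i \<or> \<not> live (s (b \<cdot> z)) i" by auto
  qed
  then obtain l y where l: "l \<in> paths_le \<Lambda> n" "y \<in> P" "s l = r y" "b \<cdot> z = l \<cdot> y"
    using full_truncate[OF bz] by metis
  obtain a w where a: "a \<in> X" "w \<in> P" "s a = r w" "y = a \<cdot> w"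
    using full_split[OF bz z(3) l] .
  note aP = X_paths[OF a(1)]
  have lP: "l \<in> P" using l by (simp add: paths_le_iff)
  have la: "s l = r a" using l a aP by (metis rng_cmp)
  have "(l \<cdot> a) \<cdot> w = b \<cdot> z" using cmp_assoc[OF lP aP a(2) la a(3)] l a by simp
  hence "fwd l a b" using fwdI[OF lP a(1) la b a(2,3) z(1) sz] by blast
  thus thesis using that l(1) fwd_rng by metis
qed

lemma fwd_cmp:
  assumes "l \<in> P" "m \<in> P" "s l = r m"
  shows "fwd (l \<cdot> m) a b \<longleftrightarrow> (\<exists>c. fwd m a c \<and> fwd l c b)"
proof -
  note lm = cmp_closed[OF assms] src_cmp[OF assms]
  have *: "fwd (l \<cdot> m) a b" if mc: "fwd m a c" "fwd l c b" for a b c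
  proof -
    obtain g where g: "g \<in> P" "s c = r g" "c \<cdot> g = m \<cdot> a" using mc by (auto simp: fwd_def)
    obtain h where h: "h \<in> P" "s b = r h" "b \<cdot> h = l \<cdot> c" using mc by (auto simp: fwd_def)
    have P: "a \<in> P" "b \<in> P" "c \<in> P" "s m = r a" "s l = r c" using mc X_paths by (auto simp: fwd_def)
    have hg: "s h = r g" using h P g assms(1) by (metis src_cmp)
    have "b \<cdot> (h \<cdot> g) = (l \<cdot> c) \<cdot> g" using cmp_assoc[OF P(2) h(1) g(1) h(2) hg] h by simp
    also have "\<dots> = l \<cdot> (m \<cdot> a)" using cmp_assoc[OF assms(1) P(3) g(1) P(5) g(2)] g by simp
    also have "\<dots> = (l \<cdot> m) \<cdot> a" using cmp_assoc[OF assms(1,2) P(1) assms(3) P(4)] by simp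
    finally have "\<exists>g\<in>P. s b = r g \<and> b \<cdot> g = (l \<cdot> m) \<cdot> a"
      using h(2) cmp_closed[OF h(1) g(1) hg] rng_cmp[OF h(1) g(1) hg] by (intro bexI[of _ "h \<cdot> g"]) auto
    moreover have "a \<in> X" "b \<in> X" using mc by (auto simp: fwd_def)
    ultimately show ?thesis unfolding fwd_def using lm P(4) by auto
  qed
  show ?thesis
  proof
    assume f: "fwd (l \<cdot> m) a b"
    hence a: "a \<in> X" "s m = r a" using lm by (auto simp: fwd_def)
    obtain c where c: "fwd m a c" using fwd_exists[OF assms(2) a] .
    obtain b' where b': "fwd l c b'" using fwd_exists[OF assms(1)] c fwd_rng[OF c] assms(3) by (metis fwd_def)
    show "\<exists>c. fwd m a c \<and> fwd l c b" using *[OF c b'] fwd_unique[OF f] b' c by metis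
  qed (use * in blast)
qed

lemma fwd_vertex:
  assumes "v \<in> vertices \<Lambda>"
  shows "fwd v a b \<longleftrightarrow> a \<in> X \<and> a = b \<and> r a = v"
proof -
  have v: "v \<in> P" "r v = v" "s v = v" using assms vertex_rng_src by (auto simp: vertices_iff)
  have *: "fwd v a a" if "a \<in> X" "r a = v" for a
    unfolding fwd_def using that v X_paths[OF that(1)] by (metis cmp_rng cmp_src rng_src src_closed)
  thus ?thesis using fwd_unique v by (metis fwd_def)
qed

lemma terminal_X_exists:
  assumes "v \<in> terminal"
  obtains a where "a \<in> X" "r a = v"
proof -
  obtain z where z: "z \<in> P" "r z = s v" "full NN (v \<cdot> z)"
    using full_extend[of v] assms terminal_paths terminalE by (metis src_rng)
  have v: "v \<in> P" "r v = v" "s v = v" using assms by (metis terminalE rng_closed, metis terminalE rng_rng, metis terminalE src_rng)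
  have vz: "v \<cdot> z \<in> P" "r (v \<cdot> z) = v" using v z cmp_closed rng_cmp by auto
  obtain a w where "a \<in> X" "w \<in> P" "s a = r w" "v \<cdot> z = a \<cdot> w"
    using full_truncate[OF vz(1) z(3)] unfolding X_def by metis
  thus thesis using that vz X_paths rng_cmp by metis
qed

text \<open>Join the two elements and truncate again. A vertex on an initial cycle is therefore the
  range of a single matrix index, which makes its projection a matrix unit.\<close>

lemma terminal_X_unique:
  assumes "v \<in> terminal" "a \<in> X" "r a = v" "b \<in> X" "r b = v"
  shows "a = b"
proof -
  obtain x y where "x \<in> P" "y \<in> P" "s a = r x" "s b = r y" "a \<cdot> x = b \<cdot> y"
    using terminal_join[OF assms(1) X_paths[OF assms(2)] assms(3) X_paths[OF assms(4)] assms(5)] .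
  thus ?thesis using paths_le_prefix_unique assms unfolding X_def by metis
qed

lemma fwd_reach:
  assumes "fwd l a b"
  shows "reach (s a) = reach (s b)"
proof -
  obtain g where g: "g \<in> P" "s b = r g" "b \<cdot> g = l \<cdot> a" using assms by (auto simp: fwd_def)
  have P: "l \<in> P" "a \<in> P" "b \<in> P" "b \<in> X" "s l = r a" using assms X_paths by (auto simp: fwd_def)
  have "s g = s a" using g P by (metis src_cmp)
  hence "s a \<in> reach (s b)" using reachI g by metis
  thus ?thesis using reach_eq[OF X_terminal[OF P(4)]] by metis
qed

section \<open>Words as partial injections of X\<close>

fun step :: "'a \<times> bool \<Rightarrow> 'a \<Rightarrow> 'a \<Rightarrow> bool" where
  "step (l, False) a b = fwd l a b"
| "step (l, True) a b = fwd l b a"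

text \<open>The head of the list acts last, as the leftmost factor of a product of operators does.
  The empty word, absent from the free algebra, starts inductions as the identity of
  \<open>X\<close>.\<close>

fun run :: "('a \<times> bool) list \<Rightarrow> 'a \<Rightarrow> 'a \<Rightarrow> bool" where
  "run [] a b \<longleftrightarrow> a \<in> X \<and> a = b"
| "run (l # w) a b \<longleftrightarrow> (\<exists>c. run w a c \<and> step l c b)"

lemma step_unique: "step l a b \<Longrightarrow> step l a b' \<Longrightarrow> b = b'"
  by (cases l; cases "snd l") (auto dest: fwd_unique fwd_inj)

lemma step_X: "step l a b \<Longrightarrow> a \<in> X \<and> b \<in> X"
  by (cases l; cases "snd l") (auto simp: fwd_def)

lemma step_flip: "step (fst l, \<not> snd l) a b \<longleftrightarrow> step l b a"
  by (cases l; cases "snd l") auto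

lemma step_reach: "step l a b \<Longrightarrow> reach (s a) = reach (s b)"
  by (cases l; cases "snd l") (auto dest: fwd_reach)

lemma run_X: "run w a b \<Longrightarrow> a \<in> X \<and> b \<in> X"
  by (induction w arbitrary: b) (auto dest: step_X)

lemma run_unique: "run w a b \<Longrightarrow> run w a b' \<Longrightarrow> b = b'"
  by (induction w arbitrary: b b') (auto dest: step_unique)

lemma run_reach: "run w a b \<Longrightarrow> reach (s a) = reach (s b)"
  by (induction w arbitrary: b) (auto dest: step_reach)

lemma run_append: "run (u @ w) a b \<longleftrightarrow> (\<exists>c. run w a c \<and> run u c b)"
  by (induction u arbitrary: b) (auto dest: run_X)

lemma run_star: "run (word_star w) a b \<longleftrightarrow> run w b a"
  by (induction w arbitrary: a) (auto simp: word_star_Cons run_append step_flip dest: step_X run_X)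

fun letter_deg :: "'a \<times> bool \<Rightarrow> int ^ 'b" where
  "letter_deg (l, False) = (\<chi> i. int (d l $ i))"
| "letter_deg (l, True) = - (\<chi> i. int (d l $ i))"

definition word_deg :: "('a \<times> bool) list \<Rightarrow> int ^ 'b" where
  "word_deg w = sum_list (map letter_deg w)"

lemma word_deg_simps [simp]: "word_deg [] = 0" "word_deg (l # w) = letter_deg l + word_deg w"
  "word_deg (u @ w) = word_deg u + word_deg w"
  by (auto simp: word_deg_def)

lemma letter_deg_flip: "letter_deg (fst l, \<not> snd l) = - letter_deg l"
  by (cases l; cases "snd l") auto

lemma word_deg_star: "word_deg (word_star w) = - word_deg w"
  by (induction w) (auto simp: word_star_Cons letter_deg_flip)

section \<open>Degrees of words modulo periods\<close>

definition base :: "'a set \<Rightarrow> 'a" where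
  "base R = (SOME v. v \<in> R)"

text \<open>A chosen path joining a fixed vertex of the component to \<open>u\<close>; its degree
  records the position of \<open>u\<close>.\<close>

definition leg :: "'a \<Rightarrow> 'a" where
  "leg u = (SOME t. t \<in> P \<and> r t = base (reach u) \<and> s t = u)"

lemma base:
  assumes "u \<in> terminal"
  shows "base (reach u) \<in> terminal" "base (reach u) \<in> reach u" "reach (base (reach u)) = reach u"
proof -
  show 1: "base (reach u) \<in> reach u"
    unfolding base_def using terminal_in_reach[OF assms] by (rule someI)
  show "base (reach u) \<in> terminal" "reach (base (reach u)) = reach u"
    using reach_terminal[OF assms 1] reach_eq[OF assms 1] by auto
qed

lemma leg:
  assumes "u \<in> terminal"
  shows "leg u \<in> P" "r (leg u) = base (reach u)" "s (leg u) = u"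
proof -
  have "u \<in> reach (base (reach u))" using base(3)[OF assms] terminal_in_reach[OF assms] by simp
  hence "\<exists>t. t \<in> P \<and> r t = base (reach u) \<and> s t = u" unfolding reach_def by auto
  from someI_ex[OF this] show "leg u \<in> P" "r (leg u) = base (reach u)" "s (leg u) = u"
    unfolding leg_def by auto
qed

text \<open>The degree by which the generator \<open>a\<close> is twisted so that all words carrying \<open>a\<close> to \<open>b\<close> differ
  by periods.\<close>

definition height :: "'a \<Rightarrow> int ^ 'b" where
  "height a = deg_diff (leg (s a)) a"

definition group_of :: "'a set \<Rightarrow> (int ^ 'b) set" where
  "group_of R = periods (base R)"

lemma group_of_zero: "u \<in> terminal \<Longrightarrow> 0 \<in> group_of (reach u)"
  and group_of_uminus: "u \<in> terminal \<Longrightarrow> g \<in> group_of (reach u) \<Longrightarrow> - g \<in> group_of (reach u)"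
  and group_of_add: "u \<in> terminal \<Longrightarrow> g \<in> group_of (reach u) \<Longrightarrow> h \<in> group_of (reach u) \<Longrightarrow>
    g + h \<in> group_of (reach u)"
  unfolding group_of_def
  by (simp_all add: base zero_in_periods periods_uminus periods_add)

text \<open>The degree changed by a coboundary: it remains additive along compositions
  (\<open>twist_add\<close>), but for a word carrying \<open>a\<close> to \<open>b\<close> it lies
  in the period group (\<open>run_twist\<close>).\<close>

definition twist :: "int ^ 'b \<Rightarrow> 'a \<Rightarrow> 'a \<Rightarrow> int ^ 'b" where
  "twist n a b = n + height b - height a"

text \<open>By \<open>b \<cdot> g = l \<cdot> a\<close>, the twisted degree is the degree difference
  of \<open>leg (s b) \<cdot> g\<close> and \<open>leg (s a)\<close>, two paths with the base vertex
  as range and source \<open>s a\<close>.\<close>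

lemma fwd_twist:
  assumes "fwd l a b"
  shows "twist (letter_deg (l, False)) a b \<in> group_of (reach (s a))"
proof -
  obtain g where g: "g \<in> P" "s b = r g" "b \<cdot> g = l \<cdot> a" using assms by (auto simp: fwd_def)
  have P: "l \<in> P" "a \<in> P" "b \<in> P" "b \<in> X" "a \<in> X" "s l = r a" using assms X_paths by (auto simp: fwd_def)
  note la = leg[OF X_terminal[OF P(5)]] and lb = leg[OF X_terminal[OF P(4)]]
  have sg: "s g = s a" using g P by (metis src_cmp)
  have lg: "s (leg (s b)) = r g" using lb g by simp
  have "d b + d g = d l + d a" using deg_cmp[OF P(3) g(1,2)] deg_cmp[OF P(1,2,6)] g by simp
  hence "int (d b $ i) + int (d g $ i) = int (d l $ i) + int (d a $ i)" for i
    by (metis of_nat_add vector_add_component)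
  hence e: "int (d g $ i) = int (d l $ i) + int (d a $ i) - int (d b $ i)" for i
    by (metis add_diff_cancel_left')
  have "twist (letter_deg (l, False)) a b = deg_diff (leg (s b) \<cdot> g) (leg (s a))"
    by (simp add: twist_def height_def deg_diff_def vec_eq_iff deg_cmp[OF lb(1) g(1) lg] e)
  also have "\<dots> \<in> periods (base (reach (s a)))"
    using la lb lg g(1) sg fwd_reach[OF assms] by (intro periodsI) (auto simp: cmp_closed rng_cmp src_cmp)
  finally show ?thesis by (simp add: group_of_def)
qed

lemma twist_add: "twist (m + n) a b = twist n a c + twist m c b"
  and twist_uminus: "twist (- n) b a = - twist n a b"
  and twist_self: "twist n a a = n"
  by (simp_all add: twist_def)

lemma step_twist:
  assumes "step l a b"
  shows "twist (letter_deg l) a b \<in> group_of (reach (s a))"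
proof (cases l)
  case (Pair x c)
  show ?thesis
  proof (cases c)
    case True
    hence f: "fwd x b a" using assms Pair by simp
    have "- twist (letter_deg (x, False)) b a \<in> group_of (reach (s b))"
      using group_of_uminus[OF X_terminal fwd_twist[OF f]] f by (auto simp: fwd_def)
    thus ?thesis using Pair True fwd_reach[OF f] by (simp add: twist_uminus[symmetric])
  next
    case False
    thus ?thesis using fwd_twist assms Pair by simp
  qed
qed

lemma run_twist: "run w a b \<Longrightarrow> twist (word_deg w) a b \<in> group_of (reach (s a))"
proof (induction w arbitrary: b)
  case Nil
  thus ?case by (auto simp: twist_self intro: group_of_zero X_terminal)
next
  case (Cons l w)
  then obtain c where c: "run w a c" "step l c b" by auto
  have "twist (word_deg (l # w)) a b = twist (word_deg w) a c + twist (letter_deg l) c b"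
    using twist_add[of "letter_deg l" "word_deg w" a b c] by simp
  thus ?case
    using group_of_add[OF X_terminal Cons.IH[OF c(1)]] step_twist[OF c(2)] run_X[OF c(1)] run_reach[OF c(1)]
    by metis
qed

text \<open>These words evaluate to matrix units times monomials and so give the evaluations dense
  range. With \<open>g\<close> written as the degree difference of \<open>x\<close> and
  \<open>y\<close>, the word stands for \<open>s_\<xi> s_\<eta>^*\<close>, where
  \<open>\<xi>\<close> and \<open>\<eta>\<close> prolong \<open>b\<close> and \<open>a\<close> to a
  common source in such a way that the twist is \<open>g\<close>.\<close>

lemma matrix_unit_word:
  assumes a: "a \<in> X" and b: "b \<in> X" and ab: "reach (s a) = reach (s b)" and g: "g \<in> group_of (reach (s a))"
  obtains w where "w \<noteq> []" "fst ` set w \<subseteq> P" "\<And>a' b'. run w a' b' \<longleftrightarrow> a' = a \<and> b' = b"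
    "twist (word_deg w) a b = g"
proof -
  define v where "v = base (reach (s a))"
  have v: "v \<in> terminal" using base(1)[OF X_terminal[OF a]] by (simp add: v_def)
  note la = leg[OF X_terminal[OF a], folded v_def]
    and lb = leg[OF X_terminal[OF b], folded ab, folded v_def]
  obtain x y where xy: "x \<in> P" "y \<in> P" "r x = v" "r y = v" "s x = s y" "g = deg_diff x y"
    using g by (auto simp: group_of_def periods_def v_def)
  \<comment> \<open>Continue \<open>x\<close> until it meets \<open>leg (s b)\<close>; below,
    \<open>y\<close> with the same continuation is carried on until it meets
    \<open>leg (s a)\<close>. Both \<open>x\<close> and \<open>y\<close> are lengthened equally,
    which keeps \<open>g\<close>.\<close>
  obtain z1 x1 where j1: "z1 \<in> P" "x1 \<in> P" "s (leg (s b)) = r z1" "s x = r x1" "leg (s b) \<cdot> z1 = x \<cdot> x1"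
    using terminal_join[OF v lb(1,2) xy(1,3)] .
  have yx1: "y \<cdot> x1 \<in> P" "r (y \<cdot> x1) = v" "s (y \<cdot> x1) = s x1"
    using xy j1 by (auto simp: cmp_closed rng_cmp src_cmp)
  obtain z2 x2 where j2: "z2 \<in> P" "x2 \<in> P" "s (leg (s a)) = r z2" "s (y \<cdot> x1) = r x2"
      "leg (s a) \<cdot> z2 = (y \<cdot> x1) \<cdot> x2"
    using terminal_join[OF v la(1,2) yx1(1,2)] .
  have x12: "s x1 = r x2" using j2 yx1 by simp
  have z1x: "s z1 = r x2"
    using src_cmp[OF lb(1) j1(1,3)] src_cmp[OF xy(1) j1(2,4)] j1(5) x12 by simp
  define z where "z = z1 \<cdot> x2"
  have z: "z \<in> P" "r z = s b" "s z = s x2" "leg (s b) \<cdot> z = (x \<cdot> x1) \<cdot> x2"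
    using j1 j2 z1x cmp_assoc[OF lb(1) j1(1) j2(2) j1(3) z1x] lb
    by (auto simp: z_def cmp_closed rng_cmp src_cmp)
  have z2: "r z2 = s a" "s z2 = s x2"
    using src_cmp[OF la(1) j2(1,3)] src_cmp[OF yx1(1) j2(2,4)] j2(3,5) la(3) by auto
  have sx1: "s (x \<cdot> x1) = r x2" using src_cmp[OF xy(1) j1(2,4)] x12 by simp
  have "deg_diff (leg (s b) \<cdot> z) (leg (s a) \<cdot> z2) = deg_diff ((x \<cdot> x1) \<cdot> x2) ((y \<cdot> x1) \<cdot> x2)"
    using z j2 by simp
  also have "\<dots> = g"
    using deg_diff_comp[OF cmp_closed[OF xy(1) j1(2,4)] j2(2) sx1 yx1(1) j2(2,4)]
      deg_diff_comp[OF xy(1) j1(2,4) xy(2) j1(2)] j1(4) xy by simp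
  finally have gz: "deg_diff (leg (s b)) (leg (s a)) + deg_diff z z2 = g"
    using deg_diff_comp[OF lb(1) z(1) _ la(1) j2(1,3)] z(2) lb by simp
  define \<xi> where "\<xi> = b \<cdot> z"
  define \<eta> where "\<eta> = a \<cdot> z2"
  note aP = X_paths[OF a] and bP = X_paths[OF b]
  have bz: "s b = r z" and az: "s a = r z2" using z z2 by auto
  have xi: "\<xi> \<in> P" "s \<xi> = s x2" and eta: "\<eta> \<in> P" "s \<eta> = s x2"
    using z z2 j2 bz az aP bP by (auto simp: \<xi>_def \<eta>_def cmp_closed src_cmp)
  have "s x2 \<in> terminal" using terminal_src(1)[OF X_terminal[OF b] z(1,2)] z by simp
  then obtain c where c: "c \<in> X" "r c = s x2" using terminal_X_exists by blast
  \<comment> \<open>The prefix in \<open>X\<close> of \<open>b \<cdot> z \<cdot> c\<close> is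
    \<open>b\<close>, whatever \<open>c\<close> is; so the word can only lead from \<open>a\<close>
    to \<open>b\<close>.\<close>
  have pre: "fwd (b \<cdot> z) c b' \<longleftrightarrow> b' = b" if "b \<in> X" "z \<in> P" "s b = r z" "s z = r c" "c \<in> X" for b z c b'
  proof -
    note P = X_paths[OF that(1)] X_paths[OF that(5)]
    have "b \<cdot> (z \<cdot> c) = (b \<cdot> z) \<cdot> c" "z \<cdot> c \<in> P" "s b = r (z \<cdot> c)"
      using cmp_assoc[OF P(1) that(2) P(2) that(3,4)] that P by (auto simp: cmp_closed rng_cmp)
    moreover have "b \<cdot> z \<in> P" "s (b \<cdot> z) = r c" using that P by (auto simp: cmp_closed src_cmp)
    ultimately have "fwd (b \<cdot> z) c b" unfolding fwd_def using that P by blast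
    thus ?thesis using fwd_unique by blast
  qed
  define w where "w = [(\<xi>, False), (\<eta>, True)]"
  have "run w a' b' \<longleftrightarrow> a' = a \<and> b' = b" for a' b'
  proof
    assume "run w a' b'"
    then obtain c' where c': "fwd \<eta> c' a'" "fwd \<xi> c' b'" by (auto simp: w_def)
    hence "c' \<in> X" "r c' = s x2" using eta by (auto simp: fwd_def)
    thus "a' = a \<and> b' = b" using c' pre[OF b z(1) bz] pre[OF a j2(1) az] z z2 unfolding \<xi>_def \<eta>_def by metis
  next
    assume "a' = a \<and> b' = b"
    moreover have "fwd \<eta> c a" "fwd \<xi> c b"
      using pre[OF b z(1) bz] pre[OF a j2(1) az] z z2 c unfolding \<xi>_def \<eta>_def by metis+
    ultimately show "run w a' b'" using a by (auto simp: w_def)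
  qed
  moreover have "twist (word_deg w) a b = g"
  proof -
    have "twist (word_deg w) a b = deg_diff (leg (s b)) (leg (s a)) + deg_diff z z2"
      by (simp add: w_def twist_def height_def deg_diff_def vec_eq_iff \<xi>_def \<eta>_def
          deg_cmp[OF bP z(1) bz] deg_cmp[OF aP j2(1) az])
    thus ?thesis using gz by simp
  qed
  ultimately show thesis using that[of w] xi eta by (auto simp: w_def)
qed

end

section \<open>Calculations modulo a C*-seminorm\<close>

text \<open>The operations live on a type that is a ring, so that ring simplification applies. There
  is no unit and no completeness, and \<open>q\<close> may vanish on nonzero elements.\<close>

locale cstar_seminormed =
  fixes sc :: "complex \<Rightarrow> 'b::ring \<Rightarrow> 'b" and st :: "'b \<Rightarrow> 'b" and q :: "'b \<Rightarrow> real"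
  assumes sc_add_right: "sc c (x + y) = sc c x + sc c y"
    and sc_add_left: "sc (c + c') x = sc c x + sc c' x"
    and sc_sc: "sc c (sc c' x) = sc (c * c') x"
    and sc_one: "sc 1 x = x"
    and sc_mult_left: "sc c x * y = sc c (x * y)"
    and sc_mult_right: "x * sc c y = sc c (x * y)"
    and st_add: "st (x + y) = st x + st y"
    and st_sc: "st (sc c x) = sc (cnj c) (st x)"
    and st_mult: "st (x * y) = st y * st x"
    and st_st: "st (st x) = x"
    and q_nonneg: "0 \<le> q x"
    and q_add: "q (x + y) \<le> q x + q y"
    and q_sc: "q (sc c x) = cmod c * q x"
    and q_mult: "q (x * y) \<le> q x * q y"
    and q_cstar: "q (st x * x) = (q x)\<^sup>2"
begin

lemma sc_zero_left [simp]: "sc 0 x = 0"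
  using sc_add_left[of 0 0 x] by simp

lemma sc_zero_right [simp]: "sc c 0 = 0"
  using sc_add_right[of c 0 0] by simp

lemma sc_minus: "sc (- c) x = - sc c x"
  using sc_add_left[of c "- c" x] by (simp add: add_eq_0_iff)

lemma sc_minus_right: "sc c (- x) = - sc c x"
  using sc_add_right[of c x "- x"] by (simp add: add_eq_0_iff)

lemma minus_sc: "- x = sc (-1) x"
  by (simp add: sc_minus sc_one)

lemma sc_sum: "sc c (\<Sum>i\<in>I. f i) = (\<Sum>i\<in>I. sc c (f i))"
  by (induction I rule: infinite_finite_induct) (simp_all add: sc_add_right)

lemma sc_sum_left: "sc (\<Sum>i\<in>I. c i) x = (\<Sum>i\<in>I. sc (c i) x)"
  by (induction I rule: infinite_finite_induct) (simp_all add: sc_add_left)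

lemma st_uminus: "st (- x) = - st x"
  by (simp add: minus_sc st_sc)

lemma st_diff: "st (x - y) = st x - st y"
  using st_add[of x "- y"] by (simp add: st_uminus)

lemma q_zero [simp]: "q 0 = 0"
  using q_sc[of 0 0] by simp

lemma q_uminus: "q (- x) = q x"
  by (simp add: minus_sc q_sc)

lemma q_diff: "q (x - y) \<le> q x + q y"
  using q_add[of x "- y"] by (simp add: q_uminus)

lemma q_sum: "q (\<Sum>i\<in>I. f i) \<le> (\<Sum>i\<in>I. q (f i))"
  by (induction I rule: infinite_finite_induct) (auto intro: order_trans[OF q_add])

lemma q_le_if_square: "(q x)\<^sup>2 \<le> c * q x \<Longrightarrow> 0 \<le> c \<Longrightarrow> q x \<le> c"
  using q_nonneg[of x] by (cases "q x = 0") (auto simp: power2_eq_square)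

lemma q_st: "q (st x) = q x"
proof -
  have le: "q x \<le> q (st x)" for x
    using q_mult[of "st x" x] q_nonneg[of "st x"] by (intro q_le_if_square) (simp_all add: q_cstar)
  show ?thesis using le[of x] le[of "st x"] by (simp add: st_st)
qed

text \<open>Equality in the quotient by the null ideal of \<open>q\<close>.\<close>

definition eqv (infix "\<doteq>" 50) where "x \<doteq> y \<longleftrightarrow> q (x - y) = 0"

lemma eqv_refl [simp, intro]: "x \<doteq> x"
  by (simp add: eqv_def)

lemma eqv_sym: "x \<doteq> y \<Longrightarrow> y \<doteq> x"
  unfolding eqv_def by (metis minus_diff_eq q_uminus)

lemma eqv_trans [trans]: "x \<doteq> y \<Longrightarrow> y \<doteq> z \<Longrightarrow> x \<doteq> z"
  unfolding eqv_def using q_add[of "x - y" "y - z"] q_nonneg[of "x - z"] by simp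

lemma eqv_zero_iff: "x \<doteq> 0 \<longleftrightarrow> q x = 0"
  by (simp add: eqv_def)

lemma q_cong: "x \<doteq> y \<Longrightarrow> q x = q y"
  unfolding eqv_def using q_add[of "x - y" y] q_add[of "y - x" x] q_uminus[of "x - y"] by simp

lemma eqv_add: "x \<doteq> y \<Longrightarrow> x' \<doteq> y' \<Longrightarrow> x + x' \<doteq> y + y'"
  unfolding eqv_def using q_add[of "x - y" "x' - y'"] q_nonneg[of "x + x' - (y + y')"]
  by (simp add: algebra_simps)

lemma eqv_sc: "x \<doteq> y \<Longrightarrow> sc c x \<doteq> sc c y"
  unfolding eqv_def using q_sc[of c "x - y"] sc_add_right[of c x "- y"] by (simp add: sc_minus_right)

lemma eqv_uminus: "x \<doteq> y \<Longrightarrow> - x \<doteq> - y"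
  using eqv_sc[of x y "-1"] by (simp add: minus_sc)

lemma eqv_diff: "x \<doteq> y \<Longrightarrow> x' \<doteq> y' \<Longrightarrow> x - x' \<doteq> y - y'"
  using eqv_add[of x y "- x'" "- y'"] eqv_uminus by simp

lemma eqv_st: "x \<doteq> y \<Longrightarrow> st x \<doteq> st y"
  unfolding eqv_def by (metis q_st st_diff)

lemma eqv_mult_left: "x \<doteq> y \<Longrightarrow> z * x \<doteq> z * y"
  unfolding eqv_def using q_mult[of z "x - y"] q_nonneg[of "z * x - z * y"] by (simp add: right_diff_distrib)

lemma eqv_mult_right: "x \<doteq> y \<Longrightarrow> x * z \<doteq> y * z"
  unfolding eqv_def using q_mult[of "x - y" z] q_nonneg[of "x * z - y * z"] by (simp add: left_diff_distrib)

lemma eqv_mult: "x \<doteq> y \<Longrightarrow> x' \<doteq> y' \<Longrightarrow> x * x' \<doteq> y * y'"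
  using eqv_mult_left eqv_mult_right eqv_trans by meson

lemma eqv_sum: "(\<And>i. i \<in> I \<Longrightarrow> f i \<doteq> g i) \<Longrightarrow> sum f I \<doteq> sum g I"
  by (induction I rule: infinite_finite_induct) (auto intro: eqv_add)

lemma q_zero_if_st_mult: "st x * x \<doteq> 0 \<Longrightarrow> x \<doteq> 0"
  using q_cstar[of x] by (simp add: eqv_zero_iff)

definition proj where "proj p \<longleftrightarrow> p * p \<doteq> p \<and> st p \<doteq> p"

lemma q_proj:
  assumes "proj p"
  shows "q p \<le> 1"
proof -
  have "st p * p \<doteq> p" using assms eqv_mult_right eqv_trans unfolding proj_def by blast
  hence "(q p)\<^sup>2 = q p" using q_cstar[of p] q_cong by metis
  thus ?thesis by (intro q_le_if_square) auto
qed

text \<open>Without a unit, \<open>1 - p\<close> exists only as the map from \<open>x\<close> to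
  \<open>x - p * x\<close>. Modulo \<open>q\<close>, the element
  \<open>(x - p x)^* (x - p x)\<close> equals \<open>x^* (x - p x)\<close>, so one factor
  \<open>q (x - p * x)\<close> cancels from its square.\<close>

lemma q_complement:
  assumes "proj p"
  shows "q (x - p * x) \<le> q x"
proof (rule q_le_if_square)
  have "st x * (st p * (p * x)) \<doteq> st x * (p * (p * x))"
    using assms unfolding proj_def by (intro eqv_mult_left eqv_mult_right) auto
  also have "p * (p * x) \<doteq> p * x"
    using assms unfolding proj_def mult.assoc[symmetric] by (intro eqv_mult_right) auto
  hence "st x * (p * (p * x)) \<doteq> st x * (p * x)" by (rule eqv_mult_left)
  finally have 1: "st x * (st p * (p * x)) \<doteq> st x * (p * x)" .
  have 2: "st x * (st p * x) \<doteq> st x * (p * x)"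
    using assms unfolding proj_def by (intro eqv_mult_left eqv_mult_right) auto
  have "st (x - p * x) * (x - p * x) =
      st x * x - st x * (p * x) - (st x * (st p * x) - st x * (st p * (p * x)))"
    by (simp add: st_diff st_mult algebra_simps)
  also have "\<dots> \<doteq> st x * x - st x * (p * x) - (st x * (p * x) - st x * (p * x))"
    using 1 2 by (intro eqv_diff) auto
  also have "\<dots> = st x * (x - p * x)" by (simp add: algebra_simps)
  finally have "(q (x - p * x))\<^sup>2 = q (st x * (x - p * x))" using q_cstar q_cong by metis
  also have "\<dots> \<le> q x * q (x - p * x)" using q_mult[of "st x"] by (simp add: q_st)
  finally show "(q (x - p * x))\<^sup>2 \<le> q x * q (x - p * x)" .
qed (rule q_nonneg)

text \<open>The unit is an extreme point of the unit ball: with \<open>s = \<delta>/\<surd>2\<close>,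
  \<open>|1 + (1 \<plusminus> \<i>)sa|\<^sup>2 = 1 + 2sa + 2s\<^sup>2a\<^sup>2\<close> is a convex combination of \<open>(1 \<plusminus> \<delta>a)\<^sup>2\<close>, and
  \<open>1 + 2sa\<close> is the mean of \<open>(1 + (1 \<plusminus> \<i>)sa)\<^sup>2\<close>; so the norm bound propagates from \<open>\<delta>\<close> to \<open>\<surd>2\<delta>\<close>.\<close>

context
  fixes e a :: 'b
  assumes ee: "e * e \<doteq> e" and ste: "st e \<doteq> e" and ea: "e * a \<doteq> a" and ae: "a * e \<doteq> a" and sta: "st a \<doteq> a"
begin

definition quad where "quad z w = e + sc z a + sc w (a * a)"

lemma linear_mult: "(e + sc z a) * (e + sc w a) \<doteq> quad (z + w) (z * w)"
proof -
  have "(e + sc z a) * (e + sc w a) = (e * e + (sc w (e * a) + sc z (a * e))) + sc (z * w) (a * a)"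
    by (simp add: algebra_simps sc_mult_left sc_mult_right sc_sc sc_add_right)
  also have "\<dots> \<doteq> (e + (sc w a + sc z a)) + sc (z * w) (a * a)"
    using ee ea ae by (intro eqv_add eqv_sc) auto
  also have "\<dots> = quad (z + w) (z * w)" by (simp add: quad_def sc_add_left algebra_simps)
  finally show ?thesis .
qed

lemma linear_st: "st (e + sc z a) \<doteq> e + sc (cnj z) a"
  using ste sta by (simp add: st_add st_sc eqv_add eqv_sc)

lemma linear_square_norm: "(q (e + sc z a))\<^sup>2 = q (quad (z + cnj z) (z * cnj z))"
proof -
  have "st (e + sc z a) * (e + sc z a) \<doteq> quad (cnj z + z) (cnj z * z)"
    using eqv_trans[OF eqv_mult_right[OF linear_st] linear_mult] .
  thus ?thesis using q_cong q_cstar by (metis add.commute mult.commute)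
qed

lemma quad_convex:
  assumes "0 \<le> c" "0 \<le> c'" "c + c' = 1" "q (quad z w) \<le> 1" "q (quad z' w') \<le> 1"
  shows "q (quad (of_real c * z + of_real c' * z') (of_real c * w + of_real c' * w')) \<le> 1"
proof -
  let ?c = "of_real c :: complex" and ?c' = "of_real c' :: complex"
  have "sc ?c e + sc ?c' e = e"
    using sc_add_left[of ?c ?c' e] assms(3) sc_one by (metis of_real_1 of_real_add)
  hence "quad (?c * z + ?c' * z') (?c * w + ?c' * w') = sc ?c (quad z w) + sc ?c' (quad z' w')"
    by (simp add: quad_def sc_add_left sc_add_right sc_sc algebra_simps)
  hence "q (quad (?c * z + ?c' * z') (?c * w + ?c' * w')) \<le> c * q (quad z w) + c' * q (quad z' w')"
    using q_add[of "sc ?c (quad z w)" "sc ?c' (quad z' w')"] assms by (simp add: q_sc)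
  also have "\<dots> \<le> c * 1 + c' * 1" using assms by (intro add_mono mult_left_mono) auto
  finally show ?thesis using assms by simp
qed

lemma linear_square_le:
  assumes "q (e + sc z a) \<le> 1"
  shows "q (quad (2 * z) (z * z)) \<le> 1"
proof -
  have "q (quad (z + z) (z * z)) = q ((e + sc z a) * (e + sc z a))"
    using q_cong[OF linear_mult] by metis
  also have "\<dots> \<le> q (e + sc z a) * q (e + sc z a)" by (rule q_mult)
  also have "\<dots> \<le> 1 * 1" using assms q_nonneg by (intro mult_mono) auto
  finally show ?thesis by (simp only: mult_2 mult_1)
qed

lemma extreme_step:
  fixes \<delta> :: real
  assumes "q (e + sc (of_real \<delta>) a) \<le> 1" "q (e + sc (- of_real \<delta>) a) \<le> 1"
  shows "q (e + sc (of_real (sqrt 2 * \<delta>)) a) \<le> 1"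
proof -
  \<comment> \<open>The weights satisfy \<open>c - c' = 1 / sqrt 2\<close>, which averages the
    linear coefficients \<open>2 \<delta>\<close> and \<open>-2 \<delta>\<close> to
    \<open>sqrt 2 * \<delta>\<close>; the quadratic coefficient is
    \<open>\<delta> * \<delta>\<close> for both.\<close>
  define c where "c = (1 + 1 / sqrt 2) / 2"
  define c' where "c' = (1 - 1 / sqrt 2) / 2"
  have cc: "0 \<le> c" "0 \<le> c'" "c + c' = 1" "c - c' = 1 / sqrt 2"
    by (auto simp: c_def c'_def field_simps)
  have "q (quad (of_real c * (2 * of_real \<delta>) + of_real c' * (2 * (- of_real \<delta>)))
      (of_real c * (of_real \<delta> * of_real \<delta>) + of_real c' * ((- of_real \<delta>) * (- of_real \<delta>)))) \<le> 1"
    using linear_square_le[OF assms(1)] linear_square_le[OF assms(2)] by (intro quad_convex cc)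
  moreover have "c * (2 * \<delta>) + c' * (2 * (- \<delta>)) = sqrt 2 * \<delta>"
  proof -
    have "c * (2 * \<delta>) + c' * (2 * (- \<delta>)) = 2 * \<delta> * (c - c')" by (simp add: algebra_simps)
    also have "\<dots> = sqrt 2 * \<delta>" unfolding cc(4) by (simp add: field_simps)
    finally show ?thesis .
  qed
  from arg_cong[OF this, of complex_of_real]
  have "complex_of_real c * (2 * of_real \<delta>) + of_real c' * (2 * (- of_real \<delta>)) = of_real (sqrt 2 * \<delta>)"
    by (simp only: of_real_add of_real_mult of_real_minus of_real_numeral)
  moreover have "c * (\<delta> * \<delta>) + c' * ((- \<delta>) * (- \<delta>)) = \<delta> * \<delta>"
    using cc(3) distrib_right[of c c' "\<delta> * \<delta>"] by simp
  hence "complex_of_real c * (of_real \<delta> * of_real \<delta>) + of_real c' * ((- of_real \<delta>) * (- of_real \<delta>))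
      = of_real (\<delta> * \<delta>)"
    by (simp only: of_real_add[symmetric] of_real_mult[symmetric] of_real_minus[symmetric])
  ultimately have main: "q (quad (of_real (sqrt 2 * \<delta>)) (of_real (\<delta> * \<delta>))) \<le> 1" by simp
  define s where "s = \<delta> / sqrt 2"
  have s: "2 * s = sqrt 2 * \<delta>" "2 * (s * s) = \<delta> * \<delta>" by (auto simp: s_def field_simps)
  have lin: "q (e + sc z a) \<le> 1" if "z = Complex s s \<or> z = Complex s (- s)" for z
  proof -
    have "z + cnj z = of_real (sqrt 2 * \<delta>)" "z * cnj z = of_real (\<delta> * \<delta>)"
      using that s by (auto simp: complex_eq_iff)
    hence "(q (e + sc z a))\<^sup>2 \<le> 1" using main linear_square_norm by simp
    thus ?thesis using q_nonneg by (simp add: power_le_one_iff abs_square_le_1)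
  qed
  \<comment> \<open>The squares of \<open>(1 + \<i>) s\<close> and \<open>(1 - \<i>) s\<close> are
    opposite, so the quadratic terms cancel in the mean.\<close>
  have "q (quad (of_real (1/2) * (2 * Complex s s) + of_real (1/2) * (2 * Complex s (- s)))
      (of_real (1/2) * (Complex s s * Complex s s) + of_real (1/2) * (Complex s (- s) * Complex s (- s)))) \<le> 1"
    by (intro quad_convex linear_square_le lin) auto
  also have "of_real (1/2) * (2 * Complex s s) + of_real (1/2) * (2 * Complex s (- s)) = of_real (sqrt 2 * \<delta>)"
    using s(1) by (auto simp: complex_eq_iff)
  also have "of_real (1/2) * (Complex s s * Complex s s) + of_real (1/2) * (Complex s (- s) * Complex s (- s)) = 0"
    by (auto simp: complex_eq_iff)
  finally show ?thesis by (simp add: quad_def)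
qed

text \<open>The bounds propagate from \<open>\<delta>\<close> to
  \<open>sqrt 2 ^ n * \<delta>\<close> for every \<open>n\<close>, and the difference of the two
  bounded elements is a multiple of \<open>a\<close> that grows with \<open>n\<close>.\<close>

lemma extreme_zero:
  fixes \<delta> :: real
  assumes "0 < \<delta>" "q (e + sc (of_real \<delta>) a) \<le> 1" "q (e + sc (- of_real \<delta>) a) \<le> 1"
  shows "q a = 0"
proof -
  have pm: "q (e + sc (of_real (sqrt 2 ^ n * \<delta>)) a) \<le> 1 \<and> q (e + sc (- of_real (sqrt 2 ^ n * \<delta>)) a) \<le> 1" for n
  proof (induction n)
    case (Suc n)
    have "q (e + sc (of_real (sqrt 2 * - (sqrt 2 ^ n * \<delta>))) a) \<le> 1"
      using Suc by (intro extreme_step) simp_all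
    moreover have "q (e + sc (of_real (sqrt 2 * (sqrt 2 ^ n * \<delta>))) a) \<le> 1"
      using Suc by (intro extreme_step) simp_all
    ultimately show ?case by (simp add: mult.assoc)
  qed (use assms in simp)
  have bd: "sqrt 2 ^ n * (\<delta> * q a) \<le> 1" for n
  proof -
    let ?z = "complex_of_real (sqrt 2 ^ n * \<delta>)"
    have "sc ?z a + sc ?z a = (e + sc ?z a) - (e + sc (- ?z) a)" by (simp add: sc_minus)
    hence "q (sc (?z + ?z) a) \<le> 2"
      using q_diff[of "e + sc ?z a" "e + sc (- ?z) a"] pm[of n] unfolding sc_add_left by simp
    moreover have "?z + ?z = of_real (2 * (sqrt 2 ^ n * \<delta>))" by simp
    hence "cmod (?z + ?z) = 2 * (sqrt 2 ^ n * \<delta>)" using assms(1) by (simp only: norm_of_real) simp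
    ultimately show ?thesis unfolding q_sc by simp
  qed
  show ?thesis
  proof (rule ccontr)
    assume "q a \<noteq> 0"
    hence pos: "0 < \<delta> * q a" using assms(1) q_nonneg[of a] by simp
    obtain n where "1 / (\<delta> * q a) < sqrt 2 ^ n" using real_arch_pow[of "sqrt 2"] by auto
    hence "1 < sqrt 2 ^ n * (\<delta> * q a)" using pos by (simp add: field_simps)
    thus False using bd[of n] by simp
  qed
qed

end

text \<open>Compress to \<open>a k = p j * (p k * p j)\<close>; the sum of these over
  \<open>k \<noteq> j\<close> vanishes. Positivity would make each summand zero, but only norms are
  available: since every \<open>p j - a k\<close> is a contraction, \<open>p j + a i / m\<close> and
  \<open>p j - a i / m\<close> lie in the unit ball, and extremality of \<open>p j\<close> yields
  \<open>a i = 0\<close>. As \<open>a i\<close> is the absolute square of \<open>p i * p j\<close>,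
  the product vanishes.\<close>

lemma orthogonal_projections:
  assumes I: "finite I" "i \<in> I" "j \<in> I" "i \<noteq> j" and p: "\<And>i. i \<in> I \<Longrightarrow> proj (p i)"
    and total: "(\<Sum>i\<in>I. p i) * p j \<doteq> p j"
  shows "p i * p j \<doteq> 0"
proof -
  define a where "a k = p j * (p k * p j)" for k
  have pp: "p k * p k \<doteq> p k" "st (p k) \<doteq> p k" if "k \<in> I" for k using p[OF that] by (auto simp: proj_def)
  have pa: "p j * a k \<doteq> a k" for k
    unfolding a_def mult.assoc[symmetric] using pp[OF I(3)] by (intro eqv_mult_right) auto
  have ap: "a k * p j \<doteq> a k" for k
    unfolding a_def mult.assoc using pp[OF I(3)] by (intro eqv_mult_left) auto
  have sta: "st (a k) \<doteq> a k" if "k \<in> I" for k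
    unfolding a_def st_mult mult.assoc[symmetric] using pp[OF I(3)] pp[OF that] by (intro eqv_mult) auto
  \<comment> \<open>Modulo \<open>q\<close>, \<open>p j - a k\<close> is \<open>z^* z\<close> for
    \<open>z = p j - p k * p j\<close>, and \<open>z\<close> is a contraction by
    \<open>q_complement\<close>.\<close>
  have compl: "q (p j - a k) \<le> 1" if k: "k \<in> I" for k
  proof -
    let ?z = "p j - p k * p j"
    have 1: "st (p j) * (st (p k) * (p k * p j)) \<doteq> a k"
    proof -
      have "st (p k) * (p k * p j) \<doteq> p k * (p k * p j)" using pp[OF k] by (intro eqv_mult_right) auto
      also have "\<dots> \<doteq> p k * p j" unfolding mult.assoc[symmetric] using pp[OF k] by (intro eqv_mult_right) auto
      finally show ?thesis unfolding a_def by (rule eqv_mult[OF pp(2)[OF I(3)]])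
    qed
    have "st ?z * ?z = st (p j) * p j - st (p j) * (p k * p j) -
        (st (p j) * (st (p k) * p j) - st (p j) * (st (p k) * (p k * p j)))"
      by (simp add: st_diff st_mult algebra_simps)
    also have "\<dots> \<doteq> p j * p j - a k - (a k - a k)"
    proof (intro eqv_diff 1)
      show "st (p j) * p j \<doteq> p j * p j" by (rule eqv_mult_right[OF pp(2)[OF I(3)]])
      show "st (p j) * (p k * p j) \<doteq> a k" unfolding a_def by (rule eqv_mult_right[OF pp(2)[OF I(3)]])
      show "st (p j) * (st (p k) * p j) \<doteq> a k"
        unfolding a_def by (rule eqv_mult[OF pp(2)[OF I(3)] eqv_mult_right[OF pp(2)[OF k]]])
    qed
    also have "\<dots> \<doteq> p j - a k - (a k - a k)" using pp[OF I(3)] by (intro eqv_diff) auto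
    finally have "st ?z * ?z \<doteq> p j - a k" by simp
    hence "q (p j - a k) = (q ?z)\<^sup>2" using q_cstar q_cong by metis
    moreover have "q ?z \<le> 1" using q_complement[OF p[OF k], of "p j"] q_proj[OF p[OF I(3)]] by linarith
    ultimately show ?thesis using q_nonneg[of ?z] by (simp add: power_le_one)
  qed
  have zero: "(\<Sum>k\<in>I - {j}. a k) \<doteq> 0"
  proof -
    have "(\<Sum>k\<in>I. a k) = p j * ((\<Sum>k\<in>I. p k) * p j)"
      by (simp add: a_def sum_distrib_left sum_distrib_right)
    also have "\<dots> \<doteq> p j * p j" by (rule eqv_mult_left[OF total])
    also have "\<dots> \<doteq> p j" using pp[OF I(3)] by simp
    finally have "a j + (\<Sum>k\<in>I - {j}. a k) \<doteq> p j" using sum.remove[OF I(1,3), of a] by simp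
    moreover have "a j \<doteq> p j"
      unfolding a_def using pp[OF I(3)] eqv_mult_left eqv_trans by meson
    ultimately have "(a j + (\<Sum>k\<in>I - {j}. a k)) - a j \<doteq> p j - p j" by (intro eqv_diff)
    thus ?thesis by simp
  qed
  define J where "J = I - {j} - {i}"
  \<comment> \<open>Since \<open>a i\<close> is minus the sum of the other \<open>a k\<close>, the
    element \<open>m p j + a i\<close> is \<open>p j\<close> plus the \<open>p j - a k\<close> for
    \<open>k\<close> in \<open>J\<close>, a sum of \<open>m\<close> contractions.\<close>
  define m where "m = Suc (card J)"
  have "(\<Sum>k\<in>I - {j}. a k) = a i + (\<Sum>k\<in>J. a k)"
    unfolding J_def using I by (intro sum.remove) auto
  hence "a i + (\<Sum>k\<in>J. a k) \<doteq> 0" using zero by simp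
  hence ai: "a i \<doteq> - (\<Sum>k\<in>J. a k)"
    using eqv_diff[of "a i + (\<Sum>k\<in>J. a k)" 0 "(\<Sum>k\<in>J. a k)" "(\<Sum>k\<in>J. a k)"] by simp
  have nat_sc: "(\<Sum>k\<in>J. x) = sc (of_nat (card J)) x" for x
    using sc_sum_left[of "\<lambda>_. 1" J x] by (simp add: sc_one)
  have m0: "complex_of_nat m \<noteq> 0" by (simp add: m_def del: of_nat_Suc)
  have pj: "sc (of_nat m) (p j) = p j + (\<Sum>k\<in>J. p j)"
    by (simp add: m_def sc_add_left sc_one nat_sc)
  have plus: "q (p j + sc (of_real (1 / m)) (a i)) \<le> 1"
  proof -
    have "sc (of_nat m) (p j) + a i \<doteq> (p j + (\<Sum>k\<in>J. p j)) + - (\<Sum>k\<in>J. a k)"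
      unfolding pj using ai by (intro eqv_add) auto
    also have "\<dots> = p j + (\<Sum>k\<in>J. p j - a k)" by (simp add: sum_subtractf)
    finally have "q (sc (of_nat m) (p j) + a i) \<le> q (p j) + (\<Sum>k\<in>J. q (p j - a k))"
      using q_cong q_add[of "p j" "\<Sum>k\<in>J. p j - a k"] q_sum[of "\<lambda>k. p j - a k" J] by fastforce
    also have "\<dots> \<le> 1 + (\<Sum>k\<in>J. 1)"
      using q_proj[OF p[OF I(3)]] compl by (intro add_mono sum_mono) (auto simp: J_def)
    finally have "q (sc (of_nat m) (p j) + a i) \<le> m" by (simp add: m_def)
    moreover have "sc (of_real (1 / m)) (sc (of_nat m) (p j) + a i) = p j + sc (of_real (1 / m)) (a i)"
      using m0 by (simp add: sc_add_right sc_sc sc_one)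
    ultimately have "q (p j + sc (of_real (1 / m)) (a i)) \<le> cmod (of_real (1 / m)) * m"
      using q_sc[of "of_real (1 / m)" "sc (of_nat m) (p j) + a i"] mult_left_mono[OF _ norm_ge_zero] by metis
    thus ?thesis by (simp only: norm_of_real) (simp add: m_def)
  qed
  have minus: "q (p j + sc (- of_real (1 / m)) (a i)) \<le> 1"
  proof -
    \<comment> \<open>Again a sum of \<open>m\<close> contractions, with \<open>p j - a i\<close> as
      one of them.\<close>
    have eq: "sc (of_nat m) (p j) - a i = (p j - a i) + (\<Sum>k\<in>J. p j)" unfolding pj by simp
    have "q (sc (of_nat m) (p j) - a i) \<le> q (p j - a i) + (\<Sum>k\<in>J. q (p j))"
      unfolding eq using q_add[of "p j - a i" "\<Sum>k\<in>J. p j"] q_sum[of "\<lambda>_. p j" J] by linarith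
    also have "\<dots> \<le> 1 + (\<Sum>k\<in>J. 1)"
      using q_proj[OF p[OF I(3)]] compl[OF I(2)] by (intro add_mono sum_mono) auto
    finally have "q (sc (of_nat m) (p j) - a i) \<le> m" by (simp add: m_def)
    moreover have "sc (of_real (1 / m)) (sc (of_nat m) (p j) - a i) = p j + sc (- of_real (1 / m)) (a i)"
      using m0 sc_add_right[of "of_real (1 / m)" "sc (of_nat m) (p j)" "- a i"]
      by (simp add: sc_sc sc_one sc_minus sc_minus_right)
    ultimately have "q (p j + sc (- of_real (1 / m)) (a i)) \<le> cmod (of_real (1 / m)) * m"
      using q_sc[of "of_real (1 / m)" "sc (of_nat m) (p j) - a i"] mult_left_mono[OF _ norm_ge_zero] by metis
    thus ?thesis by (simp only: norm_of_real) (simp add: m_def)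
  qed
  have "q (a i) = 0"
    using extreme_zero[of "p j" "a i" "1 / m", OF _ _ pa ap sta[OF I(2)] _ plus minus] pp[OF I(3)]
    by (simp add: m_def)
  hence "a i \<doteq> 0" by (simp add: eqv_zero_iff)
  moreover have "st (p i * p j) * (p i * p j) \<doteq> a i"
  proof -
    have "st (p i * p j) * (p i * p j) = st (p j) * (st (p i) * (p i * p j))" by (simp add: st_mult mult.assoc)
    also have "\<dots> \<doteq> p j * (p i * (p i * p j))"
      using pp[OF I(3)] pp[OF I(2)] by (intro eqv_mult) auto
    also have "p i * (p i * p j) \<doteq> p i * p j"
      unfolding mult.assoc[symmetric] using pp[OF I(2)] by (intro eqv_mult_right) auto
    hence "p j * (p i * (p i * p j)) \<doteq> a i" unfolding a_def by (rule eqv_mult_left)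
    finally show ?thesis .
  qed
  ultimately show ?thesis using eqv_trans q_zero_if_st_mult by blast
qed

end

section \<open>Subgroups of free abelian groups of finite rank\<close>

definition int_subgroup :: "(int ^ 'k) set \<Rightarrow> bool" where
  "int_subgroup G \<longleftrightarrow> 0 \<in> G \<and> (\<forall>x\<in>G. - x \<in> G) \<and> (\<forall>x\<in>G. \<forall>y\<in>G. x + y \<in> G)"

text \<open>An isomorphism onto \<open>\<int>^l\<close>. The rank \<open>l\<close> is a computed
  number and cannot be a type, so vectors are integer sequences that vanish from \<open>l\<close>
  on; the indices below \<open>l\<close> match those of \<open>torus l\<close>.\<close>

definition coordinates :: "nat \<Rightarrow> (int ^ 'k \<Rightarrow> nat \<Rightarrow> int) \<Rightarrow> (int ^ 'k) set \<Rightarrow> bool" where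
  "coordinates l \<kappa> G \<longleftrightarrow> bij_betw \<kappa> G {f. \<forall>j\<ge>l. f j = 0} \<and>
     (\<forall>x\<in>G. \<forall>y\<in>G. \<forall>j. \<kappa> (x + y) j = \<kappa> x j + \<kappa> y j)"

lemma int_subgroup_smult:
  assumes "int_subgroup G" "x \<in> G"
  shows "c *s x \<in> G"
proof -
  have nat: "int n *s x \<in> G" for n
  proof (induction n)
    case 0
    have "int 0 *s x = 0" by (simp add: vec_eq_iff)
    thus ?case using assms by (simp add: int_subgroup_def)
  next
    case (Suc n)
    have "int (Suc n) *s x = x + int n *s x" by (simp add: vec_eq_iff algebra_simps)
    thus ?case using assms Suc by (simp add: int_subgroup_def)
  qed
  show ?thesis
  proof (cases "0 \<le> c")
    case True
    thus ?thesis using nat[of "nat c"] by simp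
  next
    case False
    hence "c *s x = - (int (nat (- c)) *s x)" by (simp add: vec_eq_iff)
    thus ?thesis using nat[of "nat (- c)"] assms(1) by (simp add: int_subgroup_def)
  qed
qed

lemma int_subgroup_sum:
  assumes "int_subgroup G" "finite S" "S \<subseteq> G"
  shows "(\<Sum>v\<in>S. u v *s v) \<in> G"
  using assms(2,3)
proof (induction S)
  case empty
  thus ?case using assms(1) by (simp add: int_subgroup_def)
next
  case (insert v S)
  thus ?case using assms(1) int_subgroup_smult[OF assms(1), of v "u v"] by (simp add: int_subgroup_def)
qed

lemma coordinates_zero:
  assumes "int_subgroup G" "coordinates l \<kappa> G"
  shows "\<kappa> 0 j = 0"
proof -
  have "\<kappa> (0 + 0) j = \<kappa> 0 j + \<kappa> 0 j"
    using assms unfolding coordinates_def int_subgroup_def by blast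
  thus ?thesis by simp
qed

lemma coordinates_uminus:
  assumes "int_subgroup G" "coordinates l \<kappa> G" "x \<in> G"
  shows "\<kappa> (- x) j = - \<kappa> x j"
proof -
  have "\<kappa> (x + - x) j = \<kappa> x j + \<kappa> (- x) j"
    using assms unfolding coordinates_def int_subgroup_def by blast
  thus ?thesis using coordinates_zero[OF assms(1,2)] by simp
qed

lemma coordinates_smult:
  assumes "int_subgroup G" "coordinates l \<kappa> G" "x \<in> G"
  shows "\<kappa> (c *s x) j = c * \<kappa> x j"
proof -
  have nat: "\<kappa> (int n *s x) j = int n * \<kappa> x j" for n
  proof (induction n)
    case 0
    have "int 0 *s x = 0" by (simp add: vec_eq_iff)
    thus ?case using coordinates_zero[OF assms(1,2)] by simp
  next
    case (Suc n)
    have "int (Suc n) *s x = x + int n *s x" by (simp add: vec_eq_iff algebra_simps)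
    moreover have "\<kappa> (x + int n *s x) j = \<kappa> x j + \<kappa> (int n *s x) j"
      using assms int_subgroup_smult[OF assms(1,3)] unfolding coordinates_def by blast
    ultimately show ?case using Suc by (simp add: algebra_simps)
  qed
  show ?thesis
  proof (cases "0 \<le> c")
    case True
    thus ?thesis using nat[of "nat c"] by simp
  next
    case False
    hence "c *s x = - (int (nat (- c)) *s x)" by (simp add: vec_eq_iff)
    thus ?thesis
      using nat[of "nat (- c)"] coordinates_uminus[OF assms(1,2) int_subgroup_smult[OF assms(1,3)]] False
      by simp
  qed
qed

lemma coordinates_sum:
  assumes "int_subgroup G" "coordinates l \<kappa> G" "finite S" "S \<subseteq> G"
  shows "\<kappa> (\<Sum>v\<in>S. u v *s v) j = (\<Sum>v\<in>S. u v * \<kappa> v j)"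
  using assms(3,4)
proof (induction S)
  case empty
  thus ?case using coordinates_zero[OF assms(1,2)] by simp
next
  case (insert v S)
  have "\<kappa> (u v *s v + (\<Sum>v\<in>S. u v *s v)) j = \<kappa> (u v *s v) j + \<kappa> (\<Sum>v\<in>S. u v *s v) j"
    using assms(2) int_subgroup_smult[OF assms(1)] int_subgroup_sum[OF assms(1) insert(1)] insert(4)
    unfolding coordinates_def by simp
  thus ?case using insert coordinates_smult[OF assms(1,2)] by simp
qed

text \<open>Induction on the set \<open>J\<close> of coordinates in which elements may be nonzero.
  For a new coordinate \<open>i\<close>, an element \<open>g\<close> with least positive
  \<open>i\<close>-th entry splits \<open>G\<close> into the multiples of \<open>g\<close> and the
  subgroup \<open>G'\<close> of elements with zero \<open>i\<close>-th entry; division with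
  remainder shows that nothing else is left.\<close>

lemma coordinates_exist:
  fixes G :: "(int ^ 'k::finite) set"
  assumes "int_subgroup G"
  shows "\<exists>l \<kappa>. coordinates l \<kappa> G"
proof -
  have "\<exists>l \<kappa>. coordinates l \<kappa> G"
    if "int_subgroup G" "\<And>x i. x \<in> G \<Longrightarrow> i \<notin> J \<Longrightarrow> x $ i = 0" for J and G :: "(int ^ 'k) set"
    using finite[of J] that
  proof (induction J arbitrary: G)
    case empty
    hence "G = {0}" by (auto simp: int_subgroup_def vec_eq_iff)
    hence "coordinates 0 (\<lambda>_ _. 0) G" by (auto simp: coordinates_def bij_betw_def)
    thus ?case by blast
  next
    case (insert i J)
    define G' where "G' = {x\<in>G. x $ i = 0}"
    have sub: "int_subgroup G'" using insert(4) by (auto simp: int_subgroup_def G'_def)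
    have "x $ k = 0" if "x \<in> G'" "k \<notin> J" for x k
      using that insert(5)[of x k] by (cases "k = i") (auto simp: G'_def)
    then obtain l \<kappa> where \<kappa>: "coordinates l \<kappa> G'" using insert(3)[OF sub] by blast
    show ?case
    proof (cases "G' = G")
      case True
      thus ?thesis using \<kappa> by blast
    next
      case False
      define Q where "Q n \<longleftrightarrow> 0 < n \<and> (\<exists>g\<in>G. g $ i = int n)" for n
      obtain g0 where g0: "g0 \<in> G" "g0 $ i \<noteq> 0" using False by (auto simp: G'_def)
      have "\<exists>n. Q n"
      proof (cases "0 < g0 $ i")
        case True
        thus ?thesis using g0 by (intro exI[of _ "nat (g0 $ i)"]) (auto simp: Q_def)
      next
        case False
        thus ?thesis using g0 insert(4)
          by (intro exI[of _ "nat (- g0 $ i)"]) (auto simp: Q_def int_subgroup_def intro!: bexI[of _ "- g0"])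
      qed
      define n where "n = (LEAST n. Q n)"
      have Qn: "Q n" and least: "\<And>m. Q m \<Longrightarrow> n \<le> m"
        unfolding n_def using LeastI_ex[OF \<open>\<exists>n. Q n\<close>] Least_le by auto
      obtain g where g: "g \<in> G" "g $ i = int n" "0 < n" using Qn by (auto simp: Q_def)
      define q where "q x = x $ i div int n" for x :: "int ^ 'k"
      have red: "x - q x *s g \<in> G'" and qx: "x $ i = q x * int n" if "x \<in> G" for x
      proof -
        have "x + (- q x) *s g \<in> G"
          using that int_subgroup_smult[OF insert(4) g(1)] insert(4) by (simp add: int_subgroup_def)
        moreover have e: "x + (- q x) *s g = x - q x *s g" by (simp add: vec_eq_iff)
        ultimately have x': "x - q x *s g \<in> G" by simp
        have m: "(x - q x *s g) $ i = x $ i mod int n" by (simp add: q_def g minus_div_mult_eq_mod)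
        have "x $ i mod int n = 0"
        proof (rule ccontr)
          assume "x $ i mod int n \<noteq> 0"
          moreover have "0 \<le> x $ i mod int n" using g(3) by simp
          ultimately have "0 < x $ i mod int n" by linarith
          hence "Q (nat (x $ i mod int n))" using x' m unfolding Q_def by (intro conjI bexI[OF _ x']) auto
          hence "n \<le> nat (x $ i mod int n)" by (rule least)
          moreover have "x $ i mod int n < int n" using g(3) by simp
          ultimately show False using g(3) by linarith
        qed
        thus "x - q x *s g \<in> G'" "x $ i = q x * int n" using x' m by (auto simp: G'_def q_def g)
      qed
      \<comment> \<open>The multiple of \<open>g\<close> becomes the new coordinate, number
        \<open>l\<close>.\<close>
      define \<kappa>' where "\<kappa>' x = (\<kappa> (x - q x *s g))(l := q x)" for x
      have kl: "\<kappa> x j = 0" if "x \<in> G'" "l \<le> j" for x j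
        using \<kappa> that unfolding coordinates_def bij_betw_def by auto
      have kinj: "inj_on \<kappa> G'" using \<kappa> by (auto simp: coordinates_def bij_betw_def)
      have ksurj: "f \<in> \<kappa> ` G'" if "\<And>j. l \<le> j \<Longrightarrow> f j = 0" for f
        using \<kappa> that by (auto simp: coordinates_def bij_betw_def)
      have "inj_on \<kappa>' G"
      proof
        fix x y assume xy: "x \<in> G" "y \<in> G" "\<kappa>' x = \<kappa>' y"
        hence q: "q x = q y" unfolding \<kappa>'_def by (metis fun_upd_same)
        have "\<kappa> (x - q x *s g) j = \<kappa> (y - q y *s g) j" for j
          using fun_cong[OF xy(3), of j] kl[OF red[OF xy(1)], of j] kl[OF red[OF xy(2)], of j]
          by (cases "j = l") (auto simp: \<kappa>'_def)
        hence "x - q x *s g = y - q y *s g" using kinj red xy by (meson ext inj_onD)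
        thus "x = y" using q by simp
      qed
      moreover have "\<kappa>' ` G = {f. \<forall>j\<ge>Suc l. f j = 0}"
      proof (intro equalityI subsetI)
        fix f :: "nat \<Rightarrow> int" assume "f \<in> \<kappa>' ` G"
        thus "f \<in> {f. \<forall>j\<ge>Suc l. f j = 0}" using kl red by (auto simp: \<kappa>'_def)
      next
        fix f :: "nat \<Rightarrow> int" assume f: "f \<in> {f. \<forall>j\<ge>Suc l. f j = 0}"
        hence "f(l := 0) \<in> \<kappa> ` G'" by (intro ksurj) (auto simp: le_Suc_eq)
        then obtain x where x: "x \<in> G'" "\<kappa> x = f(l := 0)" by auto
        define y where "y = x + f l *s g"
        have y: "y \<in> G" using x insert(4) int_subgroup_smult[OF insert(4) g(1)]
          by (auto simp: y_def int_subgroup_def G'_def)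
        have qy: "q y = f l" using x g by (simp add: q_def y_def G'_def)
        have "\<kappa>' y = f" unfolding \<kappa>'_def qy using x by (simp add: y_def)
        thus "f \<in> \<kappa>' ` G" using y by blast
      qed
      moreover have "\<kappa>' (x + y) j = \<kappa>' x j + \<kappa>' y j" if xy: "x \<in> G" "y \<in> G" for x y j
      proof -
        have "q (x + y) * int n = (q x + q y) * int n"
          using qx[of "x + y"] qx[OF xy(1)] qx[OF xy(2)] insert(4) xy by (simp add: int_subgroup_def distrib_right)
        hence q: "q (x + y) = q x + q y" using g(3) by simp
        hence e2: "x + y - q (x + y) *s g = (x - q x *s g) + (y - q y *s g)"
          by (simp add: vec_eq_iff algebra_simps)
        have "\<kappa> ((x - q x *s g) + (y - q y *s g)) j = \<kappa> (x - q x *s g) j + \<kappa> (y - q y *s g) j"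
          using \<kappa> red xy unfolding coordinates_def by blast
        thus ?thesis unfolding \<kappa>'_def e2 using q by (simp del: add_diff_eq diff_add_eq)
      qed
      ultimately have "coordinates (Suc l) \<kappa>' G" by (auto simp: coordinates_def bij_betw_def)
      thus ?thesis by blast
    qed
  qed
  from this[of G UNIV] assms show ?thesis by simp
qed

lemma module_int_vec: "module ((*s) :: int \<Rightarrow> int ^ 'k \<Rightarrow> int ^ 'k::finite)"
  by unfold_locales (simp_all add: vec_eq_iff algebra_simps)

text \<open>Independence makes the combinations with coefficients in \<open>{0..<M}\<close> distinct, while their
  coordinates are bounded by a multiple of \<open>M\<close>; comparing the growth in \<open>M\<close> bounds the number of
  vectors.\<close>

lemma card_independent_le:
  fixes G :: "(int ^ 'k::finite) set"
  assumes G: "int_subgroup G" and \<kappa>: "coordinates l \<kappa> G" and S: "finite S" "S \<subseteq> G"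
    and ind: "\<not> module.dependent ((*s) :: int \<Rightarrow> int ^ 'k \<Rightarrow> int ^ 'k) S"
  shows "card S \<le> l"
proof (rule ccontr)
  assume "\<not> card S \<le> l"
  define C where "C = (\<Sum>v\<in>S. \<Sum>j<l. nat \<bar>\<kappa> v j\<bar>)"
  \<comment> \<open>\<open>M\<close> exceeds \<open>(2 * C + 1) ^ l\<close>, so
    \<open>M ^ Suc l\<close> distinct combinations cannot fit among at most
    \<open>((2 * C + 1) * M) ^ l\<close> coordinate vectors.\<close>
  define M where "M = (2 * C + 1) ^ l + 1"
  have Cle: "(\<Sum>v\<in>S. \<bar>\<kappa> v j\<bar>) \<le> int C" if "j < l" for j
  proof -
    have "\<bar>\<kappa> v j\<bar> \<le> (\<Sum>j<l. \<bar>\<kappa> v j\<bar>)" for v using that by (intro member_le_sum) auto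
    thus ?thesis unfolding C_def by (simp add: sum_mono)
  qed
  define F where "F u = (\<lambda>j\<in>{..<l}. \<Sum>v\<in>S. u v * \<kappa> v j)" for u :: "int ^ 'k \<Rightarrow> int"
  define A where "A = S \<rightarrow>\<^sub>E {0..<int M}"
  define B where "B = {..<l} \<rightarrow>\<^sub>E {- int (C * M)..int (C * M)}"
  have "inj_on F A"
  proof
    fix u w assume uw: "u \<in> A" "w \<in> A" "F u = F w"
    define z where "z = (\<Sum>v\<in>S. (u v - w v) *s v)"
    have z: "z \<in> G" unfolding z_def by (rule int_subgroup_sum[OF G S])
    have "\<kappa> z j = \<kappa> 0 j" for j
    proof (cases "j < l")
      case True
      have "\<kappa> z j = (\<Sum>v\<in>S. u v * \<kappa> v j) - (\<Sum>v\<in>S. w v * \<kappa> v j)"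
        unfolding z_def coordinates_sum[OF G \<kappa> S] by (simp add: left_diff_distrib sum_subtractf)
      also have "\<dots> = 0" using fun_cong[OF uw(3), of j] True by (simp add: F_def)
      finally show ?thesis using coordinates_zero[OF G \<kappa>] by simp
    next
      case False
      moreover have "\<kappa> z \<in> {f. \<forall>j\<ge>l. f j = 0}"
        using \<kappa> z bij_betwE unfolding coordinates_def by blast
      ultimately show ?thesis using coordinates_zero[OF G \<kappa>] by simp
    qed
    hence "z = 0" using \<kappa> z G unfolding coordinates_def bij_betw_def int_subgroup_def
      by (meson ext inj_onD)
    hence "u v = w v" if "v \<in> S" for v
      using ind that unfolding module.dependent_finite[OF module_int_vec S(1)] z_def
      by (metis eq_iff_diff_eq_0)
    thus "u = w" using uw(1,2) unfolding A_def by (metis PiE_ext)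
  qed
  moreover have "F ` A \<subseteq> B"
  proof
    fix f assume "f \<in> F ` A"
    then obtain u where u: "u \<in> A" "f = F u" by blast
    have "\<bar>\<Sum>v\<in>S. u v * \<kappa> v j\<bar> \<le> int (C * M)" if "j < l" for j
    proof -
      have "\<bar>\<Sum>v\<in>S. u v * \<kappa> v j\<bar> \<le> (\<Sum>v\<in>S. \<bar>u v\<bar> * \<bar>\<kappa> v j\<bar>)"
        using sum_abs[of "\<lambda>v. u v * \<kappa> v j" S] by (simp add: abs_mult)
      also have "\<dots> \<le> (\<Sum>v\<in>S. int M * \<bar>\<kappa> v j\<bar>)"
        using u by (intro sum_mono mult_right_mono) (auto simp: A_def PiE_def Pi_def less_imp_le)
      also have "\<dots> \<le> int M * int C"
        using Cle[OF that] by (simp add: sum_distrib_left[symmetric] mult_left_mono)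
      finally show ?thesis by (simp add: mult.commute)
    qed
    hence "(\<Sum>v\<in>S. u v * \<kappa> v j) \<in> {- int (C * M)..int (C * M)}" if "j < l" for j
      using that by (simp only: atLeastAtMost_iff abs_le_iff) (meson minus_le_iff)
    thus "f \<in> B" unfolding u(2) B_def F_def by (intro restrict_PiE_iff[THEN iffD2]) auto
  qed
  moreover have "finite B" unfolding B_def by (intro finite_PiE) auto
  ultimately have "card A \<le> card B" by (rule card_inj_on_le)
  moreover have "card A = M ^ card S" using S by (simp add: A_def card_PiE)
  moreover have "card B = (2 * (C * M) + 1) ^ l"
  proof -
    have "card {- int (C * M)..int (C * M)} = 2 * (C * M) + 1" by (simp only: card_atLeastAtMost_int)
    thus ?thesis unfolding B_def by (simp add: card_PiE)
  qed
  ultimately have "M ^ card S \<le> (2 * (C * M) + 1) ^ l" by simp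
  also have "\<dots> \<le> ((2 * C + 1) * M) ^ l" by (intro power_mono) (auto simp: M_def algebra_simps)
  also have "\<dots> = (2 * C + 1) ^ l * M ^ l" by (rule power_mult_distrib)
  also have "\<dots> < M * M ^ l" by (intro mult_strict_right_mono) (auto simp: M_def)
  also have "\<dots> = M ^ Suc l" by simp
  also have "\<dots> \<le> M ^ card S" using \<open>\<not> card S \<le> l\<close> by (intro power_increasing) (auto simp: M_def)
  finally show False by simp
qed

text \<open>The upper bound is \<open>card_independent_le\<close>; the preimages of the
  \<open>l\<close> unit vectors are independent and attain it.\<close>

lemma int_rank_coordinates:
  fixes G :: "(int ^ 'k::finite) set"
  assumes G: "int_subgroup G" and \<kappa>: "coordinates l \<kappa> G"
  shows "int_rank G = l"
  unfolding int_rank_def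
proof (rule Max_eqI)
  let ?I = "{card S |S. S \<subseteq> G \<and> finite S \<and> \<not> module.dependent ((*s) :: int \<Rightarrow> int ^ 'k \<Rightarrow> int ^ 'k) S}"
  show le: "y \<le> l" if "y \<in> ?I" for y using that card_independent_le[OF G \<kappa>] by auto
  have "?I \<subseteq> {..l}" using le unfolding atMost_iff subset_iff by blast
  thus "finite ?I" by (rule finite_subset) simp
  define e where "e i = inv_into G \<kappa> (\<lambda>j. if j = i then 1 else 0)" for i :: nat
  have e: "e i \<in> G" "\<kappa> (e i) = (\<lambda>j. if j = i then 1 else 0)" if "i < l" for i
  proof -
    have "(\<lambda>j. if j = i then 1 else 0) \<in> \<kappa> ` G" using \<kappa> that by (auto simp: coordinates_def bij_betw_def)
    thus "e i \<in> G" "\<kappa> (e i) = (\<lambda>j. if j = i then 1 else 0)"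
      unfolding e_def by (auto intro: inv_into_into f_inv_into_f)
  qed
  have inj: "inj_on e {..<l}"
  proof
    fix i j assume "i \<in> {..<l}" "j \<in> {..<l}" "e i = e j"
    hence "(if j = j then 1 else 0) = (if j = i then 1 else (0::int))" using e(2) by (metis lessThan_iff)
    thus "i = j" by (auto split: if_splits)
  qed
  have sub: "e ` {..<l} \<subseteq> G" using e by auto
  have "\<not> module.dependent ((*s) :: int \<Rightarrow> int ^ 'k \<Rightarrow> int ^ 'k) (e ` {..<l})"
  proof
    assume "module.dependent ((*s) :: int \<Rightarrow> int ^ 'k \<Rightarrow> int ^ 'k) (e ` {..<l})"
    then obtain u j where u: "j < l" "u (e j) \<noteq> 0" "(\<Sum>v\<in>e ` {..<l}. u v *s v) = 0"
      by (auto simp: module.dependent_finite[OF module_int_vec])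
    have "0 = \<kappa> (\<Sum>v\<in>e ` {..<l}. u v *s v) j" using u(3) coordinates_zero[OF G \<kappa>] by simp
    also have "\<dots> = (\<Sum>v\<in>e ` {..<l}. u v * \<kappa> v j)" by (rule coordinates_sum[OF G \<kappa> _ sub]) simp
    also have "\<dots> = (\<Sum>i<l. u (e i) * \<kappa> (e i) j)" by (simp add: sum.reindex[OF inj])
    also have "\<dots> = (\<Sum>i<l. if i = j then u (e i) else 0)" by (intro sum.cong) (auto simp: e)
    also have "\<dots> = u (e j)" using u(1) by simp
    finally show False using u(2) by simp
  qed
  thus "l \<in> ?I" using sub by (auto simp: card_image[OF inj] intro!: exI[of _ "e ` {..<l}"])
qed

lemma subgroup_coordinates:
  fixes G :: "(int ^ 'k::finite) set"
  assumes "int_subgroup G"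
  obtains \<kappa> where "coordinates (int_rank G) \<kappa> G"
  using coordinates_exist[OF assms] int_rank_coordinates[OF assms] by blast

section \<open>Cuntz--Krieger families modulo a C*-seminorm\<close>

locale ck_family = no_entrance_graph \<Lambda> + cstar_seminormed sc st q
  for \<Lambda> :: "('a, 'k::finite) kgraph" and sc :: "complex \<Rightarrow> 'b::ring \<Rightarrow> 'b" and st :: "'b \<Rightarrow> 'b" and q +
  fixes t :: "'a \<Rightarrow> 'b"
  assumes vertex_idem: "v \<in> vertices \<Lambda> \<Longrightarrow> t v * t v \<doteq> t v"
    and vertex_st: "v \<in> vertices \<Lambda> \<Longrightarrow> st (t v) \<doteq> t v"
    and vertex_orth: "v \<in> vertices \<Lambda> \<Longrightarrow> w \<in> vertices \<Lambda> \<Longrightarrow> v \<noteq> w \<Longrightarrow> t v * t w \<doteq> 0"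
    and t_cmp: "x \<in> P \<Longrightarrow> y \<in> P \<Longrightarrow> s x = r y \<Longrightarrow> t x * t y \<doteq> t (x \<cdot> y)"
    and t_isometry: "x \<in> P \<Longrightarrow> st (t x) * t x \<doteq> t (s x)"
    and t_ck: "v \<in> vertices \<Lambda> \<Longrightarrow> t v \<doteq> (\<Sum>x\<in>with_range \<Lambda> v (paths_le \<Lambda> n). t x * st (t x))"
begin

lemma t_src: "x \<in> P \<Longrightarrow> t x * t (s x) \<doteq> t x"
  using t_cmp[of x "s x"] by (simp add: path_simps)

lemma t_rng: "x \<in> P \<Longrightarrow> t (r x) * t x \<doteq> t x"
  using t_cmp[of "r x" x] by (simp add: path_simps)

lemma st_t_rng: "x \<in> P \<Longrightarrow> st (t x) * t (r x) \<doteq> st (t x)"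
  using eqv_trans[OF eqv_mult_left[OF eqv_sym[OF vertex_st[OF rng_vertex]]], of x "st (t x)"]
    eqv_st[OF t_rng[of x]] by (simp add: st_mult)

lemma st_t_src: "x \<in> P \<Longrightarrow> t (s x) * st (t x) \<doteq> st (t x)"
  using eqv_trans[OF eqv_mult_right[OF eqv_sym[OF vertex_st[OF src_vertex]]], of x "st (t x)"]
    eqv_st[OF t_src[of x]] by (simp add: st_mult)

lemma mult_zero_eqv: "x * y \<doteq> 0 \<Longrightarrow> a * (x * (y * b)) \<doteq> 0"
  using eqv_mult_left[OF eqv_mult_right, of "x * y" 0 a b] by (simp add: mult.assoc)

lemma t_mult_mismatch:
  assumes "x \<in> P" "y \<in> P" "s x \<noteq> r y"
  shows "t x * t y \<doteq> 0"
proof -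
  have "t x * t y \<doteq> (t x * t (s x)) * (t (r y) * t y)"
    using assms t_src t_rng by (intro eqv_mult) (auto intro: eqv_sym)
  also have "\<dots> = t x * (t (s x) * (t (r y) * t y))" by (simp add: mult.assoc)
  also have "\<dots> \<doteq> 0" using assms by (intro mult_zero_eqv vertex_orth src_vertex rng_vertex) auto
  finally show ?thesis .
qed

lemma st_t_mult_mismatch:
  assumes "x \<in> P" "y \<in> P" "r x \<noteq> r y"
  shows "st (t x) * t y \<doteq> 0"
proof -
  have "st (t x) * t y \<doteq> (st (t x) * t (r x)) * (t (r y) * t y)"
    using assms st_t_rng t_rng by (intro eqv_mult) (auto intro: eqv_sym)
  also have "\<dots> = st (t x) * (t (r x) * (t (r y) * t y))" by (simp add: mult.assoc)
  also have "\<dots> \<doteq> 0" using assms by (intro mult_zero_eqv vertex_orth rng_vertex) auto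
  finally show ?thesis .
qed

definition E :: "'a \<Rightarrow> 'a \<Rightarrow> 'b" where
  "E x y = t x * st (t y)"

lemma proj_E: "x \<in> P \<Longrightarrow> proj (E x x)"
proof -
  assume x: "x \<in> P"
  have "E x x * E x x = t x * ((st (t x) * t x) * st (t x))" by (simp add: E_def mult.assoc)
  also have "\<dots> \<doteq> t x * (t (s x) * st (t x))" by (intro eqv_mult_left eqv_mult_right t_isometry x)
  also have "\<dots> \<doteq> t x * st (t x)" by (intro eqv_mult_left st_t_src x)
  finally show ?thesis by (simp add: proj_def E_def st_mult st_st)
qed

lemma q_t: "x \<in> P \<Longrightarrow> q (t x) \<le> 1"
proof -
  assume x: "x \<in> P"
  have "proj (t (s x))" using vertex_idem vertex_st src_vertex[OF x] by (simp add: proj_def)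
  hence "q (t (s x)) \<le> 1" by (rule q_proj)
  hence "(q (t x))\<^sup>2 \<le> 1" using q_cong[OF t_isometry[OF x]] by (simp add: q_cstar)
  thus ?thesis using q_nonneg by (simp add: power_le_one_iff abs_square_le_1)
qed

lemma q_E: "x \<in> P \<Longrightarrow> y \<in> P \<Longrightarrow> q (E x y) \<le> 1"
  using q_mult[of "t x" "st (t y)"] mult_mono[OF q_t[of x] q_t[of y]] q_nonneg by (simp add: E_def q_st)

lemma finite_with_range: "finite (with_range \<Lambda> v (paths_le \<Lambda> n))"
  using finite_paths_le[of n] by (auto simp: with_range_def)

text \<open>For a common range \<open>v\<close>, the projections \<open>E z z\<close> with
  \<open>z\<close> in \<open>v\<Lambda>\<^sup>\<le>\<^sup>n\<close> sum to \<open>t v\<close>, which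
  forces them to be orthogonal. Inserting \<open>st (t x) * t x\<close> and
  \<open>st (t y) * t y\<close> brings out the product \<open>E x x * E y y\<close>.\<close>

lemma paths_le_orth:
  assumes x: "x \<in> paths_le \<Lambda> n" and y: "y \<in> paths_le \<Lambda> n" and ne: "x \<noteq> y"
  shows "st (t x) * t y \<doteq> 0"
proof (cases "r x = r y")
  case True
  have P: "x \<in> P" "y \<in> P" using x y by (auto simp: paths_le_iff)
  let ?I = "with_range \<Lambda> (r y) (paths_le \<Lambda> n)"
  have "(\<Sum>z\<in>?I. E z z) * E y y \<doteq> t (r y) * E y y"
    unfolding E_def by (rule eqv_mult_right[OF eqv_sym[OF t_ck[OF rng_vertex[OF P(2)]]]])
  also have "\<dots> = (t (r y) * t y) * st (t y)" by (simp add: E_def mult.assoc)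
  also have "\<dots> \<doteq> E y y" unfolding E_def by (intro eqv_mult_right t_rng P)
  finally have "(\<Sum>z\<in>?I. E z z) * E y y \<doteq> E y y" .
  hence orth: "E x x * E y y \<doteq> 0"
    using x y ne True
    by (intro orthogonal_projections[OF finite_with_range, of x "r y" n y])
       (auto simp: with_range_def paths_le_iff intro: proj_E)
  have "st (t x) * t y \<doteq> (t (s x) * st (t x)) * (t y * t (s y))"
    using P t_src st_t_src by (intro eqv_mult) (auto intro: eqv_sym)
  also have "\<dots> \<doteq> ((st (t x) * t x) * st (t x)) * (t y * (st (t y) * t y))"
    by (intro eqv_mult eqv_mult_left eqv_mult_right eqv_sym[OF t_isometry] P)
  also have "\<dots> = st (t x) * (E x x * (E y y * t y))" by (simp add: E_def mult.assoc)
  also have "\<dots> \<doteq> 0" by (rule mult_zero_eqv[OF orth])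
  finally show ?thesis .
next
  case False
  thus ?thesis using x y by (intro st_t_mult_mismatch) (auto simp: paths_le_iff)
qed

text \<open>For a terminal range, \<open>x\<close> is the only path with this range in
  \<open>paths_le \<Lambda> (d x)\<close>, so the sum in the last relation has a single
  term.\<close>

lemma terminal_unitary:
  assumes "x \<in> P" "r x \<in> terminal"
  shows "E x x \<doteq> t (r x)"
proof -
  have "with_range \<Lambda> (r x) (paths_le \<Lambda> (d x)) = {x}"
  proof (intro equalityI subsetI)
    fix y assume "y \<in> with_range \<Lambda> (r x) (paths_le \<Lambda> (d x))"
    hence y: "y \<in> P" "r y = r x" "d y \<le> d x" "full (d x) y"
      by (auto simp: with_range_def paths_le_iff)
    have "d y $ i = d x $ i" for i
    proof (cases "d x $ i \<le> d y $ i")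
      case True
      thus ?thesis using y(3) by (auto simp: less_eq_vec_def intro: antisym)
    next
      case False
      hence "\<not> live (s y) i" using y(4) by (auto simp: full_def)
      hence "d x $ i = 0" using terminal_src(2)[OF assms(2) y(1,2)] live_rng_if_deg[OF assms(1), of i] by blast
      thus ?thesis using False by simp
    qed
    hence "y = x" using terminal_unique[OF assms(2) y(1) assms(1) y(2)] by (simp add: vec_eq_iff)
    thus "y \<in> {x}" by simp
  next
    fix y assume "y \<in> {x}"
    thus "y \<in> with_range \<Lambda> (r x) (paths_le \<Lambda> (d x))"
      using assms by (auto simp: with_range_def paths_le_iff full_def)
  qed
  thus ?thesis using t_ck[OF rng_vertex[OF assms(1)], of "d x"] by (simp add: E_def eqv_sym)
qed

lemma E_extend:
  assumes "x \<in> P" "y \<in> P" "z \<in> P" "s x = r z" "s y = r z" "r z \<in> terminal"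
  shows "E (x \<cdot> z) (y \<cdot> z) \<doteq> E x y"
proof -
  have "E (x \<cdot> z) (y \<cdot> z) \<doteq> (t x * t z) * st (t y * t z)"
    unfolding E_def using assms by (intro eqv_mult eqv_st eqv_sym[OF t_cmp])
  also have "\<dots> = t x * (E z z * st (t y))" by (simp add: E_def st_mult mult.assoc)
  also have "\<dots> \<doteq> t x * (t (s y) * st (t y))"
    using terminal_unitary[OF assms(3,6)] assms(5) by (intro eqv_mult_left eqv_mult_right) simp
  also have "\<dots> \<doteq> E x y" unfolding E_def by (intro eqv_mult_left st_t_src assms)
  finally show ?thesis .
qed

lemma t_E: "l \<in> P \<Longrightarrow> x \<in> P \<Longrightarrow> s l = r x \<Longrightarrow> t l * E x y \<doteq> E (l \<cdot> x) y"
  unfolding E_def mult.assoc[symmetric] by (intro eqv_mult_right t_cmp)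

lemma t_E_mismatch: "l \<in> P \<Longrightarrow> x \<in> P \<Longrightarrow> s l \<noteq> r x \<Longrightarrow> t l * E x y \<doteq> 0"
  using eqv_mult_right[OF t_mult_mismatch[of l x], of "st (t y)"] by (simp add: E_def mult.assoc)

lemma st_t_E:
  assumes "l \<in> P" "x \<in> P" "s l = r x"
  shows "st (t l) * E (l \<cdot> x) y \<doteq> E x y"
proof -
  have "st (t l) * E (l \<cdot> x) y \<doteq> st (t l) * ((t l * t x) * st (t y))"
    unfolding E_def by (intro eqv_mult_left eqv_mult_right eqv_sym[OF t_cmp] assms)
  also have "\<dots> = ((st (t l) * t l) * t x) * st (t y)" by (simp add: mult.assoc)
  also have "\<dots> \<doteq> (t (s l) * t x) * st (t y)" by (intro eqv_mult_right t_isometry assms)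
  also have "\<dots> \<doteq> E x y" unfolding E_def using t_rng[OF assms(2)] assms by (intro eqv_mult_right) simp
  finally show ?thesis .
qed

lemma st_t_E_orth:
  assumes "l \<in> paths_le \<Lambda> n" "m \<in> paths_le \<Lambda> n" "l \<noteq> m" "x \<in> P" "s m = r x"
  shows "st (t l) * E (m \<cdot> x) y \<doteq> 0"
proof -
  have m: "m \<in> P" using assms by (simp add: paths_le_iff)
  have "st (t l) * E (m \<cdot> x) y \<doteq> st (t l) * ((t m * t x) * st (t y))"
    unfolding E_def by (intro eqv_mult_left eqv_mult_right eqv_sym[OF t_cmp] assms m)
  also have "\<dots> = (st (t l) * t m) * (t x * st (t y))" by (simp add: mult.assoc)
  also have "\<dots> \<doteq> 0 * (t x * st (t y))" by (intro eqv_mult_right paths_le_orth[OF assms(1-3)])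
  finally show ?thesis by simp
qed

section \<open>Normal forms of words modulo the seminorm\<close>

definition letter :: "'a \<times> bool \<Rightarrow> 'b" where
  "letter l = (if snd l then st (t (fst l)) else t (fst l))"

text \<open>Left multiplication by a word. As the ring has no unit, the empty word can act but
  cannot be a product.\<close>

fun act :: "('a \<times> bool) list \<Rightarrow> 'b \<Rightarrow> 'b" where
  "act [] x = x"
| "act (l # w) x = letter l * act w x"

text \<open>The element of degree \<open>n\<close> in row \<open>b\<close> and column
  \<open>a\<close>. The continuations \<open>z\<close> and \<open>z'\<close> serve to reach the
  degree \<open>n\<close> and a common source; different choices give the same element by
  \<open>normal_form_unique\<close>.\<close>

definition normal_form :: "int ^ 'k \<Rightarrow> 'a \<Rightarrow> 'a \<Rightarrow> 'b \<Rightarrow> bool" where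
  "normal_form n a b x \<longleftrightarrow> (\<exists>z\<in>P. \<exists>z'\<in>P. s b = r z \<and> s a = r z' \<and> s z = s z' \<and>
     n = deg_diff (b \<cdot> z) (a \<cdot> z') \<and> x \<doteq> E (b \<cdot> z) (a \<cdot> z'))"

lemma normal_form_le:
  assumes "normal_form n a b x" "a \<in> X" "b \<in> X"
  shows "q x \<le> 1"
proof -
  obtain z z' where "z \<in> P" "z' \<in> P" "s b = r z" "s a = r z'" "x \<doteq> E (b \<cdot> z) (a \<cdot> z')"
    using assms(1) by (auto simp: normal_form_def)
  thus ?thesis using q_E[of "b \<cdot> z" "a \<cdot> z'"] q_cong assms X_paths by (metis cmp_closed)
qed

text \<open>Join \<open>z\<close> and \<open>w\<close> behind \<open>b\<close>. Since
  \<open>n\<close> is the same, \<open>z'\<close> and \<open>w'\<close> with the same continuations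
  have equal degree and hence agree, by uniqueness at the terminal vertex \<open>s a\<close>; by
  \<open>E_extend\<close> the continuations do not change the elements.\<close>

lemma normal_form_unique:
  assumes nf: "normal_form n a b x" "normal_form n a b y" and a: "a \<in> X" and b: "b \<in> X"
  shows "x \<doteq> y"
proof -
  note P = X_paths[OF a] X_paths[OF b]
  obtain z z' where z: "z \<in> P" "z' \<in> P" "s b = r z" "s a = r z'" "s z = s z'"
      "n = deg_diff (b \<cdot> z) (a \<cdot> z')" "x \<doteq> E (b \<cdot> z) (a \<cdot> z')"
    using nf(1) by (auto simp: normal_form_def)
  obtain w w' where w: "w \<in> P" "w' \<in> P" "s b = r w" "s a = r w'" "s w = s w'"
      "n = deg_diff (b \<cdot> w) (a \<cdot> w')" "y \<doteq> E (b \<cdot> w) (a \<cdot> w')"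
    using nf(2) by (auto simp: normal_form_def)
  obtain u v where uv: "u \<in> P" "v \<in> P" "s z = r u" "s w = r v" "z \<cdot> u = w \<cdot> v"
    using join_after[OF b z(1,3) w(1,3)] .
  have z'u: "s z' = r u" and w'v: "s w' = r v" using z w uv by auto
  have "deg_diff b a + deg_diff z z' = deg_diff b a + deg_diff w w'"
    using z(6) w(6) deg_diff_comp[OF P(2) z(1,3) P(1) z(2,4)] deg_diff_comp[OF P(2) w(1,3) P(1) w(2,4)]
    by simp
  hence dd: "deg_diff z z' = deg_diff w w'" by simp
  have "d z + d u = d w + d v" using deg_cmp[OF z(1) uv(1,3)] deg_cmp[OF w(1) uv(2,4)] uv(5) by simp
  hence "d z $ i + d u $ i = d w $ i + d v $ i" for i by (metis vector_add_component)
  moreover have "int (d z $ i) - int (d z' $ i) = int (d w $ i) - int (d w' $ i)" for i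
    using dd by (simp add: deg_diff_def vec_eq_iff)
  ultimately have "d z' $ i + d u $ i = d w' $ i + d v $ i" for i by (smt (verit) of_nat_add of_nat_eq_iff)
  hence "d (z' \<cdot> u) = d (w' \<cdot> v)"
    by (simp add: deg_cmp[OF z(2) uv(1) z'u] deg_cmp[OF w(2) uv(2) w'v] vec_eq_iff)
  hence z'w': "z' \<cdot> u = w' \<cdot> v"
    using terminal_unique[OF X_terminal[OF a], of "z' \<cdot> u" "w' \<cdot> v"] z w uv z'u w'v
    by (simp add: cmp_closed rng_cmp)
  have ext: "E (b \<cdot> (z \<cdot> u)) (a \<cdot> (z' \<cdot> u)) \<doteq> E (b \<cdot> z) (a \<cdot> z')"
    if "z \<in> P" "z' \<in> P" "s b = r z" "s a = r z'" "s z = s z'" "u \<in> P" "s z = r u" for z z' u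
  proof -
    have "r u \<in> terminal" using terminal_src(1)[OF X_terminal[OF b] that(1)] that by simp
    moreover have "s (b \<cdot> z) = r u" "s (a \<cdot> z') = r u" using that P by (auto simp: src_cmp)
    ultimately have "E ((b \<cdot> z) \<cdot> u) ((a \<cdot> z') \<cdot> u) \<doteq> E (b \<cdot> z) (a \<cdot> z')"
      using that P by (intro E_extend) (auto simp: cmp_closed)
    moreover have "(b \<cdot> z) \<cdot> u = b \<cdot> (z \<cdot> u)" "(a \<cdot> z') \<cdot> u = a \<cdot> (z' \<cdot> u)"
      using that P by (auto intro: cmp_assoc)
    ultimately show ?thesis by simp
  qed
  have "x \<doteq> E (b \<cdot> (z \<cdot> u)) (a \<cdot> (z' \<cdot> u))"
    using eqv_trans[OF z(7) eqv_sym[OF ext[OF z(1-5) uv(1,3)]]] .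
  also have "\<dots> \<doteq> E (b \<cdot> w) (a \<cdot> w')" using ext[OF w(1-5) uv(2,4)] uv(5) z'w' by simp
  also have "\<dots> \<doteq> y" by (rule eqv_sym[OF w(7)])
  finally show ?thesis .
qed

lemma forward_normal_form:
  assumes nf: "normal_form n a b x" and X: "a \<in> X" "b \<in> X" and l: "l \<in> P"
  shows "(\<exists>c. fwd l b c \<and> normal_form (letter_deg (l, False) + n) a c (t l * x)) \<or>
    ((\<forall>c. \<not> fwd l b c) \<and> t l * x \<doteq> 0)"
proof -
  note P = X_paths[OF X(1)] X_paths[OF X(2)]
  obtain z z' where z: "z \<in> P" "z' \<in> P" "s b = r z" "s a = r z'" "s z = s z'"
      "n = deg_diff (b \<cdot> z) (a \<cdot> z')" "x \<doteq> E (b \<cdot> z) (a \<cdot> z')"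
    using nf by (auto simp: normal_form_def)
  have bz: "b \<cdot> z \<in> P" "r (b \<cdot> z) = r b" using P z by (auto simp: cmp_closed rng_cmp)
  show ?thesis
  proof (cases "s l = r b")
    case True
    obtain c where c: "fwd l b c" using fwd_exists[OF l X(2) True] .
    then obtain g where g: "c \<in> X" "g \<in> P" "s c = r g" "c \<cdot> g = l \<cdot> b" by (auto simp: fwd_def)
    have lbz: "s l = r (b \<cdot> z)" using True bz by simp
    have gz: "s g = r z"
      using src_cmp[OF X_paths[OF g(1)] g(2,3)] src_cmp[OF l P(2) True] g(4) z(3) by simp
    have eq: "l \<cdot> (b \<cdot> z) = c \<cdot> (g \<cdot> z)"
      using cmp_assoc[OF l P(2) z(1) True z(3)] cmp_assoc[OF X_paths[OF g(1)] g(2) z(1) g(3) gz] g(4) by simp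
    have "t l * x \<doteq> t l * E (b \<cdot> z) (a \<cdot> z')" by (rule eqv_mult_left[OF z(7)])
    also have "\<dots> \<doteq> E (c \<cdot> (g \<cdot> z)) (a \<cdot> z')" using t_E[OF l bz(1) lbz] eq by simp
    finally have 1: "t l * x \<doteq> E (c \<cdot> (g \<cdot> z)) (a \<cdot> z')" .
    have "letter_deg (l, False) + n = deg_diff (l \<cdot> (b \<cdot> z)) (a \<cdot> z')"
      by (simp add: z(6) deg_diff_def vec_eq_iff deg_cmp[OF l bz(1) lbz])
    hence "normal_form (letter_deg (l, False) + n) a c (t l * x)"
      unfolding normal_form_def eq using 1 z g gz
      by (intro bexI[of _ "g \<cdot> z"] bexI[of _ z']) (auto simp: cmp_closed rng_cmp src_cmp)
    thus ?thesis using c by blast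
  next
    case False
    have "t l * x \<doteq> t l * E (b \<cdot> z) (a \<cdot> z')" by (rule eqv_mult_left[OF z(7)])
    also have "\<dots> \<doteq> 0" using t_E_mismatch[OF l bz(1)] bz False by simp
    finally show ?thesis using False by (auto simp: fwd_def)
  qed
qed

text \<open>An adjoint cancels only against a path that is long enough. So
  \<open>b \<cdot> z\<close> is prolonged until a prefix \<open>m\<close> in
  \<open>paths_le \<Lambda> (d l)\<close> splits off: either \<open>m = l\<close>, and
  \<open>l\<close> cancels, or the ranges of \<open>m\<close> and \<open>l\<close> are
  orthogonal.\<close>

lemma backward_normal_form:
  assumes nf: "normal_form n a b x" and X: "a \<in> X" "b \<in> X" and l: "l \<in> P"
  shows "(\<exists>c. fwd l c b \<and> normal_form (letter_deg (l, True) + n) a c (st (t l) * x)) \<or>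
    ((\<forall>c. \<not> fwd l c b) \<and> st (t l) * x \<doteq> 0)"
proof -
  note P = X_paths[OF X(1)] X_paths[OF X(2)]
  obtain z z' where z: "z \<in> P" "z' \<in> P" "s b = r z" "s a = r z'" "s z = s z'"
      "n = deg_diff (b \<cdot> z) (a \<cdot> z')" "x \<doteq> E (b \<cdot> z) (a \<cdot> z')"
    using nf by (auto simp: normal_form_def)
  have bz: "b \<cdot> z \<in> P" "s (b \<cdot> z) = s z" "a \<cdot> z' \<in> P" "s (a \<cdot> z') = s z"
    using P z by (auto simp: cmp_closed src_cmp)
  have tm: "s z \<in> terminal" using terminal_src(1)[OF X_terminal[OF X(2)] z(1)] z(3) by simp
  obtain u where u: "u \<in> P" "r u = s z" "full (d l + NN) ((b \<cdot> z) \<cdot> u)"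
    using full_extend[OF bz(1)] bz(2) tm by metis
  have zu: "s z = r u" "s z' = r u" "s (b \<cdot> z) = r u" "s (a \<cdot> z') = r u" using u z bz by auto
  have bzu: "(b \<cdot> z) \<cdot> u \<in> P" by (rule cmp_closed[OF bz(1) u(1) zu(3)])
  have assocs: "(b \<cdot> z) \<cdot> u = b \<cdot> (z \<cdot> u)" "(a \<cdot> z') \<cdot> u = a \<cdot> (z' \<cdot> u)"
    using cmp_assoc[OF P(2) z(1) u(1) z(3) zu(1)] cmp_assoc[OF P(1) z(2) u(1) z(4) zu(2)] by auto
  have "full (d l) ((b \<cdot> z) \<cdot> u)" unfolding full_def
  proof
    fix i
    have "(d l + NN) $ i \<le> d ((b \<cdot> z) \<cdot> u) $ i \<or> \<not> live (s ((b \<cdot> z) \<cdot> u)) i"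
      using u(3) unfolding full_def by (rule spec)
    thus "d l $ i \<le> d ((b \<cdot> z) \<cdot> u) $ i \<or> \<not> live (s ((b \<cdot> z) \<cdot> u)) i" by auto
  qed
  then obtain m y where m: "m \<in> paths_le \<Lambda> (d l)" "y \<in> P" "s m = r y" "(b \<cdot> z) \<cdot> u = m \<cdot> y"
    using full_truncate[OF bzu] by metis
  obtain c w where c: "c \<in> X" "w \<in> P" "s c = r w" "y = c \<cdot> w" using full_split[OF bzu u(3) m] .
  note cP = X_paths[OF c(1)]
  have mP: "m \<in> P" using m by (simp add: paths_le_iff)
  have mc: "s m = r c" using m(3) c(4) rng_cmp[OF cP c(2,3)] by simp
  have zuP: "z \<cdot> u \<in> P" "s b = r (z \<cdot> u)" using cmp_closed[OF z(1) u(1) zu(1)] rng_cmp[OF z(1) u(1) zu(1)] z(3) by auto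
  have "(m \<cdot> c) \<cdot> w = b \<cdot> (z \<cdot> u)"
    using cmp_assoc[OF mP cP c(2) mc c(3)] m(4) c(4) assocs(1) by simp
  hence fwd: "fwd m c b" using fwdI[OF mP c(1) mc X(2) c(2,3) zuP] by blast
  have "E ((b \<cdot> z) \<cdot> u) ((a \<cdot> z') \<cdot> u) \<doteq> E (b \<cdot> z) (a \<cdot> z')"
    using tm u(2) by (intro E_extend[OF bz(1,3) u(1) zu(3,4)]) simp
  hence "x \<doteq> E (m \<cdot> y) (a \<cdot> (z' \<cdot> u))"
    using eqv_trans[OF z(7) eqv_sym] m(4) assocs(2) by metis
  hence x: "st (t l) * x \<doteq> st (t l) * E (m \<cdot> y) (a \<cdot> (z' \<cdot> u))" by (rule eqv_mult_left)
  \<comment> \<open>A path lies in \<open>paths_le\<close> of its own degree, so \<open>l\<close>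
    and \<open>m\<close> belong to the same orthogonal family.\<close>
  have lle: "l \<in> paths_le \<Lambda> (d l)" using l by (simp add: paths_le_iff full_def)
  show ?thesis
  proof (cases "m = l")
    case True
    have ly: "s l = r y" using m(3) True by simp
    have "st (t l) * x \<doteq> E (c \<cdot> w) (a \<cdot> (z' \<cdot> u))"
      using eqv_trans[OF x] st_t_E[OF l m(2) ly] True c(4) by metis
    moreover have "letter_deg (l, True) + n = deg_diff (c \<cdot> w) (a \<cdot> (z' \<cdot> u))"
    proof -
      have "d (b \<cdot> z) + d u = d l + d y"
        using deg_cmp[OF bz(1) u(1) zu(3)] deg_cmp[OF l m(2) ly] m(4) True by simp
      hence "d (b \<cdot> z) $ i + d u $ i = d l $ i + d y $ i" for i by (metis vector_add_component)
      hence "int (d (b \<cdot> z) $ i) + int (d u $ i) = int (d l $ i) + int (d y $ i)" for i by (metis of_nat_add)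
      hence e: "int (d (b \<cdot> z) $ i) = int (d l $ i) + int (d y $ i) - int (d u $ i)" for i
        by (metis add_diff_cancel_right')
      show ?thesis
        by (simp add: z(6) deg_diff_def vec_eq_iff c(4)[symmetric] assocs(2)[symmetric] deg_cmp[OF bz(3) u(1) zu(4)] e)
    qed
    moreover have "s w = s (z' \<cdot> u)"
      using src_cmp[OF cP c(2,3)] src_cmp[OF mP m(2,3)] src_cmp[OF bz(1) u(1) zu(3)]
        src_cmp[OF z(2) u(1) zu(2)] m(4) c(4) by simp
    moreover have "z' \<cdot> u \<in> P" "s a = r (z' \<cdot> u)"
      using cmp_closed[OF z(2) u(1) zu(2)] rng_cmp[OF z(2) u(1) zu(2)] z(4) by auto
    ultimately have "normal_form (letter_deg (l, True) + n) a c (st (t l) * x)"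
      unfolding normal_form_def using c by blast
    thus ?thesis using fwd True by blast
  next
    case False
    hence "st (t l) * x \<doteq> 0" using eqv_trans[OF x st_t_E_orth[OF lle m(1) _ m(2,3)]] by metis
    moreover have "\<not> fwd l c' b" for c' using fwd_paths_le_unique[OF fwd _ m(1) lle] False by blast
    ultimately show ?thesis by blast
  qed
qed

text \<open>Induction over the letters, starting from \<open>E a a\<close>, which is a normal form
  of degree 0 from \<open>a\<close> to itself.\<close>

lemma act_normal_form:
  assumes "fst ` set w \<subseteq> P" "a \<in> X"
  shows "(\<exists>b. run w a b \<and> normal_form (word_deg w) a b (act w (E a a))) \<or>
    ((\<forall>b. \<not> run w a b) \<and> act w (E a a) \<doteq> 0)"
  using assms(1)
proof (induction w)
  case Nil
  note a = X_paths[OF assms(2)]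
  have "normal_form 0 a a (E a a)"
    unfolding normal_form_def using a
    by (intro bexI[of _ "s a"]) (auto simp: path_simps)
  thus ?case using assms(2) by auto
next
  case (Cons l w)
  obtain x c where lx: "l = (x, c)" by (cases l)
  have x: "x \<in> P" using Cons.prems lx by auto
  from Cons.IH Cons.prems consider
      (nf) b where "run w a b" "normal_form (word_deg w) a b (act w (E a a))"
    | (zero) "\<forall>b. \<not> run w a b" "act w (E a a) \<doteq> 0" by auto
  thus ?case
  proof cases
    case nf
    have b: "b \<in> X" using run_X[OF nf(1)] by simp
    have runs: "run (l # w) a b' \<longleftrightarrow> step l b b'" for b'
      using nf(1) run_unique by auto
    show ?thesis unfolding runs using forward_normal_form[OF nf(2) assms(2) b x]
        backward_normal_form[OF nf(2) assms(2) b x] by (cases c) (simp_all add: lx letter_def)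
  next
    case zero
    have "letter l * act w (E a a) \<doteq> letter l * 0" by (rule eqv_mult_left[OF zero(2)])
    thus ?thesis using zero(1) by simp
  qed
qed

text \<open>The value at the empty word is a default; products are formed of nonempty words
  only.\<close>

fun word_prod :: "('a \<times> bool) list \<Rightarrow> 'b" where
  "word_prod [] = 0"
| "word_prod [l] = letter l"
| "word_prod (l # l' # w) = letter l * word_prod (l' # w)"

lemma word_prod_mult: "w \<noteq> [] \<Longrightarrow> word_prod w * x = act w x"
  by (induction w rule: word_prod.induct) (auto simp: mult.assoc)

text \<open>Both sides act as a unit modulo \<open>q\<close>. The relations for
  \<open>n = NN\<close>, added over all vertices, trade the vertex projections for the finer ones
  indexed by \<open>X\<close>.\<close>

lemma sum_E: "(\<Sum>a\<in>X. E a a) \<doteq> (\<Sum>v\<in>vertices \<Lambda>. t v)"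
proof -
  have "(\<Sum>v\<in>vertices \<Lambda>. t v) \<doteq> (\<Sum>v\<in>vertices \<Lambda>. \<Sum>a\<in>{a \<in> X. r a = v}. E a a)"
    using t_ck[of _ NN] unfolding E_def X_def with_range_def by (intro eqv_sum)
  also have "\<dots> = (\<Sum>a\<in>X. E a a)"
    using X_paths rng_vertex by (intro sum.group finite_X finite_vertices) auto
  finally show ?thesis by (rule eqv_sym)
qed

lemma letter_unit:
  assumes "fst l \<in> P"
  shows "letter l * (\<Sum>a\<in>X. E a a) \<doteq> letter l"
proof -
  define v where "v = (if snd l then r (fst l) else s (fst l))"
  have v: "v \<in> vertices \<Lambda>" using assms rng_vertex src_vertex by (auto simp: v_def)
  have lv: "letter l * t v \<doteq> letter l" using t_src st_t_rng assms by (auto simp: letter_def v_def)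
  have 0: "letter l * t w \<doteq> 0" if w: "w \<in> vertices \<Lambda>" "w \<noteq> v" for w
  proof -
    have "letter l * t w \<doteq> (letter l * t v) * t w" by (rule eqv_mult_right[OF eqv_sym[OF lv]])
    also have "\<dots> = letter l * (t v * t w)" by (simp add: mult.assoc)
    also have "\<dots> \<doteq> letter l * 0" using vertex_orth v w by (intro eqv_mult_left) auto
    finally show ?thesis by simp
  qed
  have "letter l * (\<Sum>a\<in>X. E a a) \<doteq> letter l * (\<Sum>v\<in>vertices \<Lambda>. t v)" by (rule eqv_mult_left[OF sum_E])
  also have "\<dots> = (\<Sum>w\<in>vertices \<Lambda>. letter l * t w)" by (rule sum_distrib_left)
  also have "\<dots> \<doteq> (\<Sum>w\<in>vertices \<Lambda>. if w = v then letter l else 0)"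
    using lv 0 by (intro eqv_sum) auto
  also have "\<dots> = letter l" using v finite_vertices by simp
  finally show ?thesis .
qed

lemma word_prod_unit:
  assumes "w \<noteq> []" "fst ` set w \<subseteq> P"
  shows "word_prod w \<doteq> (\<Sum>a\<in>X. act w (E a a))"
proof -
  have "word_prod w * (\<Sum>a\<in>X. E a a) \<doteq> word_prod w"
    using assms
  proof (induction w rule: word_prod.induct)
    case (2 l)
    thus ?case using letter_unit by simp
  next
    case (3 l l' w)
    thus ?case by (simp add: mult.assoc eqv_mult_left)
  qed simp
  moreover have "word_prod w * (\<Sum>a\<in>X. E a a) = (\<Sum>a\<in>X. act w (E a a))"
    by (simp add: sum_distrib_left word_prod_mult[OF assms(1)])
  ultimately show ?thesis by (simp add: eqv_sym)
qed

text \<open>Multiplication by the unit from \<open>sum_E\<close> decomposes each word into normal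
  forms. Words of equal degree that carry \<open>a\<close> to \<open>b\<close> yield the same one,
  so their coefficients are added before absolute values are taken; these sums are the later Fourier
  coefficients.\<close>

lemma q_words_le:
  assumes W: "finite W" "\<And>w. w \<in> W \<Longrightarrow> w \<noteq> [] \<and> fst ` set w \<subseteq> P"
  shows "q (\<Sum>w\<in>W. sc (c w) (word_prod w)) \<le>
    (\<Sum>a\<in>X. \<Sum>b\<in>X. \<Sum>n\<in>word_deg ` W. cmod (\<Sum>w\<in>{w \<in> W. word_deg w = n \<and> run w a b}. c w))"
proof -
  define nf where "nf n a b = (SOME x. normal_form n a b x)" for n a b
  have nf: "normal_form n a b (nf n a b)" if "normal_form n a b x" for n a b x
    unfolding nf_def using that by (rule someI)
  have act: "act w (E a a) \<doteq> (\<Sum>b\<in>X. if run w a b then nf (word_deg w) a b else 0)"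
    if w: "w \<in> W" and a: "a \<in> X" for w a
    using act_normal_form[OF conjunct2[OF W(2)[OF w]] a]
  proof (elim disjE exE conjE)
    fix b assume b: "run w a b" "normal_form (word_deg w) a b (act w (E a a))"
    have "(\<Sum>b'\<in>X. if run w a b' then nf (word_deg w) a b' else 0) =
        (\<Sum>b'\<in>X. if b' = b then nf (word_deg w) a b else 0)"
    proof (intro sum.cong refl)
      fix b'
      have "run w a b' \<longleftrightarrow> b' = b" using run_unique[OF b(1)] b(1) by blast
      thus "(if run w a b' then nf (word_deg w) a b' else 0) = (if b' = b then nf (word_deg w) a b else 0)" by simp
    qed
    also have "\<dots> = nf (word_deg w) a b" using run_X[OF b(1)] finite_X by simp
    finally show ?thesis
      using normal_form_unique[OF b(2) nf[OF b(2)] a conjunct2[OF run_X[OF b(1)]]] by metis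
  qed simp
  have "(\<Sum>w\<in>W. sc (c w) (word_prod w)) \<doteq>
      (\<Sum>w\<in>W. sc (c w) (\<Sum>a\<in>X. \<Sum>b\<in>X. if run w a b then nf (word_deg w) a b else 0))"
  proof (intro eqv_sum eqv_sc)
    fix w assume w: "w \<in> W"
    have "word_prod w \<doteq> (\<Sum>a\<in>X. act w (E a a))" using word_prod_unit W(2)[OF w] by blast
    also have "\<dots> \<doteq> (\<Sum>a\<in>X. \<Sum>b\<in>X. if run w a b then nf (word_deg w) a b else 0)"
      by (intro eqv_sum act[OF w])
    finally show "word_prod w \<doteq> (\<Sum>a\<in>X. \<Sum>b\<in>X. if run w a b then nf (word_deg w) a b else 0)" .
  qed
  also have "\<dots> = (\<Sum>a\<in>X. \<Sum>b\<in>X. \<Sum>w\<in>W. if run w a b then sc (c w) (nf (word_deg w) a b) else 0)"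
    unfolding sc_sum
    by (subst sum.swap, rule sum.cong[OF refl], subst sum.swap) (auto intro!: sum.cong)
  also have "\<dots> = (\<Sum>a\<in>X. \<Sum>b\<in>X. \<Sum>n\<in>word_deg ` W.
      sc (\<Sum>w\<in>{w \<in> W. word_deg w = n \<and> run w a b}. c w) (nf n a b))"
  proof (intro sum.cong refl)
    fix a b
    have "(\<Sum>w\<in>W. if run w a b then sc (c w) (nf (word_deg w) a b) else 0) =
        (\<Sum>n\<in>word_deg ` W. \<Sum>w\<in>{w \<in> W. word_deg w = n}. if run w a b then sc (c w) (nf (word_deg w) a b) else 0)"
      using W(1) by (intro sum.group[symmetric]) auto
    also have "\<dots> = (\<Sum>n\<in>word_deg ` W. sc (\<Sum>w\<in>{w \<in> W. word_deg w = n \<and> run w a b}. c w) (nf n a b))"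
      unfolding sc_sum_left using W(1) by (intro sum.cong refl sum.mono_neutral_cong_right) auto
    finally show "(\<Sum>w\<in>W. if run w a b then sc (c w) (nf (word_deg w) a b) else 0) = \<dots>" .
  qed
  finally have "q (\<Sum>w\<in>W. sc (c w) (word_prod w)) = q (\<Sum>a\<in>X. \<Sum>b\<in>X. \<Sum>n\<in>word_deg ` W.
      sc (\<Sum>w\<in>{w \<in> W. word_deg w = n \<and> run w a b}. c w) (nf n a b))" by (rule q_cong)
  also have "\<dots> \<le> (\<Sum>a\<in>X. \<Sum>b\<in>X. \<Sum>n\<in>word_deg ` W.
      q (sc (\<Sum>w\<in>{w \<in> W. word_deg w = n \<and> run w a b}. c w) (nf n a b)))"
    by (intro order_trans[OF q_sum] sum_mono order_refl)
  also have "\<dots> \<le> (\<Sum>a\<in>X. \<Sum>b\<in>X. \<Sum>n\<in>word_deg ` W.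
      cmod (\<Sum>w\<in>{w \<in> W. word_deg w = n \<and> run w a b}. c w))"
  proof (intro sum_mono)
    fix a b n assume ab: "a \<in> X" "b \<in> X"
    show "q (sc (\<Sum>w\<in>{w \<in> W. word_deg w = n \<and> run w a b}. c w) (nf n a b)) \<le>
        cmod (\<Sum>w\<in>{w \<in> W. word_deg w = n \<and> run w a b}. c w)"
    proof (cases "{w \<in> W. word_deg w = n \<and> run w a b} = {}")
      case False
      then obtain w where w: "w \<in> W" "word_deg w = n" "run w a b" by blast
      hence "normal_form n a b (act w (E a a))"
        using act_normal_form[OF conjunct2[OF W(2)[OF w(1)]] ab(1)] run_unique by blast
      hence "q (nf n a b) \<le> 1" using normal_form_le[OF nf ab] by blast
      thus ?thesis unfolding q_sc by (intro mult_left_le) auto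
    qed (simp only: sum.empty, simp)
  qed
  finally show ?thesis .
qed

end

section \<open>The free *-algebra\<close>

type_synonym 'a word = "('a \<times> bool) list"

definition fmul :: "'a star_poly \<Rightarrow> 'a star_poly \<Rightarrow> 'a star_poly" where
  "fmul f g = (\<lambda>w. \<Sum>i\<le>length w. f (take i w) * g (drop i w))"

definition fstar :: "'a star_poly \<Rightarrow> 'a star_poly" where
  "fstar f = (\<lambda>w. cnj (f (word_star w)))"

definition delta :: "'a word \<Rightarrow> 'a star_poly" where
  "delta u = (\<lambda>w. if w = u then 1 else 0)"

abbreviation supp :: "'a star_poly \<Rightarrow> 'a word set" where
  "supp f \<equiv> {w. f w \<noteq> 0}"

text \<open>With pairs of words in place of cut positions, associativity and compatibility with the
  star amount to reindexing sums along bijections.\<close>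

definition splits :: "'a list \<Rightarrow> ('a list \<times> 'a list) set" where
  "splits w = {(u, v). u @ v = w}"

lemma splits_eq: "splits w = (\<lambda>i. (take i w, drop i w)) ` {..length w}"
proof (intro equalityI subsetI)
  fix p assume "p \<in> splits w"
  hence "p = (take (length (fst p)) w, drop (length (fst p)) w)" "length (fst p) \<in> {..length w}"
    by (auto simp: splits_def)
  thus "p \<in> (\<lambda>i. (take i w, drop i w)) ` {..length w}" by (rule image_eqI)
qed (auto simp: splits_def)

lemma finite_splits: "finite (splits w)"
  by (simp add: splits_eq)

lemma fmul_splits: "fmul f g w = (\<Sum>(u, v)\<in>splits w. f u * g v)"
proof -
  have "inj_on (\<lambda>i. (take i w, drop i w)) {..length w}"
    by (intro inj_onI) (metis Pair_inject length_take min.absorb2 atMost_iff)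
  thus ?thesis by (simp add: fmul_def splits_eq sum.reindex)
qed

lemma fmul_assoc: "fmul (fmul f g) h = fmul f (fmul g h)"
proof
  fix w
  have "fmul (fmul f g) h w =
      (\<Sum>((p, z), (x, y))\<in>Sigma (splits w) (\<lambda>(p, z). splits p). f x * g y * h z)"
    by (simp add: fmul_splits sum_distrib_right case_prod_unfold sum.Sigma finite_splits)
  also have "\<dots> = (\<Sum>((x, p), (y, z))\<in>Sigma (splits w) (\<lambda>(x, p). splits p). f x * (g y * h z))"
    by (rule sum.reindex_bij_witness[of _ "\<lambda>((x, p), (y, z)). ((x @ y, z), (x, y))"
          "\<lambda>((p, z), (x, y)). ((x, y @ z), (y, z))"])
       (auto simp: splits_def)
  also have "\<dots> = fmul f (fmul g h) w"
    by (simp add: fmul_splits sum_distrib_left case_prod_unfold sum.Sigma finite_splits)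
  finally show "fmul (fmul f g) h w = fmul f (fmul g h) w" .
qed

lemma supp_fmul: "supp (fmul f g) \<subseteq> (\<lambda>(u, v). u @ v) ` (supp f \<times> supp g)"
proof
  fix w assume "w \<in> supp (fmul f g)"
  hence "(\<Sum>(u, v)\<in>splits w. f u * g v) \<noteq> 0" by (simp add: fmul_splits)
  then obtain u v where "(u, v) \<in> splits w" "f u * g v \<noteq> 0"
    by (metis (mono_tags, lifting) case_prod_unfold prod.collapse sum.neutral)
  thus "w \<in> (\<lambda>(u, v). u @ v) ` (supp f \<times> supp g)" by (auto simp: splits_def)
qed

lemma finite_supp_fmul: "finite (supp f) \<Longrightarrow> finite (supp g) \<Longrightarrow> finite (supp (fmul f g))"
  by (rule finite_subset[OF supp_fmul]) auto

lemma finite_supp_linear: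
  assumes "finite (supp f)" "finite (supp g)"
  shows "finite (supp (\<lambda>w. f w + g w))" "finite (supp (\<lambda>w. f w - g w))"
  using assms by (auto intro: finite_subset[of _ "supp f \<union> supp g"])

lemma word_star_star [simp]: "word_star (word_star w) = w"
  by (induction w) (auto simp: word_star_def rev_map[symmetric] case_prod_unfold comp_def)

lemma word_star_append: "word_star (u @ v) = word_star v @ word_star u"
  by (simp add: word_star_def)

lemma word_star_eq_iff: "word_star u = w \<longleftrightarrow> u = word_star w"
  by (metis word_star_star)

lemma set_word_star: "fst ` set (word_star w) = fst ` set w"
  by (induction w) (auto simp: word_star_Cons)

lemma supp_fstar: "supp (fstar f) = word_star ` supp f"
  by (auto simp: fstar_def image_iff) (metis word_star_star)

lemma fstar_fmul: "fstar (fmul f g) = fmul (fstar g) (fstar f)"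
proof
  fix w
  have "fstar (fmul f g) w = (\<Sum>(u, v)\<in>splits (word_star w). cnj (f u) * cnj (g v))"
    by (simp add: fstar_def fmul_splits case_prod_unfold)
  also have "\<dots> = (\<Sum>(u, v)\<in>splits w. cnj (g (word_star u)) * cnj (f (word_star v)))"
    by (rule sum.reindex_bij_witness[of _ "\<lambda>(u, v). (word_star v, word_star u)"
          "\<lambda>(u, v). (word_star v, word_star u)"])
       (auto simp: splits_def word_star_append word_star_eq_iff[symmetric] mult.commute)
  also have "\<dots> = fmul (fstar g) (fstar f) w" by (simp add: fmul_splits fstar_def)
  finally show "fstar (fmul f g) w = fmul (fstar g) (fstar f) w" .
qed

lemma fmul_delta: "fmul (delta u) (delta v) = delta (u @ v)"
proof
  fix w
  have "fmul (delta u) (delta v) w = (\<Sum>p\<in>splits w. if p = (u, v) then 1 else 0)"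
    unfolding fmul_splits by (intro sum.cong) (auto simp: delta_def split: if_splits)
  also have "\<dots> = (if (u, v) \<in> splits w then 1 else 0)" by (simp add: finite_splits)
  also have "\<dots> = delta (u @ v) w" by (auto simp: delta_def splits_def)
  finally show "fmul (delta u) (delta v) w = delta (u @ v) w" .
qed

lemma fstar_delta: "fstar (delta u) = delta (word_star u)"
  by (auto simp: fstar_def delta_def fun_eq_iff word_star_eq_iff)

text \<open>Finitely supported functions on nonempty words form a ring; the letters are not restricted
  here, so that seminorms become total functions on a type.\<close>

typedef 'a fsa = "{f :: 'a star_poly. finite (supp f) \<and> f [] = 0}"
  by (intro exI[of _ "\<lambda>_. 0"]) auto

setup_lifting type_definition_fsa

instantiation fsa :: (type) ring
begin

lift_definition zero_fsa :: "'a fsa" is "\<lambda>_. 0" by simp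
lift_definition plus_fsa :: "'a fsa \<Rightarrow> 'a fsa \<Rightarrow> 'a fsa" is "\<lambda>f g w. f w + g w"
  by (simp add: finite_supp_linear)
lift_definition minus_fsa :: "'a fsa \<Rightarrow> 'a fsa \<Rightarrow> 'a fsa" is "\<lambda>f g w. f w - g w"
  by (intro conjI finite_supp_linear) auto
lift_definition uminus_fsa :: "'a fsa \<Rightarrow> 'a fsa" is "\<lambda>f w. - f w" by simp
lift_definition times_fsa :: "'a fsa \<Rightarrow> 'a fsa \<Rightarrow> 'a fsa" is fmul
  by (intro conjI finite_supp_fmul) (simp_all add: fmul_def)

instance
proof
  fix a b c :: "'a fsa"
  show "a * b * c = a * (b * c)" by transfer (rule fmul_assoc)
  show "(a + b) * c = a * c + b * c"
    by transfer (simp add: fmul_def fun_eq_iff sum.distrib distrib_right)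
  show "a * (b + c) = a * b + a * c"
    by transfer (simp add: fmul_def fun_eq_iff sum.distrib distrib_left)
qed (transfer; simp add: fun_eq_iff)+

end

lift_definition fsa_scale :: "complex \<Rightarrow> 'a fsa \<Rightarrow> 'a fsa" is "\<lambda>c f w. c * f w"
  by (auto elim: rev_finite_subset)

lift_definition fsa_star :: "'a fsa \<Rightarrow> 'a fsa" is fstar
  by (simp add: supp_fstar) (simp add: fstar_def)

lift_definition fsa_gen :: "'a \<Rightarrow> 'a fsa" is "\<lambda>x. delta [(x, False)]"
  by (auto simp: delta_def)

abbreviation "free_alg \<equiv> free_star_algebra"

lemma free_sel:
  "carrier (free_alg A) = {f. finite (supp f) \<and> (\<forall>w. f w \<noteq> 0 \<longrightarrow> w \<noteq> [] \<and> fst ` set w \<subseteq> A)}"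
  "sa_zero (free_alg A) = (\<lambda>w. 0)"
  "sa_add (free_alg A) f g = (\<lambda>w. f w + g w)"
  "sa_scale (free_alg A) c f = (\<lambda>w. c * f w)"
  "sa_mult (free_alg A) f g = fmul f g"
  "sa_star (free_alg A) f = fstar f"
  by (simp_all add: free_star_algebra_def fmul_def fstar_def word_star_def)

lemma free_diff: "sa_diff (free_alg A) f g = (\<lambda>w. f w - g w)"
  by (simp add: sa_diff_def free_sel)

lemma free_gen_delta: "free_gen x = delta [(x, False)]"
  by (simp add: free_gen_def delta_def)

lemma carrier_free:
  "f \<in> carrier (free_alg A) \<longleftrightarrow> finite (supp f) \<and> (\<forall>w. f w \<noteq> 0 \<longrightarrow> w \<noteq> [] \<and> fst ` set w \<subseteq> A)"
  by (simp add: free_sel)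

lemma free_closed:
  assumes "f \<in> carrier (free_alg A)" "g \<in> carrier (free_alg A)"
  shows "(\<lambda>w. f w + g w) \<in> carrier (free_alg A)" "(\<lambda>w. f w - g w) \<in> carrier (free_alg A)"
    "(\<lambda>w. c * f w) \<in> carrier (free_alg A)" "fmul f g \<in> carrier (free_alg A)"
    "fstar f \<in> carrier (free_alg A)"
proof -
  have sub: "h \<in> carrier (free_alg A)" if h: "\<And>w. f w = 0 \<Longrightarrow> g w = 0 \<Longrightarrow> h w = 0" for h
    unfolding carrier_free
  proof (intro conjI allI impI)
    have "supp h \<subseteq> supp f \<union> supp g" using h by blast
    thus "finite (supp h)" using assms by (auto simp: carrier_free intro: finite_subset)
    fix w assume "h w \<noteq> 0"
    hence "f w \<noteq> 0 \<or> g w \<noteq> 0" using h by blast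
    thus "w \<noteq> []" "fst ` set w \<subseteq> A" using assms unfolding carrier_free by blast+
  qed
  show "(\<lambda>w. f w + g w) \<in> carrier (free_alg A)" "(\<lambda>w. f w - g w) \<in> carrier (free_alg A)"
    "(\<lambda>w. c * f w) \<in> carrier (free_alg A)"
    by (rule sub; simp)+
  show "fmul f g \<in> carrier (free_alg A)"
    unfolding carrier_free
  proof (intro conjI allI impI)
    show "finite (supp (fmul f g))" using assms by (intro finite_supp_fmul) (auto simp: carrier_free)
    fix w assume "fmul f g w \<noteq> 0"
    then obtain u v where "f u \<noteq> 0" "g v \<noteq> 0" "w = u @ v" using supp_fmul[of f g] by auto
    thus "w \<noteq> []" "fst ` set w \<subseteq> A" using assms by (auto simp: carrier_free)
  qed
  show "fstar f \<in> carrier (free_alg A)"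
    unfolding carrier_free
  proof (intro conjI allI impI)
    show "finite (supp (fstar f))" using assms by (simp add: supp_fstar carrier_free)
    fix w assume "fstar f w \<noteq> 0"
    hence "f (word_star w) \<noteq> 0" by (simp add: fstar_def)
    hence "word_star w \<noteq> []" "fst ` set (word_star w) \<subseteq> A" using assms by (auto simp: carrier_free)
    thus "w \<noteq> []" "fst ` set w \<subseteq> A" unfolding set_word_star by auto
  qed
qed

lemma free_zero_closed: "(\<lambda>w. 0) \<in> carrier (free_alg A)"
  by (simp add: carrier_free)

lemma delta_closed: "w \<noteq> [] \<Longrightarrow> fst ` set w \<subseteq> A \<Longrightarrow> delta w \<in> carrier (free_alg A)"
  by (auto simp: carrier_free delta_def)

lemma free_sum:
  assumes "finite I" "\<And>i. i \<in> I \<Longrightarrow> f i \<in> carrier (free_alg A)"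
  shows "sa_sum (free_alg A) f I = (\<lambda>w. \<Sum>i\<in>I. f i w)"
    "(\<lambda>w. \<Sum>i\<in>I. f i w) \<in> carrier (free_alg A)"
proof -
  let ?M = "\<lparr>carrier = carrier (free_alg A), mult = sa_add (free_alg A), one = sa_zero (free_alg A)\<rparr>"
  have M: "comm_monoid ?M"
    by (unfold_locales) (auto simp: free_sel(2,3) free_closed(1) free_zero_closed algebra_simps)
  have "sa_sum (free_alg A) f I = (\<lambda>w. \<Sum>i\<in>I. f i w) \<and> (\<lambda>w. \<Sum>i\<in>I. f i w) \<in> carrier (free_alg A)"
    using assms
  proof (induction I)
    case empty
    show ?case
      using comm_monoid.finprod_empty[OF M] by (simp add: sa_sum_def free_sel(2) free_zero_closed)
  next
    case (insert i I)
    have "f \<in> I \<rightarrow> carrier ?M" "f i \<in> carrier ?M" using insert by auto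
    hence "sa_sum (free_alg A) f (insert i I) = sa_add (free_alg A) (f i) (sa_sum (free_alg A) f I)"
      unfolding sa_sum_def using comm_monoid.finprod_insert[OF M insert(1,2)] by simp
    thus ?case using insert free_closed(1)[of "f i" A "\<lambda>w. \<Sum>i\<in>I. f i w"] by (simp add: free_sel(3))
  qed
  thus "sa_sum (free_alg A) f I = (\<lambda>w. \<Sum>i\<in>I. f i w)" "(\<lambda>w. \<Sum>i\<in>I. f i w) \<in> carrier (free_alg A)"
    by auto
qed

text \<open>Discarding all words with a letter outside \<open>A\<close> is a homomorphism of
  *-algebras; pulling a seminorm back along it makes the seminorm total on the type
  \<open>'a fsa\<close>.\<close>

definition restrict_letters :: "'a set \<Rightarrow> 'a star_poly \<Rightarrow> 'a star_poly" where
  "restrict_letters A f = (\<lambda>w. if fst ` set w \<subseteq> A then f w else 0)"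

lemma restrict_letters_carrier: "finite (supp f) \<Longrightarrow> f [] = 0 \<Longrightarrow> restrict_letters A f \<in> carrier (free_alg A)"
  by (auto simp: carrier_free restrict_letters_def elim: rev_finite_subset)

lemma restrict_letters_id: "f \<in> carrier (free_alg A) \<Longrightarrow> restrict_letters A f = f"
  unfolding carrier_free restrict_letters_def fun_eq_iff by metis

lemma restrict_letters_fmul: "restrict_letters A (fmul f g) = fmul (restrict_letters A f) (restrict_letters A g)"
proof
  fix w
  show "restrict_letters A (fmul f g) w = fmul (restrict_letters A f) (restrict_letters A g) w"
  proof (cases "fst ` set w \<subseteq> A")
    case True
    hence "fst ` set u \<subseteq> A \<and> fst ` set v \<subseteq> A" if "(u, v) \<in> splits w" for u v
    proof -
      have "set w = set u \<union> set v" using that by (auto simp: splits_def)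
      thus ?thesis using True by (simp add: image_Un)
    qed
    thus ?thesis using True unfolding fmul_splits restrict_letters_def by (auto intro!: sum.cong)
  next
    case False
    hence "\<not> (fst ` set u \<subseteq> A \<and> fst ` set v \<subseteq> A)" if "(u, v) \<in> splits w" for u v
    proof -
      have "set w = set u \<union> set v" using that by (auto simp: splits_def)
      thus ?thesis using False by (simp add: image_Un)
    qed
    hence "(\<Sum>(u, v)\<in>splits w. restrict_letters A f u * restrict_letters A g v) = 0"
      by (intro sum.neutral) (auto simp: restrict_letters_def)
    thus ?thesis using False by (simp add: fmul_splits restrict_letters_def)
  qed
qed

lemma restrict_letters_fstar: "restrict_letters A (fstar f) = fstar (restrict_letters A f)"
  by (simp add: restrict_letters_def fstar_def set_word_star fun_eq_iff)

definition fsa_seminorm :: "'a set \<Rightarrow> ('a star_poly \<Rightarrow> real) \<Rightarrow> 'a fsa \<Rightarrow> real" where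
  "fsa_seminorm A p x = p (restrict_letters A (Rep_fsa x))"

lemma cstar_seminormed_fsa:
  fixes p :: "'a star_poly \<Rightarrow> real"
  assumes "cstar_seminorm (free_alg A) p"
  shows "cstar_seminormed fsa_scale fsa_star (fsa_seminorm A p)"
proof
  note p = assms[unfolded cstar_seminorm_def free_sel(3-)]
  fix x y :: "'a fsa" and c c' :: complex
  let ?r = "\<lambda>x. restrict_letters A (Rep_fsa x)"
  have r: "?r x \<in> carrier (free_alg A)" for x
    using Rep_fsa[of x] by (intro restrict_letters_carrier) auto
  have radd: "?r (x + y) = (\<lambda>w. ?r x w + ?r y w)"
    by (auto simp: plus_fsa.rep_eq restrict_letters_def fun_eq_iff)
  have rsc: "?r (fsa_scale c x) = (\<lambda>w. c * ?r x w)"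
    by (auto simp: fsa_scale.rep_eq restrict_letters_def fun_eq_iff)
  have rmul: "?r (x * y) = fmul (?r x) (?r y)" for x y
    by (simp add: times_fsa.rep_eq restrict_letters_fmul)
  have rstar: "?r (fsa_star x) = fstar (?r x)"
    by (simp add: fsa_star.rep_eq restrict_letters_fstar)
  show "fsa_scale c (x + y) = fsa_scale c x + fsa_scale c y"
    and "fsa_scale (c + c') x = fsa_scale c x + fsa_scale c' x"
    and "fsa_scale c (fsa_scale c' x) = fsa_scale (c * c') x"
    and "fsa_scale 1 x = x"
    by (transfer; simp add: algebra_simps)+
  show "fsa_scale c x * y = fsa_scale c (x * y)" "x * fsa_scale c y = fsa_scale c (x * y)"
    by (transfer; simp add: fmul_def sum_distrib_left algebra_simps)+
  show "fsa_star (x + y) = fsa_star x + fsa_star y" "fsa_star (fsa_scale c x) = fsa_scale (cnj c) (fsa_star x)"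
    "fsa_star (fsa_star x) = x"
    by (transfer; simp add: fstar_def)+
  show "fsa_star (x * y) = fsa_star y * fsa_star x" by transfer (rule fstar_fmul)
  show "0 \<le> fsa_seminorm A p x" using p r by (simp add: fsa_seminorm_def)
  show "fsa_seminorm A p (x + y) \<le> fsa_seminorm A p x + fsa_seminorm A p y"
    using p r unfolding fsa_seminorm_def radd by blast
  show "fsa_seminorm A p (fsa_scale c x) = cmod c * fsa_seminorm A p x"
    using p r unfolding fsa_seminorm_def rsc by blast
  show "fsa_seminorm A p (x * y) \<le> fsa_seminorm A p x * fsa_seminorm A p y"
    using p r unfolding fsa_seminorm_def rmul by blast
  show "fsa_seminorm A p (fsa_star x * x) = (fsa_seminorm A p x)\<^sup>2"
    using p r unfolding fsa_seminorm_def rmul rstar by blast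
qed

section \<open>The defining relations as explicit polynomials\<close>

context no_entrance_graph
begin

lemma graph_relations_eq:
  "graph_relations \<Lambda> =
     {\<lambda>w. delta [(v, False), (v, False)] w - delta [(v, False)] w | v. v \<in> vertices \<Lambda>} \<union>
     {\<lambda>w. delta [(v, True)] w - delta [(v, False)] w | v. v \<in> vertices \<Lambda>} \<union>
     {delta [(v, False), (w, False)] | v w. v \<in> vertices \<Lambda> \<and> w \<in> vertices \<Lambda> \<and> v \<noteq> w} \<union>
     {\<lambda>w. delta [(x, False), (y, False)] w - delta [(x \<cdot> y, False)] w | x y. x \<in> P \<and> y \<in> P \<and> s x = r y} \<union>
     {\<lambda>w. delta [(x, True), (x, False)] w - delta [(s x, False)] w | x. x \<in> P} \<union>
     {\<lambda>w. delta [(v, False)] w - (\<Sum>x\<in>with_range \<Lambda> v (paths_le \<Lambda> n). delta [(x, False), (x, True)] w) | v n.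
        v \<in> vertices \<Lambda>}"
proof -
  have sum: "sa_sum (free_alg P) (\<lambda>x. delta [(x, False), (x, True)]) (with_range \<Lambda> v (paths_le \<Lambda> n)) =
      (\<lambda>w. \<Sum>x\<in>with_range \<Lambda> v (paths_le \<Lambda> n). delta [(x, False), (x, True)] w)" for v n
    by (intro free_sum(1) delta_closed finite_subset[OF _ finite_paths_le[of n]])
       (auto simp: with_range_def paths_le_iff)
  have ws: "word_star [(x, False)] = [(x, True)]" for x :: 'a by (simp add: word_star_def)
  show ?thesis
    unfolding graph_relations_def ck_relators_def free_sel(5,6) free_diff free_gen_delta fmul_delta
      fstar_delta ws append_Cons append_Nil sum by (rule refl)
qed

lemma graph_relationsI:
  "v \<in> vertices \<Lambda> \<Longrightarrow> (\<lambda>w. delta [(v, False), (v, False)] w - delta [(v, False)] w) \<in> graph_relations \<Lambda>"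
  "v \<in> vertices \<Lambda> \<Longrightarrow> (\<lambda>w. delta [(v, True)] w - delta [(v, False)] w) \<in> graph_relations \<Lambda>"
  "v \<in> vertices \<Lambda> \<Longrightarrow> v' \<in> vertices \<Lambda> \<Longrightarrow> v \<noteq> v' \<Longrightarrow> delta [(v, False), (v', False)] \<in> graph_relations \<Lambda>"
  "x \<in> P \<Longrightarrow> y \<in> P \<Longrightarrow> s x = r y \<Longrightarrow>
    (\<lambda>w. delta [(x, False), (y, False)] w - delta [(x \<cdot> y, False)] w) \<in> graph_relations \<Lambda>"
  "x \<in> P \<Longrightarrow> (\<lambda>w. delta [(x, True), (x, False)] w - delta [(s x, False)] w) \<in> graph_relations \<Lambda>"
  "v \<in> vertices \<Lambda> \<Longrightarrow> (\<lambda>w. delta [(v, False)] w -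
    (\<Sum>x\<in>with_range \<Lambda> v (paths_le \<Lambda> n). delta [(x, False), (x, True)] w)) \<in> graph_relations \<Lambda>"
  unfolding graph_relations_eq by blast+

text \<open>Modulo the pulled-back seminorm the free generators form a Cuntz-Krieger family, and
  \<open>f\<close> is a combination of words in them, to which \<open>q_words_le\<close>
  applies.\<close>

lemma seminorm_bound:
  assumes p: "cstar_seminorm (free_alg P) p" "\<forall>f\<in>graph_relations \<Lambda>. p f = 0"
    and f: "f \<in> carrier (free_alg P)"
  shows "p f \<le> (\<Sum>a\<in>X. \<Sum>b\<in>X. \<Sum>n\<in>word_deg ` supp f.
    cmod (\<Sum>w\<in>{w \<in> supp f. word_deg w = n \<and> run w a b}. f w))"
proof -
  let ?q = "fsa_seminorm P p"
  interpret cstar_seminormed fsa_scale fsa_star ?q by (rule cstar_seminormed_fsa[OF p(1)])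
  have rel: "eqv x y" if "(\<lambda>w. Rep_fsa x w - Rep_fsa y w) \<in> graph_relations \<Lambda>"
    "Rep_fsa x \<in> carrier (free_alg P)" "Rep_fsa y \<in> carrier (free_alg P)" for x y
    using p(2) that restrict_letters_id[OF free_closed(2)[OF that(2,3)]]
    unfolding eqv_def fsa_seminorm_def minus_fsa.rep_eq by simp
  have sumrep: "Rep_fsa (\<Sum>i\<in>I. g i) = (\<lambda>w. \<Sum>i\<in>I. Rep_fsa (g i) w)" for I :: "'c set" and g
    by (induction I rule: infinite_finite_induct) (auto simp: zero_fsa.rep_eq plus_fsa.rep_eq)
  note reps = times_fsa.rep_eq fsa_gen.rep_eq fsa_star.rep_eq fmul_delta fstar_delta zero_fsa.rep_eq sumrep
  have ws: "word_star [(x, False)] = [(x, True)]" for x :: 'a by (simp add: word_star_def)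
  have dP1: "delta [(x, b)] \<in> carrier (free_alg P)" if "x \<in> P" for x b
    using that by (auto intro: delta_closed)
  have dP2: "delta [(x, b), (y, c)] \<in> carrier (free_alg P)"
    if "x \<in> P" "y \<in> P" for x y b c
    using that by (auto intro: delta_closed)
  note dP = dP1 dP2
  have vP: "v \<in> P" if "v \<in> vertices \<Lambda>" for v using that by (simp add: vertices_iff)
  note reps' = reps ws append_Cons append_Nil
  interpret ck_family \<Lambda> fsa_scale fsa_star ?q fsa_gen
  proof
    fix v assume v: "v \<in> vertices \<Lambda>"
    show "eqv (fsa_gen v * fsa_gen v) (fsa_gen v)"
      by (rule rel; unfold reps') (intro graph_relationsI dP vP v)+
    show "eqv (fsa_star (fsa_gen v)) (fsa_gen v)"
      by (rule rel; unfold reps') (intro graph_relationsI dP vP v)+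
    show "eqv (fsa_gen v) (\<Sum>x\<in>with_range \<Lambda> v (paths_le \<Lambda> n). fsa_gen x * fsa_star (fsa_gen x))" for n
    proof (rule rel; unfold reps')
      show "(\<lambda>w. \<Sum>x\<in>with_range \<Lambda> v (paths_le \<Lambda> n). delta [(x, False), (x, True)] w) \<in> carrier (free_alg P)"
        by (intro free_sum(2) dP(2) finite_subset[OF _ finite_paths_le[of n]])
           (auto simp: with_range_def paths_le_iff)
    qed (intro graph_relationsI dP vP v)+
    fix w assume w: "w \<in> vertices \<Lambda>" "v \<noteq> w"
    show "eqv (fsa_gen v * fsa_gen w) 0"
      by (rule rel; unfold reps' diff_0_right) (intro graph_relationsI dP vP v w free_zero_closed)+
  next
    fix x y assume xy: "x \<in> P" "y \<in> P" "s x = r y"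
    show "eqv (fsa_gen x * fsa_gen y) (fsa_gen (x \<cdot> y))"
      by (rule rel; unfold reps') (intro graph_relationsI dP xy cmp_closed)+
  next
    fix x assume x: "x \<in> P"
    show "eqv (fsa_star (fsa_gen x) * fsa_gen x) (fsa_gen (s x))"
      by (rule rel; unfold reps') (intro graph_relationsI dP x src_closed)+
  qed
  have letter: "Rep_fsa (letter l) = delta [l]" for l
    by (cases l; cases "snd l") (auto simp: letter_def reps ws)
  have wp: "Rep_fsa (word_prod w) = delta w" if "w \<noteq> []" for w
    using that by (induction w rule: word_prod.induct) (auto simp: letter reps)
  have fin: "finite (supp f)" and f0: "f [] = 0" using f by (auto simp: carrier_free)
  have "Rep_fsa (\<Sum>w\<in>supp f. fsa_scale (f w) (word_prod w)) = f"
  proof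
    fix u
    have "Rep_fsa (\<Sum>w\<in>supp f. fsa_scale (f w) (word_prod w)) u = (\<Sum>w\<in>supp f. f w * delta w u)"
      unfolding sumrep fsa_scale.rep_eq
    proof (intro sum.cong refl)
      fix w assume "w \<in> supp f"
      hence "w \<noteq> []" using f0 by auto
      thus "f w * Rep_fsa (word_prod w) u = f w * delta w u" by (simp add: wp)
    qed
    also have "\<dots> = (\<Sum>w\<in>supp f. if w = u then f u else 0)"
      by (intro sum.cong) (auto simp: delta_def)
    also have "\<dots> = f u" using fin by simp
    finally show "Rep_fsa (\<Sum>w\<in>supp f. fsa_scale (f w) (word_prod w)) u = f u" .
  qed
  hence "p f = ?q (\<Sum>w\<in>supp f. fsa_scale (f w) (word_prod w))"
    using restrict_letters_id[OF f] by (simp add: fsa_seminorm_def)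
  also have "\<dots> \<le> (\<Sum>a\<in>X. \<Sum>b\<in>X. \<Sum>n\<in>word_deg ` supp f.
      cmod (\<Sum>w\<in>{w \<in> supp f. word_deg w = n \<and> run w a b}. f w))"
    using f by (intro q_words_le fin) (auto simp: carrier_free)
  finally show ?thesis .
qed

end

section \<open>Evaluation of words at points of a torus\<close>

definition lin :: "('a word \<Rightarrow> complex) \<Rightarrow> 'a star_poly \<Rightarrow> complex" where
  "lin m f = (\<Sum>w\<in>supp f. f w * m w)"

lemma lin_superset: "finite A \<Longrightarrow> supp f \<subseteq> A \<Longrightarrow> lin m f = (\<Sum>w\<in>A. f w * m w)"
  unfolding lin_def by (intro sum.mono_neutral_left) auto

lemma lin_delta: "lin m (delta u) = m u"
proof -
  have "lin m (delta u) = (\<Sum>w\<in>{u}. delta u w * m w)" by (intro lin_superset) (auto simp: delta_def)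
  thus ?thesis by (simp add: delta_def)
qed

lemma lin_zero: "lin m (\<lambda>w. 0) = 0"
  by (simp add: lin_def)

lemma lin_add:
  assumes "finite (supp f)" "finite (supp g)"
  shows "lin m (\<lambda>w. f w + g w) = lin m f + lin m g" "lin m (\<lambda>w. f w - g w) = lin m f - lin m g"
proof -
  let ?A = "supp f \<union> supp g"
  have A: "finite ?A" using assms by simp
  have "lin m (\<lambda>w. f w + g w) = (\<Sum>w\<in>?A. (f w + g w) * m w)"
    "lin m (\<lambda>w. f w - g w) = (\<Sum>w\<in>?A. (f w - g w) * m w)"
    "lin m f = (\<Sum>w\<in>?A. f w * m w)" "lin m g = (\<Sum>w\<in>?A. g w * m w)"
    by (rule lin_superset[OF A]; auto)+
  thus "lin m (\<lambda>w. f w + g w) = lin m f + lin m g" "lin m (\<lambda>w. f w - g w) = lin m f - lin m g"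
    by (simp_all add: sum.distrib sum_subtractf distrib_right left_diff_distrib)
qed

lemma lin_scale: "finite (supp f) \<Longrightarrow> lin m (\<lambda>w. c * f w) = c * lin m f"
proof -
  assume f: "finite (supp f)"
  have "lin m (\<lambda>w. c * f w) = (\<Sum>w\<in>supp f. (c * f w) * m w)" by (rule lin_superset[OF f]) auto
  thus ?thesis by (simp add: lin_def sum_distrib_left mult.assoc)
qed

lemma lin_sum:
  assumes "finite I" "\<And>i. i \<in> I \<Longrightarrow> finite (supp (f i))"
  shows "lin m (\<lambda>w. \<Sum>i\<in>I. f i w) = (\<Sum>i\<in>I. lin m (f i))" "finite (supp (\<lambda>w. \<Sum>i\<in>I. f i w))"
proof -
  have "lin m (\<lambda>w. \<Sum>i\<in>I. f i w) = (\<Sum>i\<in>I. lin m (f i)) \<and> finite (supp (\<lambda>w. \<Sum>i\<in>I. f i w))"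
    using assms
  proof (induction I)
    case (insert i I)
    thus ?case using lin_add(1)[of "f i" "\<lambda>w. \<Sum>i\<in>I. f i w" m]
        finite_supp_linear(1)[of "f i" "\<lambda>w. \<Sum>i\<in>I. f i w"] by simp
  qed (simp add: lin_zero)
  thus "lin m (\<lambda>w. \<Sum>i\<in>I. f i w) = (\<Sum>i\<in>I. lin m (f i))" "finite (supp (\<lambda>w. \<Sum>i\<in>I. f i w))" by auto
qed

text \<open>Several pairs may concatenate to the same word; summation over \<open>splits w\<close>
  keeps them apart.\<close>

lemma lin_fmul:
  assumes "finite (supp f)" "finite (supp g)"
  shows "lin m (fmul f g) = (\<Sum>u\<in>supp f. \<Sum>v\<in>supp g. f u * g v * m (u @ v))"
proof -
  let ?C = "(\<lambda>(u, v). u @ v) ` (supp f \<times> supp g)"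
  have C: "finite ?C" using assms by simp
  have "lin m (fmul f g) = (\<Sum>w\<in>?C. fmul f g w * m w)"
    by (rule lin_superset[OF C supp_fmul])
  also have "\<dots> = (\<Sum>w\<in>?C. \<Sum>(u, v)\<in>splits w. f u * g v * m (u @ v))"
    unfolding fmul_splits sum_distrib_right by (intro sum.cong refl) (auto simp: splits_def)
  also have "\<dots> = (\<Sum>(w, p)\<in>Sigma ?C splits. f (fst p) * g (snd p) * m (fst p @ snd p))"
    using C by (simp add: sum.Sigma finite_splits case_prod_unfold)
  also have "\<dots> = (\<Sum>(w, p)\<in>{(w, p). w = fst p @ snd p \<and> fst p \<in> supp f \<and> snd p \<in> supp g}.
      f (fst p) * g (snd p) * m (fst p @ snd p))"
  proof (rule sum.mono_neutral_right)
    show "finite (Sigma ?C splits)" by (rule finite_SigmaI[OF C finite_splits])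
  qed (auto simp: splits_def)
  also have "\<dots> = (\<Sum>p\<in>supp f \<times> supp g. f (fst p) * g (snd p) * m (fst p @ snd p))"
    by (rule sum.reindex_bij_witness[of _ "\<lambda>p. (fst p @ snd p, p)" snd]) auto
  also have "\<dots> = (\<Sum>u\<in>supp f. \<Sum>v\<in>supp g. f u * g v * m (u @ v))"
    by (simp add: sum.cartesian_product case_prod_unfold)
  finally show ?thesis .
qed

lemma lin_fstar:
  assumes "finite (supp f)"
  shows "lin m (fstar f) = cnj (lin (\<lambda>w. cnj (m (word_star w))) f)"
proof -
  have "lin m (fstar f) = (\<Sum>w\<in>supp f. cnj (f w) * m (word_star w))"
    unfolding lin_def supp_fstar
    by (subst sum.reindex) (auto intro!: inj_onI sum.cong simp: fstar_def dest: arg_cong[of _ _ word_star])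
  thus ?thesis by (simp add: lin_def)
qed

abbreviation torus_pts :: "nat \<Rightarrow> (nat \<Rightarrow> complex) set" where
  "torus_pts l \<equiv> {..<l} \<rightarrow>\<^sub>E sphere 0 1"

lemma topspace_torus: "topspace (torus l) = torus_pts l"
  by (simp add: torus_def)

lemma torus_nonzero: "z \<in> torus_pts l \<Longrightarrow> j < l \<Longrightarrow> z j \<noteq> 0 \<and> cmod (z j) = 1"
  by (auto simp: PiE_def Pi_def)

section \<open>Matrix representations over the tori\<close>

context no_entrance_graph
begin

definition components :: "'a set set" where
  "components = (\<lambda>a. reach (s a)) ` X"

definition block :: "'a set \<Rightarrow> 'a set" where
  "block R = {a \<in> X. reach (s a) = R}"

definition rank_of :: "'a set \<Rightarrow> nat" where
  "rank_of R = int_rank (group_of R)"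

definition coords :: "'a set \<Rightarrow> int ^ 'b \<Rightarrow> nat \<Rightarrow> int" where
  "coords R = (SOME \<kappa>. coordinates (rank_of R) \<kappa> (group_of R))"

lemma finite_block: "finite (block R)"
  using finite_X by (simp add: block_def)

lemma finite_components: "finite components"
  using finite_X by (simp add: components_def)

lemma componentsE:
  assumes "R \<in> components"
  obtains u where "u \<in> terminal" "R = reach u"
  using assms X_terminal by (auto simp: components_def)

lemma group_subgroup: "R \<in> components \<Longrightarrow> int_subgroup (group_of R)"
  by (erule componentsE) (auto simp: int_subgroup_def intro: group_of_zero group_of_uminus group_of_add)

lemma coords: "R \<in> components \<Longrightarrow> coordinates (rank_of R) (coords R) (group_of R)"
  unfolding coords_def rank_of_def using subgroup_coordinates[OF group_subgroup] by (metis someI_ex)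

text \<open>Points of the torus are the characters of the period group, read in the chosen
  coordinates.\<close>

definition character :: "'a set \<Rightarrow> (nat \<Rightarrow> complex) \<Rightarrow> int ^ 'b \<Rightarrow> complex" where
  "character R z g = (\<Prod>j<rank_of R. z j powi coords R g j)"

lemma character_zero: "R \<in> components \<Longrightarrow> character R z 0 = 1"
  by (simp add: character_def coordinates_zero[OF group_subgroup coords])

lemma character_add:
  assumes "R \<in> components" "z \<in> torus_pts (rank_of R)" "g \<in> group_of R" "h \<in> group_of R"
  shows "character R z (g + h) = character R z g * character R z h"
proof -
  have "coords R (g + h) j = coords R g j + coords R h j" for j
    using coords[OF assms(1)] assms(3,4) by (simp add: coordinates_def)
  thus ?thesis unfolding character_def prod.distrib[symmetric]
    using torus_nonzero[OF assms(2)] by (intro prod.cong) (auto simp: power_int_add)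
qed

lemma norm_character: "z \<in> torus_pts (rank_of R) \<Longrightarrow> cmod (character R z g) = 1"
  unfolding character_def prod_norm[symmetric]
  using torus_nonzero by (intro prod.neutral) (auto simp: norm_power_int)

lemma character_uminus:
  assumes "R \<in> components" "z \<in> torus_pts (rank_of R)" "g \<in> group_of R"
  shows "character R z (- g) = cnj (character R z g)"
proof -
  have "- g \<in> group_of R" using group_subgroup[OF assms(1)] assms(3) by (simp add: int_subgroup_def)
  from character_add[OF assms this] have "character R z g * character R z (- g) = 1"
    using character_zero[OF assms(1)] by simp
  moreover have "character R z g * cnj (character R z g) = 1"
    using norm_character[OF assms(2), of g] by (simp add: complex_norm_square[symmetric])
  moreover have "character R z g \<noteq> 0" using norm_character[OF assms(2), of g] by auto
  ultimately show ?thesis by (metis mult_left_cancel)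
qed

text \<open>Row \<open>b\<close>, column \<open>a\<close>: the target of the run comes first, so
  that concatenation of words becomes multiplication of matrices.\<close>

definition entry :: "'a set \<Rightarrow> (nat \<Rightarrow> complex) \<Rightarrow> 'a \<Rightarrow> 'a \<Rightarrow> 'a word \<Rightarrow> complex" where
  "entry R z b a w = (if run w a b then character R z (twist (word_deg w) a b) else 0)"

definition ev :: "'a set \<Rightarrow> (nat \<Rightarrow> complex) \<Rightarrow> 'a star_poly \<Rightarrow> 'a \<Rightarrow> 'a \<Rightarrow> complex" where
  "ev R z f b a = lin (entry R z b a) f"

lemma run_block: "run w a b \<Longrightarrow> a \<in> block R \<longleftrightarrow> b \<in> block R"
  using run_X run_reach by (auto simp: block_def)

lemma block_components: "a \<in> block R \<Longrightarrow> R \<in> components"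
  by (auto simp: block_def components_def)

lemma run_twist_block: "run w a b \<Longrightarrow> a \<in> block R \<Longrightarrow> twist (word_deg w) a b \<in> group_of R"
  using run_twist by (auto simp: block_def)

lemma norm_entry_le: "z \<in> torus_pts (rank_of R) \<Longrightarrow> cmod (entry R z b a w) \<le> 1"
  by (simp add: entry_def norm_character)

text \<open>A run is a partial function, so the sum over \<open>c\<close> has at most one nonzero
  term; there the additivity of \<open>twist\<close> meets the multiplicativity of the
  character.\<close>

lemma entry_append:
  assumes z: "z \<in> torus_pts (rank_of R)" and a: "a \<in> block R"
  shows "entry R z b a (u @ v) = (\<Sum>c\<in>block R. entry R z b c u * entry R z c a v)"
proof (cases "\<exists>c. run v a c")
  case True
  then obtain c where c: "run v a c" by blast
  have cb: "c \<in> block R" using run_block[OF c] a by simp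
  have rv: "run v a c' \<longleftrightarrow> c' = c" for c' using run_unique[OF c] c by blast
  have "(\<Sum>c'\<in>block R. entry R z b c' u * entry R z c' a v) =
      (\<Sum>c'\<in>block R. if c' = c then entry R z b c u * entry R z c a v else 0)"
    by (intro sum.cong refl) (auto simp: entry_def rv)
  also have "\<dots> = entry R z b c u * entry R z c a v" using cb finite_block by simp
  also have "\<dots> = entry R z b a (u @ v)"
  proof (cases "run u c b")
    case True
    have "character R z (twist (word_deg v) a c + twist (word_deg u) c b) =
        character R z (twist (word_deg v) a c) * character R z (twist (word_deg u) c b)"
      by (rule character_add[OF block_components[OF a] z run_twist_block[OF c a] run_twist_block[OF True cb]])
    moreover have "run (u @ v) a b" using True by (simp add: run_append rv)
    ultimately show ?thesis using c True by (simp add: entry_def twist_add[of _ _ a b c])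
  next
    case False
    hence "\<not> run (u @ v) a b" by (simp add: run_append rv)
    thus ?thesis using False by (simp add: entry_def)
  qed
  finally show ?thesis by simp
next
  case False
  thus ?thesis by (simp add: entry_def run_append)
qed

lemma entry_star:
  assumes z: "z \<in> torus_pts (rank_of R)" and a: "a \<in> block R" "b \<in> block R"
  shows "entry R z b a (word_star w) = cnj (entry R z a b w)"
proof (cases "run w b a")
  case True
  have "twist (word_deg (word_star w)) a b = - twist (word_deg w) b a"
    by (simp add: word_deg_star twist_uminus)
  thus ?thesis
    using True character_uminus[OF block_components[OF a(1)] z run_twist_block[OF True a(2)]]
    by (simp add: entry_def run_star)
qed (simp add: entry_def run_star)

lemma ev_fmul:
  assumes z: "z \<in> torus_pts (rank_of R)" and a: "a \<in> block R" and f: "finite (supp f)" "finite (supp g)"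
  shows "ev R z (fmul f g) b a = (\<Sum>c\<in>block R. ev R z f b c * ev R z g c a)"
proof -
  have "ev R z (fmul f g) b a =
      (\<Sum>u\<in>supp f. \<Sum>v\<in>supp g. \<Sum>c\<in>block R. (f u * entry R z b c u) * (g v * entry R z c a v))"
    unfolding ev_def lin_fmul[OF f] entry_append[OF z a] sum_distrib_left
    by (intro sum.cong refl) (simp add: mult_ac)
  also have "\<dots> = (\<Sum>u\<in>supp f. \<Sum>c\<in>block R. \<Sum>v\<in>supp g. (f u * entry R z b c u) * (g v * entry R z c a v))"
    by (intro sum.cong refl sum.swap)
  also have "\<dots> = (\<Sum>c\<in>block R. \<Sum>u\<in>supp f. \<Sum>v\<in>supp g. (f u * entry R z b c u) * (g v * entry R z c a v))"
    by (rule sum.swap)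
  also have "\<dots> = (\<Sum>c\<in>block R. ev R z f b c * ev R z g c a)"
    by (simp add: ev_def lin_def sum_product)
  finally show ?thesis .
qed

lemma ev_fstar:
  assumes z: "z \<in> torus_pts (rank_of R)" and a: "a \<in> block R" "b \<in> block R" and f: "finite (supp f)"
  shows "ev R z (fstar f) b a = cnj (ev R z f a b)"
  by (simp add: ev_def lin_fstar[OF f] entry_star[OF z a])

lemma ev_linear:
  assumes "finite (supp f)" "finite (supp g)"
  shows "ev R z (\<lambda>w. f w + g w) b a = ev R z f b a + ev R z g b a"
    "ev R z (\<lambda>w. f w - g w) b a = ev R z f b a - ev R z g b a"
    "ev R z (\<lambda>w. c * f w) b a = c * ev R z f b a"
  by (simp_all add: ev_def lin_add lin_scale assms)

lemma ev_delta: "ev R z (delta w) b a = entry R z b a w"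
  by (simp add: ev_def lin_delta)

lemma finite_supp_delta: "finite (supp (delta w))"
  by (simp add: delta_def)

lemma run_vertex: "v \<in> vertices \<Lambda> \<Longrightarrow> run [(v, False)] a b \<longleftrightarrow> a \<in> X \<and> a = b \<and> r a = v"
  by (auto simp: fwd_vertex)

lemma deg_vertex: "v \<in> vertices \<Lambda> \<Longrightarrow> letter_deg (v, c) = 0"
  by (cases c) (auto simp: vertices_iff vec_eq_iff)

lemma run_range:
  "run [(x, False), (x, True)] a b \<longleftrightarrow> a = b \<and> (\<exists>c. fwd x c a)"
proof -
  have "a \<in> X" if "fwd x c a" for c using that by (simp add: fwd_def)
  hence "run [(x, False), (x, True)] a b \<longleftrightarrow> (\<exists>c. fwd x c a \<and> fwd x c b)" by auto
  thus ?thesis using fwd_unique by blast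
qed

lemma run_source:
  assumes "x \<in> P"
  shows "run [(x, True), (x, False)] a b \<longleftrightarrow> a \<in> X \<and> a = b \<and> r a = s x"
proof -
  have X: "a \<in> X \<and> r a = s x" if "fwd x a c" for c using that by (simp add: fwd_def)
  hence "run [(x, True), (x, False)] a b \<longleftrightarrow> (\<exists>c. fwd x a c \<and> fwd x b c)" by auto
  also have "\<dots> \<longleftrightarrow> a = b \<and> (\<exists>c. fwd x a c)" using fwd_inj by blast
  also have "\<dots> \<longleftrightarrow> a \<in> X \<and> a = b \<and> r a = s x" using X fwd_exists[OF assms, of a] by metis
  finally show ?thesis .
qed

text \<open>Each relation reduces to a fact about \<open>fwd\<close>, the last one to the existence
  and uniqueness of an initial segment in \<open>\<Lambda>\<^sup>\<le>\<^sup>n\<close>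
  (\<open>fwd_cover\<close>, \<open>fwd_paths_le_unique\<close>). Two words that act alike in a
  relation also have the same degree, so the characters agree.\<close>

lemma ev_relations:
  assumes R: "R \<in> components" and f: "f \<in> graph_relations \<Lambda>"
  shows "ev R z f b a = 0"
proof -
  note c0 = character_zero[OF R]
  note ed = ev_linear(2)[OF finite_supp_delta finite_supp_delta] ev_delta
  have key: "entry R z b a [(v, False)] = (if a \<in> X \<and> a = b \<and> r a = v then 1 else 0)"
    if "v \<in> vertices \<Lambda>" for v
    using run_vertex[OF that] by (auto simp: entry_def deg_vertex[OF that] twist_self c0 simp del: run.simps letter_deg.simps)
  from f show ?thesis unfolding graph_relations_eq
  proof (elim UnE CollectE exE conjE)
    fix v assume f1: "f = (\<lambda>w. delta [(v, False), (v, False)] w - delta [(v, False)] w)" and h10: "v \<in> vertices \<Lambda>"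
    note 1 = h10 f1
    have "run [(v, False), (v, False)] a b \<longleftrightarrow> run [(v, False)] a b" using 1(1) by (auto simp: fwd_vertex)
    thus ?thesis unfolding 1(2) ed by (simp add: entry_def deg_vertex[OF 1(1)] del: run.simps letter_deg.simps)
  next
    fix v assume f2: "f = (\<lambda>w. delta [(v, True)] w - delta [(v, False)] w)" and h20: "v \<in> vertices \<Lambda>"
    note 2 = h20 f2
    have "run [(v, True)] a b \<longleftrightarrow> run [(v, False)] a b" using 2(1) by (auto simp: fwd_vertex)
    thus ?thesis unfolding 2(2) ed by (simp add: entry_def deg_vertex[OF 2(1)] del: run.simps letter_deg.simps)
  next
    fix v w assume f3: "f = delta [(v, False), (w, False)]" and h30: "v \<in> vertices \<Lambda>" and h31: "w \<in> vertices \<Lambda>" and h32: "v \<noteq> w"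
    note 3 = h30 h31 h32 f3
    have "\<not> run [(v, False), (w, False)] a b" using 3 by (auto simp: fwd_vertex)
    thus ?thesis unfolding 3(4) ed by (simp add: entry_def del: run.simps)
  next
    fix x y assume f4: "f = (\<lambda>w. delta [(x, False), (y, False)] w - delta [(x \<cdot> y, False)] w)" and h40: "x \<in> P" and h41: "y \<in> P" and h42: "s x = r y"
    note 4 = h40 h41 h42 f4
    have "run [(x, False), (y, False)] a b \<longleftrightarrow> run [(x \<cdot> y, False)] a b"
      using fwd_cmp[OF 4(1-3)] by (auto simp: fwd_def)
    moreover have "word_deg [(x, False), (y, False)] = word_deg [(x \<cdot> y, False)]"
      by (simp add: deg_cmp[OF 4(1-3)] vec_eq_iff)
    ultimately show ?thesis unfolding 4(4) ed by (simp only: entry_def) simp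
  next
    fix x assume f5: "f = (\<lambda>w. delta [(x, True), (x, False)] w - delta [(s x, False)] w)" and h50: "x \<in> P"
    note 5 = h50 f5
    have "run [(x, True), (x, False)] a b \<longleftrightarrow> run [(s x, False)] a b"
      using run_source[OF 5(1)] run_vertex[OF src_vertex[OF 5(1)]] by simp
    moreover have "word_deg [(x, True), (x, False)] = word_deg [(s x, False)]"
      by (simp add: vec_eq_iff deg_src[OF 5(1)])
    ultimately show ?thesis unfolding 5(2) ed by (simp only: entry_def) simp
  next
    fix v n assume f6: "f = (\<lambda>w. delta [(v, False)] w -
        (\<Sum>x\<in>with_range \<Lambda> v (paths_le \<Lambda> n). delta [(x, False), (x, True)] w))" and h60: "v \<in> vertices \<Lambda>"
    note 6 = h60 f6
    let ?I = "with_range \<Lambda> v (paths_le \<Lambda> n)"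
    have fin: "finite ?I" using finite_subset[OF _ finite_paths_le[of n]] by (auto simp: with_range_def)
    have "ev R z f b a = entry R z b a [(v, False)] - (\<Sum>x\<in>?I. entry R z b a [(x, False), (x, True)])"
      unfolding 6(2) ev_def
      by (simp add: lin_add(2) lin_sum[OF fin] finite_supp_delta lin_delta)
    also have "(\<Sum>x\<in>?I. entry R z b a [(x, False), (x, True)]) = entry R z b a [(v, False)]"
    proof (cases "a \<in> X \<and> a = b \<and> r a = v")
      case True
      then obtain x c where x: "x \<in> paths_le \<Lambda> n" "r x = r a" "fwd x c a" using fwd_cover[of a n] by metis
      have "r x = v" using x(2) True by metis
      hence xI: "x \<in> ?I" using x(1) by (simp add: with_range_def)
      have "(\<Sum>y\<in>?I. entry R z b a [(y, False), (y, True)]) = (\<Sum>y\<in>?I. if y = x then 1 else 0)"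
      proof (intro sum.cong refl)
        fix y assume y: "y \<in> ?I"
        have "run [(y, False), (y, True)] a b \<longleftrightarrow> y = x"
          unfolding run_range using fwd_paths_le_unique[OF _ x(3) _ x(1)] x(3) y True
          by (auto simp: with_range_def)
        thus "entry R z b a [(y, False), (y, True)] = (if y = x then 1 else 0)"
          using True by (simp add: entry_def twist_self c0 del: run.simps)
      qed
      also have "\<dots> = 1" using xI fin by simp
      finally show ?thesis unfolding key[OF 6(1)] if_P[OF True] .
    next
      case False
      have "entry R z b a [(y, False), (y, True)] = 0" if y: "y \<in> ?I" for y
      proof -
        have "\<not> run [(y, False), (y, True)] a b"
        proof
          assume "run [(y, False), (y, True)] a b"
          then obtain c where c: "a = b" "fwd y c a" unfolding run_range by blast
          have "a \<in> X" using c(2) by (simp add: fwd_def)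
          moreover have "r a = v" using fwd_rng[OF c(2)] y by (simp add: with_range_def)
          ultimately show False using False c(1) by blast
        qed
        thus ?thesis by (simp add: entry_def del: run.simps)
      qed
      thus ?thesis unfolding key[OF 6(1)] if_not_P[OF False] by (rule sum.neutral[OF ballI])
    qed
    finally show ?thesis by simp
  qed
qed

end

section \<open>The operator norm of complex matrices\<close>

definition mat_vec :: "'i set \<Rightarrow> ('i \<Rightarrow> 'i \<Rightarrow> complex) \<Rightarrow> ('i \<Rightarrow> complex) \<Rightarrow> 'i \<Rightarrow> complex" where
  "mat_vec Y M v b = (\<Sum>a\<in>Y. M b a * v a)"

definition vec_norm :: "'i set \<Rightarrow> ('i \<Rightarrow> complex) \<Rightarrow> real" where
  "vec_norm Y v = L2_set (\<lambda>a. cmod (v a)) Y"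

text \<open>The maximum of the entries would not satisfy the C*-identity, and only an exact
  C*-seminorm competes in the supremum that defines the universal one; hence the operator
  norm.\<close>

definition op_norm :: "'i set \<Rightarrow> ('i \<Rightarrow> 'i \<Rightarrow> complex) \<Rightarrow> real" where
  "op_norm Y M = Inf {K. 0 \<le> K \<and> (\<forall>v. vec_norm Y (mat_vec Y M v) \<le> K * vec_norm Y v)}"

lemma vec_norm_nonneg: "0 \<le> vec_norm Y v"
  by (simp add: vec_norm_def)

lemma vec_norm_cong: "(\<And>a. a \<in> Y \<Longrightarrow> v a = v' a) \<Longrightarrow> vec_norm Y v = vec_norm Y v'"
  unfolding vec_norm_def by (intro L2_set_cong) auto

lemma op_norm_cong:
  assumes "\<And>a b. a \<in> Y \<Longrightarrow> b \<in> Y \<Longrightarrow> M b a = M' b a"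
  shows "op_norm Y M = op_norm Y M'"
proof -
  have "vec_norm Y (mat_vec Y M v) = vec_norm Y (mat_vec Y M' v)" for v
    by (intro vec_norm_cong) (auto simp: mat_vec_def assms intro!: sum.cong)
  thus ?thesis by (simp add: op_norm_def)
qed

context
  fixes Y :: "'i set"
  assumes Y: "finite Y"
begin

lemma cmod_le_vec_norm: "a \<in> Y \<Longrightarrow> cmod (v a) \<le> vec_norm Y v"
  unfolding vec_norm_def using member_le_L2_set[OF Y, of a "\<lambda>a. cmod (v a)"] by simp

lemma vec_norm_scale: "vec_norm Y (\<lambda>a. c * v a) = cmod c * vec_norm Y v"
  unfolding vec_norm_def norm_mult by (rule L2_set_right_distrib[symmetric]) simp

lemma vec_norm_add: "vec_norm Y (\<lambda>a. v a + w a) \<le> vec_norm Y v + vec_norm Y w"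
proof -
  have "vec_norm Y (\<lambda>a. v a + w a) \<le> L2_set (\<lambda>a. cmod (v a) + cmod (w a)) Y"
    unfolding vec_norm_def by (intro L2_set_mono norm_triangle_ineq) auto
  also have "\<dots> \<le> vec_norm Y v + vec_norm Y w" unfolding vec_norm_def by (rule L2_set_triangle_ineq)
  finally show ?thesis .
qed

text \<open>Provides one admissible bound, so that the infimum in \<open>op_norm\<close> is taken
  over a nonempty set.\<close>

lemma mat_vec_crude: "vec_norm Y (mat_vec Y M v) \<le> (\<Sum>b\<in>Y. \<Sum>a\<in>Y. cmod (M b a)) * vec_norm Y v"
proof -
  have "vec_norm Y (mat_vec Y M v) \<le> (\<Sum>b\<in>Y. cmod (mat_vec Y M v b))"
    unfolding vec_norm_def by (intro L2_set_le_sum) auto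
  also have "\<dots> \<le> (\<Sum>b\<in>Y. \<Sum>a\<in>Y. cmod (M b a) * vec_norm Y v)"
    unfolding mat_vec_def
    by (intro sum_mono order_trans[OF norm_sum])
       (auto simp: norm_mult intro!: mult_left_mono cmod_le_vec_norm)
  finally show ?thesis by (simp add: sum_distrib_right)
qed

lemma op_norm_set: "{K. 0 \<le> K \<and> (\<forall>v. vec_norm Y (mat_vec Y M v) \<le> K * vec_norm Y v)} \<noteq> {}"
  using mat_vec_crude[of M] by (auto intro!: exI[of _ "\<Sum>b\<in>Y. \<Sum>a\<in>Y. cmod (M b a)"] sum_nonneg)

lemma op_norm_nonneg: "0 \<le> op_norm Y M"
  unfolding op_norm_def by (intro cInf_greatest op_norm_set) auto

lemma op_norm_bound: "vec_norm Y (mat_vec Y M v) \<le> op_norm Y M * vec_norm Y v"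
proof (cases "vec_norm Y v = 0")
  case True
  thus ?thesis using mat_vec_crude[of M v] by simp
next
  case False
  hence pos: "0 < vec_norm Y v" using vec_norm_nonneg[of Y v] by simp
  have "vec_norm Y (mat_vec Y M v) / vec_norm Y v \<le> op_norm Y M"
    unfolding op_norm_def using pos by (intro cInf_greatest op_norm_set) (auto simp: divide_le_eq)
  thus ?thesis using pos by (simp add: divide_le_eq)
qed

lemma op_norm_least:
  assumes "0 \<le> K" "\<And>v. vec_norm Y (mat_vec Y M v) \<le> K * vec_norm Y v"
  shows "op_norm Y M \<le> K"
  unfolding op_norm_def using assms by (intro cInf_lower) (auto intro!: bdd_belowI[of _ 0])

lemma op_norm_add: "op_norm Y (\<lambda>b a. M b a + N b a) \<le> op_norm Y M + op_norm Y N"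
proof (rule op_norm_least)
  fix v
  have "mat_vec Y (\<lambda>b a. M b a + N b a) v = (\<lambda>b. mat_vec Y M v b + mat_vec Y N v b)"
    by (simp add: mat_vec_def fun_eq_iff distrib_right sum.distrib)
  thus "vec_norm Y (mat_vec Y (\<lambda>b a. M b a + N b a) v) \<le> (op_norm Y M + op_norm Y N) * vec_norm Y v"
    using vec_norm_add[of "mat_vec Y M v" "mat_vec Y N v"] op_norm_bound[of M v] op_norm_bound[of N v]
    by (simp add: distrib_right)
qed (simp add: op_norm_nonneg)

lemma op_norm_scale: "op_norm Y (\<lambda>b a. c * M b a) = cmod c * op_norm Y M"
proof -
  have le: "op_norm Y (\<lambda>b a. c * M b a) \<le> cmod c * op_norm Y M" for c M
  proof (rule op_norm_least)
    fix v
    have "mat_vec Y (\<lambda>b a. c * M b a) v = (\<lambda>b. c * mat_vec Y M v b)"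
      by (simp add: mat_vec_def fun_eq_iff sum_distrib_left mult.assoc)
    thus "vec_norm Y (mat_vec Y (\<lambda>b a. c * M b a) v) \<le> cmod c * op_norm Y M * vec_norm Y v"
      using mult_left_mono[OF op_norm_bound[of M v], of "cmod c"] by (simp add: vec_norm_scale mult.assoc)
  qed (simp add: op_norm_nonneg)
  show ?thesis
  proof (cases "c = 0")
    case True
    thus ?thesis using le[of c M] op_norm_nonneg[of "\<lambda>b a. c * M b a"] by simp
  next
    case False
    have "op_norm Y (\<lambda>b a. inverse c * (c * M b a)) \<le> cmod (inverse c) * op_norm Y (\<lambda>b a. c * M b a)"
      by (rule le)
    moreover have "(\<lambda>b a. inverse c * (c * M b a)) = M" using False by (simp add: fun_eq_iff)
    ultimately have "cmod c * op_norm Y M \<le> op_norm Y (\<lambda>b a. c * M b a)"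
      using False by (simp add: norm_inverse norm_divide field_simps)
    thus ?thesis using le[of c M] by simp
  qed
qed

lemma mat_vec_mult: "mat_vec Y (\<lambda>b a. \<Sum>c\<in>Y. M b c * N c a) v = mat_vec Y M (mat_vec Y N v)"
proof
  fix b
  have "mat_vec Y (\<lambda>b a. \<Sum>c\<in>Y. M b c * N c a) v b = (\<Sum>a\<in>Y. \<Sum>c\<in>Y. M b c * (N c a * v a))"
    by (simp add: mat_vec_def sum_distrib_right mult.assoc)
  also have "\<dots> = (\<Sum>c\<in>Y. \<Sum>a\<in>Y. M b c * (N c a * v a))" by (rule sum.swap)
  finally show "mat_vec Y (\<lambda>b a. \<Sum>c\<in>Y. M b c * N c a) v b = mat_vec Y M (mat_vec Y N v) b"
    by (simp add: mat_vec_def sum_distrib_left)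
qed

lemma op_norm_mult: "op_norm Y (\<lambda>b a. \<Sum>c\<in>Y. M b c * N c a) \<le> op_norm Y M * op_norm Y N"
proof (rule op_norm_least)
  fix v
  have "vec_norm Y (mat_vec Y M (mat_vec Y N v)) \<le> op_norm Y M * vec_norm Y (mat_vec Y N v)"
    by (rule op_norm_bound)
  also have "\<dots> \<le> op_norm Y M * (op_norm Y N * vec_norm Y v)"
    by (intro mult_left_mono op_norm_bound op_norm_nonneg)
  finally show "vec_norm Y (mat_vec Y (\<lambda>b a. \<Sum>c\<in>Y. M b c * N c a) v) \<le> op_norm Y M * op_norm Y N * vec_norm Y v"
    by (simp add: mat_vec_mult mult.assoc)
qed (simp add: op_norm_nonneg)

lemma op_norm_entry:
  assumes "a \<in> Y" "b \<in> Y"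
  shows "cmod (M b a) \<le> op_norm Y M"
proof -
  define v where "v a' = (if a' = a then 1 else 0 :: complex)" for a'
  have "vec_norm Y v = 1"
  proof -
    have "(\<Sum>i\<in>Y. (cmod (v i))\<^sup>2) = (\<Sum>i\<in>Y. if i = a then 1 else 0)"
      by (intro sum.cong) (auto simp: v_def)
    thus ?thesis using Y assms(1) by (simp add: vec_norm_def L2_set_def)
  qed
  moreover have "mat_vec Y M v b = M b a"
  proof -
    have "mat_vec Y M v b = (\<Sum>a'\<in>Y. if a' = a then M b a else 0)"
      unfolding mat_vec_def by (intro sum.cong) (auto simp: v_def)
    thus ?thesis using Y assms(1) by simp
  qed
  ultimately show ?thesis
    using cmod_le_vec_norm[OF assms(2), of "mat_vec Y M v"] op_norm_bound[of M v] by simp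
qed

definition adjoint :: "('i \<Rightarrow> 'i \<Rightarrow> complex) \<Rightarrow> 'i \<Rightarrow> 'i \<Rightarrow> complex" where
  "adjoint M b a = cnj (M a b)"

text \<open>The Cauchy-Schwarz inequality for the inner product of \<open>v\<close> and
  \<open>M^* M v\<close>, which is the squared norm of \<open>M v\<close>.\<close>

lemma vec_norm_square_le:
  "(vec_norm Y (mat_vec Y M v))\<^sup>2 \<le> vec_norm Y v * vec_norm Y (mat_vec Y (adjoint M) (mat_vec Y M v))"
proof -
  let ?w = "mat_vec Y M v"
  let ?u = "mat_vec Y (adjoint M) ?w"
  have "(vec_norm Y ?w)\<^sup>2 = (\<Sum>b\<in>Y. (cmod (?w b))\<^sup>2)"
    by (simp add: vec_norm_def L2_set_def sum_nonneg)
  hence "complex_of_real ((vec_norm Y ?w)\<^sup>2) = (\<Sum>b\<in>Y. ?w b * cnj (?w b))"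
    by (simp only: of_real_sum complex_norm_square)
  also have "\<dots> = (\<Sum>b\<in>Y. \<Sum>a\<in>Y. v a * (M b a * cnj (?w b)))"
    unfolding mat_vec_def[of Y M v] by (simp add: sum_distrib_right mult_ac)
  also have "\<dots> = (\<Sum>a\<in>Y. \<Sum>b\<in>Y. v a * (M b a * cnj (?w b)))" by (rule sum.swap)
  also have "\<dots> = (\<Sum>a\<in>Y. v a * cnj (?u a))"
    by (simp add: mat_vec_def[of Y "adjoint M"] adjoint_def sum_distrib_left)
  finally have "(vec_norm Y ?w)\<^sup>2 = cmod (\<Sum>a\<in>Y. v a * cnj (?u a))"
    by (metis norm_of_real abs_power2 abs_of_nonneg zero_le_power2)
  also have "\<dots> \<le> (\<Sum>a\<in>Y. \<bar>cmod (v a)\<bar> * \<bar>cmod (?u a)\<bar>)"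
    by (intro order_trans[OF norm_sum] sum_mono) (simp add: norm_mult)
  also have "\<dots> \<le> vec_norm Y v * vec_norm Y ?u"
    unfolding vec_norm_def by (rule L2_set_mult_ineq)
  finally show ?thesis .
qed

lemma op_norm_cstar_le: "(op_norm Y M)\<^sup>2 \<le> op_norm Y (\<lambda>b a. \<Sum>c\<in>Y. adjoint M b c * M c a)"
proof -
  let ?K = "op_norm Y (\<lambda>b a. \<Sum>c\<in>Y. adjoint M b c * M c a)"
  have K: "0 \<le> ?K" by (rule op_norm_nonneg)
  have "op_norm Y M \<le> sqrt ?K"
  proof (rule op_norm_least)
    fix v
    have "(vec_norm Y (mat_vec Y M v))\<^sup>2 \<le>
        vec_norm Y v * vec_norm Y (mat_vec Y (\<lambda>b a. \<Sum>c\<in>Y. adjoint M b c * M c a) v)"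
      using vec_norm_square_le[of M v] by (simp add: mat_vec_mult)
    also have "\<dots> \<le> vec_norm Y v * (?K * vec_norm Y v)"
      by (intro mult_left_mono op_norm_bound vec_norm_nonneg)
    also have "\<dots> = (sqrt ?K * vec_norm Y v)\<^sup>2" using K by (simp add: power_mult_distrib power2_eq_square)
    finally show "vec_norm Y (mat_vec Y M v) \<le> sqrt ?K * vec_norm Y v"
      using K vec_norm_nonneg by (intro power2_le_imp_le[OF _ mult_nonneg_nonneg]) auto
  qed (use K in simp)
  hence "(op_norm Y M)\<^sup>2 \<le> (sqrt ?K)\<^sup>2" by (intro power_mono op_norm_nonneg)
  thus ?thesis using K by simp
qed

lemma op_norm_adjoint: "op_norm Y (adjoint M) = op_norm Y M"
proof -
  have le: "op_norm Y M \<le> op_norm Y (adjoint M)" for M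
  proof (cases "op_norm Y M = 0")
    case True
    thus ?thesis by (simp add: op_norm_nonneg)
  next
    case False
    have "(op_norm Y M)\<^sup>2 \<le> op_norm Y (adjoint M) * op_norm Y M"
      using op_norm_cstar_le op_norm_mult by (rule order_trans)
    thus ?thesis using False op_norm_nonneg[of M] by (simp add: power2_eq_square)
  qed
  have "adjoint (adjoint M) = M" by (simp add: adjoint_def fun_eq_iff)
  thus ?thesis using le[of M] le[of "adjoint M"] by simp
qed

lemma op_norm_cstar: "op_norm Y (\<lambda>b a. \<Sum>c\<in>Y. cnj (M c b) * M c a) = (op_norm Y M)\<^sup>2"
  using op_norm_cstar_le[of M] op_norm_mult[of "adjoint M" M] op_norm_adjoint[of M]
  by (simp add: adjoint_def power2_eq_square)

end

section \<open>C*-seminorms from the evaluations\<close>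

context no_entrance_graph
begin

definition ev_norm :: "'a set \<Rightarrow> (nat \<Rightarrow> complex) \<Rightarrow> 'a star_poly \<Rightarrow> real" where
  "ev_norm R z f = op_norm (block R) (ev R z f)"

lemma cstar_seminorm_ev:
  assumes z: "z \<in> torus_pts (rank_of R)"
  shows "cstar_seminorm (free_alg P) (ev_norm R z)"
  unfolding cstar_seminorm_def free_sel(3-)
proof (intro conjI ballI allI)
  fix f assume f: "f \<in> carrier (free_alg P)"
  hence fin: "finite (supp f)" by (simp add: carrier_free)
  show "0 \<le> ev_norm R z f" unfolding ev_norm_def by (rule op_norm_nonneg[OF finite_block])
  have "ev R z (\<lambda>w. c * f w) = (\<lambda>b a. c * ev R z f b a)" for c
    by (intro ext ev_linear(3)[OF fin fin])
  thus "ev_norm R z (\<lambda>w. c * f w) = cmod c * ev_norm R z f" for c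
    unfolding ev_norm_def using op_norm_scale[OF finite_block] by simp
  have "ev R z (fmul (fstar f) f) b a = (\<Sum>c\<in>block R. cnj (ev R z f c b) * ev R z f c a)"
    if "a \<in> block R" "b \<in> block R" for a b
  proof -
    have "finite (supp (fstar f))" using fin by (simp add: supp_fstar)
    hence "ev R z (fmul (fstar f) f) b a = (\<Sum>c\<in>block R. ev R z (fstar f) b c * ev R z f c a)"
      by (intro ev_fmul z that fin)
    thus ?thesis using ev_fstar[OF z _ that(2) fin] by simp
  qed
  hence "op_norm (block R) (ev R z (fmul (fstar f) f)) =
      op_norm (block R) (\<lambda>b a. \<Sum>c\<in>block R. cnj (ev R z f c b) * ev R z f c a)"
    by (rule op_norm_cong)
  thus "ev_norm R z (fmul (fstar f) f) = (ev_norm R z f)\<^sup>2"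
    unfolding ev_norm_def op_norm_cstar[OF finite_block] .
  fix g assume g: "g \<in> carrier (free_alg P)"
  hence gin: "finite (supp g)" by (simp add: carrier_free)
  have "ev R z (\<lambda>w. f w + g w) = (\<lambda>b a. ev R z f b a + ev R z g b a)"
    by (intro ext ev_linear(1) fin gin)
  thus "ev_norm R z (\<lambda>w. f w + g w) \<le> ev_norm R z f + ev_norm R z g"
    unfolding ev_norm_def using op_norm_add[OF finite_block] by simp
  have "op_norm (block R) (ev R z (fmul f g)) =
      op_norm (block R) (\<lambda>b a. \<Sum>c\<in>block R. ev R z f b c * ev R z g c a)"
    by (intro op_norm_cong ev_fmul z fin gin)
  thus "ev_norm R z (fmul f g) \<le> ev_norm R z f * ev_norm R z g"
    unfolding ev_norm_def by (rule ord_eq_le_trans[OF _ op_norm_mult[OF finite_block]])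
qed

lemma ev_norm_relations:
  assumes "R \<in> components" "f \<in> graph_relations \<Lambda>"
  shows "ev_norm R z f = 0"
proof -
  have "ev R z f = (\<lambda>b a. 0 * ev R z f b a)" using ev_relations[OF assms] by (intro ext) simp
  thus ?thesis unfolding ev_norm_def using op_norm_scale[OF finite_block, of R 0 "ev R z f"] by simp
qed

lemma norm_ev_le: "a \<in> block R \<Longrightarrow> b \<in> block R \<Longrightarrow> cmod (ev R z f b a) \<le> ev_norm R z f"
  unfolding ev_norm_def by (rule op_norm_entry[OF finite_block])

end

section \<open>Fourier coefficients on the torus\<close>

text \<open>An integer vector off finitely many hyperplanes; it will turn exponents in
  \<open>l\<close> variables into exponents in one.\<close>

lemma separating_vector:
  fixes F :: "(nat \<Rightarrow> int) set"
  assumes "finite F" "\<And>f. f \<in> F \<Longrightarrow> \<exists>j<l. f j \<noteq> 0"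
  shows "\<exists>a :: nat \<Rightarrow> int. \<forall>f\<in>F. (\<Sum>j<l. a j * f j) \<noteq> 0"
  using assms
proof (induction l arbitrary: F)
  case 0
  thus ?case by auto
next
  case (Suc l)
  define F' where "F' = {f \<in> F. \<exists>j<l. f j \<noteq> 0}"
  have "finite F'" using Suc.prems(1) by (simp add: F'_def)
  moreover have "\<exists>j<l. f j \<noteq> 0" if "f \<in> F'" for f using that by (simp add: F'_def)
  ultimately obtain a :: "nat \<Rightarrow> int" where a: "\<forall>f\<in>F'. (\<Sum>j<l. a j * f j) \<noteq> 0"
    using Suc.IH by blast
  \<comment> \<open>Every \<open>f\<close> with \<open>f l \<noteq> 0\<close> excludes at most one
    value of the last entry \<open>t\<close>.\<close>
  define bad where "bad = (\<lambda>f. - (\<Sum>j<l. a j * f j) div f l) ` F"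
  have "finite bad" using Suc.prems(1) by (simp add: bad_def)
  then obtain t where t: "t \<notin> bad" using ex_new_if_finite[OF infinite_UNIV_int] by blast
  have "(\<Sum>j<Suc l. (a(l := t)) j * f j) \<noteq> 0" if f: "f \<in> F" for f
  proof -
    have eq: "(\<Sum>j<Suc l. (a(l := t)) j * f j) = (\<Sum>j<l. a j * f j) + t * f l" by simp
    show ?thesis
    proof (cases "f l = 0")
      case True
      hence "f \<in> F'" using Suc.prems(2)[OF f] f by (auto simp: F'_def less_Suc_eq)
      thus ?thesis using a True eq by simp
    next
      case False
      show ?thesis
      proof
        assume "(\<Sum>j<Suc l. (a(l := t)) j * f j) = 0"
        hence "- (\<Sum>j<l. a j * f j) = t * f l" using eq by simp
        hence "t = - (\<Sum>j<l. a j * f j) div f l" using False by simp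
        thus False using t f by (auto simp: bad_def)
      qed
    qed
  qed
  thus ?case by blast
qed

lemma root_of_unity_sum:
  fixes m :: int
  assumes "m \<noteq> 0" "\<bar>m\<bar> < int Q"
  shows "(\<Sum>i<Q. cis (2 * pi * m / Q) ^ i) = 0"
proof -
  define x where "x = cis (2 * pi * m / Q)"
  have Q: "Q > 0" using assms by auto
  have "x ^ Q = cis (real Q * (2 * pi * m / Q))" by (simp only: x_def Complex.DeMoivre)
  also have "\<dots> = 1" using Q by simp
  finally have xQ: "x ^ Q = 1" .
  have "x \<noteq> 1"
  proof
    assume "x = 1"
    hence "exp (\<i> * complex_of_real (2 * pi * m / Q)) = 1" by (simp add: x_def cis_conv_exp)
    then obtain n :: int where "2 * pi * m / Q = of_int (2 * n) * pi" by (auto simp: exp_eq_1)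
    hence "real_of_int m = real_of_int (n * int Q)" using Q by (simp add: field_simps)
    hence mn: "m = n * int Q" by (simp only: of_int_eq_iff)
    hence "n \<noteq> 0" using assms(1) by auto
    hence "1 * int Q \<le> \<bar>n\<bar> * int Q" by (intro mult_right_mono) auto
    thus False using assms(2) mn by (simp add: abs_mult)
  qed
  thus ?thesis using geometric_sum[of x Q] xQ by (simp add: x_def)
qed

text \<open>The coefficient is extracted by averaging over a finite cyclic subgroup of the torus in
  place of integration. The averaged values are bounded by \<open>S\<close>, hence so is the
  coefficient.\<close>

lemma torus_coefficient_le:
  fixes c :: "(nat \<Rightarrow> int) \<Rightarrow> complex"
  assumes D: "finite D" "\<And>e j. e \<in> D \<Longrightarrow> l \<le> j \<Longrightarrow> e j = 0" and e0: "e0 \<in> D"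
    and bound: "\<And>z. z \<in> torus_pts l \<Longrightarrow> cmod (\<Sum>e\<in>D. c e * (\<Prod>j<l. z j powi e j)) \<le> S"
  shows "cmod (c e0) \<le> S"
proof -
  define F where "F = (\<lambda>e j. e j - e0 j) ` (D - {e0})"
  have "\<exists>j<l. f j \<noteq> 0" if fF: "f \<in> F" for f
  proof (rule ccontr)
    assume no: "\<not> (\<exists>j<l. f j \<noteq> 0)"
    obtain e where e: "e \<in> D" "e \<noteq> e0" "f = (\<lambda>j. e j - e0 j)" using fF by (auto simp: F_def)
    have "e j = e0 j" for j
    proof (cases "j < l")
      case True
      thus ?thesis using no e(3) by auto
    next
      case False
      thus ?thesis using D(2)[OF e(1), of j] D(2)[OF e0, of j] by simp
    qed
    thus False using e(2) by auto
  qed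
  then obtain a :: "nat \<Rightarrow> int" where a: "\<forall>f\<in>F. (\<Sum>j<l. a j * f j) \<noteq> 0"
    using separating_vector[of F l] D(1) by (auto simp: F_def)
  define h where "h e = (\<Sum>j<l. a j * e j)" for e :: "nat \<Rightarrow> int"
  have hne: "h e - h e0 \<noteq> 0" if "e \<in> D" "e \<noteq> e0" for e
    using a that by (auto simp: F_def h_def right_diff_distrib sum_subtractf)
  \<comment> \<open>\<open>Q\<close> exceeds every \<open>\<bar>h e - h e0\<bar>\<close>, so no
    \<open>h e\<close> with \<open>e \<noteq> e0\<close> is congruent to \<open>h e0\<close> modulo
    \<open>Q\<close>, and the root-of-unity sums remove all other terms.\<close>
  define Q where "Q = Suc (\<Sum>e\<in>D. nat \<bar>h e - h e0\<bar>)"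
  have hlt: "\<bar>h e - h e0\<bar> < int Q" if "e \<in> D" for e
  proof -
    have "nat \<bar>h e - h e0\<bar> \<le> (\<Sum>e\<in>D. nat \<bar>h e - h e0\<bar>)" using D(1) that by (intro member_le_sum) auto
    hence "nat \<bar>h e - h e0\<bar> < Q" by (simp add: Q_def)
    thus ?thesis by linarith
  qed
  \<comment> \<open>At these points the monomial with exponent \<open>e\<close> is the
    \<open>i\<close>-th power of \<open>cis (2 * pi * h e / Q)\<close>.\<close>
  define z where "z i = (\<lambda>j\<in>{..<l}. cis (2 * pi * (i * a j) / Q))" for i :: nat
  have zT: "z i \<in> torus_pts l" for i by (auto simp: z_def)
  have zp: "(\<Prod>j<l. z i j powi e j) = cis (2 * pi * (i * h e) / Q)" for i e
  proof -
    have "(\<Prod>j<l. z i j powi e j) = (\<Prod>j<l. cis (2 * pi * (i * a j) / Q * e j))"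
      by (intro prod.cong refl) (simp add: z_def cis_power_int mult.commute)
    also have "\<dots> = cis (\<Sum>j<l. 2 * pi * (i * a j) / Q * e j)"
      by (induction l) (simp_all add: cis_mult)
    also have "(\<Sum>j<l. 2 * pi * (i * a j) / Q * e j) = 2 * pi * (i * h e) / Q"
      by (simp add: h_def sum_distrib_left sum_divide_distrib mult_ac)
    finally show ?thesis .
  qed
  define G where "G i = (\<Sum>e\<in>D. c e * (\<Prod>j<l. z i j powi e j))" for i
  have "(\<Sum>i<Q. cis (- (2 * pi * (i * h e0) / Q)) * G i) =
      (\<Sum>i<Q. \<Sum>e\<in>D. c e * cis (2 * pi * (h e - h e0) / Q) ^ i)"
    unfolding G_def zp sum_distrib_left
  proof (intro sum.cong refl)
    fix i e
    have "cis (- (2 * pi * (i * h e0) / Q)) * cis (2 * pi * (i * h e) / Q) =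
        cis (2 * pi * (h e - h e0) / Q) ^ i"
      by (simp add: cis_mult Complex.DeMoivre) (simp add: algebra_simps diff_divide_distrib)
    thus "cis (- (2 * pi * (i * h e0) / Q)) * (c e * cis (2 * pi * (i * h e) / Q)) =
        c e * cis (2 * pi * (h e - h e0) / Q) ^ i" by (simp add: mult_ac)
  qed
  also have "\<dots> = (\<Sum>e\<in>D. c e * (\<Sum>i<Q. cis (2 * pi * (h e - h e0) / Q) ^ i))"
    unfolding sum_distrib_left by (rule sum.swap)
  also have "\<dots> = (\<Sum>e\<in>D. if e = e0 then c e0 * of_nat Q else 0)"
    using root_of_unity_sum[OF hne hlt] by (intro sum.cong) auto
  also have "\<dots> = c e0 * of_nat Q" using D(1) e0 by simp
  finally have eq: "(\<Sum>i<Q. cis (- (2 * pi * (i * h e0) / Q)) * G i) = c e0 * of_nat Q" .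
  have "real Q * cmod (c e0) = cmod (\<Sum>i<Q. cis (- (2 * pi * (i * h e0) / Q)) * G i)"
    unfolding eq by (simp add: norm_mult)
  also have "\<dots> \<le> (\<Sum>i<Q. S)"
    using bound[OF zT] by (intro order_trans[OF norm_sum] sum_mono) (simp add: norm_mult G_def)
  also have "\<dots> = real Q * S" by simp
  finally have "real Q * cmod (c e0) \<le> real Q * S" .
  moreover have "0 < real Q" unfolding Q_def by (rule of_nat_0_less_iff[THEN iffD2, OF zero_less_Suc])
  ultimately show ?thesis using mult_le_cancel_left_pos by blast
qed

text \<open>If \<open>r < q\<close>, write \<open>r / q = y ^ k\<close> with \<open>y < 1\<close>.
  The right side divided by the left becomes \<open>A\<close> times the \<open>k\<close>-th power of
  \<open>(B * n + 1) * y ^ n\<close> at \<open>n = 2 ^ Suc m\<close>; this tends to 0 although it is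
  at least 1.\<close>

lemma growth_comparison:
  fixes q r A B :: real
  assumes "0 \<le> q" "0 \<le> r" "0 \<le> B" "0 < k"
    and le: "\<And>m. q ^ 2 ^ Suc m \<le> A * (B * 2 ^ Suc m + 1) ^ k * r ^ 2 ^ Suc m"
  shows "q \<le> r"
proof (rule ccontr)
  assume "\<not> q \<le> r"
  hence q: "0 < q" "r < q" using assms by auto
  define y where "y = root k (r / q)"
  have y: "0 \<le> y" "y < 1" "y ^ k = r / q"
    using q assms by (auto simp: y_def real_root_lt_1_iff real_root_pow_pos2)
  have lim: "(\<lambda>n. A * ((B * real n + 1) * y ^ n) ^ k) \<longlonglongrightarrow> 0"
  proof -
    have lim1: "(\<lambda>n. B * (real n * y ^ n) + y ^ n) \<longlonglongrightarrow> B * 0 + 0"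
      using y powser_times_n_limit_0[of y]
      by (intro tendsto_add tendsto_mult tendsto_const LIMSEQ_power_zero) auto
    have "(\<lambda>n. A * (B * (real n * y ^ n) + y ^ n) ^ k) \<longlonglongrightarrow> A * (B * 0 + 0) ^ k"
      by (rule tendsto_mult[OF tendsto_const tendsto_power[OF lim1]])
    moreover have "A * (B * 0 + 0) ^ k = 0" using assms(4) by simp
    ultimately have "(\<lambda>n. A * (B * (real n * y ^ n) + y ^ n) ^ k) \<longlonglongrightarrow> 0" by (simp only:)
    thus ?thesis by (simp add: distrib_right mult.assoc)
  qed
  have ge: "1 \<le> A * ((B * real (2 ^ Suc m) + 1) * y ^ 2 ^ Suc m) ^ k" for m
  proof -
    have "(y ^ 2 ^ Suc m) ^ k = (r / q) ^ 2 ^ Suc m" by (metis y(3) power_mult mult.commute)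
    hence "A * ((B * real (2 ^ Suc m) + 1) * y ^ 2 ^ Suc m) ^ k =
        A * (B * 2 ^ Suc m + 1) ^ k * r ^ 2 ^ Suc m / q ^ 2 ^ Suc m"
      by (simp add: power_mult_distrib power_divide)
    moreover have "q ^ 2 ^ Suc m / q ^ 2 ^ Suc m \<le> A * (B * 2 ^ Suc m + 1) ^ k * r ^ 2 ^ Suc m / q ^ 2 ^ Suc m"
      using le[of m] q by (intro divide_right_mono) auto
    ultimately show ?thesis using q by simp
  qed
  obtain n0 where n0: "\<And>n. n \<ge> n0 \<Longrightarrow> \<bar>A * ((B * real n + 1) * y ^ n) ^ k\<bar> < 1"
    using LIMSEQ_D[OF lim, of 1] by auto
  have "n0 \<le> 2 ^ Suc n0" using less_exp[of "Suc n0"] by linarith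
  from n0[OF this] ge[of n0] show False by linarith
qed

section \<open>Comparison of the universal seminorm with the evaluations\<close>

context no_entrance_graph
begin

text \<open>A bound \<open>S\<close> in place of the supremum of the entries, so that no supremum
  has to be formed.\<close>

definition ev_bounded :: "real \<Rightarrow> 'a star_poly \<Rightarrow> bool" where
  "ev_bounded S f \<longleftrightarrow> (\<forall>R\<in>components. \<forall>z\<in>torus_pts (rank_of R). \<forall>a\<in>block R. \<forall>b\<in>block R.
     cmod (ev R z f b a) \<le> S)"

lemma ev_bounded_l1: "ev_bounded (\<Sum>w\<in>supp f. cmod (f w)) f"
  unfolding ev_bounded_def ev_def lin_def
  using norm_entry_le by (auto intro!: order_trans[OF norm_sum] sum_mono simp: norm_mult mult_left_le)

lemma twist_inj: "twist n a b = twist m a b \<longleftrightarrow> n = m"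
  by (simp add: twist_def)

lemma coords_inj:
  assumes "R \<in> components" "g \<in> group_of R" "h \<in> group_of R"
  shows "coords R g = coords R h \<longleftrightarrow> g = h"
  using coords[OF assms(1)] assms(2,3) unfolding coordinates_def bij_betw_def by (metis inj_onD)

lemma coords_beyond:
  assumes "R \<in> components" "g \<in> group_of R" "rank_of R \<le> j"
  shows "coords R g j = 0"
  using bij_betwE[OF conjunct1[OF coords[OF assms(1), unfolded coordinates_def]]] assms(2,3) by blast

text \<open>The entry in row \<open>b\<close> and column \<open>a\<close> is a Laurent polynomial
  whose exponents are the coordinates of the twisted degrees. Distinct degrees give distinct
  exponents, so the sum over the words of degree \<open>n\<close> is one of its
  coefficients.\<close>

lemma coefficient_bound:
  assumes f: "finite (supp f)" and S: "ev_bounded S f" "0 \<le> S" and ab: "a \<in> X" "b \<in> X"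
  shows "cmod (\<Sum>w\<in>{w \<in> supp f. word_deg w = n \<and> run w a b}. f w) \<le> S"
proof (cases "{w \<in> supp f. word_deg w = n \<and> run w a b} = {}")
  case True
  thus ?thesis using S(2) by (simp only: sum.empty norm_zero)
next
  case False
  then obtain w0 where w0: "w0 \<in> supp f" "word_deg w0 = n" "run w0 a b" by blast
  define R where "R = reach (s a)"
  have aR: "a \<in> block R" using ab by (simp add: block_def R_def)
  note R = block_components[OF aR]
  have bR: "b \<in> block R" using run_block[OF w0(3)] aR by simp
  define W where "W = {w \<in> supp f. run w a b}"
  define e where "e w = coords R (twist (word_deg w) a b)" for w
  have W: "finite W" using f by (simp add: W_def)
  have eW: "e w = e w0 \<longleftrightarrow> word_deg w = n" if "w \<in> W" for w
    unfolding e_def using coords_inj[OF R] run_twist_block[OF _ aR] that w0 twist_inj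
    by (auto simp: W_def)
  have "cmod (\<Sum>w\<in>{w \<in> W. e w = e w0}. f w) \<le> S"
  proof (rule torus_coefficient_le[of "e ` W" "rank_of R" "e w0" "\<lambda>e'. \<Sum>w\<in>{w \<in> W. e w = e'}. f w"])
    show "finite (e ` W)" "e w0 \<in> e ` W" using W w0 by (auto simp: W_def)
    show "e' j = 0" if "e' \<in> e ` W" "rank_of R \<le> j" for e' j
      using that coords_beyond[OF R run_twist_block[OF _ aR]] by (auto simp: e_def W_def)
    fix z assume z: "z \<in> torus_pts (rank_of R)"
    have "ev R z f b a = (\<Sum>w\<in>W. f w * entry R z b a w)"
      unfolding ev_def lin_def W_def using f by (intro sum.mono_neutral_right) (auto simp: entry_def)
    also have "\<dots> = (\<Sum>w\<in>W. f w * (\<Prod>j<rank_of R. z j powi e w j))"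
      by (intro sum.cong refl) (simp add: W_def entry_def character_def e_def)
    also have "\<dots> = (\<Sum>e'\<in>e ` W. \<Sum>w\<in>{w \<in> W. e w = e'}. f w * (\<Prod>j<rank_of R. z j powi e w j))"
      using W by (intro sum.group[symmetric]) auto
    also have "\<dots> = (\<Sum>e'\<in>e ` W. (\<Sum>w\<in>{w \<in> W. e w = e'}. f w) * (\<Prod>j<rank_of R. z j powi e' j))"
      unfolding sum_distrib_right by (intro sum.cong refl) auto
    finally show "cmod (\<Sum>e'\<in>e ` W. (\<Sum>w\<in>{w \<in> W. e w = e'}. f w) * (\<Prod>j<rank_of R. z j powi e' j)) \<le> S"
      using S(1) R z aR bR unfolding ev_bounded_def by metis
  qed
  also have "{w \<in> W. e w = e w0} = {w \<in> supp f. word_deg w = n \<and> run w a b}"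
    using eW by (auto simp: W_def)
  finally show ?thesis .
qed

text \<open>A length in which adjoint letters count positively. It is additive, so the bound on it
  doubles when a polynomial is squared, and it controls the entries of
  \<open>word_deg\<close>.\<close>

definition weight :: "'a word \<Rightarrow> nat" where
  "weight w = (\<Sum>l\<leftarrow>w. \<Sum>i\<in>UNIV. d (fst l) $ i)"

lemma weight_append: "weight (u @ v) = weight u + weight v"
  by (simp add: weight_def)

lemma weight_star: "weight (word_star w) = weight w"
  by (induction w) (auto simp: word_star_Cons weight_def)

lemma word_deg_le_weight: "\<bar>word_deg w $ i\<bar> \<le> int (weight w)"
proof (induction w)
  case (Cons l w)
  have "\<bar>letter_deg l $ i\<bar> = int (d (fst l) $ i)" by (cases l; cases "snd l") auto
  moreover have "d (fst l) $ i \<le> (\<Sum>i\<in>UNIV. d (fst l) $ i)" by (intro member_le_sum) auto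
  moreover have "weight (l # w) = (\<Sum>i\<in>UNIV. d (fst l) $ i) + weight w" by (simp add: weight_def)
  ultimately show ?case
    using Cons abs_triangle_ineq[of "letter_deg l $ i" "word_deg w $ i"]
    by (simp only: word_deg_simps vector_add_component of_nat_add)
qed (simp add: weight_def)

definition weight_bounded :: "nat \<Rightarrow> 'a star_poly \<Rightarrow> bool" where
  "weight_bounded D f \<longleftrightarrow> (\<forall>w\<in>supp f. weight w \<le> D)"

lemma weight_bounded_fmul:
  "weight_bounded D f \<Longrightarrow> weight_bounded D' g \<Longrightarrow> weight_bounded (D + D') (fmul f g)"
  unfolding weight_bounded_def using supp_fmul[of f g] by (fastforce simp: weight_append intro: add_mono)

lemma weight_bounded_fstar: "weight_bounded D f \<Longrightarrow> weight_bounded D (fstar f)"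
  unfolding weight_bounded_def supp_fstar by (auto simp: weight_star)

lemma card_word_deg_le:
  assumes "weight_bounded D f"
  shows "card (word_deg ` supp f) \<le> (2 * D + 1) ^ CARD('b)"
proof -
  let ?B = "(\<lambda>g. \<chi> i. g i) ` ((UNIV :: 'b set) \<rightarrow>\<^sub>E {- int D..int D})"
  have "word_deg ` supp f \<subseteq> ?B"
  proof
    fix v assume "v \<in> word_deg ` supp f"
    then obtain w where w: "weight w \<le> D" "v = word_deg w" using assms by (auto simp: weight_bounded_def)
    have "v $ i \<in> {- int D..int D}" for i using word_deg_le_weight[of w i] w by auto
    thus "v \<in> ?B" by (intro image_eqI[of _ _ "vec_nth v"]) auto
  qed
  moreover have fin: "finite ((UNIV :: 'b set) \<rightarrow>\<^sub>E {- int D..int D})" by (intro finite_PiE) auto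
  ultimately have "card (word_deg ` supp f) \<le> card ?B" by (intro card_mono finite_imageI)
  also have "\<dots> \<le> card ((UNIV :: 'b set) \<rightarrow>\<^sub>E {- int D..int D})" by (rule card_image_le[OF fin])
  also have "\<dots> = (card {- int D..int D}) ^ CARD('b)" by (simp add: card_PiE)
  also have "card {- int D..int D} = 2 * D + 1" by (simp only: card_atLeastAtMost_int)
  finally show ?thesis .
qed

lemma seminorm_polynomial_bound:
  assumes p: "cstar_seminorm (free_alg P) p" "\<forall>f\<in>graph_relations \<Lambda>. p f = 0"
    and f: "f \<in> carrier (free_alg P)" and S: "ev_bounded S f" "0 \<le> S" and D: "weight_bounded D f"
  shows "p f \<le> (real (card X))\<^sup>2 * real (2 * D + 1) ^ CARD('b) * S"
proof -
  have fin: "finite (supp f)" using f by (simp add: carrier_free)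
  have "p f \<le> (\<Sum>a\<in>X. \<Sum>b\<in>X. \<Sum>n\<in>word_deg ` supp f.
      cmod (\<Sum>w\<in>{w \<in> supp f. word_deg w = n \<and> run w a b}. f w))"
    by (rule seminorm_bound[OF p f])
  also have "\<dots> \<le> (\<Sum>a\<in>X. \<Sum>b\<in>X. \<Sum>n\<in>word_deg ` supp f. S)"
    by (intro sum_mono coefficient_bound fin S)
  also have "\<dots> = real (card X * card X) * (real (card (word_deg ` supp f)) * S)"
    by simp
  also have "\<dots> \<le> real (card X * card X) * (real ((2 * D + 1) ^ CARD('b)) * S)"
    using card_word_deg_le[OF D] S(2) by (intro mult_left_mono mult_right_mono of_nat_mono) auto
  finally show ?thesis by (simp add: power2_eq_square mult_ac)
qed

text \<open>An entry of a product is a sum of at most \<open>card X\<close> terms. The successor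
  makes the factor positive, since it will occur as a divisor.\<close>

lemma ev_bounded_fmul:
  assumes "ev_bounded S f" "ev_bounded S' g" "0 \<le> S" "0 \<le> S'" "finite (supp f)" "finite (supp g)"
  shows "ev_bounded (real (Suc (card X)) * (S * S')) (fmul f g)"
  unfolding ev_bounded_def
proof (intro ballI)
  fix R z a b assume h: "R \<in> components" "z \<in> torus_pts (rank_of R)" "a \<in> block R" "b \<in> block R"
  have "cmod (ev R z (fmul f g) b a) \<le> (\<Sum>c\<in>block R. S * S')"
    unfolding ev_fmul[OF h(2,3) assms(5,6)]
    using assms h by (intro order_trans[OF norm_sum] sum_mono) (auto simp: norm_mult ev_bounded_def intro!: mult_mono)
  also have "\<dots> = real (card (block R)) * (S * S')" by simp
  also have "\<dots> \<le> real (Suc (card X)) * (S * S')"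
    using assms card_mono[OF finite_X, of "block R"] by (intro mult_right_mono) (auto simp: block_def)
  finally show "cmod (ev R z (fmul f g) b a) \<le> real (Suc (card X)) * (S * S')" .
qed

lemma ev_bounded_fstar:
  assumes "ev_bounded S f" "finite (supp f)"
  shows "ev_bounded S (fstar f)"
  using assms unfolding ev_bounded_def by (auto simp: ev_fstar)

text \<open>Fourier coefficients bound a seminorm by the evaluations up to a factor polynomial in the degree;
  applied to the iterated squares of \<open>f\<^sup>*f\<close>, this factor disappears in the limit of the roots.\<close>

lemma seminorm_le_ev:
  assumes p: "cstar_seminorm (free_alg P) p" "\<forall>f\<in>graph_relations \<Lambda>. p f = 0"
    and f: "f \<in> carrier (free_alg P)" and S: "ev_bounded S f" "0 \<le> S"
  shows "p f \<le> real (Suc (card X)) * S"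
proof -
  define C where "C = real (Suc (card X))"
  have C: "1 \<le> C" by (simp add: C_def)
  \<comment> \<open>\<open>y m\<close> is the power \<open>2 ^ m\<close> of \<open>f^* f\<close>, so
    that \<open>p (y m)\<close> is \<open>p f\<close> to the power \<open>2 ^ Suc m\<close>.\<close>
  define y where "y m = ((\<lambda>g. fmul g g) ^^ m) (fmul (fstar f) f)" for m
  have ySuc: "y (Suc m) = fmul (y m) (y m)" and y0: "y 0 = fmul (fstar f) f" for m
    by (simp_all add: y_def)
  have fin: "finite (supp f)" using f by (simp add: carrier_free)
  define D where "D = (\<Sum>w\<in>supp f. weight w)"
  have D: "weight_bounded D f"
    unfolding weight_bounded_def D_def using fin by (auto intro: member_le_sum)
  note pp = p(1)[unfolded cstar_seminorm_def free_sel(3-)]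
  have yc: "y m \<in> carrier (free_alg P)" for m
    by (induction m) (auto simp: y0 ySuc intro: free_closed f)
  have yfin: "finite (supp (y m))" for m using yc[of m] by (simp add: carrier_free)
  have ffin: "finite (supp (fstar f))" using fin by (simp add: supp_fstar)
  have fss: "fstar (fstar f) = f" by (simp add: fstar_def)
  have ystar: "fstar (y m) = y m" for m
    by (induction m) (simp_all add: y0 ySuc fstar_fmul fss)
  have pstar: "p (fmul (fstar g) g) = (p g)\<^sup>2" if "g \<in> carrier (free_alg P)" for g using pp that by blast
  have p2: "p (fmul (fstar f) f) = (p f)\<^sup>2" by (rule pstar[OF f])
  have py: "p (y m) = p f ^ 2 ^ Suc m" for m
  proof (induction m)
    case (Suc m)
    have "p (y (Suc m)) = p (fmul (fstar (y m)) (y m))" by (simp add: ySuc ystar)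
    also have "\<dots> = (p (y m))\<^sup>2" by (rule pstar[OF yc])
    finally show ?case by (simp add: Suc power_mult[symmetric] mult.commute)
  qed (simp add: y0 p2)
  \<comment> \<open>Division by \<open>C\<close> lets the bound reproduce itself:
    \<open>T = (C S) ^ n / C\<close> satisfies \<open>C T T = (C S) ^ (2 n) / C\<close>.\<close>
  have ev: "ev_bounded ((C * S) ^ 2 ^ Suc m / C) (y m)" for m
  proof (induction m)
    case 0
    have "ev_bounded (C * (S * S)) (fmul (fstar f) f)"
      unfolding C_def using S fin ffin by (intro ev_bounded_fmul ev_bounded_fstar)
    moreover have "C * (S * S) = (C * S) ^ 2 ^ Suc 0 / C" using C by (simp add: power2_eq_square)
    ultimately show ?case by (simp add: y0)
  next
    case (Suc m)
    let ?T = "(C * S) ^ 2 ^ Suc m / C"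
    have "ev_bounded (C * (?T * ?T)) (y (Suc m))"
      unfolding C_def ySuc using Suc S(2) C by (intro ev_bounded_fmul yfin) (auto simp: C_def)
    moreover have "C * (?T * ?T) = (C * S) ^ 2 ^ Suc (Suc m) / C"
    proof -
      have "(C * S) ^ 2 ^ Suc (Suc m) = ((C * S) ^ 2 ^ Suc m)\<^sup>2"
        by (simp add: power_mult[symmetric] mult.commute)
      thus ?thesis using C by (simp add: power2_eq_square)
    qed
    ultimately show ?case by simp
  qed
  have wt: "weight_bounded (2 ^ Suc m * D) (y m)" for m
  proof (induction m)
    case 0
    show ?case using weight_bounded_fmul[OF weight_bounded_fstar[OF D] D] by (simp add: y0 mult_2)
  next
    case (Suc m)
    show ?case using weight_bounded_fmul[OF Suc Suc] by (simp add: ySuc mult_2 distrib_right)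
  qed
  show ?thesis unfolding C_def[symmetric]
  proof (rule growth_comparison[where A = "(real (card X))\<^sup>2" and B = "2 * real D" and k = "CARD('b)"])
    show "0 \<le> p f" using pp f by blast
    fix m
    have "p f ^ 2 ^ Suc m \<le> (real (card X))\<^sup>2 * real (2 * (2 ^ Suc m * D) + 1) ^ CARD('b) * ((C * S) ^ 2 ^ Suc m / C)"
      unfolding py[symmetric] using C S(2) by (intro seminorm_polynomial_bound p yc ev wt) auto
    also have "\<dots> \<le> (real (card X))\<^sup>2 * real (2 * (2 ^ Suc m * D) + 1) ^ CARD('b) * ((C * S) ^ 2 ^ Suc m / 1)"
      using C S(2) by (intro mult_left_mono divide_left_mono) auto
    also have "real (2 * (2 ^ Suc m * D) + 1) = 2 * real D * 2 ^ Suc m + 1" by (simp add: mult_ac)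
    also have "(C * S) ^ 2 ^ Suc m / 1 = (C * S) ^ 2 ^ Suc m" by simp
    finally show "p f ^ 2 ^ Suc m \<le>
      (real (card X))\<^sup>2 * (2 * real D * 2 ^ Suc m + 1) ^ CARD('b) * (C * S) ^ 2 ^ Suc m" .
  qed (use C S(2) in auto)
qed

definition graph_norm :: "'a star_poly \<Rightarrow> real" where
  "graph_norm = universal_seminorm P (graph_relations \<Lambda>)"

lemma graph_norm_le:
  assumes "f \<in> carrier (free_alg P)" "ev_bounded S f" "0 \<le> S"
  shows "graph_norm f \<le> real (Suc (card X)) * S"
proof -
  \<comment> \<open>The zero seminorm shows that the supremum is taken over a nonempty set.\<close>
  have "cstar_seminorm (free_alg P) (\<lambda>_. 0)" by (simp add: cstar_seminorm_def)
  thus ?thesis unfolding graph_norm_def universal_seminorm_def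
    by (intro cSUP_least seminorm_le_ev assms) auto
qed

lemma norm_ev_le_graph_norm:
  assumes f: "f \<in> carrier (free_alg P)" and R: "R \<in> components" "z \<in> torus_pts (rank_of R)"
    and ab: "a \<in> block R" "b \<in> block R"
  shows "cmod (ev R z f b a) \<le> graph_norm f"
proof -
  let ?A = "{p. cstar_seminorm (free_alg P) p \<and> (\<forall>r\<in>graph_relations \<Lambda>. p r = 0)}"
  have "ev_norm R z \<in> ?A" using cstar_seminorm_ev[OF R(2)] ev_norm_relations[OF R(1)] by blast
  \<comment> \<open>A real supremum is an upper bound only of a bounded family; boundedness comes
    from the sum of the absolute coefficients of \<open>f\<close>.\<close>
  moreover have "bdd_above ((\<lambda>p. p f) ` ?A)"
    using seminorm_le_ev[OF _ _ f ev_bounded_l1]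
    by (intro bdd_aboveI[of _ "real (Suc (card X)) * (\<Sum>w\<in>supp f. cmod (f w))"]) (auto simp: sum_nonneg)
  ultimately have "ev_norm R z f \<le> graph_norm f"
    unfolding graph_norm_def universal_seminorm_def by (rule cSUP_upper)
  thus ?thesis using norm_ev_le[OF ab, of z f] by linarith
qed

end

section \<open>Continuous functions on the torus\<close>

text \<open>Passes from the product topology of \<open>torus l\<close> to the topology of the
  function type. The identity is continuous both ways, because on the torus the coordinates outside
  \<open>{..<l}\<close> are constantly \<open>undefined\<close>.\<close>

lemma continuous_map_torus_iff:
  fixes f :: "(nat \<Rightarrow> complex) \<Rightarrow> complex"
  shows "continuous_map (torus l) euclidean f \<longleftrightarrow> continuous_on (torus_pts l) f"
proof -
  let ?T = "top_of_set (torus_pts l)"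
  have "continuous_map (torus l) euclidean (\<lambda>z. z j)" for j
  proof (cases "j < l")
    case True
    hence "continuous_map (torus l) (top_of_set (sphere 0 1)) (\<lambda>z. z j)"
      unfolding torus_def by (intro continuous_map_product_projection) auto
    thus ?thesis by (rule continuous_map_into_fulltopology)
  next
    case False
    have "continuous_map (torus l) euclidean (\<lambda>z. undefined :: complex)" by simp
    thus ?thesis
      by (rule continuous_map_eq) (use False in \<open>auto simp: topspace_torus PiE_def extensional_def\<close>)
  qed
  hence "continuous_map (torus l) euclidean (\<lambda>z. z)"
    unfolding euclidean_product_topology[symmetric] continuous_map_componentwise_UNIV by blast
  hence 1: "continuous_map (torus l) ?T (\<lambda>z. z)"
    unfolding continuous_map_in_subtopology topspace_torus by auto
  have 2: "continuous_map ?T (torus l) (\<lambda>z. z)"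
    unfolding torus_def continuous_map_componentwise
  proof (intro conjI ballI)
    fix j assume j: "j \<in> {..<l}"
    have "continuous_on (torus_pts l) (\<lambda>z. z j)"
      by (rule continuous_on_subset[OF continuous_on_product_coordinates]) simp
    thus "continuous_map ?T (top_of_set (sphere 0 1)) (\<lambda>z. z j)"
      using j by (auto simp: continuous_map_in_subtopology PiE_def Pi_def)
  qed (auto simp: PiE_def)
  show ?thesis
    using continuous_map_compose[OF 1, of euclidean f] continuous_map_compose[OF 2, of euclidean f]
    by (auto simp: comp_def continuous_map_iff_continuous)
qed

lemma compact_torus_pts: "compact (torus_pts l)"
proof -
  have "compact_space (torus l)"
    unfolding torus_def compact_space_product_topology by (auto simp: compact_space_subtopology)
  hence "compactin (torus l) (torus_pts l)" by (simp add: compact_space_def topspace_torus)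
  moreover have "continuous_map (torus l) euclidean (\<lambda>z. z)"
  proof -
    have "continuous_map (torus l) euclidean (\<lambda>z. z j)" for j
      unfolding continuous_map_torus_iff
      by (rule continuous_on_subset[OF continuous_on_product_coordinates]) simp
    thus ?thesis unfolding euclidean_product_topology[symmetric] continuous_map_componentwise_UNIV by blast
  qed
  ultimately have "compactin euclidean ((\<lambda>z. z) ` torus_pts l)" by (rule image_compactin)
  thus ?thesis by simp
qed

definition exponents :: "nat \<Rightarrow> (nat \<Rightarrow> int) set" where
  "exponents l = {e. \<forall>j\<ge>l. e j = 0}"

definition monomial :: "nat \<Rightarrow> (nat \<Rightarrow> int) \<Rightarrow> (nat \<Rightarrow> complex) \<Rightarrow> complex" where
  "monomial l e z = (\<Prod>j<l. z j powi e j)"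

lemma continuous_on_monomial: "continuous_on (torus_pts l) (monomial l e)"
  unfolding monomial_def
proof (intro continuous_on_prod)
  fix j assume "j \<in> {..<l}"
  moreover have "continuous_on (torus_pts l) (\<lambda>z. z j)"
    by (rule continuous_on_subset[OF continuous_on_product_coordinates]) simp
  ultimately show "continuous_on (torus_pts l) (\<lambda>z. z j powi e j)"
    using torus_nonzero by (intro continuous_on_power_int) auto
qed

text \<open>Equality is demanded on the torus only; there \<open>cnj (z j)\<close> is
  \<open>z j powi (- 1)\<close>, so conjugates of coordinates are covered.\<close>

definition laurent :: "nat \<Rightarrow> ((nat \<Rightarrow> complex) \<Rightarrow> complex) \<Rightarrow> bool" where
  "laurent l f \<longleftrightarrow> (\<exists>D c. finite D \<and> D \<subseteq> exponents l \<and>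
     (\<forall>z\<in>torus_pts l. f z = (\<Sum>e\<in>D. c e * monomial l e z)))"

lemma laurent_continuous: "laurent l f \<Longrightarrow> continuous_on (torus_pts l) f"
proof -
  assume "laurent l f"
  then obtain D c where D: "\<And>z. z \<in> torus_pts l \<Longrightarrow> f z = (\<Sum>e\<in>D. c e * monomial l e z)"
    by (auto simp: laurent_def)
  have "continuous_on (torus_pts l) (\<lambda>z. \<Sum>e\<in>D. c e * monomial l e z)"
    by (intro continuous_on_sum continuous_on_mult continuous_on_const continuous_on_monomial)
  thus ?thesis using D by (simp cong: continuous_on_cong)
qed

lemma laurent_monomial: "e \<in> exponents l \<Longrightarrow> laurent l (\<lambda>z. c * monomial l e z)"
  unfolding laurent_def by (intro exI[of _ "{e}"] exI[of _ "\<lambda>_. c"]) auto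

lemma laurent_cong: "laurent l f \<Longrightarrow> (\<And>z. z \<in> torus_pts l \<Longrightarrow> f z = g z) \<Longrightarrow> laurent l g"
  unfolding laurent_def by metis

lemma laurent_add:
  assumes "laurent l f" "laurent l g"
  shows "laurent l (\<lambda>z. f z + g z)"
proof -
  obtain D c where D: "finite D" "D \<subseteq> exponents l"
    "\<And>z. z \<in> torus_pts l \<Longrightarrow> f z = (\<Sum>e\<in>D. c e * monomial l e z)"
    using assms(1) by (auto simp: laurent_def)
  obtain D' c' where D': "finite D'" "D' \<subseteq> exponents l"
    "\<And>z. z \<in> torus_pts l \<Longrightarrow> g z = (\<Sum>e\<in>D'. c' e * monomial l e z)"
    using assms(2) by (auto simp: laurent_def)
  let ?c = "\<lambda>e. (if e \<in> D then c e else 0) + (if e \<in> D' then c' e else 0)"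
  have "f z + g z = (\<Sum>e\<in>D \<union> D'. ?c e * monomial l e z)" if z: "z \<in> torus_pts l" for z
  proof -
    have "(\<Sum>e\<in>D \<union> D'. (if e \<in> D then c e else 0) * monomial l e z) = f z"
      unfolding D(3)[OF z] using D(1) D'(1) by (intro sum.mono_neutral_cong_right) auto
    moreover have "(\<Sum>e\<in>D \<union> D'. (if e \<in> D' then c' e else 0) * monomial l e z) = g z"
      unfolding D'(3)[OF z] using D(1) D'(1) by (intro sum.mono_neutral_cong_right) auto
    ultimately show ?thesis unfolding distrib_right sum.distrib by simp
  qed
  thus ?thesis unfolding laurent_def using D D' by (intro exI[of _ "D \<union> D'"] exI[of _ ?c]) auto
qed

lemma laurent_sum:
  assumes "finite I" "\<And>i. i \<in> I \<Longrightarrow> laurent l (f i)"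
  shows "laurent l (\<lambda>z. \<Sum>i\<in>I. f i z)"
  using assms
proof (induction I)
  case empty
  show ?case unfolding laurent_def by (intro exI[of _ "{}"]) auto
qed (simp add: laurent_add)

lemma laurent_mult:
  assumes "laurent l f" "laurent l g"
  shows "laurent l (\<lambda>z. f z * g z)"
proof -
  obtain D c where D: "finite D" "D \<subseteq> exponents l"
    "\<And>z. z \<in> torus_pts l \<Longrightarrow> f z = (\<Sum>e\<in>D. c e * monomial l e z)"
    using assms(1) by (auto simp: laurent_def)
  obtain D' c' where D': "finite D'" "D' \<subseteq> exponents l"
    "\<And>z. z \<in> torus_pts l \<Longrightarrow> g z = (\<Sum>e\<in>D'. c' e * monomial l e z)"
    using assms(2) by (auto simp: laurent_def)
  have "laurent l (\<lambda>z. \<Sum>e\<in>D. \<Sum>e'\<in>D'. (c e * c' e') * monomial l (\<lambda>j. e j + e' j) z)"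
    using D D' by (intro laurent_sum laurent_monomial) (auto simp: exponents_def subset_iff)
  moreover have "(\<Sum>e\<in>D. \<Sum>e'\<in>D'. (c e * c' e') * monomial l (\<lambda>j. e j + e' j) z) = f z * g z"
    if z: "z \<in> torus_pts l" for z
  proof -
    have "monomial l (\<lambda>j. e j + e' j) z = monomial l e z * monomial l e' z" for e e'
      unfolding monomial_def prod.distrib[symmetric]
      using torus_nonzero[OF z] by (intro prod.cong) (auto simp: power_int_add)
    thus ?thesis unfolding D(3)[OF z] D'(3)[OF z] sum_product by (simp add: mult_ac)
  qed
  ultimately show ?thesis by (rule laurent_cong)
qed

lemma laurent_const: "laurent l (\<lambda>z. c)"
  using laurent_monomial[of "\<lambda>_. 0" l c] by (simp add: exponents_def monomial_def)

lemma laurent_coordinate: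
  assumes "j < l"
  shows "laurent l (\<lambda>z. z j)" "laurent l (\<lambda>z. cnj (z j))"
proof -
  have *: "laurent l (\<lambda>z. z j powi m)" for m :: int
  proof (rule laurent_cong)
    show "laurent l (\<lambda>z. 1 * monomial l (\<lambda>i. if i = j then m else 0) z)"
      using assms by (intro laurent_monomial) (auto simp: exponents_def)
    fix z :: "nat \<Rightarrow> complex"
    have "monomial l (\<lambda>i. if i = j then m else 0) z = (\<Prod>i<l. if i = j then z j powi m else 1)"
      unfolding monomial_def by (intro prod.cong) auto
    also have "\<dots> = z j powi m" using assms by simp
    finally show "1 * monomial l (\<lambda>i. if i = j then m else 0) z = z j powi m" by simp
  qed
  show "laurent l (\<lambda>z. z j)" using *[of 1] by simp
  have "cnj (z j) = z j powi (- 1)" if "z \<in> torus_pts l" for z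
  proof -
    have "z j * cnj (z j) = 1" "z j \<noteq> 0"
      using torus_nonzero[OF that assms] by (auto simp: complex_norm_square[symmetric])
    thus ?thesis by (simp add: power_int_minus field_simps)
  qed
  thus "laurent l (\<lambda>z. cnj (z j))" using laurent_cong[OF *[of "- 1"]] by metis
qed

text \<open>The Stone-Weierstrass theorem is applied to the real-valued functions that are Laurent
  polynomials when viewed as complex ones; real and imaginary parts of the coordinates separate
  points.\<close>

lemma laurent_dense_real:
  fixes f :: "(nat \<Rightarrow> complex) \<Rightarrow> real"
  assumes "continuous_on (torus_pts l) f" "0 < \<epsilon>"
  obtains g where "laurent l g" "\<And>z. z \<in> torus_pts l \<Longrightarrow> cmod (complex_of_real (f z) - g z) < \<epsilon>"
proof -
  define R where "R = {f :: (nat \<Rightarrow> complex) \<Rightarrow> real. laurent l (\<lambda>z. complex_of_real (f z))}"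
  interpret function_ring_on R "torus_pts l"
  proof
    show "compact (torus_pts l)" by (rule compact_torus_pts)
    show "continuous_on (torus_pts l) f" if "f \<in> R" for f
    proof -
      have "continuous_on (torus_pts l) (\<lambda>z. complex_of_real (f z))"
        using that laurent_continuous[of l "\<lambda>z. complex_of_real (f z)"] by (simp add: R_def)
      hence "continuous_on (torus_pts l) (\<lambda>z. Re (complex_of_real (f z)))" by (rule continuous_on_Re)
      thus ?thesis by simp
    qed
    show "(\<lambda>x. f x + g x) \<in> R" "(\<lambda>x. f x * g x) \<in> R" if "f \<in> R" "g \<in> R" for f g
      using that by (auto simp: R_def laurent_add laurent_mult)
    show "(\<lambda>_. c) \<in> R" for c by (simp add: R_def laurent_const)
    fix x y :: "nat \<Rightarrow> complex" assume xy: "x \<in> torus_pts l" "y \<in> torus_pts l" "x \<noteq> y"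
    obtain j where j: "x j \<noteq> y j" using xy(3) by (meson ext)
    \<comment> \<open>Outside \<open>{..<l}\<close> both points take the value
      \<open>undefined\<close>, so they differ at a genuine coordinate.\<close>
    have "j < l" using j PiE_arb[OF xy(1), of j] PiE_arb[OF xy(2), of j] by (cases "j < l") simp_all
    have re: "(\<lambda>z. Re (z j)) \<in> R"
    proof -
      have "laurent l (\<lambda>z. complex_of_real (1/2) * (z j + cnj (z j)))"
        by (intro laurent_mult laurent_add laurent_coordinate laurent_const \<open>j < l\<close>)
      thus ?thesis by (simp add: R_def complex_add_cnj)
    qed
    have im: "(\<lambda>z. Im (z j)) \<in> R"
    proof -
      have "laurent l (\<lambda>z. - \<i> / 2 * (z j + - 1 * cnj (z j)))"
        by (intro laurent_mult laurent_add laurent_coordinate laurent_const \<open>j < l\<close>)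
      moreover have "- \<i> / 2 * (w + - 1 * cnj w) = complex_of_real (Im w)" for w
        by (simp add: complex_eq_iff)
      ultimately show ?thesis by (simp add: R_def)
    qed
    show "\<exists>f\<in>R. f x \<noteq> f y"
      using re im j complex_eq_iff by (metis (no_types, lifting))
  qed
  obtain g where g: "g \<in> R" "\<And>z. z \<in> torus_pts l \<Longrightarrow> \<bar>f z - g z\<bar> < \<epsilon>"
    using Stone_Weierstrass_basic[OF assms] by blast
  have "cmod (complex_of_real (f z) - complex_of_real (g z)) < \<epsilon>" if "z \<in> torus_pts l" for z
    using g(2)[OF that] by (metis norm_of_real of_real_diff)
  thus thesis using that[of "\<lambda>z. complex_of_real (g z)"] g(1) by (simp add: R_def)
qed

lemma laurent_dense:
  assumes f: "continuous_on (torus_pts l) f" and e: "0 < \<epsilon>"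
  obtains g where "laurent l g" "\<And>z. z \<in> torus_pts l \<Longrightarrow> cmod (f z - g z) < \<epsilon>"
proof -
  obtain g where g: "laurent l g" "\<And>z. z \<in> torus_pts l \<Longrightarrow> cmod (complex_of_real (Re (f z)) - g z) < \<epsilon> / 2"
    using laurent_dense_real[of l "\<lambda>z. Re (f z)" "\<epsilon> / 2"] e continuous_on_Re[OF f] by auto
  obtain h where h: "laurent l h" "\<And>z. z \<in> torus_pts l \<Longrightarrow> cmod (complex_of_real (Im (f z)) - h z) < \<epsilon> / 2"
    using laurent_dense_real[of l "\<lambda>z. Im (f z)" "\<epsilon> / 2"] e continuous_on_Im[OF f] by auto
  have "cmod (f z - (g z + \<i> * h z)) < \<epsilon>" if z: "z \<in> torus_pts l" for z
  proof -
    have eq: "f z - (g z + \<i> * h z) =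
        (complex_of_real (Re (f z)) - g z) + \<i> * (complex_of_real (Im (f z)) - h z)"
      by (subst complex_eq[of "f z"]) (simp add: algebra_simps)
    have "cmod (f z - (g z + \<i> * h z)) \<le>
        cmod (complex_of_real (Re (f z)) - g z) + cmod (complex_of_real (Im (f z)) - h z)"
      using norm_triangle_ineq[of "complex_of_real (Re (f z)) - g z" "\<i> * (complex_of_real (Im (f z)) - h z)"]
      unfolding eq norm_mult by simp
    thus ?thesis using g(2)[OF z] h(2)[OF z] by linarith
  qed
  moreover have "laurent l (\<lambda>z. g z + \<i> * h z)"
    by (intro laurent_add laurent_mult laurent_const g h)
  ultimately show thesis using that by blast
qed

section \<open>Completions\<close>

text \<open>\<open>conv X b\<close> stands for convergence of the images of the \<open>X n\<close>
  to \<open>b\<close>. Only Cauchy and null sequences are compared, so \<open>p\<close> may be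
  merely equivalent to the norm of \<open>B\<close>. A class of Cauchy sequences is then the set of
  all sequences with a given limit.\<close>

lemma completion_iso:
  fixes F :: "'b star_algebra" and B :: "'c star_algebra"
  assumes cauchy: "\<And>X. cauchy_seq F p X \<longleftrightarrow> (\<exists>b\<in>carrier B. conv X b)"
    and null: "\<And>X Y b b'. b \<in> carrier B \<Longrightarrow> b' \<in> carrier B \<Longrightarrow> conv X b \<Longrightarrow> conv Y b' \<Longrightarrow>
      ((\<lambda>n. p (sa_diff F (X n) (Y n))) \<longlonglongrightarrow> 0) \<longleftrightarrow> b = b'"
    and dense: "\<And>b. b \<in> carrier B \<Longrightarrow> \<exists>X. conv X b"
    and zero: "sa_zero B \<in> carrier B" "conv (\<lambda>n. sa_zero F) (sa_zero B)"
    and add: "\<And>X Y b b'. b \<in> carrier B \<Longrightarrow> b' \<in> carrier B \<Longrightarrow> conv X b \<Longrightarrow> conv Y b' \<Longrightarrow>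
      sa_add B b b' \<in> carrier B \<and> conv (\<lambda>n. sa_add F (X n) (Y n)) (sa_add B b b')"
    and scale: "\<And>X b c. b \<in> carrier B \<Longrightarrow> conv X b \<Longrightarrow>
      sa_scale B c b \<in> carrier B \<and> conv (\<lambda>n. sa_scale F c (X n)) (sa_scale B c b)"
    and mult: "\<And>X Y b b'. b \<in> carrier B \<Longrightarrow> b' \<in> carrier B \<Longrightarrow> conv X b \<Longrightarrow> conv Y b' \<Longrightarrow>
      sa_mult B b b' \<in> carrier B \<and> conv (\<lambda>n. sa_mult F (X n) (Y n)) (sa_mult B b b')"
    and star: "\<And>X b. b \<in> carrier B \<Longrightarrow> conv X b \<Longrightarrow>
      sa_star B b \<in> carrier B \<and> conv (\<lambda>n. sa_star F (X n)) (sa_star B b)"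
  obtains \<phi> where "star_iso B (completion F p) \<phi>" "\<phi> (sa_zero B) = sa_zero (completion F p)"
    "\<And>x b. b \<in> carrier B \<Longrightarrow> conv (\<lambda>n. x) b \<Longrightarrow> \<phi> b = cauchy_class F p (\<lambda>n. x)"
proof -
  define cl where "cl b = {Y. conv Y b}" for b
  have class_eq: "cauchy_class F p X = cl b" if "b \<in> carrier B" "conv X b" for X b
    using cauchy null that unfolding cauchy_class_def cl_def by blast
  have unique: "b = b'" if "b \<in> carrier B" "b' \<in> carrier B" "conv X b" "conv X b'" for X b b'
    using null[OF that(1,1,3,3)] null[OF that] by blast
  have inj: "inj_on cl (carrier B)"
  proof
    fix b b' assume b: "b \<in> carrier B" "b' \<in> carrier B" "cl b = cl b'"
    obtain X where X: "conv X b" using dense b(1) by blast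
    hence "conv X b'" using b(3) by (auto simp: cl_def)
    thus "b = b'" using unique b X by blast
  qed
  have car: "carrier (completion F p) = cl ` carrier B"
  proof -
    have "carrier (completion F p) = cauchy_class F p ` {X. cauchy_seq F p X}"
      by (simp add: completion_def)
    also have "\<dots> = cl ` carrier B"
    proof (intro equalityI subsetI)
      fix C assume "C \<in> cauchy_class F p ` {X. cauchy_seq F p X}"
      thus "C \<in> cl ` carrier B" using cauchy class_eq by blast
    next
      fix C assume "C \<in> cl ` carrier B"
      then obtain b where b: "b \<in> carrier B" "C = cl b" by blast
      then obtain X where X: "conv X b" using dense by blast
      hence "C = cauchy_class F p X" "cauchy_seq F p X" using cauchy class_eq b by blast+
      thus "C \<in> cauchy_class F p ` {X. cauchy_seq F p X}" by blast
    qed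
    finally show ?thesis .
  qed
  \<comment> \<open>The operations of the completion are unions over representatives;
    representatives exist and all of them give the same class, which is therefore the union.\<close>
  have un2: "(\<Union>X\<in>cl b. \<Union>Y\<in>cl b'. G X Y) = A"
    if "b \<in> carrier B" "b' \<in> carrier B" "\<And>X Y. conv X b \<Longrightarrow> conv Y b' \<Longrightarrow> G X Y = A" for b b' G A
    using dense[OF that(1)] dense[OF that(2)] that(3) unfolding cl_def by blast
  have un1: "(\<Union>X\<in>cl b. G X) = A" if "b \<in> carrier B" "\<And>X. conv X b \<Longrightarrow> G X = A" for b G A
    using dense[OF that(1)] that(2) unfolding cl_def by blast
  have add_cl: "sa_add (completion F p) (cl b) (cl b') = cl (sa_add B b b')"
    if b: "b \<in> carrier B" "b' \<in> carrier B" for b b'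
  proof -
    have "(\<Union>X\<in>cl b. \<Union>Y\<in>cl b'. cauchy_class F p (\<lambda>n. sa_add F (X n) (Y n))) = cl (sa_add B b b')"
    proof (rule un2[OF b])
      fix X Y assume "conv X b" "conv Y b'"
      thus "cauchy_class F p (\<lambda>n. sa_add F (X n) (Y n)) = cl (sa_add B b b')"
        using add[OF b] by (intro class_eq) auto
    qed
    thus ?thesis by (simp add: completion_def)
  qed
  have mult_cl: "sa_mult (completion F p) (cl b) (cl b') = cl (sa_mult B b b')"
    if b: "b \<in> carrier B" "b' \<in> carrier B" for b b'
  proof -
    have "(\<Union>X\<in>cl b. \<Union>Y\<in>cl b'. cauchy_class F p (\<lambda>n. sa_mult F (X n) (Y n))) = cl (sa_mult B b b')"
    proof (rule un2[OF b])
      fix X Y assume "conv X b" "conv Y b'"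
      thus "cauchy_class F p (\<lambda>n. sa_mult F (X n) (Y n)) = cl (sa_mult B b b')"
        using mult[OF b] by (intro class_eq) auto
    qed
    thus ?thesis by (simp add: completion_def)
  qed
  have scale_cl: "sa_scale (completion F p) c (cl b) = cl (sa_scale B c b)"
    if b: "b \<in> carrier B" for b c
  proof -
    have "(\<Union>X\<in>cl b. cauchy_class F p (\<lambda>n. sa_scale F c (X n))) = cl (sa_scale B c b)"
    proof (rule un1[OF b])
      fix X assume "conv X b"
      thus "cauchy_class F p (\<lambda>n. sa_scale F c (X n)) = cl (sa_scale B c b)"
        using scale[OF b] by (intro class_eq) auto
    qed
    thus ?thesis by (simp add: completion_def)
  qed
  have star_cl: "sa_star (completion F p) (cl b) = cl (sa_star B b)"
    if b: "b \<in> carrier B" for b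
  proof -
    have "(\<Union>X\<in>cl b. cauchy_class F p (\<lambda>n. sa_star F (X n))) = cl (sa_star B b)"
    proof (rule un1[OF b])
      fix X assume "conv X b"
      thus "cauchy_class F p (\<lambda>n. sa_star F (X n)) = cl (sa_star B b)"
        using star[OF b] by (intro class_eq) auto
    qed
    thus ?thesis by (simp add: completion_def)
  qed
  have "star_iso B (completion F p) cl"
    unfolding star_iso_def using inj by (simp add: bij_betw_def car add_cl mult_cl scale_cl star_cl)
  moreover have "cl (sa_zero B) = sa_zero (completion F p)"
    using class_eq[OF zero] by (simp add: completion_def)
  moreover have "cl b = cauchy_class F p (\<lambda>n. x)" if "b \<in> carrier B" "conv (\<lambda>n. x) b" for x b
    using class_eq[OF that] by simp
  ultimately show thesis using that by blast
qed

lemma cf_sel: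
  "f \<in> carrier (continuous_functions (torus l)) \<longleftrightarrow> f \<in> extensional (torus_pts l) \<and> continuous_on (torus_pts l) f"
  "sa_zero (continuous_functions (torus l)) = (\<lambda>x\<in>torus_pts l. 0)"
  "sa_add (continuous_functions (torus l)) f g = (\<lambda>x\<in>torus_pts l. f x + g x)"
  "sa_scale (continuous_functions (torus l)) c f = (\<lambda>x\<in>torus_pts l. c * f x)"
  "sa_mult (continuous_functions (torus l)) f g = (\<lambda>x\<in>torus_pts l. f x * g x)"
  "sa_star (continuous_functions (torus l)) f = (\<lambda>x\<in>torus_pts l. cnj (f x))"
  by (simp_all add: continuous_functions_def topspace_torus continuous_map_torus_iff)

lemma cf_restrict: "continuous_on (torus_pts l) f \<Longrightarrow> restrict f (torus_pts l) \<in> carrier (continuous_functions (torus l))"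
  unfolding cf_sel by (auto cong: continuous_on_cong)

lemma cf_monoid:
  "comm_monoid \<lparr>carrier = carrier (continuous_functions (torus l)), mult = sa_add (continuous_functions (torus l)),
    one = sa_zero (continuous_functions (torus l))\<rparr>"
proof
  let ?C = "carrier (continuous_functions (torus l))"
  fix f g h
  assume "f \<in> carrier \<lparr>carrier = ?C, mult = sa_add (continuous_functions (torus l)), one = sa_zero (continuous_functions (torus l))\<rparr>"
    "g \<in> carrier \<lparr>carrier = ?C, mult = sa_add (continuous_functions (torus l)), one = sa_zero (continuous_functions (torus l))\<rparr>"
    "h \<in> carrier \<lparr>carrier = ?C, mult = sa_add (continuous_functions (torus l)), one = sa_zero (continuous_functions (torus l))\<rparr>"
  hence fgh: "f \<in> ?C" "g \<in> ?C" "h \<in> ?C" by auto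
  show "mult \<lparr>carrier = ?C, mult = sa_add (continuous_functions (torus l)), one = sa_zero (continuous_functions (torus l))\<rparr> f g
      \<in> carrier \<lparr>carrier = ?C, mult = sa_add (continuous_functions (torus l)), one = sa_zero (continuous_functions (torus l))\<rparr>"
    using fgh by (simp add: cf_sel(3)) (intro cf_restrict continuous_on_add; simp add: cf_sel(1))
qed (auto simp: cf_sel fun_eq_iff extensional_def algebra_simps cong: continuous_on_cong)

lemma cf_sum:
  assumes "finite I" "\<And>i. i \<in> I \<Longrightarrow> f i \<in> carrier (continuous_functions (torus l))"
  shows "sa_sum (continuous_functions (torus l)) f I = (\<lambda>x\<in>torus_pts l. \<Sum>i\<in>I. f i x)"
  using assms
proof (induction I)
  case empty
  have "sa_sum (continuous_functions (torus l)) f {} = sa_zero (continuous_functions (torus l))"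
    using comm_monoid.finprod_empty[OF cf_monoid[of l]] by (simp add: sa_sum_def)
  thus ?case by (simp only: cf_sel(2) sum.empty)
next
  case (insert i I)
  let ?M = "\<lparr>carrier = carrier (continuous_functions (torus l)), mult = sa_add (continuous_functions (torus l)),
    one = sa_zero (continuous_functions (torus l))\<rparr>"
  have "f \<in> I \<rightarrow> carrier ?M" "f i \<in> carrier ?M" using insert by auto
  hence "sa_sum (continuous_functions (torus l)) f (insert i I) =
      sa_add (continuous_functions (torus l)) (f i) (sa_sum (continuous_functions (torus l)) f I)"
    unfolding sa_sum_def using comm_monoid.finprod_insert[OF cf_monoid insert(1,2)] by simp
  thus ?case using insert by (auto simp: cf_sel(3) fun_eq_iff)
qed

context no_entrance_graph
begin

lemma graph_norm_nonneg:
  assumes f: "f \<in> carrier (free_alg P)"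
  shows "0 \<le> graph_norm f"
proof -
  let ?A = "{p. cstar_seminorm (free_alg P) p \<and> (\<forall>r\<in>graph_relations \<Lambda>. p r = 0)}"
  have "(\<lambda>_. 0) \<in> ?A" by (simp add: cstar_seminorm_def)
  moreover have "bdd_above ((\<lambda>p. p f) ` ?A)"
    using seminorm_le_ev[OF _ _ f ev_bounded_l1]
    by (intro bdd_aboveI[of _ "real (Suc (card X)) * (\<Sum>w\<in>supp f. cmod (f w))"]) (auto simp: sum_nonneg)
  ultimately have "(\<lambda>_. 0) f \<le> graph_norm f"
    unfolding graph_norm_def universal_seminorm_def by (rule cSUP_upper)
  thus ?thesis by simp
qed

end

lemma small_radius:
  fixes e :: real
  assumes "0 < e"
  obtains \<delta> where "0 < \<delta>" "real (Suc n) * (2 * \<delta>) < e"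
proof -
  define C where "C = real (Suc n)"
  have C: "0 < C" unfolding C_def by (rule of_nat_0_less_iff[THEN iffD2, OF zero_less_Suc])
  have "C * (2 * (e / (4 * C))) = e / 2" using C by simp
  thus thesis using that[of "e / (4 * C)"] C assms unfolding C_def[symmetric] by simp
qed

section \<open>The direct sum of matrix algebras over tori\<close>

text \<open>The index set is kept abstract, so that it can later be the set of classes of initial
  cycles over which the direct sum is formed.\<close>

locale component_index = no_entrance_graph \<Lambda>
  for \<Lambda> :: "('a, 'k::finite) kgraph" +
  fixes I :: "'c set" and comp_of :: "'c \<Rightarrow> 'a set"
  assumes comp_bij: "bij_betw comp_of I components"
begin

abbreviation "rk c \<equiv> rank_of (comp_of c)"
abbreviation "blk c \<equiv> block (comp_of c)"
abbreviation "CT c \<equiv> continuous_functions (torus (rk c))"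
abbreviation "F \<equiv> free_alg P"

definition model :: "('c \<Rightarrow> 'a \<times> 'a \<Rightarrow> (nat \<Rightarrow> complex) \<Rightarrow> complex) star_algebra" where
  "model = direct_sum I (\<lambda>c. matrix_algebra (blk c) (CT c))"

lemma comp_in: "c \<in> I \<Longrightarrow> comp_of c \<in> components"
  using comp_bij bij_betwE by blast

lemma model_carrier:
  "b \<in> carrier model \<longleftrightarrow> b \<in> (\<Pi>\<^sub>E c\<in>I. blk c \<times> blk c \<rightarrow>\<^sub>E carrier (CT c))"
  by (simp add: model_def direct_sum_def matrix_algebra_def)

lemma model_entry:
  assumes "b \<in> carrier model" "c \<in> I" "i \<in> blk c" "j \<in> blk c"
  shows "b c (i, j) \<in> carrier (CT c)"
proof -
  have "b c \<in> blk c \<times> blk c \<rightarrow>\<^sub>E carrier (CT c)" using assms by (auto simp: model_carrier)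
  thus ?thesis using assms by auto
qed

lemma model_eqI:
  assumes "b \<in> carrier model" "b' \<in> carrier model"
    "\<And>c i j z. c \<in> I \<Longrightarrow> i \<in> blk c \<Longrightarrow> j \<in> blk c \<Longrightarrow> z \<in> torus_pts (rk c) \<Longrightarrow> b c (i, j) z = b' c (i, j) z"
  shows "b = b'"
proof (rule PiE_ext[OF assms(1,2)[unfolded model_carrier]])
  fix c assume c: "c \<in> I"
  show "b c = b' c"
  proof (rule PiE_ext)
    show "b c \<in> blk c \<times> blk c \<rightarrow>\<^sub>E carrier (CT c)" "b' c \<in> blk c \<times> blk c \<rightarrow>\<^sub>E carrier (CT c)"
      using PiE_mem[OF assms(1)[unfolded model_carrier] c] PiE_mem[OF assms(2)[unfolded model_carrier] c] .
    fix ij assume "ij \<in> blk c \<times> blk c"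
    then obtain i j where ij: "ij = (i, j)" "i \<in> blk c" "j \<in> blk c" by auto
    have "b c (i, j) \<in> extensional (torus_pts (rk c))" "b' c (i, j) \<in> extensional (torus_pts (rk c))"
      using model_entry[OF assms(1) c ij(2,3)] model_entry[OF assms(2) c ij(2,3)] by (auto simp: cf_sel(1))
    thus "b c ij = b' c ij" unfolding ij(1) by (rule extensionalityI) (rule assms(3)[OF c ij(2,3)])
  qed
qed

text \<open>Extensional in every argument, hence in the carrier as soon as the functions are
  continuous; the operations of \<open>model\<close> become pointwise formulas in
  \<open>model_ops\<close>.\<close>

definition mk :: "('c \<Rightarrow> 'a \<Rightarrow> 'a \<Rightarrow> (nat \<Rightarrow> complex) \<Rightarrow> complex) \<Rightarrow>
    'c \<Rightarrow> 'a \<times> 'a \<Rightarrow> (nat \<Rightarrow> complex) \<Rightarrow> complex" where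
  "mk g = (\<lambda>c\<in>I. \<lambda>(i, j)\<in>blk c \<times> blk c. \<lambda>z\<in>torus_pts (rk c). g c i j z)"

lemma mk_apply [simp]:
  "c \<in> I \<Longrightarrow> i \<in> blk c \<Longrightarrow> j \<in> blk c \<Longrightarrow> z \<in> torus_pts (rk c) \<Longrightarrow> mk g c (i, j) z = g c i j z"
  by (simp add: mk_def)

lemma mk_carrier:
  assumes "\<And>c i j. c \<in> I \<Longrightarrow> i \<in> blk c \<Longrightarrow> j \<in> blk c \<Longrightarrow> continuous_on (torus_pts (rk c)) (g c i j)"
  shows "mk g \<in> carrier model"
  unfolding model_carrier mk_def using assms
  by (intro restrict_PiE_iff[THEN iffD2] ballI) (auto intro: cf_restrict)

lemma model_continuous:
  "b \<in> carrier model \<Longrightarrow> c \<in> I \<Longrightarrow> i \<in> blk c \<Longrightarrow> j \<in> blk c \<Longrightarrow> continuous_on (torus_pts (rk c)) (b c (i, j))"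
  using model_entry by (auto simp: cf_sel(1))

lemma model_ops:
  assumes "b \<in> carrier model" "b' \<in> carrier model"
  shows "sa_add model b b' = mk (\<lambda>c i j z. b c (i, j) z + b' c (i, j) z)"
    "sa_scale model x b = mk (\<lambda>c i j z. x * b c (i, j) z)"
    "sa_mult model b b' = mk (\<lambda>c i j z. \<Sum>l\<in>blk c. b c (i, l) z * b' c (l, j) z)"
    "sa_star model b = mk (\<lambda>c i j z. cnj (b c (j, i) z))"
    "sa_zero model = mk (\<lambda>c i j z. 0)"
proof -
  show "sa_add model b b' = mk (\<lambda>c i j z. b c (i, j) z + b' c (i, j) z)"
    "sa_scale model x b = mk (\<lambda>c i j z. x * b c (i, j) z)"
    "sa_star model b = mk (\<lambda>c i j z. cnj (b c (j, i) z))"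
    "sa_zero model = mk (\<lambda>c i j z. 0)"
    by (auto simp: model_def direct_sum_def matrix_algebra_def mk_def cf_sel fun_eq_iff)
  have "sa_sum (CT c) (\<lambda>l. sa_mult (CT c) (b c (i, l)) (b' c (l, j))) (blk c) =
      (\<lambda>z\<in>torus_pts (rk c). \<Sum>l\<in>blk c. b c (i, l) z * b' c (l, j) z)"
    if "c \<in> I" "i \<in> blk c" "j \<in> blk c" for c i j
  proof -
    have "sa_mult (CT c) (b c (i, l)) (b' c (l, j)) \<in> carrier (CT c)" if "l \<in> blk c" for l
      unfolding cf_sel(5) using model_continuous[OF assms(1)] model_continuous[OF assms(2)] that
        \<open>c \<in> I\<close> \<open>i \<in> blk c\<close> \<open>j \<in> blk c\<close>
      by (intro cf_restrict continuous_on_mult) auto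
    thus ?thesis using cf_sum[OF finite_block] by (auto simp: cf_sel(5) fun_eq_iff)
  qed
  thus "sa_mult model b b' = mk (\<lambda>c i j z. \<Sum>l\<in>blk c. b c (i, l) z * b' c (l, j) z)"
    by (auto simp: model_def direct_sum_def matrix_algebra_def mk_def fun_eq_iff)
qed

lemma model_closed:
  assumes "b \<in> carrier model" "b' \<in> carrier model"
  shows "sa_add model b b' \<in> carrier model" "sa_scale model x b \<in> carrier model"
    "sa_mult model b b' \<in> carrier model" "sa_star model b \<in> carrier model" "sa_zero model \<in> carrier model"
  unfolding model_ops[OF assms]
  by (intro mk_carrier continuous_intros model_continuous assms; assumption)+

definition close :: "real \<Rightarrow> 'a star_poly \<Rightarrow> ('c \<Rightarrow> 'a \<times> 'a \<Rightarrow> (nat \<Rightarrow> complex) \<Rightarrow> complex) \<Rightarrow> bool" where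
  "close e f b \<longleftrightarrow> (\<forall>c\<in>I. \<forall>z\<in>torus_pts (rk c). \<forall>i\<in>blk c. \<forall>j\<in>blk c.
     cmod (ev (comp_of c) z f i j - b c (i, j) z) \<le> e)"

text \<open>Uniform convergence of the matrix entries over all blocks and tori.\<close>

definition conv :: "(nat \<Rightarrow> 'a star_poly) \<Rightarrow> ('c \<Rightarrow> 'a \<times> 'a \<Rightarrow> (nat \<Rightarrow> complex) \<Rightarrow> complex) \<Rightarrow> bool" where
  "conv U b \<longleftrightarrow> (\<forall>n. U n \<in> carrier F) \<and> (\<forall>e>0. \<exists>N. \<forall>n\<ge>N. close e (U n) b)"

lemma closeD:
  "close e f b \<Longrightarrow> c \<in> I \<Longrightarrow> z \<in> torus_pts (rk c) \<Longrightarrow> i \<in> blk c \<Longrightarrow> j \<in> blk c \<Longrightarrow>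
    cmod (ev (comp_of c) z f i j - b c (i, j) z) \<le> e"
  by (simp add: close_def)

lemma ev_bounded_iff:
  "ev_bounded S f \<longleftrightarrow> (\<forall>c\<in>I. \<forall>z\<in>torus_pts (rk c). \<forall>i\<in>blk c. \<forall>j\<in>blk c. cmod (ev (comp_of c) z f i j) \<le> S)"
  unfolding ev_bounded_def bij_betw_imp_surj_on[OF comp_bij, symmetric] by blast

lemma fin: "f \<in> carrier F \<Longrightarrow> finite (supp f)"
  by (simp add: carrier_free)

lemma ev_continuous: "finite (supp f) \<Longrightarrow> continuous_on (torus_pts (rank_of R)) (\<lambda>z. ev R z f i j)"
  unfolding ev_def lin_def entry_def character_def monomial_def[symmetric]
proof (intro continuous_on_sum continuous_on_mult continuous_on_const)
  fix w
  show "continuous_on (torus_pts (rank_of R))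
      (\<lambda>z. if run w j i then monomial (rank_of R) (coords R (twist (word_deg w) j i)) z else 0)"
    by (cases "run w j i") (simp_all add: continuous_on_monomial)
qed

lemma close_diff:
  assumes "close e f b" "close e' g b" "f \<in> carrier F" "g \<in> carrier F"
  shows "ev_bounded (e + e') (\<lambda>w. f w - g w)"
  unfolding ev_bounded_iff
proof (intro ballI)
  fix c z i j assume h: "c \<in> I" "z \<in> torus_pts (rk c)" "i \<in> blk c" "j \<in> blk c"
  have eq: "ev (comp_of c) z (\<lambda>w. f w - g w) i j =
      (ev (comp_of c) z f i j - b c (i, j) z) - (ev (comp_of c) z g i j - b c (i, j) z)"
    using ev_linear(2)[OF fin[OF assms(3)] fin[OF assms(4)]] by simp
  show "cmod (ev (comp_of c) z (\<lambda>w. f w - g w) i j) \<le> e + e'"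
    unfolding eq using norm_triangle_ineq4[of "ev (comp_of c) z f i j - b c (i, j) z" "ev (comp_of c) z g i j - b c (i, j) z"]
      closeD[OF assms(1) h] closeD[OF assms(2) h] by linarith
qed

lemma close_add:
  assumes "close e f b" "close e' g b'" "f \<in> carrier F" "g \<in> carrier F" "b \<in> carrier model" "b' \<in> carrier model"
  shows "close (e + e') (\<lambda>w. f w + g w) (sa_add model b b')"
  unfolding close_def model_ops(1)[OF assms(5,6)]
proof (intro ballI)
  fix c z i j assume h: "c \<in> I" "z \<in> torus_pts (rk c)" "i \<in> blk c" "j \<in> blk c"
  show "cmod (ev (comp_of c) z (\<lambda>w. f w + g w) i j -
      mk (\<lambda>c i j z. b c (i, j) z + b' c (i, j) z) c (i, j) z) \<le> e + e'"
    using norm_triangle_ineq[of "ev (comp_of c) z f i j - b c (i, j) z" "ev (comp_of c) z g i j - b' c (i, j) z"]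
      closeD[OF assms(1) h] closeD[OF assms(2) h] h ev_linear(1)[OF fin[OF assms(3)] fin[OF assms(4)]]
    by (simp add: algebra_simps)
qed

lemma close_scale:
  assumes "close e f b" "f \<in> carrier F" "b \<in> carrier model"
  shows "close (cmod x * e) (\<lambda>w. x * f w) (sa_scale model x b)"
  unfolding close_def model_ops(2)[OF assms(3,3)]
proof (intro ballI)
  fix c z i j assume h: "c \<in> I" "z \<in> torus_pts (rk c)" "i \<in> blk c" "j \<in> blk c"
  have "cmod (x * (ev (comp_of c) z f i j - b c (i, j) z)) \<le> cmod x * e"
    unfolding norm_mult by (intro mult_left_mono closeD[OF assms(1) h]) simp
  thus "cmod (ev (comp_of c) z (\<lambda>w. x * f w) i j - mk (\<lambda>c i j z. x * b c (i, j) z) c (i, j) z) \<le> cmod x * e"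
    using h ev_linear(3)[OF fin[OF assms(2)] fin[OF assms(2)]] by (simp add: right_diff_distrib)
qed

lemma close_star:
  assumes "close e f b" "f \<in> carrier F" "b \<in> carrier model"
  shows "close e (fstar f) (sa_star model b)"
  unfolding close_def model_ops(4)[OF assms(3,3)]
proof (intro ballI)
  fix c z i j assume h: "c \<in> I" "z \<in> torus_pts (rk c)" "i \<in> blk c" "j \<in> blk c"
  have "cmod (cnj (ev (comp_of c) z f j i - b c (j, i) z)) \<le> e"
    unfolding complex_mod_cnj by (rule closeD[OF assms(1) h(1,2,4,3)])
  thus "cmod (ev (comp_of c) z (fstar f) i j - mk (\<lambda>c i j z. cnj (b c (j, i) z)) c (i, j) z) \<le> e"
    using h ev_fstar[OF h(2,4,3) fin[OF assms(2)]] by simp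
qed

text \<open>Telescope \<open>f g - b b'\<close> into \<open>(f - b) g\<close> and
  \<open>b (g - b')\<close>. The assumption \<open>close K' (\<lambda>w. 0) b\<close> says that the
  entries of \<open>b\<close> are bounded by \<open>K'\<close>.\<close>

lemma close_mult:
  assumes "close e f b" "close e g b'" "f \<in> carrier F" "g \<in> carrier F" "b \<in> carrier model" "b' \<in> carrier model"
    and K: "ev_bounded K g" "close K' (\<lambda>w. 0) b" and e: "0 \<le> e"
  shows "close (real (card X) * (e * (K + K'))) (fmul f g) (sa_mult model b b')"
  unfolding close_def model_ops(3)[OF assms(5,6)]
proof (intro ballI)
  fix c z i j assume h: "c \<in> I" "z \<in> torus_pts (rk c)" "i \<in> blk c" "j \<in> blk c"
  let ?f = "ev (comp_of c) z f" and ?g = "ev (comp_of c) z g"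
  have K0: "0 \<le> K" using K(1) h norm_ge_zero order_trans unfolding ev_bounded_iff by metis
  have tm: "cmod (?f i l * ?g l j - b c (i, l) z * b' c (l, j) z) \<le> e * (K + K')" if l: "l \<in> blk c" for l
  proof -
    have 1: "cmod (?f i l - b c (i, l) z) \<le> e" by (rule closeD[OF assms(1) h(1-3) l])
    have 2: "cmod (?g l j - b' c (l, j) z) \<le> e" by (rule closeD[OF assms(2) h(1,2) l h(4)])
    have 3: "cmod (?g l j) \<le> K" using K(1) h l by (simp add: ev_bounded_iff)
    have 4: "cmod (b c (i, l) z) \<le> K'"
      using closeD[OF K(2) h(1-3) l] by (simp add: ev_def lin_zero)
    have "?f i l * ?g l j - b c (i, l) z * b' c (l, j) z =
        (?f i l - b c (i, l) z) * ?g l j + b c (i, l) z * (?g l j - b' c (l, j) z)"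
      by (simp add: algebra_simps)
    hence "cmod (?f i l * ?g l j - b c (i, l) z * b' c (l, j) z) \<le>
        cmod (?f i l - b c (i, l) z) * cmod (?g l j) + cmod (b c (i, l) z) * cmod (?g l j - b' c (l, j) z)"
      using norm_triangle_ineq by (metis norm_mult)
    also have "\<dots> \<le> e * K + K' * e"
      using 1 2 3 4 e K0 order_trans[OF norm_ge_zero 4] by (intro add_mono mult_mono) auto
    finally show ?thesis by (simp add: algebra_simps)
  qed
  have KK: "0 \<le> K + K'" using K0 order_trans[OF norm_ge_zero closeD[OF K(2) h]] by simp
  have "cmod ((\<Sum>l\<in>blk c. ?f i l * ?g l j) - (\<Sum>l\<in>blk c. b c (i, l) z * b' c (l, j) z)) \<le>
      (\<Sum>l\<in>blk c. e * (K + K'))"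
    unfolding sum_subtractf[symmetric] by (intro order_trans[OF norm_sum] sum_mono tm)
  also have "\<dots> = real (card (blk c)) * (e * (K + K'))" by simp
  also have "\<dots> \<le> real (card X) * (e * (K + K'))"
    using KK e card_mono[OF finite_X, of "blk c"] by (intro mult_right_mono) (auto simp: block_def)
  finally show "cmod (ev (comp_of c) z (fmul f g) i j -
      mk (\<lambda>c i j z. \<Sum>l\<in>blk c. b c (i, l) z * b' c (l, j) z) c (i, j) z) \<le> real (card X) * (e * (K + K'))"
    using h ev_fmul[OF h(2,4) fin[OF assms(3)] fin[OF assms(4)]] by simp
qed

text \<open>One approximant within distance 1 suffices, as its entries are bounded by the sum of its
  absolute coefficients.\<close>

lemma conv_unique_bound:
  assumes "conv U b"
  obtains K where "0 \<le> K" "close K (\<lambda>w. 0) b"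
proof -
  obtain N where N: "close 1 (U N) b" using assms unfolding conv_def by (meson order_refl zero_less_one)
  define K where "K = (\<Sum>w\<in>supp (U N). cmod (U N w))"
  have "close (1 + K) (\<lambda>w. 0) b"
    unfolding close_def
  proof (intro ballI)
    fix c z i j assume h: "c \<in> I" "z \<in> torus_pts (rk c)" "i \<in> blk c" "j \<in> blk c"
    have "cmod (ev (comp_of c) z (U N) i j) \<le> K"
      using ev_bounded_l1[of "U N"] h unfolding ev_bounded_iff K_def by blast
    hence "cmod (b c (i, j) z) \<le> 1 + K"
      using closeD[OF N h] norm_triangle_ineq3[of "ev (comp_of c) z (U N) i j" "b c (i, j) z"] by linarith
    thus "cmod (ev (comp_of c) z (\<lambda>w. 0) i j - b c (i, j) z) \<le> 1 + K" by (simp add: ev_def lin_zero)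
  qed
  moreover have "0 \<le> 1 + K" by (simp add: K_def sum_nonneg)
  ultimately show thesis using that by blast
qed

lemma conv_add:
  assumes "b \<in> carrier model" "b' \<in> carrier model" "conv U b" "conv V b'"
  shows "conv (\<lambda>n. sa_add F (U n) (V n)) (sa_add model b b')"
  unfolding conv_def free_sel(3)
proof (intro conjI allI impI)
  show "(\<lambda>w. U n w + V n w) \<in> carrier F" for n using assms by (intro free_closed) (auto simp: conv_def)
  fix e :: real assume "0 < e"
  hence "0 < e / 2" by simp
  then obtain N M where "\<forall>n\<ge>N. close (e / 2) (U n) b" "\<forall>n\<ge>M. close (e / 2) (V n) b'"
    using assms(3,4) unfolding conv_def by meson
  moreover have "close (e / 2 + e / 2) (\<lambda>w. U n w + V n w) (sa_add model b b')"
    if "close (e / 2) (U n) b" "close (e / 2) (V n) b'" for n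
    using assms that by (intro close_add) (auto simp: conv_def)
  ultimately have "\<forall>n\<ge>max N M. close e (\<lambda>w. U n w + V n w) (sa_add model b b')" by simp
  thus "\<exists>N. \<forall>n\<ge>N. close e (\<lambda>w. U n w + V n w) (sa_add model b b')" by blast
qed

lemma close_mono: "close e f b \<Longrightarrow> e \<le> e' \<Longrightarrow> close e' f b"
  unfolding close_def by (meson order_trans)

lemma conv_scale:
  assumes "b \<in> carrier model" "conv U b"
  shows "conv (\<lambda>n. sa_scale F x (U n)) (sa_scale model x b)"
  unfolding conv_def free_sel(4)
proof (intro conjI allI impI)
  show "(\<lambda>w. x * U n w) \<in> carrier F" for n using assms by (intro free_closed) (auto simp: conv_def)
  fix e :: real assume e: "0 < e"
  hence "0 < e / (cmod x + 1)" by (simp add: add_nonneg_pos)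
  then obtain N where N: "\<forall>n\<ge>N. close (e / (cmod x + 1)) (U n) b"
    using assms(2) unfolding conv_def by meson
  have "cmod x * (e / (cmod x + 1)) \<le> e"
    using e norm_ge_zero[of x] by (simp add: divide_le_eq add_nonneg_pos)
  hence "\<forall>n\<ge>N. close e (\<lambda>w. x * U n w) (sa_scale model x b)"
    using N assms close_scale close_mono by (meson conv_def)
  thus "\<exists>N. \<forall>n\<ge>N. close e (\<lambda>w. x * U n w) (sa_scale model x b)" by blast
qed

lemma conv_star:
  assumes "b \<in> carrier model" "conv U b"
  shows "conv (\<lambda>n. sa_star F (U n)) (sa_star model b)"
  using assms close_star free_closed(5) unfolding conv_def free_sel(6) by meson

lemma conv_mult:
  assumes "b \<in> carrier model" "b' \<in> carrier model" "conv U b" "conv V b'"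
  shows "conv (\<lambda>n. sa_mult F (U n) (V n)) (sa_mult model b b')"
  unfolding conv_def free_sel(5)
proof (intro conjI allI impI)
  have UV: "U n \<in> carrier F" "V n \<in> carrier F" for n using assms by (auto simp: conv_def)
  show "fmul (U n) (V n) \<in> carrier F" for n using UV by (intro free_closed)
  fix e :: real assume e: "0 < e"
  obtain K where K: "0 \<le> K" "close K (\<lambda>w. 0) b" using conv_unique_bound[OF assms(3)] .
  obtain K' where K': "0 \<le> K'" "close K' (\<lambda>w. 0) b'" using conv_unique_bound[OF assms(4)] .
  \<comment> \<open>\<open>L - 1\<close> is the factor of \<open>\<delta>\<close> in the bound from
    \<open>close_mult\<close>, and the added 1 permits division by \<open>L\<close>. Capping
    \<open>\<delta>\<close> at 1 keeps the entries of \<open>V n\<close> below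
    \<open>1 + K'\<close>.\<close>
  define L where "L = real (card X) * (1 + K' + K) + 1"
  have L: "1 \<le> L" using K K' by (simp add: L_def)
  define \<delta> where "\<delta> = min 1 (e / L)"
  have \<delta>: "0 < \<delta>" "\<delta> \<le> 1" "\<delta> * L \<le> e" using e L by (auto simp: \<delta>_def min_def field_simps)
  obtain N where N: "\<And>n. n \<ge> N \<Longrightarrow> close \<delta> (U n) b" using assms(3) \<delta>(1) unfolding conv_def by meson
  obtain M where M: "\<And>n. n \<ge> M \<Longrightarrow> close \<delta> (V n) b'" using assms(4) \<delta>(1) unfolding conv_def by meson
  have "close e (fmul (U n) (V n)) (sa_mult model b b')" if n: "n \<ge> max N M" for n
  proof (rule close_mono)
    have "ev_bounded (1 + K') (V n)"
      unfolding ev_bounded_iff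
    proof (intro ballI)
      fix c z i j assume h: "c \<in> I" "z \<in> torus_pts (rk c)" "i \<in> blk c" "j \<in> blk c"
      have "cmod (b' c (i, j) z) \<le> K'" using closeD[OF K'(2) h] by (simp add: ev_def lin_zero)
      thus "cmod (ev (comp_of c) z (V n) i j) \<le> 1 + K'"
        using closeD[OF M h, of n] n \<delta>(2) norm_triangle_ineq2[of "ev (comp_of c) z (V n) i j" "b' c (i, j) z"]
        by simp
    qed
    thus "close (real (card X) * (\<delta> * ((1 + K') + K))) (fmul (U n) (V n)) (sa_mult model b b')"
      using N[of n] M[of n] n \<delta>(1) by (intro close_mult UV assms K) auto
    have "real (card X) * (\<delta> * ((1 + K') + K)) = \<delta> * (L - 1)" by (simp add: L_def mult_ac)
    thus "real (card X) * (\<delta> * ((1 + K') + K)) \<le> e" using \<delta> by (simp add: right_diff_distrib)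
  qed
  thus "\<exists>N. \<forall>n\<ge>N. close e (fmul (U n) (V n)) (sa_mult model b b')" by blast
qed

lemma conv_zero: "conv (\<lambda>n. sa_zero F) (sa_zero model)"
  unfolding conv_def model_ops(5)[OF mk_carrier mk_carrier, of "\<lambda>_ _ _ _. 0" "\<lambda>_ _ _ _. 0", simplified] free_sel(2)
  by (auto simp: free_zero_closed close_def ev_def lin_zero)

lemma conv_const:
  assumes "f \<in> carrier F"
  shows "mk (\<lambda>c i j z. ev (comp_of c) z f i j) \<in> carrier model"
    "conv (\<lambda>n. f) (mk (\<lambda>c i j z. ev (comp_of c) z f i j))"
  using ev_continuous[OF fin[OF assms]] assms by (auto intro: mk_carrier simp: conv_def close_def)

lemma norm_ev_diff_le:
  assumes "f \<in> carrier F" "g \<in> carrier F" "c \<in> I" "z \<in> torus_pts (rk c)" "i \<in> blk c" "j \<in> blk c"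
  shows "cmod (ev (comp_of c) z f i j - ev (comp_of c) z g i j) \<le> graph_norm (\<lambda>w. f w - g w)"
  using norm_ev_le_graph_norm[OF free_closed(2)[OF assms(1,2)] comp_in[OF assms(3)] assms(4,6,5)]
    ev_linear(2)[OF fin[OF assms(1)] fin[OF assms(2)]] by simp

lemma graph_norm_diff_le:
  assumes "close e f b" "close e g b" "f \<in> carrier F" "g \<in> carrier F" "0 \<le> e"
  shows "graph_norm (\<lambda>w. f w - g w) \<le> real (Suc (card X)) * (2 * e)"
  using graph_norm_le[OF free_closed(2)[OF assms(3,4)] close_diff[OF assms(1-4)]] assms(5) by simp

text \<open>The universal seminorm dominates every entry at every point, so the entries are
  uniformly Cauchy and their limits are continuous.\<close>

lemma cauchy_imp_conv:
  assumes U: "cauchy_seq F graph_norm U"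
  shows "\<exists>b\<in>carrier model. conv U b"
proof -
  have Uc: "U n \<in> carrier F" for n using U by (simp add: cauchy_seq_def)
  define u where "u c i j z n = ev (comp_of c) z (U n) i j" for c i j z n
  have unif: "\<exists>N. \<forall>m\<ge>N. \<forall>n\<ge>N. \<forall>c\<in>I. \<forall>z\<in>torus_pts (rk c). \<forall>i\<in>blk c. \<forall>j\<in>blk c.
      cmod (u c i j z m - u c i j z n) < e" if "0 < e" for e
  proof -
    obtain N where N: "\<And>m n. m \<ge> N \<Longrightarrow> n \<ge> N \<Longrightarrow> graph_norm (\<lambda>w. U m w - U n w) < e"
      using U \<open>0 < e\<close> unfolding cauchy_seq_def free_diff by blast
    show ?thesis
      unfolding u_def using N norm_ev_diff_le[OF Uc Uc] by (intro exI[of _ N]) (meson order_le_less_trans)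
  qed
  define b0 where "b0 c i j z = lim (u c i j z)" for c i j z
  have lim: "u c i j z \<longlonglongrightarrow> b0 c i j z"
    if "c \<in> I" "z \<in> torus_pts (rk c)" "i \<in> blk c" "j \<in> blk c" for c i j z
  proof -
    have "Cauchy (u c i j z)"
      unfolding Cauchy_def dist_norm using unif that by meson
    thus ?thesis unfolding b0_def by (simp add: Cauchy_convergent convergent_LIMSEQ_iff[symmetric])
  qed
  have close: "\<exists>N. \<forall>n\<ge>N. \<forall>c\<in>I. \<forall>z\<in>torus_pts (rk c). \<forall>i\<in>blk c. \<forall>j\<in>blk c.
      cmod (u c i j z n - b0 c i j z) \<le> e" if e0: "0 < e" for e
  proof -
    obtain N where N: "\<And>m n c i j z. m \<ge> N \<Longrightarrow> n \<ge> N \<Longrightarrow> c \<in> I \<Longrightarrow> z \<in> torus_pts (rk c) \<Longrightarrow>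
        i \<in> blk c \<Longrightarrow> j \<in> blk c \<Longrightarrow> cmod (u c i j z n - u c i j z m) < e"
      using unif[OF e0] by meson
    have "cmod (u c i j z n - b0 c i j z) \<le> e"
      if h: "n \<ge> N" "c \<in> I" "z \<in> torus_pts (rk c)" "i \<in> blk c" "j \<in> blk c" for n c i j z
    proof (rule LIMSEQ_le_const2)
      show "(\<lambda>m. cmod (u c i j z n - u c i j z m)) \<longlonglongrightarrow> cmod (u c i j z n - b0 c i j z)"
        by (intro tendsto_norm tendsto_diff tendsto_const lim h)
      show "\<exists>N. \<forall>m\<ge>N. cmod (u c i j z n - u c i j z m) \<le> e"
        using N[OF _ h] less_imp_le by blast
    qed
    thus ?thesis by blast
  qed
  have "mk b0 \<in> carrier model"
  proof (rule mk_carrier)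
    fix c i j assume h: "c \<in> I" "i \<in> blk c" "j \<in> blk c"
    have "uniform_limit (torus_pts (rk c)) (\<lambda>n z. u c i j z n) (b0 c i j) sequentially"
    proof (rule uniform_limitI)
      fix e :: real assume "0 < e"
      hence "0 < e / 2" by simp
      from close[OF this] obtain N where
        "\<And>n z. n \<ge> N \<Longrightarrow> z \<in> torus_pts (rk c) \<Longrightarrow> cmod (u c i j z n - b0 c i j z) \<le> e / 2"
        using h by meson
      moreover have "e / 2 < e" using \<open>0 < e\<close> by simp
      ultimately have "\<forall>n\<ge>N. \<forall>z\<in>torus_pts (rk c). dist (u c i j z n) (b0 c i j z) < e"
        unfolding dist_norm by (meson order_le_less_trans)
      thus "\<forall>\<^sub>F n in sequentially. \<forall>z\<in>torus_pts (rk c). dist (u c i j z n) (b0 c i j z) < e"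
        unfolding eventually_sequentially by blast
    qed
    moreover have "continuous_on (torus_pts (rk c)) (\<lambda>z. u c i j z n)" for n
      unfolding u_def by (rule ev_continuous[OF fin[OF Uc]])
    hence "\<forall>\<^sub>F n in sequentially. continuous_on (torus_pts (rk c)) (\<lambda>z. u c i j z n)" by simp
    ultimately show "continuous_on (torus_pts (rk c)) (b0 c i j)"
      using uniform_limit_theorem[OF _ _ trivial_limit_sequentially] by metis
  qed
  moreover have "conv U (mk b0)"
    unfolding conv_def close_def using Uc close by (simp add: u_def)
  ultimately show ?thesis by blast
qed

text \<open>Uses the reverse estimate \<open>graph_norm_le\<close>, whose factor
  \<open>card X + 1\<close> is absorbed into the choice of \<open>\<delta>\<close>.\<close>

lemma conv_imp_cauchy:
  assumes "conv U b"
  shows "cauchy_seq F graph_norm U"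
  unfolding cauchy_seq_def free_diff
proof (intro conjI allI impI)
  show Uc: "U n \<in> carrier F" for n using assms by (simp add: conv_def)
  fix e :: real assume e: "0 < e"
  obtain \<delta> where \<delta>: "0 < \<delta>" "real (Suc (card X)) * (2 * \<delta>) < e" using small_radius[OF e] .
  obtain N where N: "\<And>n. n \<ge> N \<Longrightarrow> close \<delta> (U n) b" using assms \<delta>(1) unfolding conv_def by meson
  have "graph_norm (\<lambda>w. U m w - U n w) < e" if "m \<ge> N" "n \<ge> N" for m n
    using graph_norm_diff_le[OF N[OF that(1)] N[OF that(2)] Uc Uc] \<delta> by linarith
  thus "\<exists>N. \<forall>m\<ge>N. \<forall>n\<ge>N. graph_norm (\<lambda>w. U m w - U n w) < e" by blast
qed

lemma conv_null_iff:
  assumes b: "b \<in> carrier model" "b' \<in> carrier model" and c: "conv U b" "conv V b'"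
  shows "(\<lambda>n. graph_norm (sa_diff F (U n) (V n))) \<longlonglongrightarrow> 0 \<longleftrightarrow> b = b'"
  unfolding free_diff
proof
  have UV: "U n \<in> carrier F" "V n \<in> carrier F" for n using c by (auto simp: conv_def)
  { assume lim: "(\<lambda>n. graph_norm (\<lambda>w. U n w - V n w)) \<longlonglongrightarrow> 0"
    show "b = b'"
    proof (rule model_eqI[OF b])
      fix c i j z assume h: "c \<in> I" "i \<in> blk c" "j \<in> blk c" "z \<in> torus_pts (rk c)"
      have "cmod (b c (i, j) z - b' c (i, j) z) \<le> e" if e: "0 < e" for e
      proof -
        have e3: "0 < e / 3" using e by simp
        obtain N1 where N1: "\<And>n. n \<ge> N1 \<Longrightarrow> close (e / 3) (U n) b" using assms(3) e3 unfolding conv_def by meson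
        obtain N2 where N2: "\<And>n. n \<ge> N2 \<Longrightarrow> close (e / 3) (V n) b'" using assms(4) e3 unfolding conv_def by meson
        obtain N3 where N3: "\<And>n. n \<ge> N3 \<Longrightarrow> \<bar>graph_norm (\<lambda>w. U n w - V n w)\<bar> < e / 3"
          using LIMSEQ_D[OF lim e3] by auto
        define n where "n = max N1 (max N2 N3)"
        let ?u = "ev (comp_of c) z (U n) i j" and ?v = "ev (comp_of c) z (V n) i j"
        have "cmod (?u - b c (i, j) z) \<le> e / 3" "cmod (?v - b' c (i, j) z) \<le> e / 3"
          using closeD[OF N1 h(1,4,2,3), of n] closeD[OF N2 h(1,4,2,3), of n] by (auto simp: n_def)
        moreover have "cmod (?u - ?v) \<le> e / 3"
          proof -
          have "N3 \<le> n" by (simp add: n_def)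
          from N3[OF this] norm_ev_diff_le[OF UV h(1,4,2,3), of n n] show ?thesis by linarith
        qed
        moreover have "b c (i, j) z - b' c (i, j) z = (?u - ?v) - (?u - b c (i, j) z) + (?v - b' c (i, j) z)"
          by simp
        hence "cmod (b c (i, j) z - b' c (i, j) z) \<le>
            cmod (?u - ?v) + cmod (?u - b c (i, j) z) + cmod (?v - b' c (i, j) z)"
          using norm_triangle_ineq norm_triangle_ineq4 by (smt (verit, ccfv_SIG))
        ultimately show ?thesis by simp
      qed
      hence "cmod (b c (i, j) z - b' c (i, j) z) \<le> 0" by (rule field_le_epsilon) simp
      thus "b c (i, j) z = b' c (i, j) z" by simp
    qed }
  assume "b = b'"
  show "(\<lambda>n. graph_norm (\<lambda>w. U n w - V n w)) \<longlonglongrightarrow> 0"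
  proof (rule LIMSEQ_I)
    fix e :: real assume e: "0 < e"
    obtain \<delta> where \<delta>: "0 < \<delta>" "real (Suc (card X)) * (2 * \<delta>) < e" using small_radius[OF e] .
    obtain N1 where N1: "\<And>n. n \<ge> N1 \<Longrightarrow> close \<delta> (U n) b" using assms(3) \<delta>(1) unfolding conv_def by meson
    obtain N2 where N2: "\<And>n. n \<ge> N2 \<Longrightarrow> close \<delta> (V n) b"
      using assms(4) \<delta>(1) \<open>b = b'\<close> unfolding conv_def by meson
    have "\<bar>graph_norm (\<lambda>w. U n w - V n w)\<bar> < e" if n: "n \<ge> max N1 N2" for n
      using graph_norm_diff_le[OF N1 N2 UV, of n n] n \<delta> graph_norm_nonneg[OF free_closed(2)[OF UV]] by force
    thus "\<exists>N. \<forall>n\<ge>N. norm (graph_norm (\<lambda>w. U n w - V n w) - 0) < e"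
      unfolding real_norm_def diff_0_right by blast
  qed
qed

text \<open>Each monomial of \<open>g\<close> is carried by a word that acts as a matrix unit, so
  the Laurent polynomial appears exactly, in a single entry of a single block.\<close>

lemma matrix_unit_approx:
  assumes c: "c \<in> I" and ij: "i \<in> blk c" "j \<in> blk c" and g: "laurent (rk c) g"
  obtains f where "f \<in> carrier F" "\<And>c' i' j' z. c' \<in> I \<Longrightarrow> i' \<in> blk c' \<Longrightarrow> j' \<in> blk c' \<Longrightarrow> z \<in> torus_pts (rk c') \<Longrightarrow>
    ev (comp_of c') z f i' j' = (if c' = c \<and> i' = i \<and> j' = j then g z else 0)"
proof -
  let ?R = "comp_of c"
  note R = comp_in[OF c]
  obtain D k where D: "finite D" "D \<subseteq> exponents (rk c)"
    "\<And>z. z \<in> torus_pts (rk c) \<Longrightarrow> g z = (\<Sum>e\<in>D. k e * monomial (rk c) e z)"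
    using g by (auto simp: laurent_def)
  have "\<forall>e\<in>D. \<exists>w. w \<noteq> [] \<and> fst ` set w \<subseteq> P \<and> (\<forall>a' b'. run w a' b' \<longleftrightarrow> a' = j \<and> b' = i) \<and>
      coords ?R (twist (word_deg w) j i) = e"
  proof
    fix e assume "e \<in> D"
    hence "e \<in> coords ?R ` group_of ?R"
      using D(2) coords[OF R] by (auto simp: exponents_def coordinates_def bij_betw_def)
    then obtain \<gamma> where \<gamma>: "\<gamma> \<in> group_of ?R" "coords ?R \<gamma> = e" by blast
    have "j \<in> X" "i \<in> X" "reach (s j) = reach (s i)" "\<gamma> \<in> group_of (reach (s j))"
      using ij \<gamma>(1) by (auto simp: block_def)
    from matrix_unit_word[OF this] show "\<exists>w. w \<noteq> [] \<and> fst ` set w \<subseteq> P \<and>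
        (\<forall>a' b'. run w a' b' \<longleftrightarrow> a' = j \<and> b' = i) \<and> coords ?R (twist (word_deg w) j i) = e"
      using \<gamma>(2) by metis
  qed
  then obtain W where W: "\<And>e. e \<in> D \<Longrightarrow> W e \<noteq> [] \<and> fst ` set (W e) \<subseteq> P \<and>
      (\<forall>a' b'. run (W e) a' b' \<longleftrightarrow> a' = j \<and> b' = i) \<and> coords ?R (twist (word_deg (W e)) j i) = e"
    by metis
  define f where "f = (\<lambda>w. \<Sum>e\<in>D. k e * delta (W e) w)"
  have tF: "(\<lambda>w. k e * delta (W e) w) \<in> carrier F" if "e \<in> D" for e
    using W[OF that] by (intro free_closed(3)[of "delta (W e)" _ "delta (W e)"] delta_closed) auto
  have "f \<in> carrier F" unfolding f_def by (rule free_sum(2)[OF D(1) tF])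
  moreover have "ev (comp_of c') z f i' j' = (if c' = c \<and> i' = i \<and> j' = j then g z else 0)"
    if h: "c' \<in> I" "i' \<in> blk c'" "j' \<in> blk c'" "z \<in> torus_pts (rk c')" for c' i' j' z
  proof -
    have "ev (comp_of c') z f i' j' = (\<Sum>e\<in>D. k e * entry (comp_of c') z i' j' (W e))"
      unfolding f_def ev_def
      by (simp add: lin_sum(1)[OF D(1) fin[OF tF]] lin_scale[OF finite_supp_delta] lin_delta)
    also have "\<dots> = (if c' = c \<and> i' = i \<and> j' = j then g z else 0)"
    proof (cases "i' = i \<and> j' = j")
      case True
      \<comment> \<open>An element of \<open>X\<close> lies in one block only, so equal matrix
        indices force equal summands.\<close>
      hence "comp_of c' = comp_of c" using h ij by (auto simp: block_def)
      hence "c' = c" using comp_bij h(1) c by (auto simp: bij_betw_def inj_on_def)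
      have "(\<Sum>e\<in>D. k e * entry (comp_of c') z i' j' (W e)) = (\<Sum>e\<in>D. k e * monomial (rk c) e z)"
      proof (intro sum.cong refl)
        fix e assume e: "e \<in> D"
        have "entry (comp_of c') z i' j' (W e) = monomial (rk c) e z"
          using W[OF e] True \<open>c' = c\<close> by (simp add: entry_def character_def monomial_def)
        thus "k e * entry (comp_of c') z i' j' (W e) = k e * monomial (rk c) e z" by simp
      qed
      thus ?thesis using D(3) h(4) True \<open>c' = c\<close> by simp
    next
      case False
      have "entry (comp_of c') z i' j' (W e) = 0" if "e \<in> D" for e
        using W[OF that] False by (auto simp: entry_def)
      thus ?thesis using False by auto
    qed
    finally show ?thesis .
  qed
  ultimately show thesis using that by blast
qed

text \<open>The entries are approximated one at a time by polynomials that vanish in all other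
  entries, so the errors do not add up.\<close>

lemma model_approx:
  assumes b: "b \<in> carrier model" and e: "0 < e"
  obtains f where "f \<in> carrier F" "close e f b"
proof -
  have "finite I" using finite_components comp_bij bij_betw_finite by blast
  define K where "K = Sigma I (\<lambda>c. blk c \<times> blk c)"
  have K: "finite K" unfolding K_def using \<open>finite I\<close> finite_block by auto
  define Q where "Q k f g \<longleftrightarrow> f \<in> carrier F \<and> (\<forall>z\<in>torus_pts (rk (fst k)). cmod (b (fst k) (snd k) z - g z) < e) \<and>
     (\<forall>c'\<in>I. \<forall>i'\<in>blk c'. \<forall>j'\<in>blk c'. \<forall>z\<in>torus_pts (rk c').
        ev (comp_of c') z f i' j' = (if (c', i', j') = k then g z else 0))" for k f g
  have "\<forall>k\<in>K. \<exists>f g. Q k f g"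
  proof
    fix k assume "k \<in> K"
    then obtain c i j where k: "k = (c, i, j)" "c \<in> I" "i \<in> blk c" "j \<in> blk c" by (auto simp: K_def)
    obtain g where g: "laurent (rk c) g" "\<And>z. z \<in> torus_pts (rk c) \<Longrightarrow> cmod (b c (i, j) z - g z) < e"
      using laurent_dense[OF model_continuous[OF b k(2-4)] e] by blast
    obtain f where f: "f \<in> carrier F" "\<And>c' i' j' z. c' \<in> I \<Longrightarrow> i' \<in> blk c' \<Longrightarrow> j' \<in> blk c' \<Longrightarrow>
        z \<in> torus_pts (rk c') \<Longrightarrow> ev (comp_of c') z f i' j' = (if c' = c \<and> i' = i \<and> j' = j then g z else 0)"
      using matrix_unit_approx[OF k(2-4) g(1)] by blast
    show "\<exists>f g. Q k f g"
      unfolding Q_def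
      using f g(2) by (intro exI[of _ f] exI[of _ g]) (auto simp: k(1))
  qed
  then obtain f g where fgQ: "\<And>k. k \<in> K \<Longrightarrow> Q k (f k) (g k)" by metis
  hence f: "\<And>k. k \<in> K \<Longrightarrow> f k \<in> carrier F"
    and g: "\<And>k z. k \<in> K \<Longrightarrow> z \<in> torus_pts (rk (fst k)) \<Longrightarrow> cmod (b (fst k) (snd k) z - g k z) < e"
    and fg: "\<And>k c' i' j' z. k \<in> K \<Longrightarrow> c' \<in> I \<Longrightarrow> i' \<in> blk c' \<Longrightarrow> j' \<in> blk c' \<Longrightarrow> z \<in> torus_pts (rk c') \<Longrightarrow>
      ev (comp_of c') z (f k) i' j' = (if (c', i', j') = k then g k z else 0)"
    unfolding Q_def by blast+
  define h where "h = (\<lambda>w. \<Sum>k\<in>K. f k w)"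
  have "h \<in> carrier F" unfolding h_def by (rule free_sum(2)[OF K f])
  moreover have "close e h b"
    unfolding close_def
  proof (intro ballI)
    fix c z i j assume a: "c \<in> I" "z \<in> torus_pts (rk c)" "i \<in> blk c" "j \<in> blk c"
    have k: "(c, i, j) \<in> K" using a by (auto simp: K_def)
    have "ev (comp_of c) z h i j = (\<Sum>k\<in>K. ev (comp_of c) z (f k) i j)"
      unfolding h_def ev_def by (rule lin_sum(1)[OF K fin[OF f]])
    also have "\<dots> = (\<Sum>k\<in>K. if k = (c, i, j) then g (c, i, j) z else 0)"
      using fg a by (intro sum.cong) auto
    also have "\<dots> = g (c, i, j) z" using K k by simp
    finally have "cmod (ev (comp_of c) z h i j - b c (i, j) z) < e"
      using g[OF k] a(2) by (simp add: norm_minus_commute)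
    thus "cmod (ev (comp_of c) z h i j - b c (i, j) z) \<le> e" by simp
  qed
  ultimately show thesis using that by blast
qed

lemma conv_dense:
  assumes "b \<in> carrier model"
  shows "\<exists>U. conv U b"
proof -
  have "\<exists>f. f \<in> carrier F \<and> close (inverse (real (Suc n))) f b" for n
    using model_approx[OF assms, of "inverse (real (Suc n))"] by (metis inverse_positive_iff_positive of_nat_0_less_iff zero_less_Suc)
  then obtain U where U: "\<And>n. U n \<in> carrier F" "\<And>n. close (inverse (real (Suc n))) (U n) b" by metis
  have "\<exists>N. \<forall>n\<ge>N. close e (U n) b" if e: "0 < e" for e
  proof -
    obtain N where N: "inverse (real (Suc N)) < e" using reals_Archimedean[OF e] by blast
    have "close e (U n) b" if "n \<ge> N" for n
    proof (rule close_mono[OF U(2)])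
      have "inverse (real (Suc n)) \<le> inverse (real (Suc N))" using that by (intro le_imp_inverse_le) auto
      thus "inverse (real (Suc n)) \<le> e" using N by linarith
    qed
    thus ?thesis by blast
  qed
  thus ?thesis using U(1) unfolding conv_def by blast
qed

lemma graph_cstar_model:
  obtains \<phi> where "star_iso model (graph_cstar \<Lambda>) \<phi>" "\<phi> (sa_zero model) = sa_zero (graph_cstar \<Lambda>)"
    "\<And>x. x \<in> P \<Longrightarrow> \<phi> (mk (\<lambda>c i j z. entry (comp_of c) z i j [(x, False)])) = graph_gen \<Lambda> x"
proof -
  have eq: "graph_cstar \<Lambda> = completion F graph_norm"
    by (simp add: graph_cstar_def universal_cstar_def graph_norm_def)
  obtain \<phi> where \<phi>: "star_iso model (completion F graph_norm) \<phi>"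
    "\<phi> (sa_zero model) = sa_zero (completion F graph_norm)"
    "\<And>x b. b \<in> carrier model \<Longrightarrow> conv (\<lambda>n. x) b \<Longrightarrow> \<phi> b = cauchy_class F graph_norm (\<lambda>n. x)"
  proof (rule completion_iso[of F graph_norm model conv])
    show "cauchy_seq F graph_norm U \<longleftrightarrow> (\<exists>b\<in>carrier model. conv U b)" for U
      using cauchy_imp_conv conv_imp_cauchy by blast
    show "sa_zero model \<in> carrier model"
      using model_closed(5)[OF conv_const(1)[OF free_zero_closed] conv_const(1)[OF free_zero_closed]] .
  qed (use conv_null_iff conv_dense conv_zero conv_add conv_scale conv_mult conv_star model_closed in auto)
  moreover have "\<phi> (mk (\<lambda>c i j z. entry (comp_of c) z i j [(x, False)])) = graph_gen \<Lambda> x" if "x \<in> P" for x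
  proof -
    have "delta [(x, False)] \<in> carrier F" using that by (intro delta_closed) auto
    from \<phi>(3)[OF conv_const[OF this]] show ?thesis
      by (simp add: graph_gen_def universal_gen_def graph_norm_def free_gen_delta ev_delta)
  qed
  ultimately show thesis using that unfolding eq by blast
qed

end

section \<open>Isomorphisms of *-algebras\<close>

definition sa_closed :: "'b star_algebra \<Rightarrow> bool" where
  "sa_closed B \<longleftrightarrow> (\<forall>x\<in>carrier B. \<forall>y\<in>carrier B. sa_add B x y \<in> carrier B \<and> sa_mult B x y \<in> carrier B) \<and>
     (\<forall>x\<in>carrier B. \<forall>c. sa_scale B c x \<in> carrier B \<and> sa_star B x \<in> carrier B)"

definition add_monoid :: "'b star_algebra \<Rightarrow> 'b monoid" where
  "add_monoid B = \<lparr>carrier = carrier B, mult = sa_add B, one = sa_zero B\<rparr>"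

lemma star_iso_in: "star_iso B C \<phi> \<Longrightarrow> x \<in> carrier B \<Longrightarrow> \<phi> x \<in> carrier C"
  by (auto simp: star_iso_def bij_betw_def)

lemma star_isoD:
  assumes "star_iso B C \<phi>" "x \<in> carrier B"
  shows "y \<in> carrier B \<Longrightarrow> \<phi> (sa_add B x y) = sa_add C (\<phi> x) (\<phi> y)"
    "\<phi> (sa_scale B c x) = sa_scale C c (\<phi> x)"
    "y \<in> carrier B \<Longrightarrow> \<phi> (sa_mult B x y) = sa_mult C (\<phi> x) (\<phi> y)"
    "\<phi> (sa_star B x) = sa_star C (\<phi> x)"
  using assms by (auto simp: star_iso_def)

lemma star_iso_inverse:
  assumes \<phi>: "star_iso B C \<phi>" and B: "sa_closed B"
  shows "star_iso C B (the_inv_into (carrier B) \<phi>)"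
proof -
  let ?g = "the_inv_into (carrier B) \<phi>"
  have bij: "bij_betw \<phi> (carrier B) (carrier C)" using \<phi> by (simp add: star_iso_def)
  have g\<phi>: "?g (\<phi> x) = x" if "x \<in> carrier B" for x
    using the_inv_into_f_f[OF bij_betw_imp_inj_on[OF bij] that] .
  have ex: "\<exists>x\<in>carrier B. y = \<phi> x" if "y \<in> carrier C" for y
    using bij that by (auto simp: bij_betw_def)
  show ?thesis
    unfolding star_iso_def
  proof (intro conjI ballI allI)
    show "bij_betw ?g (carrier C) (carrier B)" by (rule bij_betw_the_inv_into[OF bij])
    fix y assume "y \<in> carrier C"
    then obtain x where x: "x \<in> carrier B" "y = \<phi> x" using ex by blast
    show "?g (sa_scale C c y) = sa_scale B c (?g y)" for c
      using x B star_isoD(2)[OF \<phi> x(1), of c] g\<phi> unfolding sa_closed_def by metis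
    show "?g (sa_star C y) = sa_star B (?g y)"
      using x B star_isoD(4)[OF \<phi> x(1)] g\<phi> unfolding sa_closed_def by metis
    fix y' assume "y' \<in> carrier C"
    then obtain x' where x': "x' \<in> carrier B" "y' = \<phi> x'" using ex by blast
    show "?g (sa_add C y y') = sa_add B (?g y) (?g y')"
      using x x' B star_isoD(1)[OF \<phi> x(1) x'(1)] g\<phi> unfolding sa_closed_def by metis
    show "?g (sa_mult C y y') = sa_mult B (?g y) (?g y')"
      using x x' B star_isoD(3)[OF \<phi> x(1) x'(1)] g\<phi> unfolding sa_closed_def by metis
  qed
qed

lemma star_iso_compose:
  assumes "star_iso A B \<phi>" "star_iso B C \<psi>"
  shows "star_iso A C (\<psi> \<circ> \<phi>)"
  unfolding star_iso_def
  using assms star_iso_in[OF assms(1)] star_isoD[OF assms(1)] star_isoD[OF assms(2)]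
  by (auto simp: star_iso_def intro: bij_betw_trans)

text \<open>Finite sums are iterated products in the additive monoid. For a corner of the universal
  algebra the monoid laws are transported from the function algebra. \<open>star_iso\<close> does
  not mention the zero, hence the separate assumption on it.\<close>

lemma star_iso_monoid:
  assumes \<phi>: "star_iso B C \<phi>" and z: "\<phi> (sa_zero B) = sa_zero C" and B: "comm_monoid (add_monoid B)"
  shows "comm_monoid (add_monoid C)"
proof -
  interpret B: comm_monoid "add_monoid B" by (rule B)
  have cl: "sa_add B x y \<in> carrier B" "sa_zero B \<in> carrier B" if "x \<in> carrier B" "y \<in> carrier B" for x y
    using B.m_closed[of x y] B.one_closed that by (auto simp: add_monoid_def)
  have z0: "sa_zero B \<in> carrier B" using B.one_closed by (simp add: add_monoid_def)
  have laws: "sa_add B (sa_add B x y) w = sa_add B x (sa_add B y w)" "sa_add B (sa_zero B) x = x"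
    "sa_add B x y = sa_add B y x" if "x \<in> carrier B" "y \<in> carrier B" "w \<in> carrier B" for x y w
    using B.m_assoc[of x y w] B.l_one[of x] B.m_comm[of x y] that by (auto simp: add_monoid_def)
  have C: "carrier C = \<phi> ` carrier B" using \<phi> by (simp add: star_iso_def bij_betw_def)
  note h = star_isoD(1)[OF \<phi>, symmetric]
  show ?thesis
  proof (rule comm_monoidI)
    show "\<one>\<^bsub>add_monoid C\<^esub> \<in> carrier (add_monoid C)" using z0 z C by (force simp: add_monoid_def)
    fix x assume "x \<in> carrier (add_monoid C)"
    then obtain x' where x': "x' \<in> carrier B" "x = \<phi> x'" using C by (auto simp: add_monoid_def)
    show "\<one>\<^bsub>add_monoid C\<^esub> \<otimes>\<^bsub>add_monoid C\<^esub> x = x"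
      using h[OF z0 x'(1)] laws(2)[OF x'(1) z0 z0] x' z by (simp add: add_monoid_def)
    fix y assume "y \<in> carrier (add_monoid C)"
    then obtain y' where y': "y' \<in> carrier B" "y = \<phi> y'" using C by (auto simp: add_monoid_def)
    show "x \<otimes>\<^bsub>add_monoid C\<^esub> y \<in> carrier (add_monoid C)"
      using h[OF x'(1) y'(1)] cl[OF x'(1) y'(1)] x' y' C by (simp add: add_monoid_def)
    show "x \<otimes>\<^bsub>add_monoid C\<^esub> y = y \<otimes>\<^bsub>add_monoid C\<^esub> x"
      using h[OF x'(1) y'(1)] h[OF y'(1) x'(1)] laws(3)[OF x'(1) y'(1) z0] x' y' by (simp add: add_monoid_def)
    fix w assume "w \<in> carrier (add_monoid C)"
    then obtain w' where w': "w' \<in> carrier B" "w = \<phi> w'" using C by (auto simp: add_monoid_def)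
    show "x \<otimes>\<^bsub>add_monoid C\<^esub> y \<otimes>\<^bsub>add_monoid C\<^esub> w = x \<otimes>\<^bsub>add_monoid C\<^esub> (y \<otimes>\<^bsub>add_monoid C\<^esub> w)"
      using h[OF x'(1) y'(1)] h[OF cl(1)[OF x'(1) y'(1)] w'(1)] h[OF y'(1) w'(1)]
        h[OF x'(1) cl(1)[OF y'(1) w'(1)]] laws(1)[OF x'(1) y'(1) w'(1)] x' y' w'
      by (simp add: add_monoid_def)
  qed
qed

lemma star_iso_sum:
  assumes \<phi>: "star_iso B C \<phi>" and z: "\<phi> (sa_zero B) = sa_zero C" and B: "comm_monoid (add_monoid B)"
    and I: "finite I" "\<And>i. i \<in> I \<Longrightarrow> f i \<in> carrier B"
  shows "\<phi> (sa_sum B f I) = sa_sum C (\<lambda>i. \<phi> (f i)) I" "sa_sum B f I \<in> carrier B"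
proof -
  note C = star_iso_monoid[OF \<phi> z B]
  have "\<phi> (sa_sum B f I) = sa_sum C (\<lambda>i. \<phi> (f i)) I \<and> sa_sum B f I \<in> carrier B"
    using I
  proof (induction I)
    case empty
    show ?case
      using comm_monoid.finprod_empty[OF B, of f] comm_monoid.finprod_empty[OF C, of "\<lambda>i. \<phi> (f i)"] z
        monoid.one_closed[OF comm_monoid.axioms(1)[OF B]]
      by (simp add: sa_sum_def add_monoid_def)
  next
    case (insert i I)
    have fB: "f \<in> I \<rightarrow> carrier (add_monoid B)" "f i \<in> carrier (add_monoid B)"
      using insert by (auto simp: add_monoid_def)
    have fC: "(\<lambda>i. \<phi> (f i)) \<in> I \<rightarrow> carrier (add_monoid C)" "\<phi> (f i) \<in> carrier (add_monoid C)"
      using insert star_iso_in[OF \<phi>] by (auto simp: add_monoid_def)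
    have "sa_sum B f (insert i I) = sa_add B (f i) (sa_sum B f I)"
      using comm_monoid.finprod_insert[OF B insert(1,2) fB] by (simp add: sa_sum_def add_monoid_def)
    moreover have "sa_sum C (\<lambda>i. \<phi> (f i)) (insert i I) = sa_add C (\<phi> (f i)) (sa_sum C (\<lambda>i. \<phi> (f i)) I)"
      using comm_monoid.finprod_insert[OF C insert(1,2) fC] by (simp add: sa_sum_def add_monoid_def)
    moreover have IH: "\<phi> (sa_sum B f I) = sa_sum C (\<lambda>i. \<phi> (f i)) I" "sa_sum B f I \<in> carrier B"
      using insert by auto
    moreover have "sa_add B (f i) (sa_sum B f I) \<in> carrier B"
      using monoid.m_closed[OF comm_monoid.axioms(1)[OF B], of "f i" "sa_sum B f I"] insert(4) IH(2)
      by (simp add: add_monoid_def)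
    ultimately show ?case using star_isoD(1)[OF \<phi>, of "f i" "sa_sum B f I"] insert(4) by simp
  qed
  thus "\<phi> (sa_sum B f I) = sa_sum C (\<lambda>i. \<phi> (f i)) I" "sa_sum B f I \<in> carrier B" by auto
qed

lemma bij_betw_PiE:
  assumes "\<And>i. i \<in> I \<Longrightarrow> bij_betw (k i) (A i) (B i)"
  shows "bij_betw (\<lambda>f. \<lambda>i\<in>I. k i (f i)) (\<Pi>\<^sub>E i\<in>I. A i) (\<Pi>\<^sub>E i\<in>I. B i)"
proof (rule bij_betwI)
  let ?inv = "\<lambda>g. \<lambda>i\<in>I. the_inv_into (A i) (k i) (g i)"
  show "(\<lambda>f. \<lambda>i\<in>I. k i (f i)) \<in> (\<Pi>\<^sub>E i\<in>I. A i) \<rightarrow> (\<Pi>\<^sub>E i\<in>I. B i)"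
    using bij_betwE[OF assms] by fastforce
  show "?inv \<in> (\<Pi>\<^sub>E i\<in>I. B i) \<rightarrow> (\<Pi>\<^sub>E i\<in>I. A i)"
    using bij_betwE[OF bij_betw_the_inv_into[OF assms]] by fastforce
  show "?inv (\<lambda>i\<in>I. k i (f i)) = f" if f: "f \<in> (\<Pi>\<^sub>E i\<in>I. A i)" for f
  proof (rule PiE_ext[OF _ f])
    show "?inv (\<lambda>i\<in>I. k i (f i)) \<in> (\<Pi>\<^sub>E i\<in>I. A i)"
      using the_inv_into_f_f[OF bij_betw_imp_inj_on[OF assms]] PiE_mem[OF f] by auto
    fix i assume i: "i \<in> I"
    show "?inv (\<lambda>i\<in>I. k i (f i)) i = f i"
      using i the_inv_into_f_f[OF bij_betw_imp_inj_on[OF assms[OF i]] PiE_mem[OF f i]] by simp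
  qed
  show "(\<lambda>i\<in>I. k i (?inv g i)) = g" if g: "g \<in> (\<Pi>\<^sub>E i\<in>I. B i)" for g
  proof (rule PiE_ext[OF _ g])
    show "(\<lambda>i\<in>I. k i (?inv g i)) \<in> (\<Pi>\<^sub>E i\<in>I. B i)"
      using f_the_inv_into_f_bij_betw[OF assms] PiE_mem[OF g] by auto
    fix i assume i: "i \<in> I"
    show "(\<lambda>i\<in>I. k i (?inv g i)) i = g i"
      using i f_the_inv_into_f_bij_betw[OF assms[OF i]] PiE_mem[OF g i] by simp
  qed
qed

lemma direct_sum_cong:
  assumes "\<And>i. i \<in> I \<Longrightarrow> B i = C i"
  shows "direct_sum I B = direct_sum I C"
proof -
  have "(\<Pi>\<^sub>E i\<in>I. carrier (B i)) = (\<Pi>\<^sub>E i\<in>I. carrier (C i))" using assms by (intro PiE_cong) simp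
  moreover have "restrict (\<lambda>i. h (B i) i) I = restrict (\<lambda>i. h (C i) i) I" for h :: "_ \<Rightarrow> _ \<Rightarrow> 'c"
    using assms by (intro restrict_ext) simp
  ultimately show ?thesis unfolding direct_sum_def by (simp cong: restrict_cong add: assms)
qed

lemma star_iso_direct_sum:
  assumes "\<And>i. i \<in> I \<Longrightarrow> star_iso (B i) (C i) (k i)"
  shows "star_iso (direct_sum I B) (direct_sum I C) (\<lambda>f. \<lambda>i\<in>I. k i (f i))"
  unfolding star_iso_def
proof (intro conjI ballI allI)
  show "bij_betw (\<lambda>f. \<lambda>i\<in>I. k i (f i)) (carrier (direct_sum I B)) (carrier (direct_sum I C))"
    using assms by (simp add: direct_sum_def star_iso_def bij_betw_PiE)
  fix f assume f: "f \<in> carrier (direct_sum I B)"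
  hence fi: "f i \<in> carrier (B i)" if "i \<in> I" for i using that by (auto simp: direct_sum_def)
  show "(\<lambda>i\<in>I. k i (sa_scale (direct_sum I B) c f i)) = sa_scale (direct_sum I C) c (\<lambda>i\<in>I. k i (f i))" for c
    using star_isoD(2)[OF assms fi] by (auto simp: direct_sum_def fun_eq_iff)
  show "(\<lambda>i\<in>I. k i (sa_star (direct_sum I B) f i)) = sa_star (direct_sum I C) (\<lambda>i\<in>I. k i (f i))"
    using star_isoD(4)[OF assms fi] by (auto simp: direct_sum_def fun_eq_iff)
  fix g assume g: "g \<in> carrier (direct_sum I B)"
  hence gi: "g i \<in> carrier (B i)" if "i \<in> I" for i using that by (auto simp: direct_sum_def)
  show "(\<lambda>i\<in>I. k i (sa_add (direct_sum I B) f g i)) =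
      sa_add (direct_sum I C) (\<lambda>i\<in>I. k i (f i)) (\<lambda>i\<in>I. k i (g i))"
    using star_isoD(1)[OF assms fi gi] by (auto simp: direct_sum_def fun_eq_iff)
  show "(\<lambda>i\<in>I. k i (sa_mult (direct_sum I B) f g i)) =
      sa_mult (direct_sum I C) (\<lambda>i\<in>I. k i (f i)) (\<lambda>i\<in>I. k i (g i))"
    using star_isoD(3)[OF assms fi gi] by (auto simp: direct_sum_def fun_eq_iff)
qed

lemma star_iso_matrix:
  assumes \<phi>: "star_iso B C \<phi>" and z: "\<phi> (sa_zero B) = sa_zero C" and B: "comm_monoid (add_monoid B)"
    "sa_closed B" and Y: "finite Y"
  shows "star_iso (matrix_algebra Y B) (matrix_algebra Y C) (\<lambda>f. \<lambda>ij\<in>Y \<times> Y. \<phi> (f ij))"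
  unfolding star_iso_def
proof (intro conjI ballI allI)
  have "bij_betw \<phi> (carrier B) (carrier C)" using \<phi> by (simp add: star_iso_def)
  thus "bij_betw (\<lambda>f. \<lambda>ij\<in>Y \<times> Y. \<phi> (f ij)) (carrier (matrix_algebra Y B)) (carrier (matrix_algebra Y C))"
    using bij_betw_PiE[of "Y \<times> Y" "\<lambda>_. \<phi>" "\<lambda>_. carrier B" "\<lambda>_. carrier C"]
    by (simp add: matrix_algebra_def)
  fix f assume f: "f \<in> carrier (matrix_algebra Y B)"
  hence fi: "f (i, j) \<in> carrier B" if "i \<in> Y" "j \<in> Y" for i j using that by (auto simp: matrix_algebra_def)
  show "(\<lambda>ij\<in>Y \<times> Y. \<phi> (sa_scale (matrix_algebra Y B) c f ij)) =
      sa_scale (matrix_algebra Y C) c (\<lambda>ij\<in>Y \<times> Y. \<phi> (f ij))" for c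
    using star_isoD(2)[OF \<phi> fi] by (auto simp: matrix_algebra_def fun_eq_iff)
  show "(\<lambda>ij\<in>Y \<times> Y. \<phi> (sa_star (matrix_algebra Y B) f ij)) =
      sa_star (matrix_algebra Y C) (\<lambda>ij\<in>Y \<times> Y. \<phi> (f ij))"
    using star_isoD(4)[OF \<phi> fi] by (auto simp: matrix_algebra_def fun_eq_iff)
  fix g assume g: "g \<in> carrier (matrix_algebra Y B)"
  hence gi: "g (i, j) \<in> carrier B" if "i \<in> Y" "j \<in> Y" for i j using that by (auto simp: matrix_algebra_def)
  show "(\<lambda>ij\<in>Y \<times> Y. \<phi> (sa_add (matrix_algebra Y B) f g ij)) =
      sa_add (matrix_algebra Y C) (\<lambda>ij\<in>Y \<times> Y. \<phi> (f ij)) (\<lambda>ij\<in>Y \<times> Y. \<phi> (g ij))"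
    using star_isoD(1)[OF \<phi> fi gi] by (auto simp: matrix_algebra_def fun_eq_iff)
  have "\<phi> (sa_sum B (\<lambda>l. sa_mult B (f (i, l)) (g (l, j))) Y) =
      sa_sum C (\<lambda>l. sa_mult C ((\<lambda>ij\<in>Y \<times> Y. \<phi> (f ij)) (i, l)) ((\<lambda>ij\<in>Y \<times> Y. \<phi> (g ij)) (l, j))) Y"
    if ij: "i \<in> Y" "j \<in> Y" for i j
  proof -
    have "\<phi> (sa_sum B (\<lambda>l. sa_mult B (f (i, l)) (g (l, j))) Y) =
        sa_sum C (\<lambda>l. \<phi> (sa_mult B (f (i, l)) (g (l, j)))) Y"
      using fi gi ij B(2) by (intro star_iso_sum(1)[OF \<phi> z B(1) Y]) (auto simp: sa_closed_def)
    also have "\<dots> = sa_sum C (\<lambda>l. sa_mult C ((\<lambda>ij\<in>Y \<times> Y. \<phi> (f ij)) (i, l)) ((\<lambda>ij\<in>Y \<times> Y. \<phi> (g ij)) (l, j))) Y"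
      unfolding sa_sum_def add_monoid_def[symmetric]
    proof (rule comm_monoid.finprod_cong'[OF star_iso_monoid[OF \<phi> z B(1)] refl])
      show "(\<lambda>l. sa_mult C ((\<lambda>ij\<in>Y \<times> Y. \<phi> (f ij)) (i, l)) ((\<lambda>ij\<in>Y \<times> Y. \<phi> (g ij)) (l, j))) \<in> Y \<rightarrow> carrier (add_monoid C)"
        using star_isoD(3)[OF \<phi> fi gi, symmetric] ij B(2) fi gi star_iso_in[OF \<phi>]
        by (auto simp: add_monoid_def sa_closed_def)
      fix l assume "l \<in> Y"
      thus "\<phi> (sa_mult B (f (i, l)) (g (l, j))) =
          sa_mult C ((\<lambda>ij\<in>Y \<times> Y. \<phi> (f ij)) (i, l)) ((\<lambda>ij\<in>Y \<times> Y. \<phi> (g ij)) (l, j))"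
        using star_isoD(3)[OF \<phi> fi gi] ij by simp
    qed
    finally show ?thesis .
  qed
  thus "(\<lambda>ij\<in>Y \<times> Y. \<phi> (sa_mult (matrix_algebra Y B) f g ij)) =
      sa_mult (matrix_algebra Y C) (\<lambda>ij\<in>Y \<times> Y. \<phi> (f ij)) (\<lambda>ij\<in>Y \<times> Y. \<phi> (g ij))"
    by (auto simp: matrix_algebra_def fun_eq_iff)
qed

lemma cf_closed: "sa_closed (continuous_functions (torus l))"
  unfolding sa_closed_def cf_sel(3-)
  by (intro conjI ballI allI; rule cf_restrict; simp only: cf_sel(1); intro continuous_intros; simp)

lemma cf_zero: "sa_zero (continuous_functions (torus l)) \<in> carrier (continuous_functions (torus l))"
  unfolding cf_sel(2) by (rule cf_restrict) simp

section \<open>The corner at a vertex of an initial cycle\<close>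

context component_index
begin

lemma sa_closed_model: "sa_closed model"
  unfolding sa_closed_def by (intro conjI ballI allI; rule model_closed; assumption)

definition corner_entry :: "'c \<Rightarrow> 'a \<Rightarrow> ((nat \<Rightarrow> complex) \<Rightarrow> complex) \<Rightarrow>
    'c \<Rightarrow> 'a \<times> 'a \<Rightarrow> (nat \<Rightarrow> complex) \<Rightarrow> complex" where
  "corner_entry c0 a f = mk (\<lambda>c i j z. if c = c0 \<and> i = a \<and> j = a then f z else 0)"

lemma corner_entry_continuous:
  assumes "continuous_on (torus_pts (rk c0)) f"
  shows "corner_entry c0 a f \<in> carrier model"
  unfolding corner_entry_def
proof (rule mk_carrier)
  fix c i j
  show "continuous_on (torus_pts (rk c)) (\<lambda>z. if c = c0 \<and> i = a \<and> j = a then f z else 0)"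
    using assms by (cases "c = c0 \<and> i = a \<and> j = a") auto
qed

lemma corner_entry_carrier: "f \<in> carrier (CT c0) \<Longrightarrow> corner_entry c0 a f \<in> carrier model"
  by (rule corner_entry_continuous) (simp add: cf_sel(1))

text \<open>\<open>s\<^sub>v\<close> is the diagonal matrix unit at the only \<open>\<alpha> \<in> v\<Lambda>\<^sup>\<le>\<^sup>N\<close>, so its corner is a single entry.\<close>

lemma corner_iso:
  assumes \<phi>: "star_iso model (graph_cstar \<Lambda>) \<phi>" "\<phi> (sa_zero model) = sa_zero (graph_cstar \<Lambda>)"
    "\<And>x. x \<in> P \<Longrightarrow> \<phi> (mk (\<lambda>c i j z. entry (comp_of c) z i j [(x, False)])) = graph_gen \<Lambda> x"
    and c0: "c0 \<in> I" and v: "v \<in> terminal" "comp_of c0 = reach v"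
  obtains g where "star_iso (CT c0) (vertex_corner \<Lambda> v) g" "g (sa_zero (CT c0)) = sa_zero (vertex_corner \<Lambda> v)"
proof -
  obtain a where a: "a \<in> X" "r a = v" using terminal_X_exists[OF v(1)] .
  have ablk: "a \<in> blk c0"
    using a reach_eq[OF v(1), of "s a"] reachI[OF X_paths[OF a(1)] a(2)] v(2) by (simp add: block_def)
  define p where "p = mk (\<lambda>c i j z. entry (comp_of c) z i j [(v, False)])"
  have vV: "v \<in> vertices \<Lambda>" using a X_paths rng_vertex by metis
  hence vP: "v \<in> P" by (simp add: vertices_iff)
  have pc: "p \<in> carrier model"
    using conv_const(1)[OF delta_closed[of "[(v, False)]"]] vP by (simp add: p_def ev_delta)
  have p: "p = corner_entry c0 a (\<lambda>z. 1)"
  proof (rule model_eqI[OF pc corner_entry_continuous])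
    fix c i j z assume c: "c \<in> I" and ij: "i \<in> blk c" "j \<in> blk c" and z: "z \<in> torus_pts (rk c)"
    \<comment> \<open>A vertex fixes the elements of \<open>X\<close> with range \<open>v\<close>,
      of which there is only one for a terminal \<open>v\<close>.\<close>
    have "run [(v, False)] j i \<longleftrightarrow> c = c0 \<and> i = a \<and> j = a"
    proof
      assume "run [(v, False)] j i"
      hence "j \<in> X" "j = i" "r j = v" unfolding run_vertex[OF vV] by auto
      hence "j = a" "i = a" using terminal_X_unique[OF v(1)] a by auto
      moreover have "comp_of c = comp_of c0" using ij ablk \<open>j = a\<close> by (auto simp: block_def)
      hence "c = c0" using comp_bij c c0 by (auto simp: bij_betw_def inj_on_def)
      ultimately show "c = c0 \<and> i = a \<and> j = a" by simp
    qed (unfold run_vertex[OF vV], use a in blast)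
    moreover have "character (comp_of c) z (twist (word_deg [(v, False)]) a a) = 1"
      using deg_vertex[OF vV, of False] character_zero[OF comp_in[OF c]]
      by (simp add: twist_self del: letter_deg.simps)
    ultimately show "p c (i, j) z = corner_entry c0 a (\<lambda>z. 1) c (i, j) z"
      using c ij z unfolding p_def corner_entry_def entry_def by auto
  qed simp
  have pg: "\<phi> p = graph_gen \<Lambda> v" unfolding p_def by (rule \<phi>(3)[OF vP])
  \<comment> \<open>Compression by a diagonal matrix unit keeps the single entry
    \<open>(a, a)\<close> of the summand \<open>c0\<close>.\<close>
  have cut: "sa_mult model (sa_mult model p b) p = corner_entry c0 a (b c0 (a, a))" if b: "b \<in> carrier model" for b
  proof (rule model_eqI)
    show "sa_mult model (sa_mult model p b) p \<in> carrier model" by (rule model_closed(3)[OF model_closed(3)[OF pc b] pc])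
    show "corner_entry c0 a (b c0 (a, a)) \<in> carrier model"
      by (rule corner_entry_carrier[OF model_entry[OF b c0 ablk ablk]])
    fix c i j z assume h: "c \<in> I" "i \<in> blk c" "j \<in> blk c" "z \<in> torus_pts (rk c)"
    have pe: "p c (i, j) z = (if c = c0 \<and> i = a \<and> j = a then 1 else 0)" if "i \<in> blk c" "j \<in> blk c" for i j
      unfolding p corner_entry_def using h that by simp
    have l: "sa_mult model p b c (i, l) z = (if c = c0 \<and> i = a then b c (a, l) z else 0)" if l: "l \<in> blk c" for l
    proof -
      have "sa_mult model p b c (i, l) z = (\<Sum>m\<in>blk c. p c (i, m) z * b c (m, l) z)"
        unfolding model_ops(3)[OF pc b] using h l by simp
      also have "\<dots> = (\<Sum>m\<in>blk c. if m = a then (if c = c0 \<and> i = a then b c (a, l) z else 0) else 0)"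
        using pe h by (intro sum.cong) auto
      also have "\<dots> = (if c = c0 \<and> i = a then b c (a, l) z else 0)" using ablk finite_block by auto
      finally show ?thesis .
    qed
    have "sa_mult model (sa_mult model p b) p c (i, j) z = (\<Sum>m\<in>blk c. sa_mult model p b c (i, m) z * p c (m, j) z)"
      unfolding model_ops(3)[OF model_closed(3)[OF pc b] pc] using h by simp
    also have "\<dots> = (\<Sum>m\<in>blk c. if m = a then (if c = c0 \<and> i = a \<and> j = a then b c (a, a) z else 0) else 0)"
      using l pe h by (intro sum.cong) auto
    also have "\<dots> = (if c = c0 \<and> i = a \<and> j = a then b c0 (a, a) z else 0)" using ablk finite_block by auto
    finally show "sa_mult model (sa_mult model p b) p c (i, j) z = corner_entry c0 a (b c0 (a, a)) c (i, j) z"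
      unfolding corner_entry_def using h by simp
  qed
  have ent: "corner_entry c0 a f c (i, j) z = (if c = c0 \<and> i = a \<and> j = a then f z else 0)"
    if "c \<in> I" "i \<in> blk c" "j \<in> blk c" "z \<in> torus_pts (rk c)" for f c i j z
    using that by (simp add: corner_entry_def)
  define g where "g f = \<phi> (corner_entry c0 a f)" for f
  have entry_at: "corner_entry c0 a f c0 (a, a) = f" if f: "f \<in> carrier (CT c0)" for f
  proof (rule extensionalityI)
    show "corner_entry c0 a f c0 (a, a) \<in> extensional (torus_pts (rk c0))"
      using model_entry[OF corner_entry_carrier[OF f] c0 ablk ablk] by (simp add: cf_sel(1))
    show "f \<in> extensional (torus_pts (rk c0))" using f by (simp add: cf_sel(1))
    show "corner_entry c0 a f c0 (a, a) z = f z" if "z \<in> torus_pts (rk c0)" for z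
      using that c0 ablk by (simp add: corner_entry_def)
  qed
  have car: "carrier (vertex_corner \<Lambda> v) = g ` carrier (CT c0)"
  proof -
    have A: "carrier (graph_cstar \<Lambda>) = \<phi> ` carrier model" using \<phi>(1) by (simp add: star_iso_def bij_betw_def)
    have pxp: "sa_mult (graph_cstar \<Lambda>) (sa_mult (graph_cstar \<Lambda>) (graph_gen \<Lambda> v) (\<phi> b)) (graph_gen \<Lambda> v) =
        g (b c0 (a, a))" if b: "b \<in> carrier model" for b
      using star_isoD(3)[OF \<phi>(1) pc b] star_isoD(3)[OF \<phi>(1) model_closed(3)[OF pc b] pc] cut[OF b]
      by (simp add: g_def pg)
    have "carrier (vertex_corner \<Lambda> v) =
        (\<lambda>x. sa_mult (graph_cstar \<Lambda>) (sa_mult (graph_cstar \<Lambda>) (graph_gen \<Lambda> v) x) (graph_gen \<Lambda> v)) `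
          carrier (graph_cstar \<Lambda>)"
      by (simp add: vertex_corner_def corner_def Setcompr_eq_image)
    also have "\<dots> = (\<lambda>b. g (b c0 (a, a))) ` carrier model"
      unfolding A image_image by (rule image_cong[OF refl pxp])
    also have "\<dots> = g ` carrier (CT c0)"
    proof (intro equalityI subsetI)
      fix y assume "y \<in> (\<lambda>b. g (b c0 (a, a))) ` carrier model"
      thus "y \<in> g ` carrier (CT c0)" using model_entry[OF _ c0 ablk ablk] by blast
    next
      fix y assume "y \<in> g ` carrier (CT c0)"
      then obtain f where f: "f \<in> carrier (CT c0)" "y = g f" by blast
      thus "y \<in> (\<lambda>b. g (b c0 (a, a))) ` carrier model"
        using entry_at[OF f(1)] corner_entry_carrier[OF f(1)] by (intro image_eqI[of _ _ "corner_entry c0 a f"]) auto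
    qed
    finally show ?thesis .
  qed
  have inj: "inj_on g (carrier (CT c0))"
  proof
    fix f f' assume f: "f \<in> carrier (CT c0)" "f' \<in> carrier (CT c0)" "g f = g f'"
    have "inj_on \<phi> (carrier model)" using \<phi>(1) by (simp add: star_iso_def bij_betw_def)
    hence "corner_entry c0 a f = corner_entry c0 a f'"
      using f corner_entry_carrier by (auto simp: g_def dest: inj_onD)
    thus "f = f'" using entry_at f by metis
  qed
  have ops: "sa_add (vertex_corner \<Lambda> v) = sa_add (graph_cstar \<Lambda>)"
    "sa_scale (vertex_corner \<Lambda> v) = sa_scale (graph_cstar \<Lambda>)"
    "sa_mult (vertex_corner \<Lambda> v) = sa_mult (graph_cstar \<Lambda>)"
    "sa_star (vertex_corner \<Lambda> v) = sa_star (graph_cstar \<Lambda>)"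
    "sa_zero (vertex_corner \<Lambda> v) = sa_zero (graph_cstar \<Lambda>)"
    by (simp_all add: vertex_corner_def corner_def)
  have "star_iso (CT c0) (vertex_corner \<Lambda> v) g"
    unfolding star_iso_def ops
  proof (intro conjI ballI allI)
    show "bij_betw g (carrier (CT c0)) (carrier (vertex_corner \<Lambda> v))" using inj car by (simp add: bij_betw_def)
    fix f assume f: "f \<in> carrier (CT c0)"
    note fc = corner_entry_carrier[OF f, of a]
    have cl: "sa_scale (CT c0) x f \<in> carrier (CT c0)" "sa_star (CT c0) f \<in> carrier (CT c0)" for x
      using cf_closed f unfolding sa_closed_def by blast+
    have "corner_entry c0 a (sa_scale (CT c0) x f) = sa_scale model x (corner_entry c0 a f)" for x
      by (rule model_eqI[OF corner_entry_carrier[OF cl(1)] model_closed(2)[OF fc fc]])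
         (auto simp: model_ops(2)[OF fc fc] ent cf_sel)
    thus "g (sa_scale (CT c0) x f) = sa_scale (graph_cstar \<Lambda>) x (g f)" for x
      using star_isoD(2)[OF \<phi>(1) fc] by (simp add: g_def)
    have "corner_entry c0 a (sa_star (CT c0) f) = sa_star model (corner_entry c0 a f)"
      by (rule model_eqI[OF corner_entry_carrier[OF cl(2)] model_closed(4)[OF fc fc]])
         (auto simp: model_ops(4)[OF fc fc] ent cf_sel)
    thus "g (sa_star (CT c0) f) = sa_star (graph_cstar \<Lambda>) (g f)"
      using star_isoD(4)[OF \<phi>(1) fc] by (simp add: g_def)
    fix f' assume f': "f' \<in> carrier (CT c0)"
    note fc' = corner_entry_carrier[OF f', of a]
    have cl2: "sa_add (CT c0) f f' \<in> carrier (CT c0)" "sa_mult (CT c0) f f' \<in> carrier (CT c0)"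
      using cf_closed f f' unfolding sa_closed_def by blast+
    have "corner_entry c0 a (sa_add (CT c0) f f') = sa_add model (corner_entry c0 a f) (corner_entry c0 a f')"
      by (rule model_eqI[OF corner_entry_carrier[OF cl2(1)] model_closed(1)[OF fc fc']])
         (auto simp: model_ops(1)[OF fc fc'] ent cf_sel)
    thus "g (sa_add (CT c0) f f') = sa_add (graph_cstar \<Lambda>) (g f) (g f')"
      using star_isoD(1)[OF \<phi>(1) fc fc'] by (simp add: g_def)
    have "corner_entry c0 a (sa_mult (CT c0) f f') = sa_mult model (corner_entry c0 a f) (corner_entry c0 a f')"
    proof (rule model_eqI[OF corner_entry_carrier[OF cl2(2)] model_closed(3)[OF fc fc']])
      fix c i j z assume h: "c \<in> I" "i \<in> blk c" "j \<in> blk c" "z \<in> torus_pts (rk c)"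
      have "sa_mult model (corner_entry c0 a f) (corner_entry c0 a f') c (i, j) z =
          (\<Sum>l\<in>blk c. corner_entry c0 a f c (i, l) z * corner_entry c0 a f' c (l, j) z)"
        unfolding model_ops(3)[OF fc fc'] using h by simp
      also have "\<dots> = (\<Sum>l\<in>blk c. if l = a then (if c = c0 \<and> i = a \<and> j = a then f z * f' z else 0) else 0)"
        using h by (intro sum.cong) (auto simp: ent)
      also have "\<dots> = (if c = c0 \<and> i = a \<and> j = a then f z * f' z else 0)" using ablk finite_block by auto
      finally show "corner_entry c0 a (sa_mult (CT c0) f f') c (i, j) z =
          sa_mult model (corner_entry c0 a f) (corner_entry c0 a f') c (i, j) z"
        using h by (auto simp: ent cf_sel)
    qed
    thus "g (sa_mult (CT c0) f f') = sa_mult (graph_cstar \<Lambda>) (g f) (g f')"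
      using star_isoD(3)[OF \<phi>(1) fc fc'] by (simp add: g_def)
  qed
  moreover have "g (sa_zero (CT c0)) = sa_zero (vertex_corner \<Lambda> v)"
  proof -
    have "corner_entry c0 a (sa_zero (CT c0)) = sa_zero model"
      by (rule model_eqI[OF corner_entry_carrier[OF cf_zero] model_closed(5)[OF pc pc]])
         (auto simp: model_ops(5)[OF pc pc] ent cf_sel)
    thus ?thesis using \<phi>(2) by (simp add: g_def ops)
  qed
  ultimately show thesis using that by blast
qed

end

theorem theorem2p5:
  fixes \<Lambda> :: "('a, 'k::finite) kgraph" and N :: "nat ^ 'k" and rep :: "'a set \<Rightarrow> 'a"
  assumes "k_graph \<Lambda>"
    and "finite_kgraph \<Lambda>"
    and "locally_convex \<Lambda>"
    and "\<not> (\<exists>x. cycle \<Lambda> x \<and> has_entrance \<Lambda> x)"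
    and "N = (\<chi> i. card (vertices \<Lambda>))"
    and "\<And>c. c \<in> initial_cycles \<Lambda> // ic_equiv \<Lambda> \<Longrightarrow> rep c \<in> c"
  shows "star_isomorphic (graph_cstar \<Lambda>)
           (direct_sum (initial_cycles \<Lambda> // ic_equiv \<Lambda>)
              (\<lambda>c. matrix_algebra (with_source_in \<Lambda> (paths_le \<Lambda> N) (vertices_on \<Lambda> (rep c)))
                     (vertex_corner \<Lambda> (rng \<Lambda> (rep c)))))
         \<and> (\<forall>\<mu> \<in> initial_cycles \<Lambda>. star_isomorphic (vertex_corner \<Lambda> (rng \<Lambda> \<mu>))
           (continuous_functions (torus (int_rank (period_group \<Lambda> \<mu>)))))"
proof -
  interpret no_entrance_graph \<Lambda>
    using assms(1-4) by (simp add: no_entrance_graph_def no_entrance_graph_axioms_def)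
  define I where "I = initial_cycles \<Lambda> // ic_equiv \<Lambda>"
  \<comment> \<open>By \<open>vertices_on_eq\<close>, initial cycles are equivalent exactly if their
    ranges reach the same vertices, so \<open>R\<close> identifies classes with components.\<close>
  define R where "R c = reach (r (rep c))" for c
  have mem: "y \<in> ic_equiv \<Lambda> `` {x} \<longleftrightarrow> y \<in> initial_cycles \<Lambda> \<and> reach (r y) = reach (r x)"
    if "x \<in> initial_cycles \<Lambda>" for x y
    using that vertices_on_eq by (auto simp: ic_equiv_def)
  have repI: "rep c \<in> initial_cycles \<Lambda>" "c = {y \<in> initial_cycles \<Lambda>. reach (r y) = R c}" if c: "c \<in> I" for c
  proof -
    obtain x where x: "x \<in> initial_cycles \<Lambda>" "c = ic_equiv \<Lambda> `` {x}"
      using c by (auto simp: I_def elim: quotientE)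
    have "rep c \<in> c" using assms(6) c by (simp add: I_def)
    hence "rep c \<in> initial_cycles \<Lambda>" "R c = reach (r x)" using mem[OF x(1)] x(2) by (auto simp: R_def)
    thus "rep c \<in> initial_cycles \<Lambda>" "c = {y \<in> initial_cycles \<Lambda>. reach (r y) = R c}"
      using mem[OF x(1)] x(2) by auto
  qed
  have comp: "reach v \<in> components" if v: "v \<in> terminal" for v
  proof -
    obtain a where a: "a \<in> X" "r a = v" using terminal_X_exists[OF v] .
    hence "reach (s a) = reach v" using reach_eq[OF v] reachI X_paths by blast
    thus ?thesis using a by (auto simp: components_def)
  qed
  have class_of: "\<exists>c\<in>I. R c = reach (r x)" if x: "x \<in> initial_cycles \<Lambda>" for x
  proof
    let ?c = "ic_equiv \<Lambda> `` {x}"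
    show c: "?c \<in> I" unfolding I_def by (rule quotientI[OF x])
    have "x \<in> ?c" using mem[OF x] x by simp
    thus "R ?c = reach (r x)" using repI(2)[OF c] by blast
  qed
  have bij: "bij_betw R I components"
    unfolding bij_betw_def
  proof
    show "inj_on R I" by (intro inj_onI) (metis repI(2))
    show "R ` I = components"
    proof (intro equalityI subsetI)
      fix C assume "C \<in> R ` I"
      thus "C \<in> components" using repI(1) comp initial_cycleD(3) by (auto simp: R_def)
    next
      fix C assume "C \<in> components"
      then obtain u where u: "u \<in> terminal" "C = reach u" by (rule componentsE)
      then obtain x where "x \<in> initial_cycles \<Lambda>" "u = r x" by (auto simp: terminal_def)
      thus "C \<in> R ` I" using class_of u by force
    qed
  qed
  interpret component_index \<Lambda> I R by unfold_locales (rule bij)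
  obtain \<phi> where \<phi>: "star_iso model (graph_cstar \<Lambda>) \<phi>" "\<phi> (sa_zero model) = sa_zero (graph_cstar \<Lambda>)"
    "\<And>x. x \<in> P \<Longrightarrow> \<phi> (mk (\<lambda>c i j z. entry (R c) z i j [(x, False)])) = graph_gen \<Lambda> x"
    using graph_cstar_model by blast
  have cm: "comm_monoid (add_monoid (continuous_functions (torus l)))" for l
    using cf_monoid by (simp add: add_monoid_def)
  have "\<exists>g. star_iso (CT c) (vertex_corner \<Lambda> (r (rep c))) g \<and>
      g (sa_zero (CT c)) = sa_zero (vertex_corner \<Lambda> (r (rep c)))" if c: "c \<in> I" for c
    using corner_iso[OF \<phi> c initial_cycleD(3)[OF repI(1)[OF c]] R_def] by metis
  then obtain g where g: "\<And>c. c \<in> I \<Longrightarrow> star_iso (CT c) (vertex_corner \<Lambda> (r (rep c))) (g c)"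
    "\<And>c. c \<in> I \<Longrightarrow> g c (sa_zero (CT c)) = sa_zero (vertex_corner \<Lambda> (r (rep c)))" by metis
  \<comment> \<open>A source lies on the cycle exactly if it reaches the same vertices as the cycle,
    because reachability is symmetric on terminal vertices.\<close>
  have blk: "with_source_in \<Lambda> (paths_le \<Lambda> N) (vertices_on \<Lambda> (rep c)) = blk c" if c: "c \<in> I" for c
  proof -
    have N: "paths_le \<Lambda> N = X" by (simp add: X_def NN_def assms(5))
    have "s a \<in> reach (r (rep c)) \<longleftrightarrow> reach (s a) = R c" if a: "a \<in> X" for a
      using reach_eq[OF initial_cycleD(3)[OF repI(1)[OF c]], of "s a"] terminal_in_reach[OF X_terminal[OF a]]
      by (auto simp: R_def)
    thus ?thesis
      unfolding with_source_in_def N vertices_on_eq[OF repI(1)[OF c]] block_def by blast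
  qed
  \<comment> \<open>The entries of the model are functions on tori; replacing these algebras by the
    isomorphic corners yields the algebra of the claim.\<close>
  have "star_iso model (direct_sum I (\<lambda>c. matrix_algebra (blk c) (vertex_corner \<Lambda> (r (rep c)))))
      (\<lambda>f. \<lambda>c\<in>I. (\<lambda>h. \<lambda>ij\<in>blk c \<times> blk c. g c (h ij)) (f c))"
    unfolding model_def
    by (intro star_iso_direct_sum star_iso_matrix g cm cf_closed finite_block)
  moreover have "direct_sum I (\<lambda>c. matrix_algebra (blk c) (vertex_corner \<Lambda> (r (rep c)))) =
      direct_sum I (\<lambda>c. matrix_algebra (with_source_in \<Lambda> (paths_le \<Lambda> N) (vertices_on \<Lambda> (rep c)))
        (vertex_corner \<Lambda> (r (rep c))))"
    by (rule direct_sum_cong) (simp only: blk)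
  ultimately have "\<exists>h. star_iso model (direct_sum I (\<lambda>c. matrix_algebra (with_source_in \<Lambda> (paths_le \<Lambda> N) (vertices_on \<Lambda> (rep c)))
      (vertex_corner \<Lambda> (r (rep c))))) h" by auto
  then obtain h where h: "star_iso model (direct_sum I (\<lambda>c. matrix_algebra (with_source_in \<Lambda> (paths_le \<Lambda> N) (vertices_on \<Lambda> (rep c)))
      (vertex_corner \<Lambda> (r (rep c))))) h" ..
  have "star_isomorphic (graph_cstar \<Lambda>)
      (direct_sum I (\<lambda>c. matrix_algebra (with_source_in \<Lambda> (paths_le \<Lambda> N) (vertices_on \<Lambda> (rep c)))
        (vertex_corner \<Lambda> (r (rep c)))))"
    unfolding star_isomorphic_def
    by (rule exI, rule star_iso_compose[OF star_iso_inverse[OF \<phi>(1) sa_closed_model] h])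
  moreover have "star_isomorphic (vertex_corner \<Lambda> (r \<mu>)) (continuous_functions (torus (int_rank (period_group \<Lambda> \<mu>))))"
    if \<mu>: "\<mu> \<in> initial_cycles \<Lambda>" for \<mu>
  proof -
    note v = initial_cycleD(3)[OF \<mu>]
    obtain c where c: "c \<in> I" "R c = reach (r \<mu>)" using class_of[OF \<mu>] by blast
    \<comment> \<open>Periods do not depend on the vertex of the component, so the base vertex used
      in the model gives the rank at \<open>r \<mu>\<close>.\<close>
    have "group_of (R c) = periods (r \<mu>)"
      unfolding group_of_def c(2) by (rule periods_reach[OF v base(2)[OF v]])
    hence "rk c = int_rank (period_group \<Lambda> \<mu>)" by (simp add: rank_of_def period_group_eq[OF \<mu>])
    moreover obtain g where "star_iso (CT c) (vertex_corner \<Lambda> (r \<mu>)) g" by (rule corner_iso[OF \<phi> c(1) v c(2)])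
    ultimately show ?thesis using star_iso_inverse[OF _ cf_closed] unfolding star_isomorphic_def by auto
  qed
  ultimately show ?thesis unfolding I_def by blast
qed

end
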